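(* Let $X$ be a smooth separated irreducible $n$-dimensional scheme (algebraic variety) over a field $\mathbb{K}$ of characteristic $0$, with sheaf of $\mathbb{K}$-linear differential operators $\mathcal{D}_X$. Assume $\mathrm{H}^1(X,\mathcal{D}_X)=0$. Then any deformation quantization $(\mathcal{A},\psi,\boldsymbol\tau)$ of $\mathcal{O}_X$ can be globally trivialized; namely there is a globally trivialized deformation quantization $(\mathcal{A}',\psi',\{\tau'\})$ of $\mathcal{O}_X$, and a gauge equivalence $(\mathcal{A},\psi,\boldsymbol\tau)\to(\mathcal{A}',\psi',\{\tau'\})$.
   Context: $\hbar$ is an indeterminate. Star product: for $U\subset X$ open, a $\mathbb{K}[[\hbar]]$-bilinear sheaf morphism $\star:\mathcal{O}_U[[\hbar]]\times\mathcal{O}_U[[\hbar]]\to\mathcal{O}_U[[\hbar]]$ making $\mathcal{O}_U[[\hbar]]$ a sheaf of associative unital $\mathbb{K}[[\hbar]]$-algebras with unit $1\in\mathcal{O}_U$, such that there are bi-differential operators $\beta_j:\mathcal{O}_U\times\mathcal{O}_U\to\mathcal{O}_U$ with $f\star g=fg+\sum_{j\ge1}\beta_j(f,g)\hbar^j$ for local sections $f,g\in\mathcal{O}_U$. Gauge equivalence of $\mathcal{O}_U[[\hbar]]$: a $\mathbb{K}[[\hbar]]$-linear sheaf automorphism $\gamma$ with $\gamma(1)=1$ for which there are differential operators $\gamma_k:\mathcal{O}_U\to\mathcal{O}_U$ with $\gamma(f)=f+\sum_{k\ge1}\gamma_k(f)\hbar^k$ for $f\in\mathcal{O}_U$. Let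 $\mathcal{A}$ be a sheaf of $\hbar$-adically complete flat $\mathbb{K}[[\hbar]]$-algebras on $X$ and $\psi:\mathcal{A}/\hbar\mathcal{A}\to\mathcal{O}_X$ an isomorphism of sheaves of $\mathbb{K}$-algebras (also regarded as a map $\mathcal{A}\to\mathcal{O}_X$). A differential trivialization of $(\mathcal{A},\psi)$ on $U$ is an isomorphism $\tau:\mathcal{O}_U[[\hbar]]\to\mathcal{A}|_U$ of sheaves of $\mathbb{K}[[\hbar]]$-modules such that $f\star_\tau g:=\tau^{-1}(\tau(f)\star\tau(g))$ ($\star$ the product of $\mathcal{A}$) defines a star product on $\mathcal{O}_U[[\hbar]]$, and $(\psi\circ\tau)(f)=f$ for $f\in\mathcal{O}_U$. A differential structure $\boldsymbol\tau=\{\tau_i\}$ on $(\mathcal{A},\psi)$ is an open covering $X=\bigcup U_i$ with a differential trivialization $\tau_i$ on each $U_i$, such that for all $i,j$ the automorphism $\tau_j^{-1}\circ\tau_i$ of $\mathcal{O}_{U_i\cap U_j}[[\hbar]]$ is a gauge equivalence. A deformation quantization of $\mathcal{O}_X$ is a triple $(\mathcal{A},\psi,\boldsymbol\tau)$ where $\mathcal{A}$ is a sheaf of $\hbar$-adically complete flat $\mathbb{K}[[\hbar]]$-algebras on $X$, $\psi:\mathcal{A}/\hbar\mathcal{A}\to\mathcal{O}_X$ is an isomorphism of sheaves of $\mathbb{K}$-algebras, and $\boldsymbol\tau$ is a differential structure on $(\mathcal{A},\psi)$; it is globally trivialized if $\boldsymbol\tau$ consists of a single differential trivialization $\tau:\mathcal{O}_X[[\hbar]]\to\mathcal{A}$.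 A gauge equivalence $(\mathcal{A},\psi,\boldsymbol\tau)\to(\mathcal{A}',\psi',\boldsymbol\tau')$ is an isomorphism $\gamma:\mathcal{A}\to\mathcal{A}'$ of sheaves of $\mathbb{K}[[\hbar]]$-algebras with $\psi=\psi'\circ\gamma:\mathcal{A}\to\mathcal{O}_X$ and such that, if $\{U_i\},\{U'_j\}$ are the coverings of $\boldsymbol\tau,\boldsymbol\tau'$, each $\tau_j'^{-1}\circ\gamma\circ\tau_i$ is a gauge equivalence of $\mathcal{O}_{U_i\cap U'_j}[[\hbar]]$. *)

theory Defs
  imports "HOL-Analysis.Abstract_Topology" "HOL-Library.Poly_Mapping"
    "HOL-Algebra.QuotRing" "HOL-Algebra.Module" "HOL-Algebra.Generated_Groups" "HOL-Algebra.Subrings"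
begin

section \<open>Modules and algebras\<close>

text \<open>
  Everything is carried by the record type of \<^theory>\<open>HOL-Algebra.Module\<close>. If only the
  module structure matters, the fields \<open>mult\<close> and \<open>one\<close> are ignored.
\<close>

text \<open>Unlike \<^locale>\<open>algebra\<close>, the following does not require commutativity of \<open>M\<close>.\<close>

definition assoc_algebra :: "('k, 'c) ring_scheme \<Rightarrow> ('k, 'r, 'd) module_scheme \<Rightarrow> bool" where
  "assoc_algebra R M \<longleftrightarrow> module R M \<and> ring M \<and>
     (\<forall>a\<in>carrier R. \<forall>x\<in>carrier M. \<forall>y\<in>carrier M.
        (a \<odot>\<^bsub>M\<^esub> x) \<otimes>\<^bsub>M\<^esub> y = a \<odot>\<^bsub>M\<^esub> (x \<otimes>\<^bsub>M\<^esub> y) \<and>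
        x \<otimes>\<^bsub>M\<^esub> (a \<odot>\<^bsub>M\<^esub> y) = a \<odot>\<^bsub>M\<^esub> (x \<otimes>\<^bsub>M\<^esub> y))"

definition mod_hom ::
  "('k, 'c) ring_scheme \<Rightarrow> ('k, 'r, 'd) module_scheme \<Rightarrow> ('k, 's, 'e) module_scheme \<Rightarrow> ('r \<Rightarrow> 's) set"
where
  "mod_hom R M N = {h \<in> carrier M \<rightarrow> carrier N.
     (\<forall>x\<in>carrier M. \<forall>y\<in>carrier M. h (x \<oplus>\<^bsub>M\<^esub> y) = h x \<oplus>\<^bsub>N\<^esub> h y) \<and>
     (\<forall>a\<in>carrier R. \<forall>x\<in>carrier M. h (a \<odot>\<^bsub>M\<^esub> x) = a \<odot>\<^bsub>N\<^esub> h x)}"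

definition quot_mod :: "('k, 'r, 'd) module_scheme \<Rightarrow> 'r set \<Rightarrow> ('k, 'r set) module" where
  "quot_mod M N = \<lparr>carrier = a_rcosets\<^bsub>M\<^esub> N, mult = rcoset_mult M N, one = N +>\<^bsub>M\<^esub> \<one>\<^bsub>M\<^esub>,
     zero = N, add = set_add M, smult = (\<lambda>c X. \<Union>x\<in>X. N +>\<^bsub>M\<^esub> (c \<odot>\<^bsub>M\<^esub> x))\<rparr>"

definition restrict_scalars :: "('j \<Rightarrow> 'k) \<Rightarrow> ('k, 'r) module \<Rightarrow> ('j, 'r) module" where
  "restrict_scalars \<phi> M = \<lparr>carrier = carrier M, mult = mult M, one = one M,
     zero = zero M, add = add M, smult = (\<lambda>c. smult M (\<phi> c))\<rparr>"

definition span_submodule ::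
  "('k, 'c) ring_scheme \<Rightarrow> ('k, 'r, 'd) module_scheme \<Rightarrow> 'r set \<Rightarrow> 'r set"
where
  "span_submodule R M S = \<Inter>{N. submodule N R M \<and> S \<subseteq> N}"

definition free_of_rank ::
  "('k, 'c) ring_scheme \<Rightarrow> ('k, 'r, 'd) module_scheme \<Rightarrow> nat \<Rightarrow> bool"
where
  "free_of_rank R M n \<longleftrightarrow> (\<exists>w. (\<forall>i<n. w i \<in> carrier M) \<and>
     (\<forall>m\<in>carrier M. \<exists>!c. c \<in> {..<n} \<rightarrow>\<^sub>E carrier R \<and>
        m = (\<Oplus>\<^bsub>M\<^esub>i\<in>{..<n}. c i \<odot>\<^bsub>M\<^esub> w i)))"

definition fin_gen_algebra :: "('k, 'c) ring_scheme \<Rightarrow> ('k, 'r, 'd) module_scheme \<Rightarrow> bool" where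
  "fin_gen_algebra R M \<longleftrightarrow> (\<exists>S. finite S \<and> S \<subseteq> carrier M \<and>
     (\<forall>B. subring B M \<and> (\<forall>c\<in>carrier R. \<forall>b\<in>B. c \<odot>\<^bsub>M\<^esub> b \<in> B) \<and> S \<subseteq> B \<longrightarrow> B = carrier M))"

text \<open>The maximal ideal and the residue field of a local ring.\<close>

definition max_ideal :: "('r, 'c) ring_scheme \<Rightarrow> 'r set" where
  "max_ideal R = carrier R - Units R"

definition residue_field :: "('k, 'r, 'd) module_scheme \<Rightarrow> ('k, 'r set) module" where
  "residue_field M = quot_mod M (max_ideal M)"

subsection \<open>Tensor products and flatness\<close>

text \<open>
  \<open>M \<otimes> N\<close> is the quotient of the free abelian group on \<open>M \<times> N\<close> by the bilinearity relations.
  For algebras \<open>M\<close> and \<open>N\<close> the free group carries the multiplication of the monoid ring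
  of the multiplicative monoid \<open>M \<times> N\<close>.
\<close>

definition tensor_free ::
  "('k, 'm, 'c) module_scheme \<Rightarrow> ('k, 'n, 'd) module_scheme \<Rightarrow> ('k, 'm \<times> 'n \<Rightarrow>\<^sub>0 int) module"
where
  "tensor_free M N = \<lparr>carrier = {z. Poly_Mapping.keys z \<subseteq> carrier M \<times> carrier N},
     mult = (\<lambda>z w. frag_extend (\<lambda>(a, b). frag_extend
               (\<lambda>(c, d). frag_of (a \<otimes>\<^bsub>M\<^esub> c, b \<otimes>\<^bsub>N\<^esub> d)) w) z),
     one = frag_of (\<one>\<^bsub>M\<^esub>, \<one>\<^bsub>N\<^esub>), zero = 0, add = (+),
     smult = (\<lambda>c. frag_extend (\<lambda>(a, b). frag_of (c \<odot>\<^bsub>M\<^esub> a, b)))\<rparr>"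

definition tensor_rel ::
  "('k, 'r) ring_scheme \<Rightarrow> ('k, 'm, 'c) module_scheme \<Rightarrow> ('k, 'n, 'd) module_scheme
     \<Rightarrow> ('m \<times> 'n \<Rightarrow>\<^sub>0 int) set"
where
  "tensor_rel R M N = generate (add_monoid (tensor_free M N))
     ({frag_of (a \<oplus>\<^bsub>M\<^esub> a', b) - frag_of (a, b) - frag_of (a', b) | a a' b.
         a \<in> carrier M \<and> a' \<in> carrier M \<and> b \<in> carrier N} \<union>
      {frag_of (a, b \<oplus>\<^bsub>N\<^esub> b') - frag_of (a, b) - frag_of (a, b') | a b b'.
         a \<in> carrier M \<and> b \<in> carrier N \<and> b' \<in> carrier N} \<union>
      {frag_of (c \<odot>\<^bsub>M\<^esub> a, b) - frag_of (a, c \<odot>\<^bsub>N\<^esub> b) | c a b.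
         c \<in> carrier R \<and> a \<in> carrier M \<and> b \<in> carrier N})"

definition tensor ::
  "('k, 'r) ring_scheme \<Rightarrow> ('k, 'm, 'c) module_scheme \<Rightarrow> ('k, 'n, 'd) module_scheme
     \<Rightarrow> ('k, ('m \<times> 'n \<Rightarrow>\<^sub>0 int) set) module"
where
  "tensor R M N = quot_mod (tensor_free M N) (tensor_rel R M N)"

text \<open>
  \<open>M\<close> is flat if \<open>N' \<otimes> M \<rightarrow> N \<otimes> M\<close> is injective for all modules \<open>N' \<subseteq> N\<close>. It suffices to
  test this on finitely generated \<open>N\<close>; these are quotients of some \<open>R\<^sup>n\<close> and hence have an
  isomorphic copy in the type of \<open>N\<close> below, so restricting to this type loses nothing.
\<close>

definition flat_module :: "('k, 'c) ring_scheme \<Rightarrow> ('k, 'm, 'd) module_scheme \<Rightarrow> bool" where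
  "flat_module R M \<longleftrightarrow> module R M \<and>
     (\<forall>(N :: ('k, (nat \<Rightarrow> 'k) set) module) N'. module R N \<and> submodule N' R N \<longrightarrow>
        inj_on (\<lambda>X. \<Union>z\<in>X. tensor_rel R N M +>\<^bsub>tensor_free N M\<^esub> z)
          (carrier (tensor R (N\<lparr>carrier := N'\<rparr>) M)))"

subsection \<open>Kaehler differentials\<close>

definition kaehler_free :: "('k, 'b, 'd) module_scheme \<Rightarrow> ('b, 'b \<Rightarrow> 'b) module" where
  "kaehler_free B = \<lparr>carrier = {\<phi>. (\<forall>b. \<phi> b \<in> carrier B) \<and> (\<forall>b. b \<notin> carrier B \<longrightarrow> \<phi> b = \<zero>\<^bsub>B\<^esub>) \<and>
       finite {b. \<phi> b \<noteq> \<zero>\<^bsub>B\<^esub>}},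
     mult = (\<lambda>_ _. undefined), one = undefined, zero = (\<lambda>_. \<zero>\<^bsub>B\<^esub>),
     add = (\<lambda>\<phi> \<chi> b. \<phi> b \<oplus>\<^bsub>B\<^esub> \<chi> b), smult = (\<lambda>a \<phi> b. a \<otimes>\<^bsub>B\<^esub> \<phi> b)\<rparr>"

definition kaehler_gen :: "('k, 'b, 'd) module_scheme \<Rightarrow> 'b \<Rightarrow> 'b \<Rightarrow> 'b" where
  "kaehler_gen B b = (\<lambda>c. if c = b then \<one>\<^bsub>B\<^esub> else \<zero>\<^bsub>B\<^esub>)"

definition kaehler_rel :: "('k, 'c) ring_scheme \<Rightarrow> ('k, 'b, 'd) module_scheme \<Rightarrow> ('b \<Rightarrow> 'b) set" where
  "kaehler_rel K B = (let F = kaehler_free B; d = kaehler_gen B in span_submodule B F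
     ({d (a \<oplus>\<^bsub>B\<^esub> b) \<ominus>\<^bsub>F\<^esub> (d a \<oplus>\<^bsub>F\<^esub> d b) | a b. a \<in> carrier B \<and> b \<in> carrier B} \<union>
      {d (a \<otimes>\<^bsub>B\<^esub> b) \<ominus>\<^bsub>F\<^esub> ((a \<odot>\<^bsub>F\<^esub> d b) \<oplus>\<^bsub>F\<^esub> (b \<odot>\<^bsub>F\<^esub> d a)) | a b. a \<in> carrier B \<and> b \<in> carrier B} \<union>
      {d (c \<odot>\<^bsub>B\<^esub> \<one>\<^bsub>B\<^esub>) | c. c \<in> carrier K}))"

definition kaehler :: "('k, 'c) ring_scheme \<Rightarrow> ('k, 'b, 'd) module_scheme \<Rightarrow> ('b, ('b \<Rightarrow> 'b) set) module" where
  "kaehler K B = quot_mod (kaehler_free B) (kaehler_rel K B)"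

text \<open>For a \<open>B\<close>-module \<open>M\<close> and an ideal \<open>I\<close>: the \<open>B/I\<close>-module \<open>M/IM = M \<otimes> B/I\<close>.\<close>

definition mod_ideal ::
  "('b, 'c) ring_scheme \<Rightarrow> 'b set \<Rightarrow> ('b, 'm, 'd) module_scheme \<Rightarrow> ('b set, 'm set) module"
where
  "mod_ideal B I M = (let N = span_submodule B M {a \<odot>\<^bsub>M\<^esub> m | a m. a \<in> I \<and> m \<in> carrier M} in
     \<lparr>carrier = a_rcosets\<^bsub>M\<^esub> N, mult = rcoset_mult M N, one = N +>\<^bsub>M\<^esub> \<one>\<^bsub>M\<^esub>,
      zero = N, add = set_add M, smult = (\<lambda>X Y. \<Union>a\<in>X. \<Union>y\<in>Y. N +>\<^bsub>M\<^esub> (a \<odot>\<^bsub>M\<^esub> y))\<rparr>)"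

subsection \<open>Power series\<close>

definition ps_ring :: "('r, 'c) ring_scheme \<Rightarrow> (nat \<Rightarrow> 'r) ring" where
  "ps_ring R = \<lparr>carrier = {f. \<forall>n. f n \<in> carrier R},
     mult = (\<lambda>f g n. \<Oplus>\<^bsub>R\<^esub>i\<in>{..n}. f i \<otimes>\<^bsub>R\<^esub> g (n - i)),
     one = (\<lambda>n. if n = 0 then \<one>\<^bsub>R\<^esub> else \<zero>\<^bsub>R\<^esub>), zero = (\<lambda>_. \<zero>\<^bsub>R\<^esub>),
     add = (\<lambda>f g n. f n \<oplus>\<^bsub>R\<^esub> g n)\<rparr>"

definition ps_mod :: "('k, 'r, 'd) module_scheme \<Rightarrow> (nat \<Rightarrow> 'k, nat \<Rightarrow> 'r) module" where
  "ps_mod M = ring.extend (ps_ring M)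
     \<lparr>smult = (\<lambda>c f n. \<Oplus>\<^bsub>M\<^esub>i\<in>{..n}. c i \<odot>\<^bsub>M\<^esub> f (n - i))\<rparr>"

definition ps_const :: "('r, 'c) ring_scheme \<Rightarrow> 'r \<Rightarrow> nat \<Rightarrow> 'r" where
  "ps_const R c = (\<lambda>n. if n = 0 then c else \<zero>\<^bsub>R\<^esub>)"

definition hbar :: "('r, 'c) ring_scheme \<Rightarrow> nat \<Rightarrow> 'r" where
  "hbar R = (\<lambda>n. if n = 1 then \<one>\<^bsub>R\<^esub> else \<zero>\<^bsub>R\<^esub>)"


section \<open>Sheaves\<close>

text \<open>
  Sections and restriction maps are only meaningful on the open sets of the topology \<open>T\<close> in
  question. The restriction of a sheaf to an open \<open>U\<close> is therefore the same record, considered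
  over \<^term>\<open>subtopology T U\<close>. Morphisms are families of maps indexed by open sets.
\<close>

record ('a, 'k, 'r) presheaf =
  sec :: "'a set \<Rightarrow> ('k, 'r) module"
  res :: "'a set \<Rightarrow> 'a set \<Rightarrow> 'r \<Rightarrow> 'r"

type_synonym ('a, 'r, 's) sheaf_map = "'a set \<Rightarrow> 'r \<Rightarrow> 's"

definition module_presheaf ::
  "('k, 'c) ring_scheme \<Rightarrow> 'a topology \<Rightarrow> ('a, 'k, 'r) presheaf \<Rightarrow> bool"
where
  "module_presheaf R T F \<longleftrightarrow>
     (\<forall>U. openin T U \<longrightarrow> module R (sec F U)) \<and>
     (\<forall>U V. openin T U \<and> openin T V \<and> V \<subseteq> U \<longrightarrow> res F U V \<in> mod_hom R (sec F U) (sec F V)) \<and>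
     (\<forall>U. openin T U \<longrightarrow> (\<forall>s\<in>carrier (sec F U). res F U U s = s)) \<and>
     (\<forall>U V W. openin T U \<and> openin T V \<and> openin T W \<and> W \<subseteq> V \<and> V \<subseteq> U \<longrightarrow>
        (\<forall>s\<in>carrier (sec F U). res F V W (res F U V s) = res F U W s))"

definition sheaf_axiom :: "'a topology \<Rightarrow> ('a, 'k, 'r) presheaf \<Rightarrow> bool" where
  "sheaf_axiom T F \<longleftrightarrow> (\<forall>\<V> s. (\<forall>V\<in>\<V>. openin T V \<and> s V \<in> carrier (sec F V)) \<and>
     (\<forall>V\<in>\<V>. \<forall>W\<in>\<V>. res F V (V \<inter> W) (s V) = res F W (V \<inter> W) (s W)) \<longrightarrow>
     (\<exists>!t. t \<in> carrier (sec F (\<Union>\<V>)) \<and> (\<forall>V\<in>\<V>. res F (\<Union>\<V>) V t = s V)))"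

definition module_sheaf ::
  "('k, 'c) ring_scheme \<Rightarrow> 'a topology \<Rightarrow> ('a, 'k, 'r) presheaf \<Rightarrow> bool"
where
  "module_sheaf R T F \<longleftrightarrow> module_presheaf R T F \<and> sheaf_axiom T F"

definition algebra_sheaf ::
  "('k, 'c) ring_scheme \<Rightarrow> 'a topology \<Rightarrow> ('a, 'k, 'r) presheaf \<Rightarrow> bool"
where
  "algebra_sheaf R T F \<longleftrightarrow> module_sheaf R T F \<and>
     (\<forall>U. openin T U \<longrightarrow> assoc_algebra R (sec F U)) \<and>
     (\<forall>U V. openin T U \<and> openin T V \<and> V \<subseteq> U \<longrightarrow> res F U V \<in> ring_hom (sec F U) (sec F V))"

definition sheaf_hom ::
  "('k, 'c) ring_scheme \<Rightarrow> 'a topology \<Rightarrow> ('a, 'k, 'r) presheaf \<Rightarrow> ('a, 'k, 's) presheaf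
     \<Rightarrow> ('a, 'r, 's) sheaf_map \<Rightarrow> bool"
where
  "sheaf_hom R T F G h \<longleftrightarrow>
     (\<forall>U. openin T U \<longrightarrow> h U \<in> mod_hom R (sec F U) (sec G U)) \<and>
     (\<forall>U V. openin T U \<and> openin T V \<and> V \<subseteq> U \<longrightarrow>
        (\<forall>s\<in>carrier (sec F U). h V (res F U V s) = res G U V (h U s)))"

definition sheaf_iso ::
  "('k, 'c) ring_scheme \<Rightarrow> 'a topology \<Rightarrow> ('a, 'k, 'r) presheaf \<Rightarrow> ('a, 'k, 's) presheaf
     \<Rightarrow> ('a, 'r, 's) sheaf_map \<Rightarrow> bool"
where
  "sheaf_iso R T F G h \<longleftrightarrow> sheaf_hom R T F G h \<and>
     (\<forall>U. openin T U \<longrightarrow> bij_betw (h U) (carrier (sec F U)) (carrier (sec G U)))"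

definition algebra_sheaf_iso ::
  "('k, 'c) ring_scheme \<Rightarrow> 'a topology \<Rightarrow> ('a, 'k, 'r) presheaf \<Rightarrow> ('a, 'k, 's) presheaf
     \<Rightarrow> ('a, 'r, 's) sheaf_map \<Rightarrow> bool"
where
  "algebra_sheaf_iso R T F G h \<longleftrightarrow> sheaf_iso R T F G h \<and>
     (\<forall>U. openin T U \<longrightarrow> h U \<in> ring_hom (sec F U) (sec G U))"

subsection \<open>Stalks, sheafification, quotients\<close>

definition germ ::
  "'a topology \<Rightarrow> ('a, 'k, 'r) presheaf \<Rightarrow> 'a \<Rightarrow> 'a set \<Rightarrow> 'r \<Rightarrow> ('a set \<times> 'r) set"
where
  "germ T F x U s = {(V, t). openin T V \<and> x \<in> V \<and> t \<in> carrier (sec F V) \<and>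
     (\<exists>W. openin T W \<and> x \<in> W \<and> W \<subseteq> U \<inter> V \<and> res F U W s = res F V W t)}"

definition stalk ::
  "'a topology \<Rightarrow> ('a, 'k, 'r) presheaf \<Rightarrow> 'a \<Rightarrow> ('k, ('a set \<times> 'r) set) module"
where
  "stalk T F x = \<lparr>carrier = {germ T F x U s | U s. openin T U \<and> x \<in> U \<and> s \<in> carrier (sec F U)},
     mult = (\<lambda>X Y. \<Union>(U, s)\<in>X. \<Union>(V, t)\<in>Y.
       germ T F x (U \<inter> V) (res F U (U \<inter> V) s \<otimes>\<^bsub>sec F (U \<inter> V)\<^esub> res F V (U \<inter> V) t)),
     one = germ T F x (topspace T) \<one>\<^bsub>sec F (topspace T)\<^esub>,
     zero = germ T F x (topspace T) \<zero>\<^bsub>sec F (topspace T)\<^esub>,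
     add = (\<lambda>X Y. \<Union>(U, s)\<in>X. \<Union>(V, t)\<in>Y.
       germ T F x (U \<inter> V) (res F U (U \<inter> V) s \<oplus>\<^bsub>sec F (U \<inter> V)\<^esub> res F V (U \<inter> V) t)),
     smult = (\<lambda>c X. \<Union>(U, s)\<in>X. germ T F x U (c \<odot>\<^bsub>sec F U\<^esub> s))\<rparr>"

text \<open>The family of all germs of a section. It serves as canonical map both to the
  sheafification and to the Godement sheaf.\<close>

definition germs ::
  "'a topology \<Rightarrow> ('a, 'k, 'r) presheaf \<Rightarrow> ('a, 'r, 'a \<Rightarrow> ('a set \<times> 'r) set) sheaf_map"
where
  "germs T F U s = (\<lambda>x\<in>U. germ T F x U s)"

definition pointwise ::
  "'x set \<Rightarrow> ('x \<Rightarrow> ('k, 's) module) \<Rightarrow> ('x \<Rightarrow> 's) set \<Rightarrow> ('k, 'x \<Rightarrow> 's) module"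
where
  "pointwise U S C = \<lparr>carrier = C, mult = (\<lambda>s t. \<lambda>x\<in>U. s x \<otimes>\<^bsub>S x\<^esub> t x), one = (\<lambda>x\<in>U. \<one>\<^bsub>S x\<^esub>),
     zero = (\<lambda>x\<in>U. \<zero>\<^bsub>S x\<^esub>), add = (\<lambda>s t. \<lambda>x\<in>U. s x \<oplus>\<^bsub>S x\<^esub> t x),
     smult = (\<lambda>c s. \<lambda>x\<in>U. c \<odot>\<^bsub>S x\<^esub> s x)\<rparr>"

definition sheafify ::
  "'a topology \<Rightarrow> ('a, 'k, 'r) presheaf \<Rightarrow> ('a, 'k, 'a \<Rightarrow> ('a set \<times> 'r) set) presheaf"
where
  "sheafify T F = \<lparr>sec = (\<lambda>U. pointwise U (stalk T F)
       {s \<in> extensional U. \<forall>x\<in>U. \<exists>V t. openin T V \<and> x \<in> V \<and> V \<subseteq> U \<and> t \<in> carrier (sec F V) \<and>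
          restrict s V = germs T F V t}),
     res = (\<lambda>U V s. restrict s V)\<rparr>"

definition sheafify_map ::
  "'a topology \<Rightarrow> ('a, 'k, 's) presheaf \<Rightarrow> ('a, 'r, 's) sheaf_map
     \<Rightarrow> ('a, 'a \<Rightarrow> ('a set \<times> 'r) set, 'a \<Rightarrow> ('a set \<times> 's) set) sheaf_map"
where
  "sheafify_map T G h U s = (\<lambda>x\<in>U. \<Union>(V, t)\<in>s x. germ T G x V (h V t))"

text \<open>The presheaf \<open>U \<mapsto> F(U)/N(U)\<close>; the quotient sheaf is its sheafification.\<close>

definition quot_presheaf ::
  "('a, 'k, 'r) presheaf \<Rightarrow> ('a set \<Rightarrow> 'r set) \<Rightarrow> ('a, 'k, 'r set) presheaf"
where
  "quot_presheaf F N = \<lparr>sec = (\<lambda>U. quot_mod (sec F U) (N U)),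
     res = (\<lambda>U V X. \<Union>x\<in>X. N V +>\<^bsub>sec F V\<^esub> res F U V x)\<rparr>"

subsection \<open>First cohomology\<close>

text \<open>
  Sheaf cohomology by means of the Godement resolution \<open>0 \<rightarrow> F \<rightarrow> C\<^sup>0 \<rightarrow> C\<^sup>1 \<rightarrow> \<dots>\<close>, where
  \<open>C\<^sup>0(U)\<close> is the product of the stalks of \<open>F\<close> at the points of \<open>U\<close>, \<open>Z = C\<^sup>0/F\<close> and \<open>C\<^sup>1\<close> is the
  Godement sheaf of \<open>Z\<close>. The kernel of \<open>\<Gamma>(C\<^sup>1) \<rightarrow> \<Gamma>(C\<^sup>2)\<close> is \<open>\<Gamma>(Z)\<close>.
\<close>

definition godement ::
  "'a topology \<Rightarrow> ('a, 'k, 'r) presheaf \<Rightarrow> ('a, 'k, 'a \<Rightarrow> ('a set \<times> 'r) set) presheaf"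
where
  "godement T F = \<lparr>sec = (\<lambda>U. pointwise U (stalk T F) (\<Pi>\<^sub>E x\<in>U. carrier (stalk T F x))),
     res = (\<lambda>U V s. restrict s V)\<rparr>"

definition godement_quot where
  "godement_quot T F = quot_presheaf (godement T F) (\<lambda>U. germs T F U ` carrier (sec F U))"

definition H1 where
  "H1 T F = (let X = topspace T; G = godement T F; Q = godement_quot T F in
     quot_mod (sec (sheafify T Q) X)
       ((\<lambda>b. germs T Q X ((germs T F X ` carrier (sec F X)) +>\<^bsub>sec G X\<^esub> b)) ` carrier (sec G X)))"


section \<open>Schemes over a field\<close>

subsection \<open>Spectrum of a ring\<close>

definition zariski :: "('r, 'c) ring_scheme \<Rightarrow> 'r set topology" where
  "zariski R = topology_generated_by {{p. primeideal p R \<and> f \<notin> p} | f. f \<in> carrier R}"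

definition loc_frac :: "('r, 'c) ring_scheme \<Rightarrow> 'r set \<Rightarrow> 'r \<Rightarrow> 'r \<Rightarrow> ('r \<times> 'r) set" where
  "loc_frac R S a s = {(b, t). b \<in> carrier R \<and> t \<in> S \<and>
     (\<exists>u\<in>S. u \<otimes>\<^bsub>R\<^esub> (t \<otimes>\<^bsub>R\<^esub> a) = u \<otimes>\<^bsub>R\<^esub> (s \<otimes>\<^bsub>R\<^esub> b))}"

definition localization :: "('k, 'r) module \<Rightarrow> 'r set \<Rightarrow> ('k, ('r \<times> 'r) set) module" where
  "localization R S = \<lparr>carrier = {loc_frac R S a s | a s. a \<in> carrier R \<and> s \<in> S},
     mult = (\<lambda>X Y. \<Union>(a, s)\<in>X. \<Union>(b, t)\<in>Y. loc_frac R S (a \<otimes>\<^bsub>R\<^esub> b) (s \<otimes>\<^bsub>R\<^esub> t)),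
     one = loc_frac R S \<one>\<^bsub>R\<^esub> \<one>\<^bsub>R\<^esub>, zero = loc_frac R S \<zero>\<^bsub>R\<^esub> \<one>\<^bsub>R\<^esub>,
     add = (\<lambda>X Y. \<Union>(a, s)\<in>X. \<Union>(b, t)\<in>Y.
              loc_frac R S ((a \<otimes>\<^bsub>R\<^esub> t) \<oplus>\<^bsub>R\<^esub> (b \<otimes>\<^bsub>R\<^esub> s)) (s \<otimes>\<^bsub>R\<^esub> t)),
     smult = (\<lambda>c X. \<Union>(a, s)\<in>X. loc_frac R S (c \<odot>\<^bsub>R\<^esub> a) s)\<rparr>"

definition spec_sheaf :: "('k, 'r) module \<Rightarrow> ('r set, 'k, 'r set \<Rightarrow> ('r \<times> 'r) set) presheaf" where
  "spec_sheaf R = \<lparr>sec = (\<lambda>W. pointwise W (\<lambda>p. localization R (carrier R - p))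
       {s \<in> extensional W. \<forall>p\<in>W. \<exists>V a f. openin (zariski R) V \<and> p \<in> V \<and> V \<subseteq> W \<and>
          a \<in> carrier R \<and> f \<in> carrier R \<and>
          (\<forall>q\<in>V. f \<notin> q \<and> s q = loc_frac R (carrier R - q) a f)}),
     res = (\<lambda>U V s. restrict s V)\<rparr>"

subsection \<open>Schemes\<close>

definition pushforward :: "('a \<Rightarrow> 'b) \<Rightarrow> 'a set \<Rightarrow> ('a, 'k, 'r) presheaf \<Rightarrow> ('b, 'k, 'r) presheaf" where
  "pushforward \<phi> U F = \<lparr>sec = (\<lambda>W. sec F {x \<in> U. \<phi> x \<in> W}),
     res = (\<lambda>V W. res F {x \<in> U. \<phi> x \<in> V} {x \<in> U. \<phi> x \<in> W})\<rparr>"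

text \<open>
  \<open>U\<close> is isomorphic, as a ringed space over \<open>K\<close>, to the spectrum of some \<open>K\<close>-algebra \<open>R\<close>. As \<open>R\<close> is
  necessarily isomorphic to the ring of sections over \<open>U\<close>, its type is no restriction. An
  isomorphism of ringed spaces to a locally ringed space is automatically local.
\<close>

definition affine_open ::
  "('k, 'c) ring_scheme \<Rightarrow> 'a topology \<Rightarrow> ('a, 'k, 'r) presheaf \<Rightarrow> 'a set \<Rightarrow> bool"
where
  "affine_open K T OX U \<longleftrightarrow> openin T U \<and>
     (\<exists>(R :: ('k, 'r) module) \<phi> \<Phi>. algebra K R \<and>
        homeomorphic_map (subtopology T U) (zariski R) \<phi> \<and>
        algebra_sheaf_iso K (zariski R) (spec_sheaf R) (pushforward \<phi> U OX) \<Phi>)"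

definition scheme_over ::
  "('k, 'c) ring_scheme \<Rightarrow> 'a topology \<Rightarrow> ('a, 'k, 'r) presheaf \<Rightarrow> bool"
where
  "scheme_over K T OX \<longleftrightarrow> algebra_sheaf K T OX \<and> (\<forall>U. openin T U \<longrightarrow> cring (sec OX U)) \<and>
     (\<forall>x\<in>topspace T. \<exists>U. affine_open K T OX U \<and> x \<in> U)"

definition finite_type ::
  "('k, 'c) ring_scheme \<Rightarrow> 'a topology \<Rightarrow> ('a, 'k, 'r) presheaf \<Rightarrow> bool"
where
  "finite_type K T OX \<longleftrightarrow> (\<exists>\<U>. finite \<U> \<and> \<Union>\<U> = topspace T \<and>
     (\<forall>U\<in>\<U>. affine_open K T OX U \<and> fin_gen_algebra K (sec OX U)))"

definition irreducible_closed :: "'a topology \<Rightarrow> 'a set \<Rightarrow> bool" where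
  "irreducible_closed T C \<longleftrightarrow> closedin T C \<and> C \<noteq> {} \<and>
     (\<forall>A B. closedin T A \<and> closedin T B \<and> C \<subseteq> A \<union> B \<longrightarrow> C \<subseteq> A \<or> C \<subseteq> B)"

definition irreducible_space :: "'a topology \<Rightarrow> bool" where
  "irreducible_space T \<longleftrightarrow> irreducible_closed T (topspace T)"

definition has_irreducible_chain :: "'a topology \<Rightarrow> nat \<Rightarrow> bool" where
  "has_irreducible_chain T n \<longleftrightarrow> (\<exists>C :: nat \<Rightarrow> 'a set.
     (\<forall>i\<le>n. irreducible_closed T (C i)) \<and> (\<forall>i<n. C i \<subset> C (Suc i)))"

definition krull_dim :: "'a topology \<Rightarrow> nat \<Rightarrow> bool" where
  "krull_dim T n \<longleftrightarrow> has_irreducible_chain T n \<and> \<not> has_irreducible_chain T (Suc n)"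

text \<open>
  Smoothness of relative dimension \<open>n\<close> over a field as in Hartshorne III.10, for irreducible \<open>X\<close>
  of finite type: \<open>X\<close> has dimension \<open>n\<close>, and the fibre of the sheaf of differentials at each point
  \<open>x\<close> has dimension \<open>n\<close> over the residue field. Flatness over a field is automatic.
  The stalk of the sheaf of differentials at \<open>x\<close> is the module of differentials of the local
  ring at \<open>x\<close>.
\<close>

definition smooth_over ::
  "('k, 'c) ring_scheme \<Rightarrow> 'a topology \<Rightarrow> ('a, 'k, 'r) presheaf \<Rightarrow> nat \<Rightarrow> bool"
where
  "smooth_over K T OX n \<longleftrightarrow> krull_dim T n \<and>
     (\<forall>x\<in>topspace T. let B = stalk T OX x in
        free_of_rank (residue_field B) (mod_ideal B (max_ideal B) (kaehler K B)) n)"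

subsection \<open>Separatedness\<close>

text \<open>
  The topological space underlying \<open>X \<times> X\<close> (fibre product over \<open>K\<close>): its points are the triples
  \<open>(x, y, p)\<close>, where \<open>p\<close> is a prime ideal of \<open>\<kappa>(x) \<otimes> \<kappa>(y)\<close>. For affine open \<open>U\<close> and \<open>V\<close> the open
  subspace \<open>U \<times> V\<close> is the spectrum of \<open>O(U) \<otimes> O(V)\<close>, so the topology of \<open>X \<times> X\<close> is generated by the
  principal open subsets of these spectra. An element of \<open>O(U) \<otimes> O(V)\<close> is given by a
  representative \<open>h\<close>.
\<close>

definition point_field ::
  "'a topology \<Rightarrow> ('a, 'k, 'r) presheaf \<Rightarrow> 'a \<Rightarrow> ('k, ('a set \<times> 'r) set set) module"
where
  "point_field T OX x = residue_field (stalk T OX x)"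

definition point_value ::
  "'a topology \<Rightarrow> ('a, 'k, 'r) presheaf \<Rightarrow> 'a \<Rightarrow> 'a set \<Rightarrow> 'r \<Rightarrow> ('a set \<times> 'r) set set"
where
  "point_value T OX x U f = max_ideal (stalk T OX x) +>\<^bsub>stalk T OX x\<^esub> germ T OX x U f"

definition product_basic_open where
  "product_basic_open K T OX U V h =
     {(x, y, p). x \<in> U \<and> y \<in> V \<and> primeideal p (tensor K (point_field T OX x) (point_field T OX y)) \<and>
        tensor_rel K (point_field T OX x) (point_field T OX y)
          +>\<^bsub>tensor_free (point_field T OX x) (point_field T OX y)\<^esub>
          frag_extend (\<lambda>(f, g). frag_of (point_value T OX x U f, point_value T OX y V g)) h \<notin> p}"

definition self_product where
  "self_product K T OX = topology_generated_by {product_basic_open K T OX U V h | U V h.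
     affine_open K T OX U \<and> affine_open K T OX V \<and> h \<in> carrier (tensor_free (sec OX U) (sec OX V))}"

text \<open>The diagonal sends \<open>x\<close> to \<open>(x, x, ker (\<kappa>(x) \<otimes> \<kappa>(x) \<rightarrow> \<kappa>(x)))\<close>.\<close>

definition diagonal_point where
  "diagonal_point K T OX x = (x, x, let k = point_field T OX x in
     {X \<in> carrier (tensor K k k). \<exists>z\<in>X.
        (\<Oplus>\<^bsub>k\<^esub>c\<in>Poly_Mapping.keys z. add_pow k (Poly_Mapping.lookup z c) (fst c \<otimes>\<^bsub>k\<^esub> snd c)) = \<zero>\<^bsub>k\<^esub>})"

text \<open>The diagonal morphism is a closed immersion iff its image is closed.\<close>

definition separated_over ::
  "('k, 'c) ring_scheme \<Rightarrow> 'a topology \<Rightarrow> ('a, 'k, 'r) presheaf \<Rightarrow> bool"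
where
  "separated_over K T OX \<longleftrightarrow> closedin (self_product K T OX) (diagonal_point K T OX ` topspace T)"


section \<open>Differential operators\<close>

definition commutator ::
  "('a, 'k, 'r) presheaf \<Rightarrow> ('a, 'r, 'r) sheaf_map \<Rightarrow> 'a set \<Rightarrow> 'r \<Rightarrow> ('a, 'r, 'r) sheaf_map"
where
  "commutator OX P V f W g =
     P W (res OX V W f \<otimes>\<^bsub>sec OX W\<^esub> g) \<ominus>\<^bsub>sec OX W\<^esub> (res OX V W f \<otimes>\<^bsub>sec OX W\<^esub> P W g)"

text \<open>Grothendieck's definition; the first argument is a strict bound on the order.\<close>

primrec diff_order_less ::
  "nat \<Rightarrow> 'a topology \<Rightarrow> ('a, 'k, 'r) presheaf \<Rightarrow> ('a, 'r, 'r) sheaf_map \<Rightarrow> bool"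
where
  "diff_order_less 0 T OX P \<longleftrightarrow>
     (\<forall>V g. openin T V \<and> g \<in> carrier (sec OX V) \<longrightarrow> P V g = \<zero>\<^bsub>sec OX V\<^esub>)"
| "diff_order_less (Suc d) T OX P \<longleftrightarrow>
     (\<forall>V f. openin T V \<and> f \<in> carrier (sec OX V) \<longrightarrow>
        diff_order_less d (subtopology T V) OX (commutator OX P V f))"

text \<open>The order is only required to be locally bounded, so that differential operators form
  a sheaf. On the quasi-compact open sets this makes no difference.\<close>

definition diff_op ::
  "('k, 'c) ring_scheme \<Rightarrow> 'a topology \<Rightarrow> ('a, 'k, 'r) presheaf \<Rightarrow> ('a, 'r, 'r) sheaf_map \<Rightarrow> bool"
where
  "diff_op K T OX P \<longleftrightarrow> sheaf_hom K T OX OX P \<and>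
     (\<forall>x\<in>topspace T. \<exists>V d. openin T V \<and> x \<in> V \<and> diff_order_less d (subtopology T V) OX P)"

definition bidiff_op ::
  "('k, 'c) ring_scheme \<Rightarrow> 'a topology \<Rightarrow> ('a, 'k, 'r) presheaf
     \<Rightarrow> ('a set \<Rightarrow> 'r \<Rightarrow> 'r \<Rightarrow> 'r) \<Rightarrow> bool"
where
  "bidiff_op K T OX \<beta> \<longleftrightarrow>
     (\<forall>U. openin T U \<longrightarrow> (\<forall>f\<in>carrier (sec OX U).
        (\<lambda>g. \<beta> U f g) \<in> mod_hom K (sec OX U) (sec OX U) \<and>
        (\<lambda>g. \<beta> U g f) \<in> mod_hom K (sec OX U) (sec OX U))) \<and>
     (\<forall>U V. openin T U \<and> openin T V \<and> V \<subseteq> U \<longrightarrow>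
        (\<forall>f\<in>carrier (sec OX U). \<forall>g\<in>carrier (sec OX U).
           \<beta> V (res OX U V f) (res OX U V g) = res OX U V (\<beta> U f g))) \<and>
     (\<forall>x\<in>topspace T. \<exists>V d. openin T V \<and> x \<in> V \<and>
        (\<forall>W f. openin T W \<and> W \<subseteq> V \<and> f \<in> carrier (sec OX W) \<longrightarrow>
           diff_order_less d (subtopology T W) OX (\<lambda>W' g. \<beta> W' (res OX W W' f) g) \<and>
           diff_order_less d (subtopology T W) OX (\<lambda>W' g. \<beta> W' g (res OX W W' f))))"

text \<open>The sheaf \<open>\<D>\<^sub>X\<close>. To make equality of sections extensional, operators are \<^const>\<open>undefined\<close>
  outside of their domain.\<close>

definition cut ::
  "'a topology \<Rightarrow> ('a, 'k, 'r) presheaf \<Rightarrow> 'a set \<Rightarrow> ('a, 'r, 'r) sheaf_map \<Rightarrow> ('a, 'r, 'r) sheaf_map"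
where
  "cut T OX U P = (\<lambda>W f. if openin T W \<and> W \<subseteq> U \<and> f \<in> carrier (sec OX W) then P W f else undefined)"

definition diff_op_sheaf ::
  "('k, 'c) ring_scheme \<Rightarrow> 'a topology \<Rightarrow> ('a, 'k, 'r) presheaf
     \<Rightarrow> ('a, 'k, 'a set \<Rightarrow> 'r \<Rightarrow> 'r) presheaf"
where
  "diff_op_sheaf K T OX = \<lparr>sec = (\<lambda>U. \<lparr>carrier = {P. cut T OX U P = P \<and> diff_op K (subtopology T U) OX P},
       mult = (\<lambda>P Q. cut T OX U (\<lambda>W f. P W (Q W f))),
       one = cut T OX U (\<lambda>W f. f),
       zero = cut T OX U (\<lambda>W f. \<zero>\<^bsub>sec OX W\<^esub>),
       add = (\<lambda>P Q. cut T OX U (\<lambda>W f. P W f \<oplus>\<^bsub>sec OX W\<^esub> Q W f)),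
       smult = (\<lambda>c P. cut T OX U (\<lambda>W f. c \<odot>\<^bsub>sec OX W\<^esub> P W f))\<rparr>),
     res = (\<lambda>U V P. cut T OX V P)\<rparr>"


section \<open>Deformation quantizations\<close>

definition ps_sheaf :: "('a, 'k, 'r) presheaf \<Rightarrow> ('a, nat \<Rightarrow> 'k, nat \<Rightarrow> 'r) presheaf" where
  "ps_sheaf F = \<lparr>sec = (\<lambda>U. ps_mod (sec F U)), res = (\<lambda>U V f n. res F U V (f n))\<rparr>"

text \<open>A star product or gauge equivalence of \<open>\<O>\<^sub>U[[\<hbar>]]\<close> is obtained by taking
  \<^term>\<open>subtopology T U\<close> for \<open>T\<close> in the following.\<close>

definition star_product ::
  "('k, 'c) ring_scheme \<Rightarrow> 'a topology \<Rightarrow> ('a, 'k, 'r) presheaf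
     \<Rightarrow> ('a set \<Rightarrow> (nat \<Rightarrow> 'r) \<Rightarrow> (nat \<Rightarrow> 'r) \<Rightarrow> (nat \<Rightarrow> 'r)) \<Rightarrow> bool"
where
  "star_product K T OX star \<longleftrightarrow>
     algebra_sheaf (ps_ring K) T
       \<lparr>sec = (\<lambda>V. (sec (ps_sheaf OX) V)\<lparr>mult := star V\<rparr>), res = res (ps_sheaf OX)\<rparr> \<and>
     (\<exists>\<beta>. (\<forall>j\<ge>1. bidiff_op K T OX (\<beta> j)) \<and>
        (\<forall>V f g. openin T V \<and> f \<in> carrier (sec OX V) \<and> g \<in> carrier (sec OX V) \<longrightarrow>
           star V (ps_const (sec OX V) f) (ps_const (sec OX V) g) =
             (\<lambda>j. if j = 0 then f \<otimes>\<^bsub>sec OX V\<^esub> g else \<beta> j V f g)))"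

definition gauge_equivalence ::
  "('k, 'c) ring_scheme \<Rightarrow> 'a topology \<Rightarrow> ('a, 'k, 'r) presheaf
     \<Rightarrow> ('a, nat \<Rightarrow> 'r, nat \<Rightarrow> 'r) sheaf_map \<Rightarrow> bool"
where
  "gauge_equivalence K T OX \<gamma> \<longleftrightarrow>
     sheaf_iso (ps_ring K) T (ps_sheaf OX) (ps_sheaf OX) \<gamma> \<and>
     (\<forall>V. openin T V \<longrightarrow> \<gamma> V \<one>\<^bsub>sec (ps_sheaf OX) V\<^esub> = \<one>\<^bsub>sec (ps_sheaf OX) V\<^esub>) \<and>
     (\<exists>\<gamma>'. (\<forall>k\<ge>1. diff_op K T OX (\<gamma>' k)) \<and>
        (\<forall>V f. openin T V \<and> f \<in> carrier (sec OX V) \<longrightarrow>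
           \<gamma> V (ps_const (sec OX V) f) = (\<lambda>k. if k = 0 then f else \<gamma>' k V f)))"

subsection \<open>Complete flat sheaves\<close>

definition hbar_multiples ::
  "('k, 'c) ring_scheme \<Rightarrow> ('a, nat \<Rightarrow> 'k, 'm) presheaf \<Rightarrow> nat \<Rightarrow> 'a set \<Rightarrow> 'm set"
where
  "hbar_multiples K A m U = smult (sec A U) (hbar K [^]\<^bsub>ps_ring K\<^esub> m) ` carrier (sec A U)"

definition mod_hbar ::
  "('k, 'c) ring_scheme \<Rightarrow> ('a, nat \<Rightarrow> 'k, 'm) presheaf \<Rightarrow> nat \<Rightarrow> ('a, nat \<Rightarrow> 'k, 'm set) presheaf"
where
  "mod_hbar K A m = quot_presheaf A (hbar_multiples K A m)"

text \<open>The canonical map from \<open>A\<close> to the sheaf \<open>A/\<hbar>\<^sup>m A\<close>.\<close>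

definition to_mod_hbar ::
  "('k, 'c) ring_scheme \<Rightarrow> 'a topology \<Rightarrow> ('a, nat \<Rightarrow> 'k, 'm) presheaf \<Rightarrow> nat
     \<Rightarrow> ('a, 'm, 'a \<Rightarrow> ('a set \<times> 'm set) set) sheaf_map"
where
  "to_mod_hbar K T A m U a = germs T (mod_hbar K A m) U (hbar_multiples K A m U +>\<^bsub>sec A U\<^esub> a)"

text \<open>\<open>A\<close> is the inverse limit of the sheaves \<open>A/\<hbar>\<^sup>m A\<close>.\<close>

definition hbar_complete ::
  "('k, 'c) ring_scheme \<Rightarrow> 'a topology \<Rightarrow> ('a, nat \<Rightarrow> 'k, 'm) presheaf \<Rightarrow> bool"
where
  "hbar_complete K T A \<longleftrightarrow> (\<forall>U. openin T U \<longrightarrow>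
     bij_betw (\<lambda>a m. to_mod_hbar K T A m U a) (carrier (sec A U))
       {s. \<forall>m. s m \<in> carrier (sec (sheafify T (mod_hbar K A m)) U) \<and>
           sheafify_map T (mod_hbar K A m)
             (\<lambda>V X. \<Union>a\<in>X. hbar_multiples K A m V +>\<^bsub>sec A V\<^esub> a) U (s (Suc m)) = s m})"

definition hbar_flat ::
  "('k, 'c) ring_scheme \<Rightarrow> 'a topology \<Rightarrow> ('a, nat \<Rightarrow> 'k, 'm) presheaf \<Rightarrow> bool"
where
  "hbar_flat K T A \<longleftrightarrow> (\<forall>x\<in>topspace T. flat_module (ps_ring K) (stalk T A x))"

definition reduction ::
  "('k, 'c) ring_scheme \<Rightarrow> 'a topology \<Rightarrow> ('a, nat \<Rightarrow> 'k, 'm) presheaf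
     \<Rightarrow> ('a, 'k, 'a \<Rightarrow> ('a set \<times> 'm set) set) presheaf"
where
  "reduction K T A = (let Q = sheafify T (mod_hbar K A 1) in
     \<lparr>sec = (\<lambda>U. restrict_scalars (ps_const K) (sec Q U)), res = res Q\<rparr>)"

subsection \<open>Differential structures\<close>

record ('i, 'a, 'r, 'm) triv_family =
  idx :: "'i set"
  cov :: "'i \<Rightarrow> 'a set"
  triv :: "'i \<Rightarrow> ('a, nat \<Rightarrow> 'r, 'm) sheaf_map"

type_synonym ('a, 'r, 'm) reduction_map =
  "('a, 'a \<Rightarrow> ('a set \<times> 'm set) set, 'r) sheaf_map"

definition reduction_lift ::
  "('k, 'c) ring_scheme \<Rightarrow> 'a topology \<Rightarrow> ('a, nat \<Rightarrow> 'k, 'm) presheaf \<Rightarrow> ('a, 'r, 'm) reduction_map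
     \<Rightarrow> ('a, 'm, 'r) sheaf_map"
where
  "reduction_lift K T A \<psi> U a = \<psi> U (to_mod_hbar K T A 1 U a)"

definition triv_inv ::
  "('a, 'k, 'r) presheaf \<Rightarrow> ('a, nat \<Rightarrow> 'r, 'm) sheaf_map \<Rightarrow> ('a, 'm, nat \<Rightarrow> 'r) sheaf_map"
where
  "triv_inv OX \<tau> V = inv_into (carrier (sec (ps_sheaf OX) V)) (\<tau> V)"

definition diff_trivialization ::
  "('k, 'c) ring_scheme \<Rightarrow> 'a topology \<Rightarrow> ('a, 'k, 'r) presheaf \<Rightarrow> ('a, nat \<Rightarrow> 'k, 'm) presheaf
     \<Rightarrow> ('a, 'r, 'm) reduction_map \<Rightarrow> 'a set \<Rightarrow> ('a, nat \<Rightarrow> 'r, 'm) sheaf_map \<Rightarrow> bool"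
where
  "diff_trivialization K T OX A \<psi> U \<tau> \<longleftrightarrow>
     sheaf_iso (ps_ring K) (subtopology T U) (ps_sheaf OX) A \<tau> \<and>
     star_product K (subtopology T U) OX
       (\<lambda>V f g. triv_inv OX \<tau> V (\<tau> V f \<otimes>\<^bsub>sec A V\<^esub> \<tau> V g)) \<and>
     (\<forall>V f. openin (subtopology T U) V \<and> f \<in> carrier (sec OX V) \<longrightarrow>
        reduction_lift K T A \<psi> V (\<tau> V (ps_const (sec OX V) f)) = f)"

definition diff_structure ::
  "('k, 'c) ring_scheme \<Rightarrow> 'a topology \<Rightarrow> ('a, 'k, 'r) presheaf \<Rightarrow> ('a, nat \<Rightarrow> 'k, 'm) presheaf
     \<Rightarrow> ('a, 'r, 'm) reduction_map \<Rightarrow> ('i, 'a, 'r, 'm) triv_family \<Rightarrow> bool"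
where
  "diff_structure K T OX A \<psi> \<tau> \<longleftrightarrow>
     (\<forall>i\<in>idx \<tau>. openin T (cov \<tau> i)) \<and> (\<Union>i\<in>idx \<tau>. cov \<tau> i) = topspace T \<and>
     (\<forall>i\<in>idx \<tau>. diff_trivialization K T OX A \<psi> (cov \<tau> i) (triv \<tau> i)) \<and>
     (\<forall>i\<in>idx \<tau>. \<forall>j\<in>idx \<tau>. gauge_equivalence K (subtopology T (cov \<tau> i \<inter> cov \<tau> j)) OX
        (\<lambda>V f. triv_inv OX (triv \<tau> j) V (triv \<tau> i V f)))"

definition deformation_quantization ::
  "('k, 'c) ring_scheme \<Rightarrow> 'a topology \<Rightarrow> ('a, 'k, 'r) presheaf \<Rightarrow> ('a, nat \<Rightarrow> 'k, 'm) presheaf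
     \<Rightarrow> ('a, 'r, 'm) reduction_map \<Rightarrow> ('i, 'a, 'r, 'm) triv_family \<Rightarrow> bool"
where
  "deformation_quantization K T OX A \<psi> \<tau> \<longleftrightarrow>
     algebra_sheaf (ps_ring K) T A \<and> hbar_complete K T A \<and> hbar_flat K T A \<and>
     algebra_sheaf_iso K T (reduction K T A) OX \<psi> \<and>
     diff_structure K T OX A \<psi> \<tau>"

definition globally_trivialized :: "'a topology \<Rightarrow> ('i, 'a, 'r, 'm) triv_family \<Rightarrow> bool" where
  "globally_trivialized T \<tau> \<longleftrightarrow> (\<exists>i. idx \<tau> = {i} \<and> cov \<tau> i = topspace T)"

definition dq_gauge_equivalence ::
  "('k, 'c) ring_scheme \<Rightarrow> 'a topology \<Rightarrow> ('a, 'k, 'r) presheaf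
     \<Rightarrow> ('a, nat \<Rightarrow> 'k, 'm) presheaf \<Rightarrow> ('a, 'r, 'm) reduction_map \<Rightarrow> ('i, 'a, 'r, 'm) triv_family
     \<Rightarrow> ('a, nat \<Rightarrow> 'k, 'n) presheaf \<Rightarrow> ('a, 'r, 'n) reduction_map \<Rightarrow> ('j, 'a, 'r, 'n) triv_family
     \<Rightarrow> ('a, 'm, 'n) sheaf_map \<Rightarrow> bool"
where
  "dq_gauge_equivalence K T OX A \<psi> \<tau> A' \<psi>' \<tau>' \<gamma> \<longleftrightarrow>
     algebra_sheaf_iso (ps_ring K) T A A' \<gamma> \<and>
     (\<forall>V a. openin T V \<and> a \<in> carrier (sec A V) \<longrightarrow>
        reduction_lift K T A \<psi> V a = reduction_lift K T A' \<psi>' V (\<gamma> V a)) \<and>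
     (\<forall>i\<in>idx \<tau>. \<forall>j\<in>idx \<tau>'. gauge_equivalence K (subtopology T (cov \<tau> i \<inter> cov \<tau>' j)) OX
        (\<lambda>V f. triv_inv OX (triv \<tau>' j) V (\<gamma> V (triv \<tau> i V f))))"

end

theory Submission
  imports Defs
begin

text \<open>
  The sheaf \<open>A\<close> and the isomorphism \<open>\<psi>\<close> can be kept: it suffices to find one differential
  trivialization \<open>\<sigma>\<close> of \<open>(A, \<psi>)\<close> on all of \<open>X\<close> that differs from each \<open>\<tau> i\<close> by a gauge equivalence.
  So \<open>\<sigma>\<close> should be \<open>\<tau> i \<circ> \<rho> i\<close> over \<open>U i\<close>, for gauge equivalences \<open>\<rho> i\<close>. These maps glue if and only if
  \<open>g i j \<circ> \<rho> i = \<rho> j\<close> on overlaps, where \<open>g i j\<close> is the transition map from \<open>\<tau> i\<close> to \<open>\<tau> j\<close>. In other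
  words, the cocycle \<open>g\<close> in the sheaf of groups of gauge equivalences has to be a coboundary.

  A gauge equivalence is a series \<open>1 + R\<^sub>1 \<hbar> + R\<^sub>2 \<hbar>\<^sup>2 + \<dots>\<close> with differential operators \<open>R\<^sub>k\<close> that
  annihilate \<open>1\<close>, so \<open>\<rho>\<close> can be constructed one power of \<open>\<hbar>\<close> at a time. Once the coefficients
  \<open>R\<^sub>m i\<close> with \<open>m < k\<close> satisfy the equation in degrees below \<open>k\<close>, the equation in degree \<open>k\<close> reads
  \<open>R\<^sub>k j - R\<^sub>k i = P i j\<close>, where \<open>P i j\<close> is a differential operator determined by the lower
  coefficients. The cocycle condition for \<open>g\<close> yields \<open>P i j + P j l = P i l\<close>, so \<open>P\<close> is a Cech cocycle
  of differential operators. It splits since the first cohomology of the sheaf of differential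
  operators vanishes: this is \<open>cech_cocycle_splits\<close>, which compares Cech cocycles on an arbitrary
  open cover with sections of the first Godement quotient. As \<open>P i j\<close> annihilates \<open>1\<close>, the functions
  \<open>R\<^sub>k i 1\<close> agree on overlaps, and subtracting multiplication by them yields operators that annihilate
  \<open>1\<close>. The construction is carried out in \<open>gauge_cocycle_splits\<close>.

  That \<open>\<sigma>\<close> is a differential trivialization is a local question (\<open>global_diff_trivialization\<close>). On
  \<open>U i\<close> the product induced by \<open>\<sigma>\<close> is the star product induced by \<open>\<tau> i\<close>, transported along \<open>\<rho> i\<close>.
  Its coefficients, and those of the inverse of \<open>\<rho> i\<close>, satisfy recursions which show that they are
  (bi)differential operators (\<open>star_transport_coeff\<close>, \<open>gauge_inverse\<close>). The ingredients for these
  recursions are that (bi)differential operators are closed under sums and compositions, and that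
  \<open>K[[\<hbar>]]\<close>-linear maps are determined by their values on constant series (\<open>ps_hom_coeff\<close>).
\<close>

section \<open>Presheaves of abelian groups and modules\<close>

lemma mod_homD:
  assumes "h \<in> mod_hom R M N"
  shows "\<And>x. x \<in> carrier M \<Longrightarrow> h x \<in> carrier N"
    and "\<And>x y. x \<in> carrier M \<Longrightarrow> y \<in> carrier M \<Longrightarrow> h (x \<oplus>\<^bsub>M\<^esub> y) = h x \<oplus>\<^bsub>N\<^esub> h y"
    and "\<And>a x. a \<in> carrier R \<Longrightarrow> x \<in> carrier M \<Longrightarrow> h (a \<odot>\<^bsub>M\<^esub> x) = a \<odot>\<^bsub>N\<^esub> h x"
  using assms unfolding mod_hom_def by auto

lemma mod_homI:
  assumes "\<And>x. x \<in> carrier M \<Longrightarrow> h x \<in> carrier N"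
    and "\<And>x y. x \<in> carrier M \<Longrightarrow> y \<in> carrier M \<Longrightarrow> h (x \<oplus>\<^bsub>M\<^esub> y) = h x \<oplus>\<^bsub>N\<^esub> h y"
    and "\<And>a x. a \<in> carrier R \<Longrightarrow> x \<in> carrier M \<Longrightarrow> h (a \<odot>\<^bsub>M\<^esub> x) = a \<odot>\<^bsub>N\<^esub> h x"
  shows "h \<in> mod_hom R M N"
  using assms unfolding mod_hom_def by auto

lemma abelian_group_hom_of_additive:
  assumes "abelian_group M" "abelian_group N"
    and "\<And>x. x \<in> carrier M \<Longrightarrow> h x \<in> carrier N"
    and "\<And>x y. x \<in> carrier M \<Longrightarrow> y \<in> carrier M \<Longrightarrow> h (x \<oplus>\<^bsub>M\<^esub> y) = h x \<oplus>\<^bsub>N\<^esub> h y"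
  shows "abelian_group_hom M N h"
  using assms
  by (intro abelian_group_homI group_hom.intro group_hom_axioms.intro)
     (auto simp: hom_def abelian_group.a_group)

lemma mod_hom_abelian:
  assumes "h \<in> mod_hom R M N" "module R M" "module R N"
  shows "abelian_group_hom M N h"
  using assms by (intro abelian_group_hom_of_additive) (auto simp: mod_homD module.axioms)

lemma (in abelian_group_hom) hom_finsum_le:
  fixes n :: nat
  assumes "\<And>i. i \<le> n \<Longrightarrow> f i \<in> carrier G"
  shows "h (\<Oplus>\<^bsub>G\<^esub>i\<in>{..n}. f i) = (\<Oplus>\<^bsub>H\<^esub>i\<in>{..n}. h (f i))"
  using assms
proof (induction n)
  case (Suc n)
  have "f \<in> {..n} \<rightarrow> carrier G" "(\<lambda>i. h (f i)) \<in> {..n} \<rightarrow> carrier H"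
    using Suc.prems by auto
  then show ?case
    using Suc by (simp add: G.finsum_Suc H.finsum_Suc Pi_iff)
qed simp

lemma openin_sub:
  "openin T U \<Longrightarrow> openin (subtopology T U) V \<longleftrightarrow> openin T V \<and> V \<subseteq> U"
  by (rule openin_open_subtopology)

lemma subtopology_sub: "V \<subseteq> U \<Longrightarrow> subtopology (subtopology T U) V = subtopology T V"
  by (simp add: subtopology_subtopology Int_absorb1)

text \<open>Stalks, Godement sheaves and quotient presheaves are built from the additive structure of the
  sections, so this is the setting of the cohomological part of the proof.\<close>

locale abelian_presheaf =
  fixes T :: "'a topology" and F :: "('a, 'k, 'r) presheaf"
  assumes abelian: "openin T U \<Longrightarrow> abelian_group (sec F U)"
    and res_hom: "openin T U \<Longrightarrow> openin T V \<Longrightarrow> V \<subseteq> U \<Longrightarrow>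
      abelian_group_hom (sec F U) (sec F V) (res F U V)"
    and res_id: "openin T U \<Longrightarrow> s \<in> carrier (sec F U) \<Longrightarrow> res F U U s = s"
    and res_res: "openin T U \<Longrightarrow> openin T V \<Longrightarrow> openin T W \<Longrightarrow> W \<subseteq> V \<Longrightarrow> V \<subseteq> U \<Longrightarrow>
      s \<in> carrier (sec F U) \<Longrightarrow> res F V W (res F U V s) = res F U W s"
begin

lemma res_closed: "openin T U \<Longrightarrow> openin T V \<Longrightarrow> V \<subseteq> U \<Longrightarrow> s \<in> carrier (sec F U) \<Longrightarrow>
    res F U V s \<in> carrier (sec F V)"
  using abelian_group_hom.hom_closed[OF res_hom] by blast

lemma res_add: "openin T U \<Longrightarrow> openin T V \<Longrightarrow> V \<subseteq> U \<Longrightarrow> s \<in> carrier (sec F U) \<Longrightarrow>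
    t \<in> carrier (sec F U) \<Longrightarrow> res F U V (s \<oplus>\<^bsub>sec F U\<^esub> t) = res F U V s \<oplus>\<^bsub>sec F V\<^esub> res F U V t"
  using abelian_group_hom.hom_add[OF res_hom] by blast

lemma res_zero: "openin T U \<Longrightarrow> openin T V \<Longrightarrow> V \<subseteq> U \<Longrightarrow> res F U V \<zero>\<^bsub>sec F U\<^esub> = \<zero>\<^bsub>sec F V\<^esub>"
  using abelian_group_hom.hom_zero[OF res_hom] by blast

lemma res_a_inv: "openin T U \<Longrightarrow> openin T V \<Longrightarrow> V \<subseteq> U \<Longrightarrow> s \<in> carrier (sec F U) \<Longrightarrow>
    res F U V (\<ominus>\<^bsub>sec F U\<^esub> s) = \<ominus>\<^bsub>sec F V\<^esub> res F U V s"
  using abelian_group_hom.hom_a_inv[OF res_hom] by blast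

lemma zero_closed: "openin T U \<Longrightarrow> \<zero>\<^bsub>sec F U\<^esub> \<in> carrier (sec F U)"
  using abelian abelian_group.axioms(1) abelian_monoid.zero_closed by blast

lemma add_closed: "openin T U \<Longrightarrow> s \<in> carrier (sec F U) \<Longrightarrow> t \<in> carrier (sec F U) \<Longrightarrow>
    s \<oplus>\<^bsub>sec F U\<^esub> t \<in> carrier (sec F U)"
  by (meson abelian abelian_group.axioms(1) abelian_monoid.a_closed)

lemma a_inv_closed: "openin T U \<Longrightarrow> s \<in> carrier (sec F U) \<Longrightarrow> \<ominus>\<^bsub>sec F U\<^esub> s \<in> carrier (sec F U)"
  by (meson abelian abelian_group.a_inv_closed)

end

lemma module_presheaf_abelian:
  assumes "module_presheaf R T F"
  shows "abelian_presheaf T F"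
proof (rule abelian_presheaf.intro)
  show "abelian_group (sec F U)" if "openin T U" for U
    using assms that unfolding module_presheaf_def by (metis module.axioms(2))
  show "abelian_group_hom (sec F U) (sec F V) (res F U V)" if "openin T U" "openin T V" "V \<subseteq> U" for U V
  proof -
    have "res F U V \<in> mod_hom R (sec F U) (sec F V)" "module R (sec F U)" "module R (sec F V)"
      using assms that unfolding module_presheaf_def by simp_all
    then show ?thesis by (rule mod_hom_abelian)
  qed
qed (use assms in \<open>unfold module_presheaf_def, blast+\<close>)

lemma module_presheaf_sub:
  assumes "module_presheaf R T F" "openin T U"
  shows "module_presheaf R (subtopology T U) F"
  using assms unfolding module_presheaf_def by (simp add: openin_sub)

lemma sheaf_axiom_sub:
  assumes "sheaf_axiom T F" "openin T U"
  shows "sheaf_axiom (subtopology T U) F"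
  unfolding sheaf_axiom_def
proof (intro allI impI)
  fix \<V> s
  assume "(\<forall>V\<in>\<V>. openin (subtopology T U) V \<and> s V \<in> carrier (sec F V)) \<and>
    (\<forall>V\<in>\<V>. \<forall>W\<in>\<V>. res F V (V \<inter> W) (s V) = res F W (V \<inter> W) (s W))"
  then show "\<exists>!t. t \<in> carrier (sec F (\<Union>\<V>)) \<and> (\<forall>V\<in>\<V>. res F (\<Union>\<V>) V t = s V)"
    unfolding openin_sub[OF assms(2)]
    by (intro assms(1)[unfolded sheaf_axiom_def, THEN spec, THEN spec, THEN mp]) blast
qed

lemma module_sheaf_sub:
  assumes "module_sheaf R T F" "openin T U"
  shows "module_sheaf R (subtopology T U) F"
  using assms unfolding module_sheaf_def by (simp add: module_presheaf_sub sheaf_axiom_sub)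

lemma algebra_sheaf_sub:
  assumes "algebra_sheaf R T F" "openin T U"
  shows "algebra_sheaf R (subtopology T U) F"
  using assms unfolding algebra_sheaf_def by (simp add: module_sheaf_sub openin_sub)

lemma sheaf_hom_sub:
  assumes "sheaf_hom R T F G h" "openin T U"
  shows "sheaf_hom R (subtopology T U) F G h"
  using assms unfolding sheaf_hom_def by (simp add: openin_sub)

lemma sheaf_homD:
  assumes "sheaf_hom R T F G h" "openin T U"
  shows "h U \<in> mod_hom R (sec F U) (sec G U)"
    and "\<And>s. s \<in> carrier (sec F U) \<Longrightarrow> h U s \<in> carrier (sec G U)"
    and "\<And>s t. s \<in> carrier (sec F U) \<Longrightarrow> t \<in> carrier (sec F U) \<Longrightarrow>
           h U (s \<oplus>\<^bsub>sec F U\<^esub> t) = h U s \<oplus>\<^bsub>sec G U\<^esub> h U t"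
    and "\<And>a s. a \<in> carrier R \<Longrightarrow> s \<in> carrier (sec F U) \<Longrightarrow>
           h U (a \<odot>\<^bsub>sec F U\<^esub> s) = a \<odot>\<^bsub>sec G U\<^esub> h U s"
    and "\<And>V s. openin T V \<Longrightarrow> V \<subseteq> U \<Longrightarrow> s \<in> carrier (sec F U) \<Longrightarrow>
           h V (res F U V s) = res G U V (h U s)"
proof -
  show 1: "h U \<in> mod_hom R (sec F U) (sec G U)"
    using assms unfolding sheaf_hom_def by blast
  show "\<And>s. s \<in> carrier (sec F U) \<Longrightarrow> h U s \<in> carrier (sec G U)"
    and "\<And>s t. s \<in> carrier (sec F U) \<Longrightarrow> t \<in> carrier (sec F U) \<Longrightarrow>
           h U (s \<oplus>\<^bsub>sec F U\<^esub> t) = h U s \<oplus>\<^bsub>sec G U\<^esub> h U t"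
    and "\<And>a s. a \<in> carrier R \<Longrightarrow> s \<in> carrier (sec F U) \<Longrightarrow>
           h U (a \<odot>\<^bsub>sec F U\<^esub> s) = a \<odot>\<^bsub>sec G U\<^esub> h U s"
    using mod_homD[OF 1] by blast+
  show "\<And>V s. openin T V \<Longrightarrow> V \<subseteq> U \<Longrightarrow> s \<in> carrier (sec F U) \<Longrightarrow>
           h V (res F U V s) = res G U V (h U s)"
    using assms unfolding sheaf_hom_def by blast
qed

lemma sheaf_hom_cong:
  assumes "sheaf_hom R T F G h" "module_presheaf R T F"
    and "\<And>U s. openin T U \<Longrightarrow> s \<in> carrier (sec F U) \<Longrightarrow> h' U s = h U s"
  shows "sheaf_hom R T F G h'"
proof -
  interpret abelian_presheaf T F by (rule module_presheaf_abelian[OF assms(2)])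
  have smult: "a \<odot>\<^bsub>sec F U\<^esub> s \<in> carrier (sec F U)"
    if "openin T U" "a \<in> carrier R" "s \<in> carrier (sec F U)" for U a s
    using assms(2) that unfolding module_presheaf_def by (meson module.smult_closed)
  show ?thesis
    unfolding sheaf_hom_def mod_hom_def
    using sheaf_homD[OF assms(1)] by (auto simp: assms(3) add_closed smult res_closed)
qed

lemma sheaf_hom_comp:
  assumes "sheaf_hom R T F G h" "sheaf_hom R T G H k"
  shows "sheaf_hom R T F H (\<lambda>U s. k U (h U s))"
  unfolding sheaf_hom_def mod_hom_def
  using sheaf_homD[OF assms(1)] sheaf_homD[OF assms(2)] by auto

text \<open>The sheaf axiom speaks of sections indexed by the members of the cover. An indexed cover may
  name the same open set twice, but the overlap condition then forces the two sections to be equal.\<close>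

lemma sheaf_glue:
  assumes F: "abelian_presheaf T F" "sheaf_axiom T F"
    and U: "\<And>i. i \<in> I \<Longrightarrow> openin T (U i)"
    and s: "\<And>i. i \<in> I \<Longrightarrow> s i \<in> carrier (sec F (U i))"
    and agree: "\<And>i j. i \<in> I \<Longrightarrow> j \<in> I \<Longrightarrow>
      res F (U i) (U i \<inter> U j) (s i) = res F (U j) (U i \<inter> U j) (s j)"
  shows "\<exists>!t. t \<in> carrier (sec F (\<Union>i\<in>I. U i)) \<and> (\<forall>i\<in>I. res F (\<Union>i\<in>I. U i) (U i) t = s i)"
proof -
  interpret abelian_presheaf T F by (rule F)
  define p where "p V = (SOME i. i \<in> I \<and> U i = V)" for V
  have p: "p V \<in> I \<and> U (p V) = V" if "V \<in> U ` I" for V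
  proof -
    from that have "\<exists>i. i \<in> I \<and> U i = V" by auto
    then show ?thesis unfolding p_def by (rule someI_ex)
  qed
  have eq: "s (p (U i)) = s i" if "i \<in> I" for i
  proof -
    have q: "p (U i) \<in> I" "U (p (U i)) = U i" using p that by auto
    have "s (p (U i)) \<in> carrier (sec F (U i))" using s[OF q(1)] q(2) by simp
    then show ?thesis
      using agree[OF q(1) that] q U[OF that] s[OF that] by (simp add: res_id)
  qed
  have "\<exists>!t. t \<in> carrier (sec F (\<Union>(U ` I))) \<and> (\<forall>V\<in>U ` I. res F (\<Union>(U ` I)) V t = s (p V))"
  proof (rule F(2)[unfolded sheaf_axiom_def, rule_format], intro conjI ballI)
    fix V W assume "V \<in> U ` I" "W \<in> U ` I"
    then obtain i j where "i \<in> I" "V = U i" "j \<in> I" "W = U j" by blast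
    then show "res F V (V \<inter> W) (s (p V)) = res F W (V \<inter> W) (s (p W))"
      using agree[of i j] eq[of i] eq[of j] by simp
  next
    fix V assume "V \<in> U ` I"
    then obtain i where "i \<in> I" "V = U i" by blast
    then show "openin T V" "s (p V) \<in> carrier (sec F V)" using U s[of i] eq[of i] by simp_all
  qed
  then show ?thesis using eq by simp
qed

lemma sheaf_separated:
  assumes F: "abelian_presheaf T F" "sheaf_axiom T F"
    and U: "\<And>i. i \<in> I \<Longrightarrow> openin T (U i)" "V = (\<Union>i\<in>I. U i)"
    and st: "s \<in> carrier (sec F V)" "t \<in> carrier (sec F V)"
    and eq: "\<And>i. i \<in> I \<Longrightarrow> res F V (U i) s = res F V (U i) t"
  shows "s = t"
proof -
  interpret abelian_presheaf T F by (rule F)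
  have V: "openin T V" using U by auto
  have sub: "U i \<subseteq> V" if "i \<in> I" for i using U that by auto
  have "\<exists>!u. u \<in> carrier (sec F (\<Union>i\<in>I. U i)) \<and>
      (\<forall>i\<in>I. res F (\<Union>i\<in>I. U i) (U i) u = res F V (U i) s)"
    by (rule sheaf_glue[OF F]) (use U V sub st in \<open>auto simp: res_closed res_res openin_Int\<close>)
  then show ?thesis using st eq U(2) by (metis (no_types, lifting))
qed

text \<open>The glued map sends \<open>s\<close> to the section that restricts to \<open>h i\<close> of the restriction of \<open>s\<close> on each
  \<open>V \<inter> U i\<close>. Such a section is unique, and every property of the glued map follows from this
  uniqueness.\<close>

lemma glue_sheaf_homs:
  assumes F: "module_presheaf R T F" and G: "module_sheaf R T G"
    and U: "\<And>i. i \<in> I \<Longrightarrow> openin T (U i)" "(\<Union>i\<in>I. U i) = topspace T"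
    and h: "\<And>i. i \<in> I \<Longrightarrow> sheaf_hom R (subtopology T (U i)) F G (h i)"
    and agree: "\<And>i j V s. i \<in> I \<Longrightarrow> j \<in> I \<Longrightarrow> openin T V \<Longrightarrow> V \<subseteq> U i \<inter> U j \<Longrightarrow>
      s \<in> carrier (sec F V) \<Longrightarrow> h i V s = h j V s"
  obtains k where "sheaf_hom R T F G k"
    and "\<And>i V s. i \<in> I \<Longrightarrow> openin T V \<Longrightarrow> V \<subseteq> U i \<Longrightarrow> s \<in> carrier (sec F V) \<Longrightarrow> k V s = h i V s"
proof -
  interpret F: abelian_presheaf T F by (rule module_presheaf_abelian[OF F])
  have G1: "module_presheaf R T G" and G2: "sheaf_axiom T G"
    using G by (auto simp: module_sheaf_def)
  interpret G: abelian_presheaf T G by (rule module_presheaf_abelian[OF G1])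
  have cover: "V = (\<Union>i\<in>I. V \<inter> U i)" if "openin T V" for V
    using openin_subset[OF that] unfolding U(2)[symmetric] by blast
  have hD: "h i V \<in> mod_hom R (sec F V) (sec G V)" "\<And>W s. openin T W \<Longrightarrow> W \<subseteq> V \<Longrightarrow>
      s \<in> carrier (sec F V) \<Longrightarrow> h i W (res F V W s) = res G V W (h i V s)"
    if "i \<in> I" "openin T V" "V \<subseteq> U i" for i V
    using sheaf_homD[OF h[OF that(1)]] that U(1) by (auto simp: openin_sub)
  have ex: "\<exists>!t. t \<in> carrier (sec G V) \<and>
      (\<forall>i\<in>I. res G V (V \<inter> U i) t = h i (V \<inter> U i) (res F V (V \<inter> U i) s))"
    if V: "openin T V" and s: "s \<in> carrier (sec F V)" for V s
  proof -
    have o: "openin T (V \<inter> U i)" if "i \<in> I" for i using V U(1) that by auto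
    have 1: "res F V (V \<inter> U i) s \<in> carrier (sec F (V \<inter> U i))" if "i \<in> I" for i
      using o V s that by (simp add: F.res_closed)
    have "\<exists>!t. t \<in> carrier (sec G (\<Union>i\<in>I. V \<inter> U i)) \<and>
      (\<forall>i\<in>I. res G (\<Union>i\<in>I. V \<inter> U i) (V \<inter> U i) t = h i (V \<inter> U i) (res F V (V \<inter> U i) s))"
    proof (rule sheaf_glue[OF G.abelian_presheaf_axioms G2])
      fix i assume i: "i \<in> I"
      show "openin T (V \<inter> U i)" by (rule o[OF i])
      show "h i (V \<inter> U i) (res F V (V \<inter> U i) s) \<in> carrier (sec G (V \<inter> U i))"
        using mod_homD(1)[OF hD(1)[OF i o[OF i]]] 1[OF i] by simp
    next
      fix i j assume i: "i \<in> I" and j: "j \<in> I"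
      let ?W = "(V \<inter> U i) \<inter> (V \<inter> U j)"
      have W: "openin T ?W" using o i j by auto
      have "res G (V \<inter> U i) ?W (h i (V \<inter> U i) (res F V (V \<inter> U i) s)) = h i ?W (res F V ?W s)"
        using hD(2)[OF i o[OF i] _ W Int_lower1 1[OF i]] F.res_res[OF V o[OF i] W Int_lower1 Int_lower1 s] by simp
      moreover have "res G (V \<inter> U j) ?W (h j (V \<inter> U j) (res F V (V \<inter> U j) s)) = h j ?W (res F V ?W s)"
        using hD(2)[OF j o[OF j] _ W Int_lower2 1[OF j]] F.res_res[OF V o[OF j] W Int_lower2 Int_lower1 s] by simp
      moreover have "h i ?W (res F V ?W s) = h j ?W (res F V ?W s)"
        by (rule agree[OF i j W]) (use F.res_closed[OF V W _ s] in auto)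
      ultimately show "res G (V \<inter> U i) ?W (h i (V \<inter> U i) (res F V (V \<inter> U i) s)) =
          res G (V \<inter> U j) ?W (h j (V \<inter> U j) (res F V (V \<inter> U j) s))" by simp
    qed
    then show ?thesis using cover[OF V] by simp
  qed
  define k where "k V s = (THE t. t \<in> carrier (sec G V) \<and>
      (\<forall>i\<in>I. res G V (V \<inter> U i) t = h i (V \<inter> U i) (res F V (V \<inter> U i) s)))" for V s
  have k: "k V s \<in> carrier (sec G V)"
    "\<And>i. i \<in> I \<Longrightarrow> res G V (V \<inter> U i) (k V s) = h i (V \<inter> U i) (res F V (V \<inter> U i) s)"
    if "openin T V" "s \<in> carrier (sec F V)" for V s
    using theI'[OF ex[OF that]] unfolding k_def by auto
  have kI: "k V s = t" if "openin T V" "s \<in> carrier (sec F V)" "t \<in> carrier (sec G V)"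
    "\<And>i. i \<in> I \<Longrightarrow> res G V (V \<inter> U i) t = h i (V \<inter> U i) (res F V (V \<inter> U i) s)" for V s t
    using ex[OF that(1,2)] k[OF that(1,2)] that(3,4) by (elim ex1E) (metis)
  have smF: "a \<odot>\<^bsub>sec F V\<^esub> s \<in> carrier (sec F V)"
    if "openin T V" "a \<in> carrier R" "s \<in> carrier (sec F V)" for V a s
    using F that unfolding module_presheaf_def by (meson module.smult_closed)
  have smG: "a \<odot>\<^bsub>sec G V\<^esub> s \<in> carrier (sec G V)"
    if "openin T V" "a \<in> carrier R" "s \<in> carrier (sec G V)" for V a s
    using G1 that unfolding module_presheaf_def by (meson module.smult_closed)
  have rsF: "res F U V (a \<odot>\<^bsub>sec F U\<^esub> s) = a \<odot>\<^bsub>sec F V\<^esub> res F U V s"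
    if "openin T U" "openin T V" "V \<subseteq> U" "a \<in> carrier R" "s \<in> carrier (sec F U)" for U V a s
    using F that unfolding module_presheaf_def by (meson mod_homD(3))
  have rsG: "res G U V (a \<odot>\<^bsub>sec G U\<^esub> s) = a \<odot>\<^bsub>sec G V\<^esub> res G U V s"
    if "openin T U" "openin T V" "V \<subseteq> U" "a \<in> carrier R" "s \<in> carrier (sec G U)" for U V a s
    using G1 that unfolding module_presheaf_def by (meson mod_homD(3))
  have loc: "k V s = h i V s" if i: "i \<in> I" and V: "openin T V" "V \<subseteq> U i" and s: "s \<in> carrier (sec F V)"
    for i V s
  proof (rule kI[OF V(1) s])
    show "h i V s \<in> carrier (sec G V)" using mod_homD(1)[OF hD(1)[OF i V]] s .
    fix j assume j: "j \<in> I"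
    have W: "openin T (V \<inter> U j)" using V U(1)[OF j] by auto
    have "res G V (V \<inter> U j) (h i V s) = h i (V \<inter> U j) (res F V (V \<inter> U j) s)"
      using hD(2)[OF i V W] s by auto
    also have "\<dots> = h j (V \<inter> U j) (res F V (V \<inter> U j) s)"
      by (rule agree[OF i j W]) (use F.res_closed[OF V(1) W _ s] V in auto)
    finally show "res G V (V \<inter> U j) (h i V s) = h j (V \<inter> U j) (res F V (V \<inter> U j) s)" .
  qed
  have "sheaf_hom R T F G k"
    unfolding sheaf_hom_def
  proof (intro conjI allI impI ballI)
    fix V assume V: "openin T V"
    have o: "openin T (V \<inter> U i)" if "i \<in> I" for i using V U(1) that by auto
    have 1: "res F V (V \<inter> U i) s \<in> carrier (sec F (V \<inter> U i))" if "i \<in> I" "s \<in> carrier (sec F V)" for i s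
      using o V that by (simp add: F.res_closed)
    show "k V \<in> mod_hom R (sec F V) (sec G V)"
    proof (rule mod_homI)
      fix s assume s: "s \<in> carrier (sec F V)"
      show "k V s \<in> carrier (sec G V)" by (rule k(1)[OF V s])
    next
      fix s t assume s: "s \<in> carrier (sec F V)" and t: "t \<in> carrier (sec F V)"
      show "k V (s \<oplus>\<^bsub>sec F V\<^esub> t) = k V s \<oplus>\<^bsub>sec G V\<^esub> k V t"
      proof (rule kI[OF V F.add_closed[OF V s t]])
        show "k V s \<oplus>\<^bsub>sec G V\<^esub> k V t \<in> carrier (sec G V)"
          by (intro G.add_closed V k(1) s t)
        fix i assume i: "i \<in> I"
        show "res G V (V \<inter> U i) (k V s \<oplus>\<^bsub>sec G V\<^esub> k V t) =
            h i (V \<inter> U i) (res F V (V \<inter> U i) (s \<oplus>\<^bsub>sec F V\<^esub> t))"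
          using mod_homD(2)[OF hD(1)[OF i o[OF i]] 1[OF i s] 1[OF i t]]
          by (simp add: G.res_add F.res_add V o i k s t)
      qed
    next
      fix a s assume a: "a \<in> carrier R" and s: "s \<in> carrier (sec F V)"
      show "k V (a \<odot>\<^bsub>sec F V\<^esub> s) = a \<odot>\<^bsub>sec G V\<^esub> k V s"
      proof (rule kI[OF V smF[OF V a s]])
        show "a \<odot>\<^bsub>sec G V\<^esub> k V s \<in> carrier (sec G V)"
          by (intro smG V k(1) a s)
        fix i assume i: "i \<in> I"
        show "res G V (V \<inter> U i) (a \<odot>\<^bsub>sec G V\<^esub> k V s) =
            h i (V \<inter> U i) (res F V (V \<inter> U i) (a \<odot>\<^bsub>sec F V\<^esub> s))"
          using mod_homD(3)[OF hD(1)[OF i o[OF i]] a 1[OF i s]]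
          by (simp add: rsG rsF V o i k s a)
      qed
    qed
  next
    fix V W s assume "openin T V \<and> openin T W \<and> W \<subseteq> V" and s: "s \<in> carrier (sec F V)"
    then have V: "openin T V" and W: "openin T W" "W \<subseteq> V" by auto
    show "k W (res F V W s) = res G V W (k V s)"
    proof (rule kI[OF W(1) F.res_closed[OF V W s]])
      show "res G V W (k V s) \<in> carrier (sec G W)"
        by (intro G.res_closed V W k(1) s)
      fix i assume i: "i \<in> I"
      have o: "openin T (W \<inter> U i)" "openin T (V \<inter> U i)" using V W U(1)[OF i] by auto
      have "res G W (W \<inter> U i) (res G V W (k V s)) = res G (V \<inter> U i) (W \<inter> U i) (res G V (V \<inter> U i) (k V s))"
        using V W o k(1)[OF V s] by (simp add: G.res_res Int_mono subset_trans[OF _ W(2)] le_infI1)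
      also have "\<dots> = h i (W \<inter> U i) (res F (V \<inter> U i) (W \<inter> U i) (res F V (V \<inter> U i) s))"
        using hD(2)[OF i o(2) Int_lower2 o(1)] F.res_closed[OF V o(2) Int_lower1 s] W(2)
        by (simp add: k(2)[OF V s i] le_infI1)
      also have "res F (V \<inter> U i) (W \<inter> U i) (res F V (V \<inter> U i) s) = res F W (W \<inter> U i) (res F V W s)"
        using V W o s by (simp add: F.res_res Int_mono le_infI1)
      finally show "res G W (W \<inter> U i) (res G V W (k V s)) = h i (W \<inter> U i) (res F W (W \<inter> U i) (res F V W s))" .
    qed
  qed
  then show ?thesis using loc that by blast
qed

text \<open>Injectivity on the members of the cover makes the local preimages of a section agree on overlaps,
  so that they glue.\<close>

lemma sheaf_iso_if_locally_bij:
  assumes F: "module_sheaf R T F" and G: "module_presheaf R T G" "sheaf_axiom T G"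
    and h: "sheaf_hom R T F G h"
    and U: "\<And>i. i \<in> I \<Longrightarrow> openin T (U i)" "(\<Union>i\<in>I. U i) = topspace T"
    and bij: "\<And>i V. i \<in> I \<Longrightarrow> openin T V \<Longrightarrow> V \<subseteq> U i \<Longrightarrow>
      bij_betw (h V) (carrier (sec F V)) (carrier (sec G V))"
  shows "sheaf_iso R T F G h"
  unfolding sheaf_iso_def
proof (intro conjI allI impI h)
  fix V assume V: "openin T V"
  have F1: "module_presheaf R T F" and F2: "sheaf_axiom T F"
    using F by (auto simp: module_sheaf_def)
  interpret F: abelian_presheaf T F by (rule module_presheaf_abelian[OF F1])
  interpret G: abelian_presheaf T G by (rule module_presheaf_abelian[OF G(1)])
  have cover: "V = (\<Union>i\<in>I. V \<inter> U i)"
    using openin_subset[OF V] unfolding U(2)[symmetric] by blast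
  have o: "openin T (V \<inter> U i)" if "i \<in> I" for i using V U(1) that by auto
  note bij = bij[OF _ o]
  have nat: "h W (res F V' W s) = res G V' W (h V' s)"
    if "openin T V'" "openin T W" "W \<subseteq> V'" "s \<in> carrier (sec F V')" for V' W s
    using sheaf_homD(5)[OF h that(1,2,3,4)] .
  have cl: "h V' s \<in> carrier (sec G V')" if "openin T V'" "s \<in> carrier (sec F V')" for V' s
    using sheaf_homD(2)[OF h that] .
  show "bij_betw (h V) (carrier (sec F V)) (carrier (sec G V))"
    unfolding bij_betw_def
  proof (intro conjI inj_onI subset_antisym subsetI)
    fix s t assume s: "s \<in> carrier (sec F V)" and t: "t \<in> carrier (sec F V)" and eq: "h V s = h V t"
    show "s = t"
    proof (rule sheaf_separated[OF F.abelian_presheaf_axioms F2 o cover s t])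
      fix i assume i: "i \<in> I"
      have "h (V \<inter> U i) (res F V (V \<inter> U i) s) = h (V \<inter> U i) (res F V (V \<inter> U i) t)"
        using eq V o[OF i] s t by (simp add: nat)
      then show "res F V (V \<inter> U i) s = res F V (V \<inter> U i) t"
        using bij[OF i i] V o[OF i] s t by (auto simp: bij_betw_def inj_on_def F.res_closed)
    qed
  next
    fix b assume "b \<in> h V ` carrier (sec F V)"
    then show "b \<in> carrier (sec G V)" using cl V by auto
  next
    fix b assume b: "b \<in> carrier (sec G V)"
    define s where "s i = inv_into (carrier (sec F (V \<inter> U i))) (h (V \<inter> U i)) (res G V (V \<inter> U i) b)" for i
    have s: "s i \<in> carrier (sec F (V \<inter> U i))" "h (V \<inter> U i) (s i) = res G V (V \<inter> U i) b" if "i \<in> I" for i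
    proof -
      have "res G V (V \<inter> U i) b \<in> h (V \<inter> U i) ` carrier (sec F (V \<inter> U i))"
        using bij[OF that that] G.res_closed[OF V o[OF that] _ b] by (auto simp: bij_betw_def)
      then show "s i \<in> carrier (sec F (V \<inter> U i))" "h (V \<inter> U i) (s i) = res G V (V \<inter> U i) b"
        unfolding s_def by (auto intro: inv_into_into f_inv_into_f)
    qed
    have "\<exists>!t. t \<in> carrier (sec F (\<Union>i\<in>I. V \<inter> U i)) \<and>
      (\<forall>i\<in>I. res F (\<Union>i\<in>I. V \<inter> U i) (V \<inter> U i) t = s i)"
    proof (rule sheaf_glue[OF F.abelian_presheaf_axioms F2 o s(1)])
      fix i j assume i: "i \<in> I" and j: "j \<in> I"
      let ?W = "(V \<inter> U i) \<inter> (V \<inter> U j)"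
      have W: "openin T ?W" using o i j by auto
      have "h ?W (res F (V \<inter> U i) ?W (s i)) = res G V ?W b"
        using nat[OF o[OF i] W Int_lower1 s(1)[OF i]] s(2)[OF i] G.res_res[OF V o[OF i] W Int_lower1 Int_lower1 b] by simp
      moreover have "h ?W (res F (V \<inter> U j) ?W (s j)) = res G V ?W b"
        using nat[OF o[OF j] W Int_lower2 s(1)[OF j]] s(2)[OF j] G.res_res[OF V o[OF j] W Int_lower2 Int_lower1 b] by simp
      moreover have "inj_on (h ?W) (carrier (sec F ?W))"
        using assms(7)[OF i W] by (simp add: bij_betw_def le_infI1)
      ultimately show "res F (V \<inter> U i) ?W (s i) = res F (V \<inter> U j) ?W (s j)"
        using F.res_closed[OF o[OF i] W Int_lower1 s(1)[OF i]] F.res_closed[OF o[OF j] W Int_lower2 s(1)[OF j]]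
        by (simp add: inj_on_def)
    qed
    then obtain t where t: "t \<in> carrier (sec F V)" "\<And>i. i \<in> I \<Longrightarrow> res F V (V \<inter> U i) t = s i"
      using ex1_implies_ex unfolding cover[symmetric] by metis
    have "h V t = b"
    proof (rule sheaf_separated[OF G.abelian_presheaf_axioms G(2) o cover cl[OF V t(1)] b])
      fix i assume i: "i \<in> I"
      show "res G V (V \<inter> U i) (h V t) = res G V (V \<inter> U i) b"
        using nat[OF V o[OF i] _ t(1)] t(2)[OF i] s(2)[OF i] by auto
    qed
    then show "b \<in> h V ` carrier (sec F V)" using t by auto
  qed
qed

section \<open>Calculus of differential operators\<close>

locale ringed_space =
  fixes K :: "('k, 'c) ring_scheme" and T :: "'a topology" and OX :: "('a, 'k, 'r) presheaf"
  assumes algebra_sheaf: "algebra_sheaf K T OX"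
    and cring: "openin T U \<Longrightarrow> cring (sec OX U)"

lemma ringed_space_sub:
  "ringed_space K T OX \<Longrightarrow> openin T U \<Longrightarrow> ringed_space K (subtopology T U) OX"
  unfolding ringed_space_def by (simp add: algebra_sheaf_sub openin_sub)

context ringed_space
begin

lemma module_sheaf: "module_sheaf K T OX"
  using algebra_sheaf by (simp add: algebra_sheaf_def)

lemma module_presheaf: "module_presheaf K T OX"
  using module_sheaf by (simp add: module_sheaf_def)

lemma sheaf_axiom: "sheaf_axiom T OX"
  using module_sheaf by (simp add: module_sheaf_def)

sublocale abelian_presheaf T OX
  by (rule module_presheaf_abelian[OF module_presheaf])

lemma module: "openin T U \<Longrightarrow> module K (sec OX U)"
  using module_presheaf by (simp add: module_presheaf_def)

lemma res_ring_hom: "openin T U \<Longrightarrow> openin T V \<Longrightarrow> V \<subseteq> U \<Longrightarrow> res OX U V \<in> ring_hom (sec OX U) (sec OX V)"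
  using algebra_sheaf by (simp add: algebra_sheaf_def)

lemma res_mult: "openin T U \<Longrightarrow> openin T V \<Longrightarrow> V \<subseteq> U \<Longrightarrow> f \<in> carrier (sec OX U) \<Longrightarrow>
    g \<in> carrier (sec OX U) \<Longrightarrow> res OX U V (f \<otimes>\<^bsub>sec OX U\<^esub> g) = res OX U V f \<otimes>\<^bsub>sec OX V\<^esub> res OX U V g"
  using ring_hom_mult[OF res_ring_hom] .

lemma res_one: "openin T U \<Longrightarrow> openin T V \<Longrightarrow> V \<subseteq> U \<Longrightarrow> res OX U V \<one>\<^bsub>sec OX U\<^esub> = \<one>\<^bsub>sec OX V\<^esub>"
  using ring_hom_one[OF res_ring_hom] .

lemma smult_closed: "openin T U \<Longrightarrow> c \<in> carrier K \<Longrightarrow> f \<in> carrier (sec OX U) \<Longrightarrow>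
    c \<odot>\<^bsub>sec OX U\<^esub> f \<in> carrier (sec OX U)"
  using module.smult_closed[OF module] .

lemma mult_closed: "openin T U \<Longrightarrow> f \<in> carrier (sec OX U) \<Longrightarrow> g \<in> carrier (sec OX U) \<Longrightarrow>
    f \<otimes>\<^bsub>sec OX U\<^esub> g \<in> carrier (sec OX U)"
  using ring.ring_simprules(5)[OF cring.axioms(1)[OF cring]] .

lemma one_closed: "openin T U \<Longrightarrow> \<one>\<^bsub>sec OX U\<^esub> \<in> carrier (sec OX U)"
  using ring.ring_simprules(6)[OF cring.axioms(1)[OF cring]] .

lemma mult_smult: "openin T U \<Longrightarrow> c \<in> carrier K \<Longrightarrow> f \<in> carrier (sec OX U) \<Longrightarrow> g \<in> carrier (sec OX U) \<Longrightarrow>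
    f \<otimes>\<^bsub>sec OX U\<^esub> (c \<odot>\<^bsub>sec OX U\<^esub> g) = c \<odot>\<^bsub>sec OX U\<^esub> (f \<otimes>\<^bsub>sec OX U\<^esub> g)"
  using algebra_sheaf unfolding algebra_sheaf_def assoc_algebra_def by simp

lemma sheaf_hom_zero:
  assumes "sheaf_hom K T OX OX P" "openin T U"
  shows "P U \<zero>\<^bsub>sec OX U\<^esub> = \<zero>\<^bsub>sec OX U\<^esub>"
  using abelian_group_hom.hom_zero[OF mod_hom_abelian[OF sheaf_homD(1)[OF assms] module module]] assms(2) by simp

lemma sheaf_hom_minus:
  assumes "sheaf_hom K T OX OX P" "openin T U" "f \<in> carrier (sec OX U)" "g \<in> carrier (sec OX U)"
  shows "P U (f \<ominus>\<^bsub>sec OX U\<^esub> g) = P U f \<ominus>\<^bsub>sec OX U\<^esub> P U g"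
proof -
  interpret abelian_group_hom "sec OX U" "sec OX U" "P U"
    by (rule mod_hom_abelian[OF sheaf_homD(1)[OF assms(1,2)] module module]) (fact assms(2))+
  show ?thesis using assms by (simp add: a_minus_def)
qed

lemma sheaf_hom_add:
  assumes P: "sheaf_hom K T OX OX P" and Q: "sheaf_hom K T OX OX Q"
  shows "sheaf_hom K T OX OX (\<lambda>U f. P U f \<oplus>\<^bsub>sec OX U\<^esub> Q U f)"
  unfolding sheaf_hom_def
proof (intro conjI allI impI ballI mod_homI)
  fix U assume U: "openin T U"
  interpret module K "sec OX U" by (rule module[OF U])
  note Pc = sheaf_homD(2)[OF P U] and Qc = sheaf_homD(2)[OF Q U]
  show "P U f \<oplus>\<^bsub>sec OX U\<^esub> Q U f \<in> carrier (sec OX U)" if "f \<in> carrier (sec OX U)" for f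
    using that Pc Qc by simp
  show "P U (f \<oplus>\<^bsub>sec OX U\<^esub> g) \<oplus>\<^bsub>sec OX U\<^esub> Q U (f \<oplus>\<^bsub>sec OX U\<^esub> g) =
      P U f \<oplus>\<^bsub>sec OX U\<^esub> Q U f \<oplus>\<^bsub>sec OX U\<^esub> (P U g \<oplus>\<^bsub>sec OX U\<^esub> Q U g)"
    if "f \<in> carrier (sec OX U)" "g \<in> carrier (sec OX U)" for f g
    using that Pc Qc by (simp add: sheaf_homD(3)[OF P U] sheaf_homD(3)[OF Q U] M.a_ac)
  show "P U (c \<odot>\<^bsub>sec OX U\<^esub> f) \<oplus>\<^bsub>sec OX U\<^esub> Q U (c \<odot>\<^bsub>sec OX U\<^esub> f) =
      c \<odot>\<^bsub>sec OX U\<^esub> (P U f \<oplus>\<^bsub>sec OX U\<^esub> Q U f)"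
    if "c \<in> carrier K" "f \<in> carrier (sec OX U)" for c f
    using that Pc Qc by (simp add: sheaf_homD(4)[OF P U] sheaf_homD(4)[OF Q U] smult_r_distr)
next
  fix U V f assume "openin T U \<and> openin T V \<and> V \<subseteq> U" "f \<in> carrier (sec OX U)"
  then show "P V (res OX U V f) \<oplus>\<^bsub>sec OX V\<^esub> Q V (res OX U V f) =
      res OX U V (P U f \<oplus>\<^bsub>sec OX U\<^esub> Q U f)"
    by (simp add: sheaf_homD(5)[OF P] sheaf_homD(5)[OF Q] res_add sheaf_homD(2)[OF P] sheaf_homD(2)[OF Q])
qed

lemma sheaf_hom_neg:
  assumes P: "sheaf_hom K T OX OX P"
  shows "sheaf_hom K T OX OX (\<lambda>U f. \<ominus>\<^bsub>sec OX U\<^esub> P U f)"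
  unfolding sheaf_hom_def
proof (intro conjI allI impI ballI mod_homI)
  fix U assume U: "openin T U"
  interpret module K "sec OX U" by (rule module[OF U])
  note Pc = sheaf_homD(2)[OF P U]
  show "\<ominus>\<^bsub>sec OX U\<^esub> P U f \<in> carrier (sec OX U)" if "f \<in> carrier (sec OX U)" for f
    using that Pc by simp
  show "\<ominus>\<^bsub>sec OX U\<^esub> P U (f \<oplus>\<^bsub>sec OX U\<^esub> g) = \<ominus>\<^bsub>sec OX U\<^esub> P U f \<oplus>\<^bsub>sec OX U\<^esub> \<ominus>\<^bsub>sec OX U\<^esub> P U g"
    if "f \<in> carrier (sec OX U)" "g \<in> carrier (sec OX U)" for f g
    using that Pc by (simp add: sheaf_homD(3)[OF P U] M.minus_add)
  show "\<ominus>\<^bsub>sec OX U\<^esub> P U (c \<odot>\<^bsub>sec OX U\<^esub> f) = c \<odot>\<^bsub>sec OX U\<^esub> (\<ominus>\<^bsub>sec OX U\<^esub> P U f)"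
    if "c \<in> carrier K" "f \<in> carrier (sec OX U)" for c f
    using that Pc by (simp add: sheaf_homD(4)[OF P U] smult_r_minus)
next
  fix U V f assume "openin T U \<and> openin T V \<and> V \<subseteq> U" "f \<in> carrier (sec OX U)"
  then show "\<ominus>\<^bsub>sec OX V\<^esub> P V (res OX U V f) = res OX U V (\<ominus>\<^bsub>sec OX U\<^esub> P U f)"
    by (simp add: sheaf_homD(5)[OF P] res_a_inv sheaf_homD(2)[OF P])
qed

lemma sheaf_hom_mult:
  assumes U: "openin T U" and q: "q \<in> carrier (sec OX U)"
  shows "sheaf_hom K (subtopology T U) OX OX (\<lambda>V f. res OX U V q \<otimes>\<^bsub>sec OX V\<^esub> f)"
  unfolding sheaf_hom_def openin_sub[OF U]
proof (intro conjI allI impI ballI mod_homI)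
  fix V assume "openin T V \<and> V \<subseteq> U"
  then have V: "openin T V" "V \<subseteq> U" by auto
  interpret cring "sec OX V" by (rule cring[OF V(1)])
  note rc = res_closed[OF U V q]
  show "res OX U V q \<otimes>\<^bsub>sec OX V\<^esub> f \<in> carrier (sec OX V)" if "f \<in> carrier (sec OX V)" for f
    using that rc by simp
  show "res OX U V q \<otimes>\<^bsub>sec OX V\<^esub> (f \<oplus>\<^bsub>sec OX V\<^esub> g) =
      res OX U V q \<otimes>\<^bsub>sec OX V\<^esub> f \<oplus>\<^bsub>sec OX V\<^esub> res OX U V q \<otimes>\<^bsub>sec OX V\<^esub> g"
    if "f \<in> carrier (sec OX V)" "g \<in> carrier (sec OX V)" for f g
    using that rc by (simp add: r_distr)
  show "res OX U V q \<otimes>\<^bsub>sec OX V\<^esub> (c \<odot>\<^bsub>sec OX V\<^esub> f) = c \<odot>\<^bsub>sec OX V\<^esub> (res OX U V q \<otimes>\<^bsub>sec OX V\<^esub> f)"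
    if "c \<in> carrier K" "f \<in> carrier (sec OX V)" for c f
    using mult_smult[OF V(1) that(1) rc that(2)] .
next
  fix V W f assume "(openin T V \<and> V \<subseteq> U) \<and> (openin T W \<and> W \<subseteq> U) \<and> W \<subseteq> V" "f \<in> carrier (sec OX V)"
  then show "res OX U W q \<otimes>\<^bsub>sec OX W\<^esub> res OX V W f = res OX V W (res OX U V q \<otimes>\<^bsub>sec OX V\<^esub> f)"
    using U q by (simp add: res_mult res_closed res_res)
qed

lemma sheaf_hom_commutator:
  assumes P: "sheaf_hom K T OX OX P" and V: "openin T V" and f: "f \<in> carrier (sec OX V)"
  shows "sheaf_hom K (subtopology T V) OX OX (commutator OX P V f)"
proof -
  interpret V: ringed_space K "subtopology T V" OX
    by (rule ringed_space_sub[OF _ V]) unfold_locales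
  have PV: "sheaf_hom K (subtopology T V) OX OX P" by (rule sheaf_hom_sub[OF P V])
  have m: "sheaf_hom K (subtopology T V) OX OX (\<lambda>W g. res OX V W f \<otimes>\<^bsub>sec OX W\<^esub> g)"
    by (rule sheaf_hom_mult[OF V f])
  have "commutator OX P V f = (\<lambda>W g. P W (res OX V W f \<otimes>\<^bsub>sec OX W\<^esub> g) \<oplus>\<^bsub>sec OX W\<^esub>
      (\<ominus>\<^bsub>sec OX W\<^esub> (res OX V W f \<otimes>\<^bsub>sec OX W\<^esub> P W g)))"
    by (intro ext) (simp add: commutator_def a_minus_def)
  then show ?thesis
    by (simp only:) (intro V.sheaf_hom_add V.sheaf_hom_neg sheaf_hom_comp[OF m PV] sheaf_hom_comp[OF PV m])
qed

end

lemma diff_order_less_sub: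
  assumes "diff_order_less d T OX P" "openin T U"
  shows "diff_order_less d (subtopology T U) OX P"
  using assms by (cases d) (auto simp: openin_sub subtopology_sub)

lemma diff_order_less_cong:
  assumes "ringed_space K T OX" "diff_order_less d T OX P"
    and "\<And>V f. openin T V \<Longrightarrow> f \<in> carrier (sec OX V) \<Longrightarrow> P V f = Q V f"
  shows "diff_order_less d T OX Q"
  using assms
proof (induction d arbitrary: T P Q)
  case (Suc d)
  interpret ringed_space K T OX by (rule Suc.prems)
  show ?case
    unfolding diff_order_less.simps
  proof (intro allI impI)
    fix V f assume "openin T V \<and> f \<in> carrier (sec OX V)"
    then have V: "openin T V" and f: "f \<in> carrier (sec OX V)" by auto
    have "diff_order_less d (subtopology T V) OX (commutator OX P V f)"
      using Suc.prems(2) V f by simp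
    then show "diff_order_less d (subtopology T V) OX (commutator OX Q V f)"
    proof (rule Suc.IH[OF ringed_space_sub[OF Suc.prems(1) V]])
      fix W g assume "openin (subtopology T V) W" and g: "g \<in> carrier (sec OX W)"
      then have W: "openin T W" "W \<subseteq> V" by (auto simp: openin_sub[OF V])
      show "commutator OX P V f W g = commutator OX Q V f W g"
        by (simp add: commutator_def Suc.prems(3) W g mult_closed res_closed[OF V W f])
    qed
  qed
qed simp

text \<open>The bound \<open>0\<close> means that the operator vanishes, and then its commutators vanish as well.\<close>

lemma diff_order_less_Suc:
  assumes "ringed_space K T OX" "sheaf_hom K T OX OX P" "diff_order_less d T OX P"
  shows "diff_order_less (Suc d) T OX P"
  using assms
proof (induction d arbitrary: T P)
  case 0
  interpret ringed_space K T OX by (rule 0)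
  show ?case
    unfolding diff_order_less.simps
  proof (intro allI impI)
    fix V f W g assume "openin T V \<and> f \<in> carrier (sec OX V)"
      and W: "openin (subtopology T V) W \<and> g \<in> carrier (sec OX W)"
    then have V: "openin T V" and f: "f \<in> carrier (sec OX V)" by auto
    have W: "openin T W" "W \<subseteq> V" and g: "g \<in> carrier (sec OX W)" using W by (auto simp: openin_sub[OF V])
    interpret W: cring "sec OX W" by (rule cring[OF W(1)])
    have z: "P W g = \<zero>\<^bsub>sec OX W\<^esub>" if "g \<in> carrier (sec OX W)" for g
      using 0(3) W(1) that by simp
    show "commutator OX P V f W g = \<zero>\<^bsub>sec OX W\<^esub>"
      using res_closed[OF V W f] g by (simp add: commutator_def z a_minus_def)
  qed
next
  case (Suc d)
  interpret ringed_space K T OX by (rule Suc.prems)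
  show ?case
    unfolding diff_order_less.simps(2)[of "Suc d"]
  proof (intro allI impI)
    fix V f assume "openin T V \<and> f \<in> carrier (sec OX V)"
    then have V: "openin T V" and f: "f \<in> carrier (sec OX V)" by auto
    show "diff_order_less (Suc d) (subtopology T V) OX (commutator OX P V f)"
      using Suc.prems(3) V f
      by (intro Suc.IH ringed_space_sub[OF Suc.prems(1) V] sheaf_hom_commutator[OF Suc.prems(2)]) auto
  qed
qed

lemma diff_order_less_mono:
  assumes "ringed_space K T OX" "sheaf_hom K T OX OX P" "diff_order_less d T OX P" "d \<le> e"
  shows "diff_order_less e T OX P"
  using assms(4)
  by (induction e rule: dec_induct) (use assms diff_order_less_Suc in blast)+

lemma diff_order_less_add:
  assumes "ringed_space K T OX" "sheaf_hom K T OX OX P" "sheaf_hom K T OX OX Q"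
    "diff_order_less d T OX P" "diff_order_less d T OX Q"
  shows "diff_order_less d T OX (\<lambda>V f. P V f \<oplus>\<^bsub>sec OX V\<^esub> Q V f)"
  using assms
proof (induction d arbitrary: T P Q)
  case 0
  interpret ringed_space K T OX by (rule 0)
  show ?case
    unfolding diff_order_less.simps
  proof (intro allI impI)
    fix V f assume V: "openin T V \<and> f \<in> carrier (sec OX V)"
    interpret V: cring "sec OX V" by (rule cring) (use V in simp)
    show "P V f \<oplus>\<^bsub>sec OX V\<^esub> Q V f = \<zero>\<^bsub>sec OX V\<^esub>" using 0(4,5) V by simp
  qed
next
  case (Suc d)
  interpret ringed_space K T OX by (rule Suc.prems)
  note P = Suc.prems(2) and Q = Suc.prems(3)
  show ?case
    unfolding diff_order_less.simps
  proof (intro allI impI)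
    fix V f assume "openin T V \<and> f \<in> carrier (sec OX V)"
    then have V: "openin T V" and f: "f \<in> carrier (sec OX V)" by auto
    have 1: "diff_order_less d (subtopology T V) OX
        (\<lambda>W g. commutator OX P V f W g \<oplus>\<^bsub>sec OX W\<^esub> commutator OX Q V f W g)"
      using Suc.prems V f
      by (intro Suc.IH ringed_space_sub[OF Suc.prems(1) V] sheaf_hom_commutator) auto
    show "diff_order_less d (subtopology T V) OX (commutator OX (\<lambda>V f. P V f \<oplus>\<^bsub>sec OX V\<^esub> Q V f) V f)"
    proof (rule diff_order_less_cong[OF ringed_space_sub[OF Suc.prems(1) V] 1])
      fix W g assume "openin (subtopology T V) W" and g: "g \<in> carrier (sec OX W)"
      then have W: "openin T W" "W \<subseteq> V" by (auto simp: openin_sub[OF V])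
      interpret W: cring "sec OX W" by (rule cring[OF W(1)])
      note c = res_closed[OF V W f] sheaf_homD(2)[OF P W(1)] sheaf_homD(2)[OF Q W(1)] g
      show "commutator OX P V f W g \<oplus>\<^bsub>sec OX W\<^esub> commutator OX Q V f W g =
          commutator OX (\<lambda>V f. P V f \<oplus>\<^bsub>sec OX V\<^esub> Q V f) V f W g"
        using c by (simp add: commutator_def a_minus_def W.r_distr W.minus_add W.a_ac)
    qed
  qed
qed

text \<open>By the derivation rule \<open>[PQ, f] = P[Q, f] + [P, f]Q\<close>, commuting with a function lowers the sum
  of the two bounds. If one of the bounds is \<open>0\<close> already, the respective summand vanishes.\<close>

lemma diff_order_less_comp:
  assumes "ringed_space K T OX" "sheaf_hom K T OX OX P" "sheaf_hom K T OX OX Q"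
    "diff_order_less d T OX P" "diff_order_less e T OX Q"
  shows "diff_order_less (d + e) T OX (\<lambda>V f. P V (Q V f))"
  using assms
proof (induction n \<equiv> "d + e" arbitrary: T P Q d e)
  case 0
  interpret ringed_space K T OX by (rule 0)
  show ?case using 0 by (auto simp: zero_closed)
next
  case (Suc n)
  interpret ringed_space K T OX by (rule Suc.prems)
  note P = Suc.prems(2) and Q = Suc.prems(3)
  have "diff_order_less (Suc n) T OX (\<lambda>V f. P V (Q V f))"
    unfolding diff_order_less.simps
  proof (intro allI impI)
    fix V f assume "openin T V \<and> f \<in> carrier (sec OX V)"
    then have V: "openin T V" and f: "f \<in> carrier (sec OX V)" by auto
    note RV = ringed_space_sub[OF Suc.prems(1) V]
    interpret RV: ringed_space K "subtopology T V" OX by (rule RV)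
    note PV = sheaf_hom_sub[OF P V] and QV = sheaf_hom_sub[OF Q V]
    note cP = sheaf_hom_commutator[OF P V f] and cQ = sheaf_hom_commutator[OF Q V f]
    have 1: "diff_order_less n (subtopology T V) OX (\<lambda>W g. P W (commutator OX Q V f W g))"
    proof (cases e)
      case 0
      have z: "Q W g = \<zero>\<^bsub>sec OX W\<^esub>" if "openin T W" "g \<in> carrier (sec OX W)" for W g
        using Suc.prems(5) 0 that by simp
      have "diff_order_less 0 (subtopology T V) OX (\<lambda>W g. P W (commutator OX Q V f W g))"
        unfolding diff_order_less.simps
      proof (intro allI impI)
        fix W g assume "openin (subtopology T V) W \<and> g \<in> carrier (sec OX W)"
        then have W: "openin T W" "W \<subseteq> V" and g: "g \<in> carrier (sec OX W)" by (auto simp: openin_sub[OF V])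
        interpret W: cring "sec OX W" by (rule cring[OF W(1)])
        show "P W (commutator OX Q V f W g) = \<zero>\<^bsub>sec OX W\<^esub>"
          using res_closed[OF V W f] W g by (simp add: commutator_def z a_minus_def sheaf_hom_zero[OF P])
      qed
      then show ?thesis
        by (rule diff_order_less_mono[OF RV sheaf_hom_comp[OF cQ PV]]) simp
    next
      case (Suc e')
      show ?thesis
        using Suc.prems V f Suc Suc.hyps(2) diff_order_less_sub[OF Suc.prems(4) V]
        using Suc.hyps(1)[of d e', OF _ RV PV cQ] by simp
    qed
    have 2: "diff_order_less n (subtopology T V) OX (\<lambda>W g. commutator OX P V f W (Q W g))"
    proof (cases d)
      case 0
      have z: "P W g = \<zero>\<^bsub>sec OX W\<^esub>" if "openin T W" "g \<in> carrier (sec OX W)" for W g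
        using Suc.prems(4) 0 that by simp
      have "diff_order_less 0 (subtopology T V) OX (\<lambda>W g. commutator OX P V f W (Q W g))"
        unfolding diff_order_less.simps
      proof (intro allI impI)
        fix W g assume "openin (subtopology T V) W \<and> g \<in> carrier (sec OX W)"
        then have W: "openin T W" "W \<subseteq> V" and g: "g \<in> carrier (sec OX W)" by (auto simp: openin_sub[OF V])
        interpret W: cring "sec OX W" by (rule cring[OF W(1)])
        show "commutator OX P V f W (Q W g) = \<zero>\<^bsub>sec OX W\<^esub>"
          using res_closed[OF V W f] W g sheaf_homD(2)[OF Q W(1) g]
          by (simp add: commutator_def z a_minus_def)
      qed
      then show ?thesis
        by (rule diff_order_less_mono[OF RV sheaf_hom_comp[OF QV cP]]) simp
    next
      case (Suc d')
      show ?thesis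
        using Suc.prems V f Suc Suc.hyps(2) diff_order_less_sub[OF Suc.prems(5) V]
        using Suc.hyps(1)[of d' e, OF _ RV cP QV] by simp
    qed
    have 3: "diff_order_less n (subtopology T V) OX
        (\<lambda>W g. P W (commutator OX Q V f W g) \<oplus>\<^bsub>sec OX W\<^esub> commutator OX P V f W (Q W g))"
      by (rule diff_order_less_add[OF RV sheaf_hom_comp[OF cQ PV] sheaf_hom_comp[OF QV cP] 1 2])
    show "diff_order_less n (subtopology T V) OX (commutator OX (\<lambda>V f. P V (Q V f)) V f)"
    proof (rule diff_order_less_cong[OF RV 3])
      fix W g assume "openin (subtopology T V) W" and g: "g \<in> carrier (sec OX W)"
      then have W: "openin T W" "W \<subseteq> V" by (auto simp: openin_sub[OF V])
      interpret W: cring "sec OX W" by (rule cring[OF W(1)])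
      have fc: "res OX V W f \<in> carrier (sec OX W)" by (rule res_closed[OF V W f])
      note Qc = sheaf_homD(2)[OF Q W(1)]
      note c = fc g Qc[OF g] Qc[OF W.m_closed[OF fc g]] sheaf_homD(2)[OF P W(1)]
      have "P W (commutator OX Q V f W g) = P W (Q W (res OX V W f \<otimes>\<^bsub>sec OX W\<^esub> g)) \<ominus>\<^bsub>sec OX W\<^esub>
          P W (res OX V W f \<otimes>\<^bsub>sec OX W\<^esub> Q W g)"
        using c by (simp add: commutator_def sheaf_hom_minus[OF P W(1)])
      then show "P W (commutator OX Q V f W g) \<oplus>\<^bsub>sec OX W\<^esub> commutator OX P V f W (Q W g) =
          commutator OX (\<lambda>V f. P V (Q V f)) V f W g"
        using c by (simp add: commutator_def a_minus_def W.a_assoc W.l_neg)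
           (simp add: W.a_assoc[symmetric] W.l_neg)
    qed
  qed
  then show ?case using Suc.hyps(2) by simp
qed

lemma (in ringed_space) diff_order_less_mult:
  assumes "openin T U" "q \<in> carrier (sec OX U)"
  shows "diff_order_less 1 (subtopology T U) OX (\<lambda>V f. res OX U V q \<otimes>\<^bsub>sec OX V\<^esub> f)"
  unfolding One_nat_def diff_order_less.simps openin_sub[OF assms(1)]
proof (intro allI impI)
  fix V f W g assume "(openin T V \<and> V \<subseteq> U) \<and> f \<in> carrier (sec OX V)"
    and W: "openin (subtopology (subtopology T U) V) W \<and> g \<in> carrier (sec OX W)"
  then have V: "openin T V" "V \<subseteq> U" and f: "f \<in> carrier (sec OX V)" by auto
  have W: "openin T W" "W \<subseteq> V" and g: "g \<in> carrier (sec OX W)"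
    using W by (auto simp: subtopology_sub[OF V(2)] openin_sub[OF V(1)])
  interpret W: cring "sec OX W" by (rule cring[OF W(1)])
  have c: "res OX V W f \<in> carrier (sec OX W)" "res OX U W q \<in> carrier (sec OX W)"
    using res_closed[OF V(1) W f] res_closed[OF assms(1) W(1) _ assms(2)] V W by auto
  have "res OX U W q \<otimes>\<^bsub>sec OX W\<^esub> (res OX V W f \<otimes>\<^bsub>sec OX W\<^esub> g) =
      res OX V W f \<otimes>\<^bsub>sec OX W\<^esub> (res OX U W q \<otimes>\<^bsub>sec OX W\<^esub> g)"
    using c g by (simp add: W.m_lcomm)
  then show "commutator OX (\<lambda>V f. res OX U V q \<otimes>\<^bsub>sec OX V\<^esub> f) V f W g = \<zero>\<^bsub>sec OX W\<^esub>"
    using c g by (simp add: commutator_def a_minus_def W.r_neg)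
qed

subsection \<open>Differential operators\<close>

lemma diff_op_sheaf_hom: "diff_op K T OX P \<Longrightarrow> sheaf_hom K T OX OX P"
  by (simp add: diff_op_def)

lemma diff_op_sub:
  assumes "diff_op K T OX P" "openin T U"
  shows "diff_op K (subtopology T U) OX P"
  unfolding diff_op_def
proof (intro conjI ballI)
  show "sheaf_hom K (subtopology T U) OX OX P"
    by (rule sheaf_hom_sub[OF diff_op_sheaf_hom[OF assms(1)] assms(2)])
  fix x assume "x \<in> topspace (subtopology T U)"
  then have x: "x \<in> topspace T" "x \<in> U" by auto
  then obtain V d where V: "openin T V" "x \<in> V" "diff_order_less d (subtopology T V) OX P"
    using assms(1) unfolding diff_op_def by blast
  have "diff_order_less d (subtopology (subtopology T V) (V \<inter> U)) OX P"
    by (intro diff_order_less_sub V(3)) (use V assms(2) in \<open>auto simp: openin_sub\<close>)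
  then have "diff_order_less d (subtopology (subtopology T U) (V \<inter> U)) OX P"
    by (simp add: subtopology_sub)
  then show "\<exists>V d. openin (subtopology T U) V \<and> x \<in> V \<and> diff_order_less d (subtopology (subtopology T U) V) OX P"
    using V x assms(2) by (intro exI[of _ "V \<inter> U"] exI[of _ d]) (auto simp: openin_sub)
qed

lemma diff_op_local2:
  assumes "diff_op K T OX P" "diff_op K T OX Q" "x \<in> topspace T"
  obtains V d e where "openin T V" "x \<in> V" "diff_order_less d (subtopology T V) OX P"
    "diff_order_less e (subtopology T V) OX Q"
proof -
  obtain V d where V: "openin T V" "x \<in> V" "diff_order_less d (subtopology T V) OX P"
    using assms unfolding diff_op_def by blast
  obtain W e where W: "openin T W" "x \<in> W" "diff_order_less e (subtopology T W) OX Q"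
    using assms unfolding diff_op_def by blast
  have "diff_order_less d (subtopology (subtopology T V) (V \<inter> W)) OX P"
    "diff_order_less e (subtopology (subtopology T W) (V \<inter> W)) OX Q"
    using V W by (auto intro!: diff_order_less_sub simp: openin_sub)
  then show ?thesis
    using that[of "V \<inter> W" d e] V W by (auto simp: subtopology_sub)
qed

context ringed_space
begin

lemma ringed_sub: "openin T U \<Longrightarrow> ringed_space K (subtopology T U) OX"
  by (rule ringed_space_sub) unfold_locales

lemma diff_op_cong:
  assumes "diff_op K T OX P"
    and eq: "\<And>V f. openin T V \<Longrightarrow> f \<in> carrier (sec OX V) \<Longrightarrow> Q V f = P V f"
  shows "diff_op K T OX Q"
  unfolding diff_op_def
proof (intro conjI ballI)
  show "sheaf_hom K T OX OX Q"
    by (rule sheaf_hom_cong[OF diff_op_sheaf_hom[OF assms(1)] module_presheaf eq])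
  fix x assume "x \<in> topspace T"
  then obtain V d where V: "openin T V" "x \<in> V" "diff_order_less d (subtopology T V) OX P"
    using assms(1) unfolding diff_op_def by blast
  have "diff_order_less d (subtopology T V) OX Q"
    by (rule diff_order_less_cong[OF ringed_sub[OF V(1)] V(3)]) (auto simp: eq openin_sub V(1))
  then show "\<exists>V d. openin T V \<and> x \<in> V \<and> diff_order_less d (subtopology T V) OX Q"
    using V by blast
qed

lemma diff_op_mult:
  assumes "openin T U" "q \<in> carrier (sec OX U)"
  shows "diff_op K (subtopology T U) OX (\<lambda>V f. res OX U V q \<otimes>\<^bsub>sec OX V\<^esub> f)"
  unfolding diff_op_def
proof (intro conjI ballI)
  show "sheaf_hom K (subtopology T U) OX OX (\<lambda>V f. res OX U V q \<otimes>\<^bsub>sec OX V\<^esub> f)"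
    by (rule sheaf_hom_mult[OF assms])
  fix x assume "x \<in> topspace (subtopology T U)"
  then have "openin (subtopology T U) U \<and> x \<in> U \<and> diff_order_less 1 (subtopology (subtopology T U) U) OX
      (\<lambda>V f. res OX U V q \<otimes>\<^bsub>sec OX V\<^esub> f)"
    using diff_order_less_mult[OF assms] assms(1) by (simp add: openin_sub subtopology_sub)
  then show "\<exists>V d. openin (subtopology T U) V \<and> x \<in> V \<and> diff_order_less d (subtopology (subtopology T U) V) OX
      (\<lambda>V f. res OX U V q \<otimes>\<^bsub>sec OX V\<^esub> f)" by blast
qed

lemma diff_op_id: "diff_op K T OX (\<lambda>_ f. f)"
proof -
  have X: "openin T (topspace T)" by simp
  have "diff_op K (subtopology T (topspace T)) OX
      (\<lambda>V f. res OX (topspace T) V \<one>\<^bsub>sec OX (topspace T)\<^esub> \<otimes>\<^bsub>sec OX V\<^esub> f)"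
    by (rule diff_op_mult[OF X one_closed[OF X]])
  then show ?thesis
    unfolding subtopology_topspace
  proof (rule diff_op_cong)
    fix V f assume V: "openin T V" and f: "f \<in> carrier (sec OX V)"
    interpret V: cring "sec OX V" by (rule cring[OF V])
    show "f = res OX (topspace T) V \<one>\<^bsub>sec OX (topspace T)\<^esub> \<otimes>\<^bsub>sec OX V\<^esub> f"
      using f by (simp add: res_one[OF X V openin_subset[OF V]])
  qed
qed

lemma diff_op_add:
  assumes P: "diff_op K T OX P" and Q: "diff_op K T OX Q"
  shows "diff_op K T OX (\<lambda>V f. P V f \<oplus>\<^bsub>sec OX V\<^esub> Q V f)"
  unfolding diff_op_def
proof (intro conjI ballI sheaf_hom_add diff_op_sheaf_hom[OF P] diff_op_sheaf_hom[OF Q])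
  fix x assume "x \<in> topspace T"
  then obtain V d e where V: "openin T V" "x \<in> V" and de: "diff_order_less d (subtopology T V) OX P"
    "diff_order_less e (subtopology T V) OX Q"
    using diff_op_local2[OF P Q] by metis
  note R = ringed_sub[OF V(1)]
  note h = sheaf_hom_sub[OF diff_op_sheaf_hom[OF P] V(1)] sheaf_hom_sub[OF diff_op_sheaf_hom[OF Q] V(1)]
  have "diff_order_less (max d e) (subtopology T V) OX (\<lambda>V f. P V f \<oplus>\<^bsub>sec OX V\<^esub> Q V f)"
    by (rule diff_order_less_add[OF R h diff_order_less_mono[OF R h(1) de(1)] diff_order_less_mono[OF R h(2) de(2)]])
       simp_all
  then show "\<exists>V d. openin T V \<and> x \<in> V \<and>
      diff_order_less d (subtopology T V) OX (\<lambda>V f. P V f \<oplus>\<^bsub>sec OX V\<^esub> Q V f)"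
    using V by blast
qed

lemma diff_op_comp:
  assumes P: "diff_op K T OX P" and Q: "diff_op K T OX Q"
  shows "diff_op K T OX (\<lambda>V f. P V (Q V f))"
  unfolding diff_op_def
proof (intro conjI ballI sheaf_hom_comp[OF diff_op_sheaf_hom[OF Q] diff_op_sheaf_hom[OF P]])
  fix x assume "x \<in> topspace T"
  then obtain V d e where V: "openin T V" "x \<in> V" and de: "diff_order_less d (subtopology T V) OX P"
    "diff_order_less e (subtopology T V) OX Q"
    using diff_op_local2[OF P Q] by metis
  have "diff_order_less (d + e) (subtopology T V) OX (\<lambda>V f. P V (Q V f))"
    by (rule diff_order_less_comp[OF ringed_sub[OF V(1)] sheaf_hom_sub[OF diff_op_sheaf_hom[OF P] V(1)]
          sheaf_hom_sub[OF diff_op_sheaf_hom[OF Q] V(1)] de])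
  then show "\<exists>V d. openin T V \<and> x \<in> V \<and> diff_order_less d (subtopology T V) OX (\<lambda>V f. P V (Q V f))"
    using V by blast
qed

lemma diff_op_uminus: "diff_op K T OX (\<lambda>V f. \<ominus>\<^bsub>sec OX V\<^esub> f)"
proof -
  have X: "openin T (topspace T)" by simp
  have "diff_op K (subtopology T (topspace T)) OX
      (\<lambda>V f. res OX (topspace T) V (\<ominus>\<^bsub>sec OX (topspace T)\<^esub> \<one>\<^bsub>sec OX (topspace T)\<^esub>) \<otimes>\<^bsub>sec OX V\<^esub> f)"
    by (rule diff_op_mult[OF X a_inv_closed[OF X one_closed[OF X]]])
  then show ?thesis
    unfolding subtopology_topspace
  proof (rule diff_op_cong)
    fix V f assume V: "openin T V" and f: "f \<in> carrier (sec OX V)"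
    interpret V: cring "sec OX V" by (rule cring[OF V])
    show "\<ominus>\<^bsub>sec OX V\<^esub> f =
      res OX (topspace T) V (\<ominus>\<^bsub>sec OX (topspace T)\<^esub> \<one>\<^bsub>sec OX (topspace T)\<^esub>) \<otimes>\<^bsub>sec OX V\<^esub> f"
      using f by (simp add: res_one[OF X V openin_subset[OF V]]
        res_a_inv[OF X V openin_subset[OF V] one_closed[OF X]] V.l_minus)
  qed
qed

lemma diff_op_neg:
  "diff_op K T OX P \<Longrightarrow> diff_op K T OX (\<lambda>V f. \<ominus>\<^bsub>sec OX V\<^esub> P V f)"
  by (rule diff_op_comp[OF diff_op_uminus])

lemma diff_op_minus:
  assumes "diff_op K T OX P" "diff_op K T OX Q"
  shows "diff_op K T OX (\<lambda>V f. P V f \<ominus>\<^bsub>sec OX V\<^esub> Q V f)"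
  unfolding a_minus_def by (intro diff_op_add diff_op_neg assms)

lemma diff_op_closed:
  "diff_op K T OX P \<Longrightarrow> openin T V \<Longrightarrow> f \<in> carrier (sec OX V) \<Longrightarrow> P V f \<in> carrier (sec OX V)"
  by (rule sheaf_homD(2)[OF diff_op_sheaf_hom])

lemma diff_op_zero: "diff_op K T OX (\<lambda>V f. \<zero>\<^bsub>sec OX V\<^esub>)"
proof (rule diff_op_cong[OF diff_op_minus[OF diff_op_id diff_op_id]])
  fix V f assume V: "openin T V" and f: "f \<in> carrier (sec OX V)"
  interpret V: cring "sec OX V" by (rule cring[OF V])
  show "\<zero>\<^bsub>sec OX V\<^esub> = f \<ominus>\<^bsub>sec OX V\<^esub> f" using f by (simp add: a_minus_def V.r_neg)
qed

lemma diff_op_sum: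
  fixes n :: nat
  assumes "\<And>a. a \<le> n \<Longrightarrow> diff_op K T OX (P a)"
  shows "diff_op K T OX (\<lambda>V f. \<Oplus>\<^bsub>sec OX V\<^esub>a\<in>{..n}. P a V f)"
  using assms
proof (induction n)
  case 0
  show ?case
  proof (rule diff_op_cong[OF 0[OF order_refl]])
    fix V f assume V: "openin T V" and f: "f \<in> carrier (sec OX V)"
    interpret V: cring "sec OX V" by (rule cring[OF V])
    show "(\<Oplus>\<^bsub>sec OX V\<^esub>a\<in>{..0}. P a V f) = P 0 V f"
      using diff_op_closed[OF 0[OF order_refl] V f] by simp
  qed
next
  case (Suc n)
  show ?case
  proof (rule diff_op_cong[OF diff_op_add[OF Suc.prems[OF order_refl] Suc.IH]])
    fix V f assume V: "openin T V" and f: "f \<in> carrier (sec OX V)"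
    interpret V: cring "sec OX V" by (rule cring[OF V])
    show "(\<Oplus>\<^bsub>sec OX V\<^esub>a\<in>{..Suc n}. P a V f) = P (Suc n) V f \<oplus>\<^bsub>sec OX V\<^esub> (\<Oplus>\<^bsub>sec OX V\<^esub>a\<in>{..n}. P a V f)"
      using diff_op_closed[OF Suc.prems V f] by (intro V.finsum_Suc) auto
  qed (use Suc.prems in auto)
qed

end

subsection \<open>Bidifferential operators\<close>

text \<open>The order bound in the definition of \<^const>\<open>bidiff_op\<close>, with separate bounds for the two
  arguments: the closure properties below produce different bounds.\<close>

definition slices_less ::
  "nat \<Rightarrow> nat \<Rightarrow> 'a topology \<Rightarrow> ('a, 'k, 'r) presheaf \<Rightarrow> ('a set \<Rightarrow> 'r \<Rightarrow> 'r \<Rightarrow> 'r) \<Rightarrow> 'a set \<Rightarrow> bool"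
where
  "slices_less d e T OX \<beta> V \<longleftrightarrow> (\<forall>W f. openin T W \<and> W \<subseteq> V \<and> f \<in> carrier (sec OX W) \<longrightarrow>
     diff_order_less d (subtopology T W) OX (\<lambda>W' g. \<beta> W' (res OX W W' f) g) \<and>
     diff_order_less e (subtopology T W) OX (\<lambda>W' g. \<beta> W' g (res OX W W' f)))"

lemma slices_lessD:
  assumes "slices_less d e T OX \<beta> V" "openin T W" "W \<subseteq> V" "f \<in> carrier (sec OX W)"
  shows "diff_order_less d (subtopology T W) OX (\<lambda>W' g. \<beta> W' (res OX W W' f) g)"
    and "diff_order_less e (subtopology T W) OX (\<lambda>W' g. \<beta> W' g (res OX W W' f))"
  using assms unfolding slices_less_def by simp_all

lemma bidiff_op_swap:
  assumes "bidiff_op K T OX \<beta>"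
  shows "bidiff_op K T OX (\<lambda>V f g. \<beta> V g f)"
  unfolding bidiff_op_def
proof (intro conjI)
  show "\<forall>x\<in>topspace T. \<exists>V d. openin T V \<and> x \<in> V \<and>
      (\<forall>W f. openin T W \<and> W \<subseteq> V \<and> f \<in> carrier (sec OX W) \<longrightarrow>
        diff_order_less d (subtopology T W) OX (\<lambda>W' g. \<beta> W' g (res OX W W' f)) \<and>
        diff_order_less d (subtopology T W) OX (\<lambda>W' g. \<beta> W' (res OX W W' f) g))"
    using assms unfolding bidiff_op_def by meson
qed (use assms in \<open>simp_all add: bidiff_op_def\<close>)

context ringed_space
begin

text \<open>With one argument fixed, a bidifferential operator is an ordinary operator on the open set where
  this argument lives. All closure properties are thereby reduced to those of differential
  operators.\<close>

lemma bidiff_slice: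
  assumes \<beta>: "bidiff_op K T OX \<beta>" and W: "openin T W" and f: "f \<in> carrier (sec OX W)"
  shows "sheaf_hom K (subtopology T W) OX OX (\<lambda>W' g. \<beta> W' (res OX W W' f) g)"
  unfolding sheaf_hom_def openin_sub[OF W]
proof (intro conjI allI impI ballI)
  fix U assume "openin T U \<and> U \<subseteq> W"
  then show "(\<lambda>g. \<beta> U (res OX W U f) g) \<in> mod_hom K (sec OX U) (sec OX U)"
    using \<beta> res_closed[OF W _ _ f] unfolding bidiff_op_def by simp
next
  fix U V g assume a: "(openin T U \<and> U \<subseteq> W) \<and> (openin T V \<and> V \<subseteq> W) \<and> V \<subseteq> U" and g: "g \<in> carrier (sec OX U)"
  then have "\<beta> V (res OX U V (res OX W U f)) (res OX U V g) = res OX U V (\<beta> U (res OX W U f) g)"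
    using \<beta> res_closed[OF W _ _ f] unfolding bidiff_op_def by simp
  then show "\<beta> V (res OX W V f) (res OX U V g) = res OX U V (\<beta> U (res OX W U f) g)"
    using a by (simp add: res_res[OF W _ _ _ _ f])
qed

lemma bidiff_closed:
  assumes "bidiff_op K T OX \<beta>" "openin T W" "f \<in> carrier (sec OX W)" "g \<in> carrier (sec OX W)"
  shows "\<beta> W f g \<in> carrier (sec OX W)"
proof -
  have "(\<lambda>g. \<beta> W f g) \<in> mod_hom K (sec OX W) (sec OX W)"
    using assms unfolding bidiff_op_def by simp
  then show ?thesis using assms(4) by (rule mod_homD(1))
qed

lemma bidiff_opI:
  assumes 1: "\<And>W f. openin T W \<Longrightarrow> f \<in> carrier (sec OX W) \<Longrightarrow>
      sheaf_hom K (subtopology T W) OX OX (\<lambda>W' g. \<beta> W' (res OX W W' f) g)"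
    and 2: "\<And>W f. openin T W \<Longrightarrow> f \<in> carrier (sec OX W) \<Longrightarrow>
      sheaf_hom K (subtopology T W) OX OX (\<lambda>W' g. \<beta> W' g (res OX W W' f))"
    and 3: "\<And>x. x \<in> topspace T \<Longrightarrow> \<exists>V d e. openin T V \<and> x \<in> V \<and> slices_less d e T OX \<beta> V"
  shows "bidiff_op K T OX \<beta>"
  unfolding bidiff_op_def
proof (intro conjI allI impI ballI)
  fix U f assume U: "openin T U" and f: "f \<in> carrier (sec OX U)"
  have UU: "openin (subtopology T U) U" using U by (simp add: openin_sub)
  show "(\<lambda>g. \<beta> U f g) \<in> mod_hom K (sec OX U) (sec OX U)"
    using sheaf_homD(1)[OF 1[OF U f] UU] by (simp add: res_id[OF U f])
  show "(\<lambda>g. \<beta> U g f) \<in> mod_hom K (sec OX U) (sec OX U)"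
    using sheaf_homD(1)[OF 2[OF U f] UU] by (simp add: res_id[OF U f])
next
  fix U V f g assume "openin T U \<and> openin T V \<and> V \<subseteq> U" and f: "f \<in> carrier (sec OX U)" and g: "g \<in> carrier (sec OX U)"
  then have U: "openin T U" and V: "openin T V" "V \<subseteq> U" by auto
  have UU: "openin (subtopology T U) U" and VU: "openin (subtopology T U) V" using U V by (simp_all add: openin_sub)
  show "\<beta> V (res OX U V f) (res OX U V g) = res OX U V (\<beta> U f g)"
    using sheaf_homD(5)[OF 1[OF U f] UU VU V(2) g] by (simp add: res_id[OF U f])
next
  fix x assume "x \<in> topspace T"
  then obtain V d e where V: "openin T V" "x \<in> V" and sl: "slices_less d e T OX \<beta> V"
    using 3 by blast
  have "diff_order_less (max d e) (subtopology T W) OX (\<lambda>W' g. \<beta> W' (res OX W W' f) g)"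
    "diff_order_less (max d e) (subtopology T W) OX (\<lambda>W' g. \<beta> W' g (res OX W W' f))"
    if W: "openin T W" "W \<subseteq> V" "f \<in> carrier (sec OX W)" for W f
    using diff_order_less_mono[OF ringed_sub[OF W(1)] 1[OF W(1,3)] slices_lessD(1)[OF sl W], of "max d e"]
      diff_order_less_mono[OF ringed_sub[OF W(1)] 2[OF W(1,3)] slices_lessD(2)[OF sl W], of "max d e"]
    by simp_all
  then show "\<exists>V d. openin T V \<and> x \<in> V \<and>
      (\<forall>W f. openin T W \<and> W \<subseteq> V \<and> f \<in> carrier (sec OX W) \<longrightarrow>
        diff_order_less d (subtopology T W) OX (\<lambda>W' g. \<beta> W' (res OX W W' f) g) \<and>
        diff_order_less d (subtopology T W) OX (\<lambda>W' g. \<beta> W' g (res OX W W' f)))"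
    using V by (intro exI[of _ V] exI[of _ "max d e"]) simp
qed

lemma bidiff_local:
  assumes "bidiff_op K T OX \<beta>" "x \<in> topspace T"
  obtains V d where "openin T V" "x \<in> V" "slices_less d d T OX \<beta> V"
proof -
  have "\<exists>V d. openin T V \<and> x \<in> V \<and> slices_less d d T OX \<beta> V"
    using assms unfolding bidiff_op_def slices_less_def by simp
  then show ?thesis using that by blast
qed

lemma bidiff_cong:
  assumes \<beta>: "bidiff_op K T OX \<beta>"
    and eq: "\<And>V f g. openin T V \<Longrightarrow> f \<in> carrier (sec OX V) \<Longrightarrow> g \<in> carrier (sec OX V) \<Longrightarrow> \<beta>' V f g = \<beta> V f g"
  shows "bidiff_op K T OX \<beta>'"
proof (rule bidiff_opI)
  note \<beta>s = bidiff_op_swap[OF \<beta>]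
  fix W f assume W: "openin T W" and f: "f \<in> carrier (sec OX W)"
  note mp = module_presheaf_sub[OF module_presheaf W]
  show "sheaf_hom K (subtopology T W) OX OX (\<lambda>W' g. \<beta>' W' (res OX W W' f) g)"
    by (rule sheaf_hom_cong[OF bidiff_slice[OF \<beta> W f] mp])
       (auto intro!: eq simp: openin_sub[OF W] res_closed[OF W _ _ f])
  show "sheaf_hom K (subtopology T W) OX OX (\<lambda>W' g. \<beta>' W' g (res OX W W' f))"
    by (rule sheaf_hom_cong[OF bidiff_slice[OF \<beta>s W f] mp])
       (auto intro!: eq simp: openin_sub[OF W] res_closed[OF W _ _ f])
next
  fix x assume x: "x \<in> topspace T"
  obtain V d where V: "openin T V" "x \<in> V" and sld: "slices_less d d T OX \<beta> V"
      by (rule bidiff_local[OF \<beta> x])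
    note d = slices_lessD[OF sld]
  have "diff_order_less d (subtopology T W) OX (\<lambda>W' g. \<beta>' W' (res OX W W' f) g)"
    "diff_order_less d (subtopology T W) OX (\<lambda>W' g. \<beta>' W' g (res OX W W' f))"
    if W: "openin T W" "W \<subseteq> V" and f: "f \<in> carrier (sec OX W)" for W f
  proof -
    have c: "openin T W'" "res OX W W' f \<in> carrier (sec OX W')" if "openin (subtopology T W) W'" for W'
      using that by (simp_all add: openin_sub[OF W(1)] res_closed[OF W(1) _ _ f])
    show "diff_order_less d (subtopology T W) OX (\<lambda>W' g. \<beta>' W' (res OX W W' f) g)"
      by (rule diff_order_less_cong[OF ringed_sub[OF W(1)] d(1)[OF W f]]) (simp add: eq c)
    show "diff_order_less d (subtopology T W) OX (\<lambda>W' g. \<beta>' W' g (res OX W W' f))"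
      by (rule diff_order_less_cong[OF ringed_sub[OF W(1)] d(2)[OF W f]]) (simp add: eq c)
  qed
  then show "\<exists>V d e. openin T V \<and> x \<in> V \<and> slices_less d e T OX \<beta>' V"
    using V by (intro exI[of _ V] exI[of _ d]) (simp add: slices_less_def)
qed

lemma diff_op_local_sub:
  assumes "diff_op K T OX P" "x \<in> topspace T"
  obtains V d where "openin T V" "x \<in> V"
    "\<And>W. openin T W \<Longrightarrow> W \<subseteq> V \<Longrightarrow> diff_order_less d (subtopology T W) OX P"
proof -
  obtain V d where V: "openin T V" "x \<in> V" "diff_order_less d (subtopology T V) OX P"
    using assms unfolding diff_op_def by blast
  have "diff_order_less d (subtopology T W) OX P" if "openin T W" "W \<subseteq> V" for W
    using diff_order_less_sub[OF V(3), of W] that V(1) by (simp add: openin_sub subtopology_sub)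
  then show ?thesis using V that by blast
qed

lemma bidiff_comp:
  assumes P: "diff_op K T OX P" and \<beta>: "bidiff_op K T OX \<beta>"
  shows "bidiff_op K T OX (\<lambda>V f g. P V (\<beta> V f g))"
proof (rule bidiff_opI)
  note \<beta>s = bidiff_op_swap[OF \<beta>] and Ph = diff_op_sheaf_hom[OF P]
  fix W f assume W: "openin T W" and f: "f \<in> carrier (sec OX W)"
  show "sheaf_hom K (subtopology T W) OX OX (\<lambda>W' g. P W' (\<beta> W' (res OX W W' f) g))"
    by (rule sheaf_hom_comp[OF bidiff_slice[OF \<beta> W f] sheaf_hom_sub[OF Ph W]])
  show "sheaf_hom K (subtopology T W) OX OX (\<lambda>W' g. P W' (\<beta> W' g (res OX W W' f)))"
    by (rule sheaf_hom_comp[OF bidiff_slice[OF \<beta>s W f] sheaf_hom_sub[OF Ph W]])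
next
  note \<beta>s = bidiff_op_swap[OF \<beta>] and Ph = diff_op_sheaf_hom[OF P]
  fix x assume x: "x \<in> topspace T"
  obtain V d where V: "openin T V" "x \<in> V" and sld: "slices_less d d T OX \<beta> V"
      by (rule bidiff_local[OF \<beta> x])
    note d = slices_lessD[OF sld]
  obtain V' e where V': "openin T V'" "x \<in> V'" and e:
    "\<And>W. openin T W \<Longrightarrow> W \<subseteq> V' \<Longrightarrow> diff_order_less e (subtopology T W) OX P"
    by (rule diff_op_local_sub[OF P x]) (rule that; assumption?; blast)
  have "diff_order_less (e + d) (subtopology T W) OX (\<lambda>W' g. P W' (\<beta> W' (res OX W W' f) g))"
    "diff_order_less (e + d) (subtopology T W) OX (\<lambda>W' g. P W' (\<beta> W' g (res OX W W' f)))"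
    if W: "openin T W" "W \<subseteq> V \<inter> V'" and f: "f \<in> carrier (sec OX W)" for W f
  proof -
    have W': "W \<subseteq> V" "W \<subseteq> V'" using W by auto
    show "diff_order_less (e + d) (subtopology T W) OX (\<lambda>W' g. P W' (\<beta> W' (res OX W W' f) g))"
      by (rule diff_order_less_comp[OF ringed_sub[OF W(1)] sheaf_hom_sub[OF Ph W(1)]
            bidiff_slice[OF \<beta> W(1) f] e[OF W(1) W'(2)] d(1)[OF W(1) W'(1) f]])
    show "diff_order_less (e + d) (subtopology T W) OX (\<lambda>W' g. P W' (\<beta> W' g (res OX W W' f)))"
      by (rule diff_order_less_comp[OF ringed_sub[OF W(1)] sheaf_hom_sub[OF Ph W(1)]
            bidiff_slice[OF \<beta>s W(1) f] e[OF W(1) W'(2)] d(2)[OF W(1) W'(1) f]])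
  qed
  then show "\<exists>V d e. openin T V \<and> x \<in> V \<and> slices_less d e T OX (\<lambda>V f g. P V (\<beta> V f g)) V"
    using V V' by (intro exI[of _ "V \<inter> V'"] exI[of _ "e + d"]) (simp add: openin_Int slices_less_def)
qed

text \<open>In the first argument, precomposition changes the function at which the slice is taken; in the
  second argument it composes the slice with \<open>P\<close>.\<close>

lemma bidiff_precomp_left:
  assumes \<beta>: "bidiff_op K T OX \<beta>" and P: "diff_op K T OX P"
  shows "bidiff_op K T OX (\<lambda>V f g. \<beta> V (P V f) g)"
proof -
  note \<beta>s = bidiff_op_swap[OF \<beta>] and Ph = diff_op_sheaf_hom[OF P]
  have eq: "\<beta> W' (res OX W W' (P W f)) g = \<beta> W' (P W' (res OX W W' f)) g"
    if "openin T W" "f \<in> carrier (sec OX W)" "openin (subtopology T W) W'" for W W' f g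
    using sheaf_homD(5)[OF Ph that(1) _ _ that(2)] that(1,3) by (simp add: openin_sub)
  show ?thesis
  proof (rule bidiff_opI)
    fix W f assume W: "openin T W" and f: "f \<in> carrier (sec OX W)"
    note mp = module_presheaf_sub[OF module_presheaf W]
    show "sheaf_hom K (subtopology T W) OX OX (\<lambda>W' g. \<beta> W' (P W' (res OX W W' f)) g)"
      by (rule sheaf_hom_cong[OF bidiff_slice[OF \<beta> W diff_op_closed[OF P W f]] mp]) (simp add: eq[OF W f])
    show "sheaf_hom K (subtopology T W) OX OX (\<lambda>W' g. \<beta> W' (P W' g) (res OX W W' f))"
      by (rule sheaf_hom_comp[OF sheaf_hom_sub[OF Ph W] bidiff_slice[OF \<beta>s W f]])
  next
    fix x assume x: "x \<in> topspace T"
    obtain V d where V: "openin T V" "x \<in> V" and sld: "slices_less d d T OX \<beta> V"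
      by (rule bidiff_local[OF \<beta> x])
    note d = slices_lessD[OF sld]
    obtain V' e where V': "openin T V'" "x \<in> V'" and e:
      "\<And>W. openin T W \<Longrightarrow> W \<subseteq> V' \<Longrightarrow> diff_order_less e (subtopology T W) OX P"
      by (rule diff_op_local_sub[OF P x]) (rule that; assumption?; blast)
    have "diff_order_less d (subtopology T W) OX (\<lambda>W' g. \<beta> W' (P W' (res OX W W' f)) g)"
      "diff_order_less (d + e) (subtopology T W) OX (\<lambda>W' g. \<beta> W' (P W' g) (res OX W W' f))"
      if W: "openin T W" "W \<subseteq> V \<inter> V'" and f: "f \<in> carrier (sec OX W)" for W f
    proof -
      have W': "W \<subseteq> V" "W \<subseteq> V'" using W by auto
      show "diff_order_less d (subtopology T W) OX (\<lambda>W' g. \<beta> W' (P W' (res OX W W' f)) g)"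
        by (rule diff_order_less_cong[OF ringed_sub[OF W(1)] d(1)[OF W(1) W'(1) diff_op_closed[OF P W(1) f]]])
           (simp add: eq[OF W(1) f])
      show "diff_order_less (d + e) (subtopology T W) OX (\<lambda>W' g. \<beta> W' (P W' g) (res OX W W' f))"
        by (rule diff_order_less_comp[OF ringed_sub[OF W(1)] bidiff_slice[OF \<beta>s W(1) f]
              sheaf_hom_sub[OF Ph W(1)] d(2)[OF W(1) W'(1) f] e[OF W(1) W'(2)]])
    qed
    then show "\<exists>V d e. openin T V \<and> x \<in> V \<and> slices_less d e T OX (\<lambda>V f g. \<beta> V (P V f) g) V"
      using V V' by (intro exI[of _ "V \<inter> V'"] exI[of _ d] exI[of _ "d + e"]) (simp add: openin_Int slices_less_def)
  qed
qed

lemma bidiff_precomp: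
  assumes "bidiff_op K T OX \<beta>" "diff_op K T OX P" "diff_op K T OX Q"
  shows "bidiff_op K T OX (\<lambda>V f g. \<beta> V (P V f) (Q V g))"
  using bidiff_op_swap[OF bidiff_precomp_left[OF bidiff_op_swap[OF bidiff_precomp_left[OF assms(1,2)]] assms(3)]] .

lemma bidiff_add:
  assumes \<beta>: "bidiff_op K T OX \<beta>" and \<beta>': "bidiff_op K T OX \<beta>'"
  shows "bidiff_op K T OX (\<lambda>V f g. \<beta> V f g \<oplus>\<^bsub>sec OX V\<^esub> \<beta>' V f g)"
proof (rule bidiff_opI)
  fix W f assume W: "openin T W" and f: "f \<in> carrier (sec OX W)"
  interpret W: ringed_space K "subtopology T W" OX by (rule ringed_sub[OF W])
  show "sheaf_hom K (subtopology T W) OX OX (\<lambda>W' g. \<beta> W' (res OX W W' f) g \<oplus>\<^bsub>sec OX W'\<^esub> \<beta>' W' (res OX W W' f) g)"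
    by (intro W.sheaf_hom_add bidiff_slice \<beta> \<beta>' W f)
  show "sheaf_hom K (subtopology T W) OX OX (\<lambda>W' g. \<beta> W' g (res OX W W' f) \<oplus>\<^bsub>sec OX W'\<^esub> \<beta>' W' g (res OX W W' f))"
    by (rule W.sheaf_hom_add[OF bidiff_slice[OF bidiff_op_swap[OF \<beta>] W f] bidiff_slice[OF bidiff_op_swap[OF \<beta>'] W f]])
next
  fix x assume x: "x \<in> topspace T"
  obtain V d where V: "openin T V" "x \<in> V" and sld: "slices_less d d T OX \<beta> V"
      by (rule bidiff_local[OF \<beta> x])
    note d = slices_lessD[OF sld]
  obtain V' e where V': "openin T V'" "x \<in> V'" and sle: "slices_less e e T OX \<beta>' V'"
      by (rule bidiff_local[OF \<beta>' x])
    note e = slices_lessD[OF sle]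
  have "diff_order_less (max d e) (subtopology T W) OX
        (\<lambda>W' g. \<beta> W' (res OX W W' f) g \<oplus>\<^bsub>sec OX W'\<^esub> \<beta>' W' (res OX W W' f) g)"
    "diff_order_less (max d e) (subtopology T W) OX
        (\<lambda>W' g. \<beta> W' g (res OX W W' f) \<oplus>\<^bsub>sec OX W'\<^esub> \<beta>' W' g (res OX W W' f))"
    if W: "openin T W" "W \<subseteq> V \<inter> V'" and f: "f \<in> carrier (sec OX W)" for W f
  proof -
    have W': "W \<subseteq> V" "W \<subseteq> V'" using W by auto
    note R = ringed_sub[OF W(1)]
    note s = bidiff_slice[OF \<beta> W(1) f] bidiff_slice[OF \<beta>' W(1) f]
      bidiff_slice[OF bidiff_op_swap[OF \<beta>] W(1) f] bidiff_slice[OF bidiff_op_swap[OF \<beta>'] W(1) f]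
    show "diff_order_less (max d e) (subtopology T W) OX
        (\<lambda>W' g. \<beta> W' (res OX W W' f) g \<oplus>\<^bsub>sec OX W'\<^esub> \<beta>' W' (res OX W W' f) g)"
      by (rule diff_order_less_add[OF R s(1,2) diff_order_less_mono[OF R s(1) d(1)[OF W(1) W'(1) f]]
            diff_order_less_mono[OF R s(2) e(1)[OF W(1) W'(2) f]]]) simp_all
    show "diff_order_less (max d e) (subtopology T W) OX
        (\<lambda>W' g. \<beta> W' g (res OX W W' f) \<oplus>\<^bsub>sec OX W'\<^esub> \<beta>' W' g (res OX W W' f))"
      by (rule diff_order_less_add[OF R s(3,4) diff_order_less_mono[OF R s(3) d(2)[OF W(1) W'(1) f]]
            diff_order_less_mono[OF R s(4) e(2)[OF W(1) W'(2) f]]]) simp_all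
  qed
  then show "\<exists>V d e. openin T V \<and> x \<in> V \<and> slices_less d e T OX (\<lambda>V f g. \<beta> V f g \<oplus>\<^bsub>sec OX V\<^esub> \<beta>' V f g) V"
    using V V' by (intro exI[of _ "V \<inter> V'"] exI[of _ "max d e"]) (simp add: openin_Int slices_less_def)
qed

lemma bidiff_minus:
  assumes "bidiff_op K T OX \<beta>" "bidiff_op K T OX \<beta>'"
  shows "bidiff_op K T OX (\<lambda>V f g. \<beta> V f g \<ominus>\<^bsub>sec OX V\<^esub> \<beta>' V f g)"
  unfolding a_minus_def
  by (rule bidiff_add[OF assms(1) bidiff_comp[OF diff_op_uminus assms(2)]])

lemma bidiff_sum:
  fixes n :: nat
  assumes "\<And>a. a \<le> n \<Longrightarrow> bidiff_op K T OX (\<beta> a)"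
  shows "bidiff_op K T OX (\<lambda>V f g. \<Oplus>\<^bsub>sec OX V\<^esub>a\<in>{..n}. \<beta> a V f g)"
  using assms
proof (induction n)
  case 0
  show ?case
  proof (rule bidiff_cong[OF 0[OF order_refl]])
    fix V f g assume V: "openin T V" and fg: "f \<in> carrier (sec OX V)" "g \<in> carrier (sec OX V)"
    interpret V: cring "sec OX V" by (rule cring[OF V])
    show "(\<Oplus>\<^bsub>sec OX V\<^esub>a\<in>{..0}. \<beta> a V f g) = \<beta> 0 V f g"
      using bidiff_closed[OF 0[OF order_refl] V fg] by simp
  qed
next
  case (Suc n)
  show ?case
  proof (rule bidiff_cong[OF bidiff_add[OF Suc.prems[OF order_refl] Suc.IH]])
    fix V f g assume V: "openin T V" and fg: "f \<in> carrier (sec OX V)" "g \<in> carrier (sec OX V)"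
    interpret V: cring "sec OX V" by (rule cring[OF V])
    show "(\<Oplus>\<^bsub>sec OX V\<^esub>a\<in>{..Suc n}. \<beta> a V f g) = \<beta> (Suc n) V f g \<oplus>\<^bsub>sec OX V\<^esub> (\<Oplus>\<^bsub>sec OX V\<^esub>a\<in>{..n}. \<beta> a V f g)"
      using bidiff_closed[OF Suc.prems V fg] by (intro V.finsum_Suc) auto
  qed (use Suc.prems in auto)
qed

lemma bidiff_mult: "bidiff_op K T OX (\<lambda>V f g. f \<otimes>\<^bsub>sec OX V\<^esub> g)"
proof -
  have eq: "g \<otimes>\<^bsub>sec OX W'\<^esub> res OX W W' f = res OX W W' f \<otimes>\<^bsub>sec OX W'\<^esub> g"
    if "openin T W" "f \<in> carrier (sec OX W)" "openin (subtopology T W) W'" "g \<in> carrier (sec OX W')" for W W' f g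
    using cring.cring_simprules(14)[OF cring, of W' g "res OX W W' f"] that
    by (simp add: openin_sub res_closed)
  show ?thesis
  proof (rule bidiff_opI)
    fix W f assume W: "openin T W" and f: "f \<in> carrier (sec OX W)"
    show "sheaf_hom K (subtopology T W) OX OX (\<lambda>W' g. res OX W W' f \<otimes>\<^bsub>sec OX W'\<^esub> g)"
      by (rule sheaf_hom_mult[OF W f])
    show "sheaf_hom K (subtopology T W) OX OX (\<lambda>W' g. g \<otimes>\<^bsub>sec OX W'\<^esub> res OX W W' f)"
      by (rule sheaf_hom_cong[OF sheaf_hom_mult[OF W f] module_presheaf_sub[OF module_presheaf W]])
         (rule eq[OF W f])
  next
    fix x assume x: "x \<in> topspace T"
    have "diff_order_less 1 (subtopology T W) OX (\<lambda>W' g. res OX W W' f \<otimes>\<^bsub>sec OX W'\<^esub> g)"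
      "diff_order_less 1 (subtopology T W) OX (\<lambda>W' g. g \<otimes>\<^bsub>sec OX W'\<^esub> res OX W W' f)"
      if W: "openin T W" and f: "f \<in> carrier (sec OX W)" for W f
      using diff_order_less_mult[OF W f]
        diff_order_less_cong[OF ringed_sub[OF W] diff_order_less_mult[OF W f], of "\<lambda>W' g. g \<otimes>\<^bsub>sec OX W'\<^esub> res OX W W' f"]
        eq[OF W f] by auto
    then show "\<exists>V d e. openin T V \<and> x \<in> V \<and> slices_less d e T OX (\<lambda>V f g. f \<otimes>\<^bsub>sec OX V\<^esub> g) V"
      using x by (intro exI[of _ "topspace T"] exI[of _ 1]) (simp add: slices_less_def)
  qed
qed

end

section \<open>Cech cocycles and Godement cohomology\<close>

subsection \<open>Stalks of presheaves of abelian groups\<close>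

context abelian_presheaf
begin

lemma germ_subset:
  assumes U: "openin T U" "s \<in> carrier (sec F U)" and V: "openin T V" "t \<in> carrier (sec F V)"
    and W: "openin T W" "x \<in> W" "W \<subseteq> U \<inter> V" "res F U W s = res F V W t"
  shows "germ T F x U s \<subseteq> germ T F x V t"
proof (clarsimp simp: germ_def)
  fix V' t' W'
  assume V': "openin T V'" "t' \<in> carrier (sec F V')"
    and W': "openin T W'" "x \<in> W'" "W' \<subseteq> U" "W' \<subseteq> V'" "res F U W' s = res F V' W' t'"
  let ?W = "W \<inter> W'"
  have o: "openin T ?W" and sub: "?W \<subseteq> W" "?W \<subseteq> W'" "W \<subseteq> U" "W \<subseteq> V"
    using W W' by auto
  have "res F V ?W t = res F W ?W (res F V W t)" using V W o sub by (simp add: res_res)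
  also have "\<dots> = res F U ?W s" using U W o sub by (simp add: W(4)[symmetric] res_res)
  also have "\<dots> = res F W' ?W (res F U W' s)" using res_res[OF U(1) W'(1) o sub(2) W'(3) U(2)] by simp
  also have "\<dots> = res F V' ?W t'" using V' W' o sub by (simp add: res_res)
  finally show "\<exists>W. openin T W \<and> x \<in> W \<and> W \<subseteq> V \<and> W \<subseteq> V' \<and> res F V W t = res F V' W t'"
    using o sub W W' by (intro exI[of _ ?W]) auto
qed

lemma mem_germ_self: "openin T U \<Longrightarrow> x \<in> U \<Longrightarrow> s \<in> carrier (sec F U) \<Longrightarrow> (U, s) \<in> germ T F x U s"
  by (auto simp: germ_def)

lemma germ_eq_iff:
  assumes "openin T U" "s \<in> carrier (sec F U)" "openin T V" "x \<in> V" "t \<in> carrier (sec F V)"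
  shows "germ T F x U s = germ T F x V t \<longleftrightarrow>
    (\<exists>W. openin T W \<and> x \<in> W \<and> W \<subseteq> U \<inter> V \<and> res F U W s = res F V W t)"
proof
  assume "germ T F x U s = germ T F x V t"
  then have "(V, t) \<in> germ T F x U s" using mem_germ_self assms by simp
  then show "\<exists>W. openin T W \<and> x \<in> W \<and> W \<subseteq> U \<inter> V \<and> res F U W s = res F V W t"
    by (simp add: germ_def)
next
  assume "\<exists>W. openin T W \<and> x \<in> W \<and> W \<subseteq> U \<inter> V \<and> res F U W s = res F V W t"
  then obtain W where W: "openin T W" "x \<in> W" "W \<subseteq> U \<inter> V" "res F U W s = res F V W t" by blast
  have W': "W \<subseteq> V \<inter> U" using W(3) by auto
  show "germ T F x U s = germ T F x V t"
    using germ_subset[OF assms(1,2,3,5) W] germ_subset[OF assms(3,5,1,2) W(1,2) W' W(4)[symmetric]] by simp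
qed

lemma germ_res:
  assumes "openin T U" "openin T V" "V \<subseteq> U" "x \<in> V" "s \<in> carrier (sec F U)"
  shows "germ T F x V (res F U V s) = germ T F x U s"
  using assms by (subst germ_eq_iff) (auto simp: res_closed res_res intro!: exI[of _ V] res_id)

lemma mem_germ_eq:
  assumes "openin T U" "s \<in> carrier (sec F U)" "(V, t) \<in> germ T F x U s"
  shows "openin T V" "x \<in> V" "t \<in> carrier (sec F V)" "germ T F x V t = germ T F x U s"
proof -
  show V: "openin T V" "x \<in> V" "t \<in> carrier (sec F V)" using assms(3) by (auto simp: germ_def)
  have "\<exists>W. openin T W \<and> x \<in> W \<and> W \<subseteq> U \<inter> V \<and> res F U W s = res F V W t"
    using assms(3) by (simp add: germ_def)
  then show "germ T F x V t = germ T F x U s" using germ_eq_iff[OF assms(1,2) V] by simp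
qed

lemma germ_closed: "openin T U \<Longrightarrow> x \<in> U \<Longrightarrow> s \<in> carrier (sec F U) \<Longrightarrow>
    germ T F x U s \<in> carrier (stalk T F x)"
  by (auto simp: stalk_def)

lemma stalkE:
  assumes "X \<in> carrier (stalk T F x)"
  obtains U s where "openin T U" "x \<in> U" "s \<in> carrier (sec F U)" "X = germ T F x U s"
  using assms by (auto simp: stalk_def)

lemma stalkE2:
  assumes "X \<in> carrier (stalk T F x)" "Y \<in> carrier (stalk T F x)"
  obtains U s t where "openin T U" "x \<in> U" "s \<in> carrier (sec F U)" "X = germ T F x U s"
    "t \<in> carrier (sec F U)" "Y = germ T F x U t"
proof -
  obtain U s where U: "openin T U" "x \<in> U" "s \<in> carrier (sec F U)" "X = germ T F x U s"
    by (rule stalkE[OF assms(1)])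
  obtain V t where V: "openin T V" "x \<in> V" "t \<in> carrier (sec F V)" "Y = germ T F x V t"
    by (rule stalkE[OF assms(2)])
  have o: "openin T (U \<inter> V)" "x \<in> U \<inter> V" using U V by auto
  show ?thesis
    by (rule that[OF o, of "res F U (U \<inter> V) s" "res F V (U \<inter> V) t"])
       (use U V o in \<open>simp_all add: res_closed germ_res\<close>)
qed

lemma stalkE3:
  assumes "X \<in> carrier (stalk T F x)" "Y \<in> carrier (stalk T F x)" "Z \<in> carrier (stalk T F x)"
  obtains U s t u where "openin T U" "x \<in> U" "s \<in> carrier (sec F U)" "X = germ T F x U s"
    "t \<in> carrier (sec F U)" "Y = germ T F x U t" "u \<in> carrier (sec F U)" "Z = germ T F x U u"
proof -
  obtain U s t where U: "openin T U" "x \<in> U" "s \<in> carrier (sec F U)" "X = germ T F x U s"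
    "t \<in> carrier (sec F U)" "Y = germ T F x U t"
    by (rule stalkE2[OF assms(1,2)])
  obtain V u where V: "openin T V" "x \<in> V" "u \<in> carrier (sec F V)" "Z = germ T F x V u"
    by (rule stalkE[OF assms(3)])
  have o: "openin T (U \<inter> V)" "x \<in> U \<inter> V" using U V by auto
  show ?thesis
    by (rule that[OF o, of "res F U (U \<inter> V) s" "res F U (U \<inter> V) t" "res F V (U \<inter> V) u"])
       (use U V o in \<open>simp_all add: res_closed germ_res\<close>)
qed

lemma stalk_add:
  assumes U: "openin T U" "x \<in> U" and s: "s \<in> carrier (sec F U)" and t: "t \<in> carrier (sec F U)"
  shows "germ T F x U s \<oplus>\<^bsub>stalk T F x\<^esub> germ T F x U t = germ T F x U (s \<oplus>\<^bsub>sec F U\<^esub> t)"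
proof -
  have eq: "germ T F x (V \<inter> V') (res F V (V \<inter> V') s' \<oplus>\<^bsub>sec F (V \<inter> V')\<^esub> res F V' (V \<inter> V') t') =
      germ T F x U (s \<oplus>\<^bsub>sec F U\<^esub> t)"
    if st: "(V, s') \<in> germ T F x U s" "(V', t') \<in> germ T F x U t" for V s' V' t'
  proof -
    note V = mem_germ_eq(1-3)[OF U(1) s st(1)] and V' = mem_germ_eq(1-3)[OF U(1) t st(2)]
    obtain W where W: "openin T W" "x \<in> W" "W \<subseteq> U \<inter> V" "res F U W s = res F V W s'"
      using st(1) unfolding germ_def by blast
    obtain W' where W': "openin T W'" "x \<in> W'" "W' \<subseteq> U \<inter> V'" "res F U W' t = res F V' W' t'"
      using st(2) unfolding germ_def by blast
    let ?W = "W \<inter> W'"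
    have o: "openin T ?W" "openin T (V \<inter> V')" using W W' V V' by auto
    have sub: "?W \<subseteq> W" "?W \<subseteq> W'" "W \<subseteq> U" "W \<subseteq> V" "W' \<subseteq> U" "W' \<subseteq> V'" "?W \<subseteq> V \<inter> V'" "?W \<subseteq> U"
      "V \<inter> V' \<subseteq> V" "V \<inter> V' \<subseteq> V'"
      using W W' by auto
    have 1: "res F V ?W s' = res F U ?W s"
      using res_res[OF V(1) W(1) o(1) sub(1,4) V(3)] res_res[OF U(1) W(1) o(1) sub(1,3) s] W(4) by simp
    have 2: "res F V' ?W t' = res F U ?W t"
      using res_res[OF V'(1) W'(1) o(1) sub(2,6) V'(3)] res_res[OF U(1) W'(1) o(1) sub(2,5) t] W'(4) by simp
    have c: "res F V (V \<inter> V') s' \<in> carrier (sec F (V \<inter> V'))" "res F V' (V \<inter> V') t' \<in> carrier (sec F (V \<inter> V'))"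
      using res_closed[OF V(1) o(2) sub(9) V(3)] res_closed[OF V'(1) o(2) sub(10) V'(3)] by auto
    have "res F (V \<inter> V') ?W (res F V (V \<inter> V') s' \<oplus>\<^bsub>sec F (V \<inter> V')\<^esub> res F V' (V \<inter> V') t') =
        res F U ?W (s \<oplus>\<^bsub>sec F U\<^esub> t)"
      using res_add[OF o(2,1) sub(7) c] res_res[OF V(1) o(2,1) sub(7,9) V(3)]
        res_res[OF V'(1) o(2,1) sub(7,10) V'(3)] res_add[OF U(1) o(1) sub(8) s t] 1 2 by simp
    then show ?thesis
      using o sub W(2) W'(2) by (subst germ_eq_iff[OF o(2) add_closed[OF o(2) c] U add_closed[OF U(1) s t]])
        (intro exI[of _ ?W], auto)
  qed
  have ne: "(U, s) \<in> germ T F x U s" "(U, t) \<in> germ T F x U t"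
    using mem_germ_self[OF U] s t by auto
  have "germ T F x U s \<oplus>\<^bsub>stalk T F x\<^esub> germ T F x U t =
      (\<Union>p\<in>germ T F x U s. \<Union>q\<in>germ T F x U t. germ T F x U (s \<oplus>\<^bsub>sec F U\<^esub> t))"
    unfolding stalk_def
    by (simp only: module.simps ring.simps) (intro SUP_cong refl, auto simp: eq)
  then show ?thesis using ne by auto
qed

lemma stalk_zero: "openin T U \<Longrightarrow> x \<in> U \<Longrightarrow> \<zero>\<^bsub>stalk T F x\<^esub> = germ T F x U \<zero>\<^bsub>sec F U\<^esub>"
  using germ_res[of "topspace T" U x "\<zero>\<^bsub>sec F (topspace T)\<^esub>"] res_zero[of "topspace T" U]
  by (simp add: stalk_def zero_closed openin_subset)

lemma stalk_abelian:
  assumes x: "x \<in> topspace T"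
  shows "abelian_group (stalk T F x)"
proof (rule abelian_groupI)
  note ab = abelian_group.axioms(1)[OF abelian]
  fix X Y assume X: "X \<in> carrier (stalk T F x)" and Y: "Y \<in> carrier (stalk T F x)"
  obtain U s t where U: "openin T U" "x \<in> U" and s: "s \<in> carrier (sec F U)" "X = germ T F x U s"
    and t: "t \<in> carrier (sec F U)" "Y = germ T F x U t"
    by (rule stalkE2[OF X Y])
  interpret U: abelian_group "sec F U" by (rule abelian[OF U(1)])
  show "X \<oplus>\<^bsub>stalk T F x\<^esub> Y \<in> carrier (stalk T F x)"
    using U s t by (simp add: stalk_add germ_closed)
  show "X \<oplus>\<^bsub>stalk T F x\<^esub> Y = Y \<oplus>\<^bsub>stalk T F x\<^esub> X"
    using U s t by (simp add: stalk_add U.a_comm)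
next
  fix X Y Z assume X: "X \<in> carrier (stalk T F x)" and Y: "Y \<in> carrier (stalk T F x)" and Z: "Z \<in> carrier (stalk T F x)"
  obtain U s t u where U: "openin T U" "x \<in> U" and s: "s \<in> carrier (sec F U)" "X = germ T F x U s"
    and t: "t \<in> carrier (sec F U)" "Y = germ T F x U t"
    and u: "u \<in> carrier (sec F U)" "Z = germ T F x U u"
    by (rule stalkE3[OF X Y Z])
  interpret U: abelian_group "sec F U" by (rule abelian[OF U(1)])
  show "X \<oplus>\<^bsub>stalk T F x\<^esub> Y \<oplus>\<^bsub>stalk T F x\<^esub> Z = X \<oplus>\<^bsub>stalk T F x\<^esub> (Y \<oplus>\<^bsub>stalk T F x\<^esub> Z)"
    using U s t u by (simp add: stalk_add U.a_assoc)
next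
  show "\<zero>\<^bsub>stalk T F x\<^esub> \<in> carrier (stalk T F x)"
    using x by (auto simp: stalk_zero[of "topspace T"] germ_closed zero_closed)
next
  fix X assume X: "X \<in> carrier (stalk T F x)"
  obtain U s where U: "openin T U" "x \<in> U" and s: "s \<in> carrier (sec F U)" "X = germ T F x U s"
    by (rule stalkE[OF X])
  interpret U: abelian_group "sec F U" by (rule abelian[OF U(1)])
  show "\<zero>\<^bsub>stalk T F x\<^esub> \<oplus>\<^bsub>stalk T F x\<^esub> X = X"
    using U s by (simp add: stalk_zero[OF U] stalk_add)
  show "\<exists>Y\<in>carrier (stalk T F x). Y \<oplus>\<^bsub>stalk T F x\<^esub> X = \<zero>\<^bsub>stalk T F x\<^esub>"
    using U s by (intro bexI[of _ "germ T F x U (\<ominus>\<^bsub>sec F U\<^esub> s)"])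
      (simp_all add: stalk_zero[OF U] stalk_add germ_closed U.l_neg)
qed

lemma section_eq_if_germs_eq:
  assumes F: "sheaf_axiom T F" and U: "openin T U"
    and s: "s \<in> carrier (sec F U)" and t: "t \<in> carrier (sec F U)"
    and eq: "\<And>x. x \<in> U \<Longrightarrow> germ T F x U s = germ T F x U t"
  shows "s = t"
proof -
  have "\<exists>W. openin T W \<and> x \<in> W \<and> W \<subseteq> U \<and> res F U W s = res F U W t" if x: "x \<in> U" for x
    using eq[OF x] germ_eq_iff[OF U s U x t] by simp
  then obtain W where W: "\<And>x. x \<in> U \<Longrightarrow> openin T (W x) \<and> x \<in> W x \<and> W x \<subseteq> U \<and> res F U (W x) s = res F U (W x) t"
    by metis
  show ?thesis
  proof (rule sheaf_separated[OF abelian_presheaf_axioms F])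
    show "U = (\<Union>x\<in>U. W x)" using W by blast
  qed (use W s t in auto)
qed

end

subsection \<open>Quotient presheaves and the Godement sheaf\<close>

lemma quot_mod_abelian:
  assumes "abelian_group M" "additive_subgroup N M"
  shows "abelian_group (quot_mod M N)"
proof -
  interpret abelian_subgroup N M by (rule abelian_subgroupI3[OF assms(2,1)])
  interpret Q: comm_group "M A_Mod N" by (rule a_factorgroup_is_comm_group)
  have eq: "carrier (quot_mod M N) = carrier (M A_Mod N)" "\<zero>\<^bsub>quot_mod M N\<^esub> = \<one>\<^bsub>M A_Mod N\<^esub>"
    "\<And>X Y. X \<oplus>\<^bsub>quot_mod M N\<^esub> Y = X \<otimes>\<^bsub>M A_Mod N\<^esub> Y"
    by (simp_all add: quot_mod_def A_FactGroup_def')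
  show ?thesis
    by (rule abelian_groupI; unfold eq) (simp_all add: Q.m_assoc Q.m_comm Q.m_lcomm Q.l_inv_ex del: add_A_FactGroup)
qed

lemma carrier_quot_mod: "carrier (quot_mod M N) = (\<lambda>a. N +>\<^bsub>M\<^esub> a) ` carrier M"
  by (auto simp: quot_mod_def A_RCOSETS_def')

lemma coset_eq_iff:
  assumes "abelian_group M" "additive_subgroup N M" "a \<in> carrier M" "b \<in> carrier M"
  shows "N +>\<^bsub>M\<^esub> a = N +>\<^bsub>M\<^esub> b \<longleftrightarrow> (\<exists>n\<in>N. a = n \<oplus>\<^bsub>M\<^esub> b)"
proof -
  interpret abelian_subgroup N M by (rule abelian_subgroupI3[OF assms(2,1)])
  have mem: "a \<in> N +>\<^bsub>M\<^esub> b \<longleftrightarrow> (\<exists>n\<in>N. a = n \<oplus>\<^bsub>M\<^esub> b)"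
    by (auto simp: a_r_coset_def')
  have "a \<in> N +>\<^bsub>M\<^esub> a" by (rule a_rcos_self[OF assms(3)])
  then show ?thesis
    using mem a_repr_independence[OF _ assms(4) a_subgroup] by metis
qed

context abelian_presheaf
begin

context
  fixes N :: "'a set \<Rightarrow> 'r set"
  assumes N: "openin T U \<Longrightarrow> additive_subgroup (N U) (sec F U)"
    and N_res: "openin T U \<Longrightarrow> openin T V \<Longrightarrow> V \<subseteq> U \<Longrightarrow> n \<in> N U \<Longrightarrow> res F U V n \<in> N V"
begin

lemma quot_res_coset:
  assumes U: "openin T U" "openin T V" "V \<subseteq> U" and a: "a \<in> carrier (sec F U)"
  shows "res (quot_presheaf F N) U V (N U +>\<^bsub>sec F U\<^esub> a) = N V +>\<^bsub>sec F V\<^esub> res F U V a"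
proof -
  interpret NU: abelian_subgroup "N U" "sec F U" by (rule abelian_subgroupI3[OF N abelian]) fact+
  have eq: "N V +>\<^bsub>sec F V\<^esub> res F U V b = N V +>\<^bsub>sec F V\<^esub> res F U V a"
    if b: "b \<in> N U +>\<^bsub>sec F U\<^esub> a" for b
  proof -
    obtain n where n: "n \<in> N U" "b = n \<oplus>\<^bsub>sec F U\<^esub> a"
      using b by (auto simp: a_r_coset_def')
    have "res F U V b = res F U V n \<oplus>\<^bsub>sec F V\<^esub> res F U V a"
      using n a U by (simp add: res_add)
    moreover have "res F U V n \<in> carrier (sec F V)" using n U by (simp add: res_closed)
    ultimately show ?thesis
      using coset_eq_iff[OF abelian[OF U(2)] N[OF U(2)]] N_res[OF U n(1)] a U
      by (metis add_closed res_closed)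
  qed
  have "a \<in> N U +>\<^bsub>sec F U\<^esub> a" by (rule NU.a_rcos_self[OF a])
  then have "(\<Union>b\<in>N U +>\<^bsub>sec F U\<^esub> a. N V +>\<^bsub>sec F V\<^esub> res F U V a) = N V +>\<^bsub>sec F V\<^esub> res F U V a"
    by blast
  moreover have "res (quot_presheaf F N) U V (N U +>\<^bsub>sec F U\<^esub> a) =
      (\<Union>b\<in>N U +>\<^bsub>sec F U\<^esub> a. N V +>\<^bsub>sec F V\<^esub> res F U V a)"
    unfolding quot_presheaf_def by (simp only: presheaf.simps) (intro SUP_cong refl eq)
  ultimately show ?thesis by simp
qed

lemma quot_presheaf_abelian: "abelian_presheaf T (quot_presheaf F N)"
proof (rule abelian_presheaf.intro)
  fix U assume U: "openin T U"
  show "abelian_group (sec (quot_presheaf F N) U)"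
    using quot_mod_abelian[OF abelian[OF U] N[OF U]] by (simp add: quot_presheaf_def)
  fix X assume "X \<in> carrier (sec (quot_presheaf F N) U)"
  then obtain a where a: "a \<in> carrier (sec F U)" "X = N U +>\<^bsub>sec F U\<^esub> a"
    by (auto simp: quot_presheaf_def carrier_quot_mod)
  show "res (quot_presheaf F N) U U X = X"
    using a U by (simp add: quot_res_coset res_id)
  fix V W assume "openin T V" "openin T W" "W \<subseteq> V" "V \<subseteq> U"
  then show "res (quot_presheaf F N) V W (res (quot_presheaf F N) U V X) = res (quot_presheaf F N) U W X"
    using a U by (simp add: quot_res_coset res_closed res_res)
next
  fix U V assume U: "openin T U" "openin T V" "V \<subseteq> U"
  show "abelian_group_hom (sec (quot_presheaf F N) U) (sec (quot_presheaf F N) V) (res (quot_presheaf F N) U V)"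
  proof (rule abelian_group_hom_of_additive)
    show "abelian_group (sec (quot_presheaf F N) U)" "abelian_group (sec (quot_presheaf F N) V)"
      using quot_mod_abelian[OF abelian N] U by (simp_all add: quot_presheaf_def)
    fix X assume "X \<in> carrier (sec (quot_presheaf F N) U)"
    then obtain a where a: "a \<in> carrier (sec F U)" "X = N U +>\<^bsub>sec F U\<^esub> a"
      by (auto simp: quot_presheaf_def carrier_quot_mod)
    then show "res (quot_presheaf F N) U V X \<in> carrier (sec (quot_presheaf F N) V)"
      using U by (simp add: quot_res_coset) (simp add: quot_presheaf_def carrier_quot_mod res_closed)
    fix Y assume "Y \<in> carrier (sec (quot_presheaf F N) U)"
    then obtain b where b: "b \<in> carrier (sec F U)" "Y = N U +>\<^bsub>sec F U\<^esub> b"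
      by (auto simp: quot_presheaf_def carrier_quot_mod)
    have add: "(N W +>\<^bsub>sec F W\<^esub> a) \<oplus>\<^bsub>sec (quot_presheaf F N) W\<^esub> (N W +>\<^bsub>sec F W\<^esub> b) =
        N W +>\<^bsub>sec F W\<^esub> (a \<oplus>\<^bsub>sec F W\<^esub> b)"
      if "openin T W" "a \<in> carrier (sec F W)" "b \<in> carrier (sec F W)" for W a b
      using abelian_subgroup.a_rcos_sum[OF abelian_subgroupI3[OF N abelian]] that
      by (simp add: quot_presheaf_def quot_mod_def)
    show "res (quot_presheaf F N) U V (X \<oplus>\<^bsub>sec (quot_presheaf F N) U\<^esub> Y) =
        res (quot_presheaf F N) U V X \<oplus>\<^bsub>sec (quot_presheaf F N) V\<^esub> res (quot_presheaf F N) U V Y"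
      using a b U by (simp add: add quot_res_coset add_closed res_closed res_add)
  qed
qed

end

end

lemma pointwise_abelian:
  assumes "\<And>x. x \<in> U \<Longrightarrow> abelian_group (S x)"
  shows "abelian_group (pointwise U S (\<Pi>\<^sub>E x\<in>U. carrier (S x)))"
proof (rule abelian_groupI)
  note ab = abelian_group.axioms(1)[OF assms]
  fix s t assume s: "s \<in> carrier (pointwise U S (\<Pi>\<^sub>E x\<in>U. carrier (S x)))"
    and t: "t \<in> carrier (pointwise U S (\<Pi>\<^sub>E x\<in>U. carrier (S x)))"
  then have st: "s x \<in> carrier (S x)" "t x \<in> carrier (S x)" if "x \<in> U" for x
    using that by (auto simp: pointwise_def)
  show "s \<oplus>\<^bsub>pointwise U S (\<Pi>\<^sub>E x\<in>U. carrier (S x))\<^esub> t \<in> carrier (pointwise U S (\<Pi>\<^sub>E x\<in>U. carrier (S x)))"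
    using st by (auto simp: pointwise_def abelian_monoid.a_closed[OF ab])
  show "s \<oplus>\<^bsub>pointwise U S (\<Pi>\<^sub>E x\<in>U. carrier (S x))\<^esub> t = t \<oplus>\<^bsub>pointwise U S (\<Pi>\<^sub>E x\<in>U. carrier (S x))\<^esub> s"
    using st by (auto simp: pointwise_def abelian_monoid.a_comm[OF ab] intro!: restrict_ext)
  fix u assume u: "u \<in> carrier (pointwise U S (\<Pi>\<^sub>E x\<in>U. carrier (S x)))"
  then have ux: "u x \<in> carrier (S x)" if "x \<in> U" for x
    using that by (auto simp: pointwise_def)
  show "s \<oplus>\<^bsub>pointwise U S (\<Pi>\<^sub>E x\<in>U. carrier (S x))\<^esub> t \<oplus>\<^bsub>pointwise U S (\<Pi>\<^sub>E x\<in>U. carrier (S x))\<^esub> u =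
     s \<oplus>\<^bsub>pointwise U S (\<Pi>\<^sub>E x\<in>U. carrier (S x))\<^esub> (t \<oplus>\<^bsub>pointwise U S (\<Pi>\<^sub>E x\<in>U. carrier (S x))\<^esub> u)"
    using st ux by (auto simp: pointwise_def abelian_monoid.a_assoc[OF ab] intro!: restrict_ext)
next
  note ab = abelian_group.axioms(1)[OF assms]
  show "\<zero>\<^bsub>pointwise U S (\<Pi>\<^sub>E x\<in>U. carrier (S x))\<^esub> \<in> carrier (pointwise U S (\<Pi>\<^sub>E x\<in>U. carrier (S x)))"
    by (auto simp: pointwise_def abelian_monoid.zero_closed[OF ab])
  fix s assume s: "s \<in> carrier (pointwise U S (\<Pi>\<^sub>E x\<in>U. carrier (S x)))"
  then have sx: "s \<in> extensional U" "\<And>x. x \<in> U \<Longrightarrow> s x \<in> carrier (S x)"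
    by (auto simp: pointwise_def PiE_iff)
  show "\<zero>\<^bsub>pointwise U S (\<Pi>\<^sub>E x\<in>U. carrier (S x))\<^esub> \<oplus>\<^bsub>pointwise U S (\<Pi>\<^sub>E x\<in>U. carrier (S x))\<^esub> s = s"
    using sx by (auto simp: pointwise_def abelian_monoid.l_zero[OF ab] extensional_def restrict_def)
  show "\<exists>t\<in>carrier (pointwise U S (\<Pi>\<^sub>E x\<in>U. carrier (S x))).
      t \<oplus>\<^bsub>pointwise U S (\<Pi>\<^sub>E x\<in>U. carrier (S x))\<^esub> s = \<zero>\<^bsub>pointwise U S (\<Pi>\<^sub>E x\<in>U. carrier (S x))\<^esub>"
    using sx assms
    by (intro bexI[of _ "\<lambda>x\<in>U. \<ominus>\<^bsub>S x\<^esub> s x"])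
       (auto simp: pointwise_def abelian_group.a_inv_closed abelian_group.l_neg intro!: restrict_ext)
qed

context abelian_presheaf
begin

lemma in_topspace: "openin T U \<Longrightarrow> x \<in> U \<Longrightarrow> x \<in> topspace T"
  using openin_subset by blast

lemma carrier_godement: "c \<in> carrier (sec (godement T F) U) \<longleftrightarrow>
    c \<in> extensional U \<and> (\<forall>x\<in>U. c x \<in> carrier (stalk T F x))"
  by (auto simp: godement_def pointwise_def PiE_iff)

lemma godement_add: "x \<in> U \<Longrightarrow> (c \<oplus>\<^bsub>sec (godement T F) U\<^esub> d) x = c x \<oplus>\<^bsub>stalk T F x\<^esub> d x"
  by (simp add: godement_def pointwise_def)

lemma godement_sec_abelian: "openin T U \<Longrightarrow> abelian_group (sec (godement T F) U)"
  unfolding godement_def by (auto intro!: pointwise_abelian stalk_abelian in_topspace)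

lemma godement_abelian: "abelian_presheaf T (godement T F)"
proof (rule abelian_presheaf.intro)
  fix U V assume U: "openin T U" and V: "openin T V" "V \<subseteq> U"
  show "abelian_group_hom (sec (godement T F) U) (sec (godement T F) V) (res (godement T F) U V)"
    using V by (intro abelian_group_hom_of_additive godement_sec_abelian U V)
      (auto simp: godement_def pointwise_def restrict_def PiE_iff extensional_def fun_eq_iff dest: subsetD)
next
  show "res (godement T F) U U s = s" if "s \<in> carrier (sec (godement T F) U)" for U s
    using that unfolding carrier_godement by (simp add: godement_def extensional_restrict)
  show "res (godement T F) V W (res (godement T F) U V s) = res (godement T F) U W s"
    if "W \<subseteq> V" for U V W s
    using that by (auto simp: godement_def restrict_restrict Int_absorb1)
qed (rule godement_sec_abelian)

lemma germs_hom:
  assumes U: "openin T U"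
  shows "abelian_group_hom (sec F U) (sec (godement T F) U) (germs T F U)"
  by (intro abelian_group_hom_of_additive godement_sec_abelian abelian U)
     (auto simp: germs_def carrier_godement germ_closed[OF U] stalk_add[OF U] godement_def pointwise_def
        intro!: restrict_ext)

lemma germs_subgroup:
  assumes U: "openin T U"
  shows "additive_subgroup (germs T F U ` carrier (sec F U)) (sec (godement T F) U)"
proof (rule additive_subgroupI)
  interpret abelian_group_hom "sec F U" "sec (godement T F) U" "germs T F U" by (rule germs_hom[OF U])
  show "subgroup (germs T F U ` carrier (sec F U)) (add_monoid (sec (godement T F) U))"
    using group_hom.img_is_subgroup[OF a_group_hom] by simp
qed

lemma germs_res:
  assumes "openin T U" "openin T V" "V \<subseteq> U" "s \<in> carrier (sec F U)"
  shows "restrict (germs T F U s) V = germs T F V (res F U V s)"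
  using assms by (auto simp: germs_def fun_eq_iff germ_res)

lemma germs_image_res:
  "openin T U \<Longrightarrow> openin T V \<Longrightarrow> V \<subseteq> U \<Longrightarrow> n \<in> germs T F U ` carrier (sec F U) \<Longrightarrow>
    res (godement T F) U V n \<in> germs T F V ` carrier (sec F V)"
  by (auto simp: godement_def germs_res res_closed)

lemma godement_quot_abelian: "abelian_presheaf T (godement_quot T F)"
  unfolding godement_quot_def
  by (rule abelian_presheaf.quot_presheaf_abelian[OF godement_abelian germs_subgroup germs_image_res])

lemma godement_quot_res:
  assumes "openin T U" "openin T V" "V \<subseteq> U" "c \<in> carrier (sec (godement T F) U)"
  shows "res (godement_quot T F) U V (germs T F U ` carrier (sec F U) +>\<^bsub>sec (godement T F) U\<^esub> c) =
    germs T F V ` carrier (sec F V) +>\<^bsub>sec (godement T F) V\<^esub> restrict c V"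
  using abelian_presheaf.quot_res_coset[OF godement_abelian germs_subgroup germs_image_res assms]
  by (simp add: godement_quot_def godement_def)

end

subsection \<open>Splitting Cech cocycles\<close>

text \<open>A quotient group is trivial only if the subgroup is everything: the coset of \<open>s\<close> contains \<open>s\<close> and
  is equal to the subgroup.\<close>

lemma (in abelian_presheaf) H1_zeroD:
  assumes H1: "carrier (H1 T F) = {\<zero>\<^bsub>H1 T F\<^esub>}"
    and s: "s \<in> carrier (sec (sheafify T (godement_quot T F)) (topspace T))"
  obtains b where "b \<in> carrier (sec (godement T F) (topspace T))"
    "s = germs T (godement_quot T F) (topspace T)
      (germs T F (topspace T) ` carrier (sec F (topspace T)) +>\<^bsub>sec (godement T F) (topspace T)\<^esub> b)"
proof -
  let ?X = "topspace T" and ?Q = "godement_quot T F" and ?G = "godement T F"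
  let ?D = "germs T F ?X ` carrier (sec F ?X)"
  let ?M = "sec (sheafify T ?Q) ?X"
  define N where "N = (\<lambda>b. germs T ?Q ?X (?D +>\<^bsub>sec ?G ?X\<^esub> b)) ` carrier (sec ?G ?X)"
  interpret Q: abelian_presheaf T ?Q by (rule godement_quot_abelian)
  interpret GX: abelian_group "sec ?G ?X" by (rule godement_sec_abelian) simp
  have X: "openin T ?X" by simp
  have "?D +>\<^bsub>sec ?G ?X\<^esub> \<zero>\<^bsub>sec ?G ?X\<^esub> = ?D"
  proof -
    interpret additive_subgroup ?D "sec ?G ?X" by (rule germs_subgroup[OF X])
    show ?thesis by (rule GX.a_coset_add_zero[OF a_subset])
  qed
  moreover have "\<zero>\<^bsub>sec ?Q ?X\<^esub> = ?D"
    by (simp add: godement_quot_def quot_presheaf_def quot_mod_def)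
  ultimately have "\<zero>\<^bsub>?M\<^esub> = germs T ?Q ?X (?D +>\<^bsub>sec ?G ?X\<^esub> \<zero>\<^bsub>sec ?G ?X\<^esub>)"
    by (auto simp: sheafify_def pointwise_def germs_def Q.stalk_zero[OF X] intro!: restrict_ext)
  then have zero: "\<zero>\<^bsub>?M\<^esub> \<in> N" unfolding N_def by blast
  have sx: "s \<in> extensional ?X" "s x \<in> carrier (stalk T ?Q x)" if x: "x \<in> ?X" for x
  proof -
    show "s \<in> extensional ?X" using s by (simp add: sheafify_def pointwise_def)
    obtain V t where V: "openin T V" "x \<in> V" "t \<in> carrier (sec ?Q V)" "restrict s V = germs T ?Q V t"
      using s x unfolding sheafify_def pointwise_def by simp blast
    then have "s x = germ T ?Q x V t" by (metis germs_def restrict_apply')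
    then show "s x \<in> carrier (stalk T ?Q x)" using Q.germ_closed V by simp
  qed
  have ext: "s \<in> extensional ?X" using s by (simp add: sheafify_def pointwise_def)
  have "\<zero>\<^bsub>?M\<^esub> \<oplus>\<^bsub>?M\<^esub> s = restrict s ?X"
  proof -
    have "\<zero>\<^bsub>stalk T ?Q x\<^esub> \<oplus>\<^bsub>stalk T ?Q x\<^esub> s x = s x" if "x \<in> ?X" for x
      using abelian_monoid.l_zero[OF abelian_group.axioms(1)[OF Q.stalk_abelian[OF that]] sx(2)[OF that]] .
    then show ?thesis by (auto simp: sheafify_def pointwise_def intro!: restrict_ext)
  qed
  then have "\<zero>\<^bsub>?M\<^esub> \<oplus>\<^bsub>?M\<^esub> s = s" by (simp add: extensional_restrict[OF ext])
  then have mem: "s \<in> N +>\<^bsub>?M\<^esub> s" using zero by (force simp: a_r_coset_def')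
  have H: "H1 T F = quot_mod ?M N" by (simp add: H1_def Let_def N_def)
  have "carrier (H1 T F) = (\<lambda>a. N +>\<^bsub>?M\<^esub> a) ` carrier ?M"
    unfolding H by (rule carrier_quot_mod)
  then have "N +>\<^bsub>?M\<^esub> s \<in> carrier (H1 T F)" using s by blast
  moreover have "\<zero>\<^bsub>H1 T F\<^esub> = N" unfolding H by (simp add: quot_mod_def)
  ultimately have "N +>\<^bsub>?M\<^esub> s = N" using H1 by simp
  then have "s \<in> N" using mem by simp
  then show ?thesis using that unfolding N_def by blast
qed

text \<open>The cocycle is split by the discontinuous cochain whose value at \<open>x\<close> is the germ of
  \<open>P (\<iota> x) i\<close>, where \<open>\<iota> x\<close> is a chosen member of the cover containing \<open>x\<close>. Modulo sections of
  the sheaf these cochains agree on overlaps, so they glue to a section of the Godement quotient. By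
  assumption this section lifts to a global cochain \<open>b\<close>; subtracting \<open>b\<close> turns the local cochains
  into sections.\<close>

lemma (in abelian_presheaf) cech_cocycle_splits:
  assumes F: "sheaf_axiom T F" and H1: "carrier (H1 T F) = {\<zero>\<^bsub>H1 T F\<^esub>}"
    and U: "\<And>i. i \<in> I \<Longrightarrow> openin T (U i)" "(\<Union>i\<in>I. U i) = topspace T"
    and P: "\<And>i j. i \<in> I \<Longrightarrow> j \<in> I \<Longrightarrow> P i j \<in> carrier (sec F (U i \<inter> U j))"
    and cocycle: "\<And>i j l. i \<in> I \<Longrightarrow> j \<in> I \<Longrightarrow> l \<in> I \<Longrightarrow>
      res F (U i \<inter> U j) (U i \<inter> U j \<inter> U l) (P i j) \<oplus>\<^bsub>sec F (U i \<inter> U j \<inter> U l)\<^esub>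
      res F (U j \<inter> U l) (U i \<inter> U j \<inter> U l) (P j l) = res F (U i \<inter> U l) (U i \<inter> U j \<inter> U l) (P i l)"
  obtains q where "\<And>i. i \<in> I \<Longrightarrow> q i \<in> carrier (sec F (U i))"
    and "\<And>i j. i \<in> I \<Longrightarrow> j \<in> I \<Longrightarrow> res F (U j) (U i \<inter> U j) (q j) =
      P i j \<oplus>\<^bsub>sec F (U i \<inter> U j)\<^esub> res F (U i) (U i \<inter> U j) (q i)"
proof -
  let ?X = "topspace T" and ?Q = "godement_quot T F" and ?G = "godement T F"
  define D where "D V = germs T F V ` carrier (sec F V)" for V
  interpret Q: abelian_presheaf T ?Q by (rule godement_quot_abelian)
  have X: "openin T ?X" by simp
  have o: "openin T (U i \<inter> U j)" if "i \<in> I" "j \<in> I" for i j using U(1) that by auto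
  have Dsub: "additive_subgroup (D V) (sec ?G V)" if "openin T V" for V
    unfolding D_def by (rule germs_subgroup[OF that])
  \<comment> \<open>on germs the cocycle condition holds without restriction maps\<close>
  define p where "p i j x = germ T F x (U i \<inter> U j) (P i j)" for i j x
  have pc: "p i j x \<in> carrier (stalk T F x)" if "i \<in> I" "j \<in> I" "x \<in> U i \<inter> U j" for i j x
    unfolding p_def by (rule germ_closed[OF o _ P]) (use that in auto)
  have pp: "p i j x \<oplus>\<^bsub>stalk T F x\<^esub> p j l x = p i l x"
    if i: "i \<in> I" and j: "j \<in> I" and l: "l \<in> I" and x: "x \<in> U i \<inter> U j \<inter> U l" for i j l x
  proof -
    let ?V = "U i \<inter> U j \<inter> U l"
    have V: "openin T ?V" using U(1) i j l by auto
    have s: "?V \<subseteq> U i \<inter> U j" "?V \<subseteq> U j \<inter> U l" "?V \<subseteq> U i \<inter> U l" by auto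
    note g = germ_res[OF o[OF i j] V s(1) x P[OF i j]] germ_res[OF o[OF j l] V s(2) x P[OF j l]]
      germ_res[OF o[OF i l] V s(3) x P[OF i l]]
    note c = res_closed[OF o[OF i j] V s(1) P[OF i j]] res_closed[OF o[OF j l] V s(2) P[OF j l]]
    show ?thesis
      using stalk_add[OF V x c] cocycle[OF i j l] g unfolding p_def by simp
  qed
  define \<iota> where "\<iota> x = (SOME i. i \<in> I \<and> x \<in> U i)" for x
  have \<iota>: "\<iota> x \<in> I" "x \<in> U (\<iota> x)" if x: "x \<in> ?X" for x
  proof -
    have "\<exists>i. i \<in> I \<and> x \<in> U i" using U(2) x by blast
    then have "\<iota> x \<in> I \<and> x \<in> U (\<iota> x)" unfolding \<iota>_def by (rule someI_ex)
    then show "\<iota> x \<in> I" "x \<in> U (\<iota> x)" by auto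
  qed
  have inX: "x \<in> ?X" if "i \<in> I" "x \<in> U i" for i x using U(2) that by blast
  define c where "c i = (\<lambda>x\<in>U i. p (\<iota> x) i x)" for i
  have cx: "c i x \<in> carrier (stalk T F x)" if "i \<in> I" "x \<in> U i" for i x
    using that \<iota>[OF inX[OF that]] by (simp add: c_def pc)
  have cG: "c i \<in> carrier (sec ?G (U i))" if "i \<in> I" for i
    unfolding carrier_godement using cx that by (simp add: c_def)
  have ccp: "c j x = p i j x \<oplus>\<^bsub>stalk T F x\<^esub> c i x"
    if i: "i \<in> I" and j: "j \<in> I" and x: "x \<in> U i \<inter> U j" for i j x
  proof -
    have xX: "x \<in> ?X" using inX i x by blast
    interpret abelian_group "stalk T F x" by (rule stalk_abelian[OF xX])
    have "c j x = c i x \<oplus>\<^bsub>stalk T F x\<^esub> p i j x"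
      using pp[OF \<iota>(1)[OF xX] i j] \<iota>(2)[OF xX] x by (simp add: c_def)
    then show ?thesis using a_comm[OF cx[OF i] pc[OF i j x]] x by simp
  qed
  \<comment> \<open>classes of the local cochains modulo germs of sections\<close>
  define C where "C i = D (U i) +>\<^bsub>sec ?G (U i)\<^esub> c i" for i
  have CQ: "C i \<in> carrier (sec ?Q (U i))" if "i \<in> I" for i
    unfolding C_def godement_quot_def quot_presheaf_def D_def
    using cG[OF that] by (simp add: carrier_quot_mod)
  have Cres: "res ?Q (U i) V (C i) = D V +>\<^bsub>sec ?G V\<^esub> restrict (c i) V"
    if "i \<in> I" "openin T V" "V \<subseteq> U i" for i V
    unfolding C_def D_def using godement_quot_res[OF U(1) that(2,3) cG] that(1) by simp
  have rG: "restrict d V \<in> carrier (sec ?G V)"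
    if "d \<in> carrier (sec ?G W)" "V \<subseteq> W" for d V W
    using that unfolding carrier_godement by auto
  have Ceq: "germ T ?Q x (U i) (C i) = germ T ?Q x (U j) (C j)"
    if i: "i \<in> I" and j: "j \<in> I" and x: "x \<in> U i \<inter> U j" for i j x
  proof -
    let ?V = "U i \<inter> U j"
    have "restrict (c j) ?V = germs T F ?V (P i j) \<oplus>\<^bsub>sec ?G ?V\<^esub> restrict (c i) ?V"
      using ccp[OF i j] by (auto simp: godement_def pointwise_def germs_def p_def intro!: restrict_ext)
    moreover have "germs T F ?V (P i j) \<in> D ?V" using P[OF i j] by (simp add: D_def)
    ultimately have "D ?V +>\<^bsub>sec ?G ?V\<^esub> restrict (c j) ?V = D ?V +>\<^bsub>sec ?G ?V\<^esub> restrict (c i) ?V"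
      using coset_eq_iff[OF godement_sec_abelian[OF o[OF i j]] Dsub[OF o[OF i j]] rG[OF cG[OF j] Int_lower2]
          rG[OF cG[OF i] Int_lower1]] by blast
    then have "res ?Q (U j) ?V (C j) = res ?Q (U i) ?V (C i)"
      using Cres[OF i o[OF i j] Int_lower1] Cres[OF j o[OF i j] Int_lower2] by simp
    then show ?thesis
      using Q.germ_res[OF U(1)[OF i] o[OF i j] Int_lower1 x CQ[OF i]]
        Q.germ_res[OF U(1)[OF j] o[OF i j] Int_lower2 x CQ[OF j]] by simp
  qed
  define s where "s = (\<lambda>x\<in>?X. germ T ?Q x (U (\<iota> x)) (C (\<iota> x)))"
  have s_eq: "s x = germ T ?Q x (U i) (C i)" if "i \<in> I" "x \<in> U i" for i x
    using Ceq[OF \<iota>(1) that(1)] \<iota>(2) inX[OF that] that unfolding s_def by simp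
  have "s \<in> carrier (sec (sheafify T ?Q) ?X)"
    unfolding sheafify_def pointwise_def partial_object.simps presheaf.simps mem_Collect_eq
  proof (intro conjI ballI)
    show "s \<in> extensional ?X" by (simp add: s_def)
    fix x assume x: "x \<in> ?X"
    let ?i = "\<iota> x"
    have "restrict s (U ?i) = germs T ?Q (U ?i) (C ?i)"
      unfolding germs_def by (intro restrict_ext s_eq \<iota>[OF x])
    then show "\<exists>V t. openin T V \<and> x \<in> V \<and> V \<subseteq> ?X \<and> t \<in> carrier (sec ?Q V) \<and> restrict s V = germs T ?Q V t"
      using U(1)[OF \<iota>(1)[OF x]] \<iota>(2)[OF x] CQ[OF \<iota>(1)[OF x]] openin_subset[OF U(1)[OF \<iota>(1)[OF x]]]
      by (intro exI[of _ "U ?i"] exI[of _ "C ?i"]) simp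
  qed
  then obtain b where b: "b \<in> carrier (sec ?G ?X)"
    and sb: "s = germs T ?Q ?X (D ?X +>\<^bsub>sec ?G ?X\<^esub> b)"
    unfolding D_def by (rule H1_zeroD[OF H1])
  have bQ: "D ?X +>\<^bsub>sec ?G ?X\<^esub> b \<in> carrier (sec ?Q ?X)"
    unfolding godement_quot_def quot_presheaf_def D_def using b by (simp add: carrier_quot_mod)
  have bx: "b x \<in> carrier (stalk T F x)" if "x \<in> ?X" for x
    using b that unfolding carrier_godement by simp
  \<comment> \<open>near each point, the class of \<open>c i\<close> is that of \<open>b\<close>, so \<open>c i\<close> and \<open>b\<close> differ by a section\<close>
  have local: "\<exists>W t. openin T W \<and> x \<in> W \<and> W \<subseteq> U i \<and> t \<in> carrier (sec F W) \<and>
      (\<forall>y\<in>W. c i y = germ T F y W t \<oplus>\<^bsub>stalk T F y\<^esub> b y)" if i: "i \<in> I" and x: "x \<in> U i" for i x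
  proof -
    have "germ T ?Q x (U i) (C i) = germ T ?Q x ?X (D ?X +>\<^bsub>sec ?G ?X\<^esub> b)"
      using s_eq[OF i x] sb inX[OF i x] by (simp add: germs_def)
    then obtain W where W: "openin T W" "x \<in> W" "W \<subseteq> U i \<inter> ?X"
      "res ?Q (U i) W (C i) = res ?Q ?X W (D ?X +>\<^bsub>sec ?G ?X\<^esub> b)"
      using Q.germ_eq_iff[OF U(1)[OF i] CQ[OF i] X inX[OF i x] bQ] by blast
    have W': "W \<subseteq> U i" "W \<subseteq> ?X" using W(3) by auto
    have "res ?Q ?X W (D ?X +>\<^bsub>sec ?G ?X\<^esub> b) = D W +>\<^bsub>sec ?G W\<^esub> restrict b W"
      unfolding D_def by (rule godement_quot_res[OF X W(1) W'(2) b])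
    then have "D W +>\<^bsub>sec ?G W\<^esub> restrict (c i) W = D W +>\<^bsub>sec ?G W\<^esub> restrict b W"
      using W(4) Cres[OF i W(1) W'(1)] by simp
    then obtain t where t: "t \<in> carrier (sec F W)"
      "restrict (c i) W = germs T F W t \<oplus>\<^bsub>sec ?G W\<^esub> restrict b W"
      using coset_eq_iff[OF godement_sec_abelian[OF W(1)] Dsub[OF W(1)] rG[OF cG[OF i] W'(1)] rG[OF b W'(2)]]
      unfolding D_def by blast
    have "c i y = germ T F y W t \<oplus>\<^bsub>stalk T F y\<^esub> b y" if "y \<in> W" for y
      using fun_cong[OF t(2), of y] that by (simp add: godement_add germs_def)
    then show ?thesis using W W' t(1) by blast
  qed
  have ex: "\<exists>t. t \<in> carrier (sec F (U i)) \<and> (\<forall>y\<in>U i. c i y = germ T F y (U i) t \<oplus>\<^bsub>stalk T F y\<^esub> b y)"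
    if i: "i \<in> I" for i
  proof -
    obtain W t where Wt: "\<And>x. x \<in> U i \<Longrightarrow> openin T (W x) \<and> x \<in> W x \<and> W x \<subseteq> U i \<and>
        t x \<in> carrier (sec F (W x)) \<and> (\<forall>y\<in>W x. c i y = germ T F y (W x) (t x) \<oplus>\<^bsub>stalk T F y\<^esub> b y)"
      using local[OF i] by metis
    have Ui: "(\<Union>x\<in>U i. W x) = U i" using Wt by blast
    have "\<exists>!u. u \<in> carrier (sec F (\<Union>x\<in>U i. W x)) \<and> (\<forall>x\<in>U i. res F (\<Union>x\<in>U i. W x) (W x) u = t x)"
    proof (rule sheaf_glue[OF abelian_presheaf_axioms F])
      fix x y assume x: "x \<in> U i" and y: "y \<in> U i"
      have Wx: "openin T (W x)" "t x \<in> carrier (sec F (W x))" and Wy: "openin T (W y)" "t y \<in> carrier (sec F (W y))"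
        using Wt x y by auto
      have Wxy: "openin T (W x \<inter> W y)" using Wx Wy by auto
      show "res F (W x) (W x \<inter> W y) (t x) = res F (W y) (W x \<inter> W y) (t y)"
      proof (rule section_eq_if_germs_eq[OF F Wxy])
        show "res F (W x) (W x \<inter> W y) (t x) \<in> carrier (sec F (W x \<inter> W y))"
          "res F (W y) (W x \<inter> W y) (t y) \<in> carrier (sec F (W x \<inter> W y))"
          using Wx Wy Wxy by (simp_all add: res_closed)
        fix z assume z: "z \<in> W x \<inter> W y"
        have zX: "z \<in> ?X" using in_topspace[OF Wxy z] .
        interpret abelian_group "stalk T F z" by (rule stalk_abelian[OF zX])
        have gc: "germ T F z (W x) (t x) \<in> carrier (stalk T F z)" "germ T F z (W y) (t y) \<in> carrier (stalk T F z)"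
          using z Wx Wy by (simp_all add: germ_closed)
        have "germ T F z (W x) (t x) \<oplus>\<^bsub>stalk T F z\<^esub> b z = germ T F z (W y) (t y) \<oplus>\<^bsub>stalk T F z\<^esub> b z"
          using Wt[OF x] Wt[OF y] z by (metis IntD1 IntD2)
        then have "germ T F z (W x) (t x) = germ T F z (W y) (t y)"
          using gc bx[OF zX] by simp
        then show "germ T F z (W x \<inter> W y) (res F (W x) (W x \<inter> W y) (t x)) =
            germ T F z (W x \<inter> W y) (res F (W y) (W x \<inter> W y) (t y))"
          using germ_res[OF Wx(1) Wxy Int_lower1 z Wx(2)] germ_res[OF Wy(1) Wxy Int_lower2 z Wy(2)] by simp
      qed
    qed (use Wt in auto)
    then obtain u where u: "u \<in> carrier (sec F (U i))" "\<And>x. x \<in> U i \<Longrightarrow> res F (U i) (W x) u = t x"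
      unfolding Ui by blast
    have "c i y = germ T F y (U i) u \<oplus>\<^bsub>stalk T F y\<^esub> b y" if y: "y \<in> U i" for y
    proof -
      have "openin T (W y)" "W y \<subseteq> U i" "y \<in> W y" using Wt[OF y] by auto
      then have "germ T F y (U i) u = germ T F y (W y) (t y)"
        using germ_res[OF U(1)[OF i] _ _ _ u(1)] u(2)[OF y] by metis
      then show ?thesis using Wt[OF y] by simp
    qed
    then show ?thesis using u(1) by blast
  qed
  then obtain q where q: "\<And>i. i \<in> I \<Longrightarrow> q i \<in> carrier (sec F (U i))"
    "\<And>i y. i \<in> I \<Longrightarrow> y \<in> U i \<Longrightarrow> c i y = germ T F y (U i) (q i) \<oplus>\<^bsub>stalk T F y\<^esub> b y"
    by metis
  show ?thesis
  proof (rule that[OF q(1)])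
    fix i j assume i: "i \<in> I" and j: "j \<in> I"
    let ?V = "U i \<inter> U j"
    note V = o[OF i j]
    have rc: "res F (U j) ?V (q j) \<in> carrier (sec F ?V)" "res F (U i) ?V (q i) \<in> carrier (sec F ?V)"
      by (intro res_closed U q V i j Int_lower1 Int_lower2)+
    show "res F (U j) ?V (q j) = P i j \<oplus>\<^bsub>sec F ?V\<^esub> res F (U i) ?V (q i)"
    proof (rule section_eq_if_germs_eq[OF F V rc(1) add_closed[OF V P[OF i j] rc(2)]])
      fix x assume x: "x \<in> ?V"
      have xX: "x \<in> ?X" using in_topspace[OF V x] .
      interpret abelian_group "stalk T F x" by (rule stalk_abelian[OF xX])
      have x': "x \<in> U i" "x \<in> U j" using x by auto
      have gc: "germ T F x (U i) (q i) \<in> carrier (stalk T F x)" "germ T F x (U j) (q j) \<in> carrier (stalk T F x)"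
        using x' U(1) q(1) i j by (simp_all add: germ_closed)
      have "germ T F x (U j) (q j) \<oplus>\<^bsub>stalk T F x\<^esub> b x =
          p i j x \<oplus>\<^bsub>stalk T F x\<^esub> germ T F x (U i) (q i) \<oplus>\<^bsub>stalk T F x\<^esub> b x"
        using ccp[OF i j x] q(2)[OF i x'(1)] q(2)[OF j x'(2)] gc bx[OF xX] pc[OF i j x] by (simp add: a_assoc)
      then have "germ T F x (U j) (q j) = p i j x \<oplus>\<^bsub>stalk T F x\<^esub> germ T F x (U i) (q i)"
        using gc bx[OF xX] pc[OF i j x] by simp
      then show "germ T F x ?V (res F (U j) ?V (q j)) = germ T F x ?V (P i j \<oplus>\<^bsub>sec F ?V\<^esub> res F (U i) ?V (q i))"
        using germ_res[OF U(1)[OF i] V Int_lower1 x q(1)[OF i]] germ_res[OF U(1)[OF j] V Int_lower2 x q(1)[OF j]]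
        by (simp add: p_def stalk_add[OF V x P[OF i j] rc(2), symmetric])
    qed
  qed
qed

subsection \<open>Cocycles of differential operators\<close>

lemma cut_apply: "openin T W \<Longrightarrow> W \<subseteq> U \<Longrightarrow> f \<in> carrier (sec OX W) \<Longrightarrow> cut T OX U P W f = P W f"
  by (simp add: cut_def)

lemma cut_cong:
  assumes "\<And>W f. openin T W \<Longrightarrow> W \<subseteq> U \<Longrightarrow> f \<in> carrier (sec OX W) \<Longrightarrow> P W f = Q W f"
  shows "cut T OX U P = cut T OX U Q"
  using assms by (auto simp: cut_def fun_eq_iff)

lemma cut_cut: "V \<subseteq> U \<Longrightarrow> cut T OX V (cut T OX U P) = cut T OX V P"
  by (rule cut_cong) (auto simp: cut_apply)

lemma topspace_sub: "openin T U \<Longrightarrow> topspace (subtopology T U) = U"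
  using openin_subset[of T U] by (simp add: Int_absorb1)

context ringed_space
begin

abbreviation "\<D> \<equiv> diff_op_sheaf K T OX"

lemma carrier_D: "P \<in> carrier (sec \<D> U) \<longleftrightarrow> cut T OX U P = P \<and> diff_op K (subtopology T U) OX P"
  by (simp add: diff_op_sheaf_def)

lemma diff_op_cut:
  assumes "openin T U" "diff_op K (subtopology T U) OX P"
  shows "diff_op K (subtopology T U) OX (cut T OX U P)"
  by (rule ringed_space.diff_op_cong[OF ringed_sub[OF assms(1)] assms(2)])
     (simp add: openin_sub[OF assms(1)] cut_apply)

lemma cut_in_D: "openin T U \<Longrightarrow> diff_op K (subtopology T U) OX P \<Longrightarrow> cut T OX U P \<in> carrier (sec \<D> U)"
  by (simp add: carrier_D diff_op_cut cut_cut)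

lemma D_eqI:
  assumes "P \<in> carrier (sec \<D> U)" "Q \<in> carrier (sec \<D> U)"
    and "\<And>W f. openin T W \<Longrightarrow> W \<subseteq> U \<Longrightarrow> f \<in> carrier (sec OX W) \<Longrightarrow> P W f = Q W f"
  shows "P = Q"
  using assms(1,2) cut_cong[of T U OX P Q] assms(3) by (simp add: carrier_D)

lemma D_closed:
  assumes "openin T U" "P \<in> carrier (sec \<D> U)" "openin T W" "W \<subseteq> U" "f \<in> carrier (sec OX W)"
  shows "P W f \<in> carrier (sec OX W)"
  using ringed_space.diff_op_closed[OF ringed_sub[OF assms(1)], of P W f] assms
  by (simp add: carrier_D openin_sub)

lemma D_add_apply: "openin T W \<Longrightarrow> W \<subseteq> U \<Longrightarrow> f \<in> carrier (sec OX W) \<Longrightarrow>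
    (P \<oplus>\<^bsub>sec \<D> U\<^esub> Q) W f = P W f \<oplus>\<^bsub>sec OX W\<^esub> Q W f"
  by (simp add: diff_op_sheaf_def cut_apply)

lemma D_res: "res \<D> U V P = cut T OX V P"
  by (simp add: diff_op_sheaf_def)

lemma D_sec_abelian:
  assumes U: "openin T U"
  shows "abelian_group (sec \<D> U)"
proof (rule abelian_groupI)
  interpret U: ringed_space K "subtopology T U" OX by (rule ringed_sub[OF U])
  have add: "P \<oplus>\<^bsub>sec \<D> U\<^esub> Q \<in> carrier (sec \<D> U)" if "P \<in> carrier (sec \<D> U)" "Q \<in> carrier (sec \<D> U)" for P Q
  proof -
    have "P \<oplus>\<^bsub>sec \<D> U\<^esub> Q = cut T OX U (\<lambda>W f. P W f \<oplus>\<^bsub>sec OX W\<^esub> Q W f)" by (simp add: diff_op_sheaf_def)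
    then show ?thesis using cut_in_D[OF U U.diff_op_add] that by (simp add: carrier_D)
  qed
  have zero: "\<zero>\<^bsub>sec \<D> U\<^esub> \<in> carrier (sec \<D> U)"
    using cut_in_D[OF U U.diff_op_zero] by (simp add: diff_op_sheaf_def)
  have zero_apply: "\<zero>\<^bsub>sec \<D> U\<^esub> W f = \<zero>\<^bsub>sec OX W\<^esub>" if "openin T W" "W \<subseteq> U" "f \<in> carrier (sec OX W)" for W f
    using that by (simp add: diff_op_sheaf_def cut_apply)
  show "\<zero>\<^bsub>sec \<D> U\<^esub> \<in> carrier (sec \<D> U)" by (rule zero)
  fix P assume P: "P \<in> carrier (sec \<D> U)"
  note Pc = D_closed[OF U P]
  show "\<zero>\<^bsub>sec \<D> U\<^esub> \<oplus>\<^bsub>sec \<D> U\<^esub> P = P"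
  proof (rule D_eqI[OF add[OF zero P] P])
    fix W f assume W: "openin T W" "W \<subseteq> U" and f: "f \<in> carrier (sec OX W)"
    interpret cring "sec OX W" by (rule cring[OF W(1)])
    show "(\<zero>\<^bsub>sec \<D> U\<^esub> \<oplus>\<^bsub>sec \<D> U\<^esub> P) W f = P W f"
      using Pc[OF W f] by (simp add: D_add_apply W f zero_apply)
  qed
  define M where "M = cut T OX U (\<lambda>W f. \<ominus>\<^bsub>sec OX W\<^esub> P W f)"
  have M: "M \<in> carrier (sec \<D> U)" unfolding M_def
    using P by (intro cut_in_D U U.diff_op_neg) (simp add: carrier_D)
  have "M \<oplus>\<^bsub>sec \<D> U\<^esub> P = \<zero>\<^bsub>sec \<D> U\<^esub>"
  proof (rule D_eqI[OF add[OF M P] zero])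
    fix W f assume W: "openin T W" "W \<subseteq> U" and f: "f \<in> carrier (sec OX W)"
    interpret cring "sec OX W" by (rule cring[OF W(1)])
    show "(M \<oplus>\<^bsub>sec \<D> U\<^esub> P) W f = \<zero>\<^bsub>sec \<D> U\<^esub> W f"
      using Pc[OF W f] by (simp add: D_add_apply W f zero_apply M_def cut_apply l_neg)
  qed
  then show "\<exists>M\<in>carrier (sec \<D> U). M \<oplus>\<^bsub>sec \<D> U\<^esub> P = \<zero>\<^bsub>sec \<D> U\<^esub>" using M by blast
  fix Q assume Q: "Q \<in> carrier (sec \<D> U)"
  note Qc = D_closed[OF U Q]
  show "P \<oplus>\<^bsub>sec \<D> U\<^esub> Q \<in> carrier (sec \<D> U)" by (rule add[OF P Q])
  show "P \<oplus>\<^bsub>sec \<D> U\<^esub> Q = Q \<oplus>\<^bsub>sec \<D> U\<^esub> P"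
  proof (rule D_eqI[OF add[OF P Q] add[OF Q P]])
    fix W f assume W: "openin T W" "W \<subseteq> U" and f: "f \<in> carrier (sec OX W)"
    interpret cring "sec OX W" by (rule cring[OF W(1)])
    show "(P \<oplus>\<^bsub>sec \<D> U\<^esub> Q) W f = (Q \<oplus>\<^bsub>sec \<D> U\<^esub> P) W f"
      using Pc[OF W f] Qc[OF W f] by (simp add: D_add_apply W f a_comm)
  qed
  fix S assume S: "S \<in> carrier (sec \<D> U)"
  note Sc = D_closed[OF U S]
  show "P \<oplus>\<^bsub>sec \<D> U\<^esub> Q \<oplus>\<^bsub>sec \<D> U\<^esub> S = P \<oplus>\<^bsub>sec \<D> U\<^esub> (Q \<oplus>\<^bsub>sec \<D> U\<^esub> S)"
  proof (rule D_eqI[OF add[OF add[OF P Q] S] add[OF P add[OF Q S]]])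
    fix W f assume W: "openin T W" "W \<subseteq> U" and f: "f \<in> carrier (sec OX W)"
    interpret cring "sec OX W" by (rule cring[OF W(1)])
    show "(P \<oplus>\<^bsub>sec \<D> U\<^esub> Q \<oplus>\<^bsub>sec \<D> U\<^esub> S) W f = (P \<oplus>\<^bsub>sec \<D> U\<^esub> (Q \<oplus>\<^bsub>sec \<D> U\<^esub> S)) W f"
      using Pc[OF W f] Qc[OF W f] Sc[OF W f] by (simp add: D_add_apply W f a_assoc)
  qed
qed

lemma D_abelian_presheaf: "abelian_presheaf T \<D>"
proof (rule abelian_presheaf.intro)
  fix U V assume U: "openin T U" and V: "openin T V" "V \<subseteq> U"
  show "abelian_group_hom (sec \<D> U) (sec \<D> V) (res \<D> U V)"
  proof (rule abelian_group_hom_of_additive[OF D_sec_abelian[OF U] D_sec_abelian[OF V(1)]])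
    show "res \<D> U V P \<in> carrier (sec \<D> V)" if P: "P \<in> carrier (sec \<D> U)" for P
    proof -
      have "diff_op K (subtopology (subtopology T U) V) OX P"
        by (rule diff_op_sub) (use P V U in \<open>auto simp: carrier_D openin_sub\<close>)
      then show ?thesis using cut_in_D[OF V(1)] V by (simp add: D_res subtopology_sub)
    qed
    show "res \<D> U V (P \<oplus>\<^bsub>sec \<D> U\<^esub> Q) = res \<D> U V P \<oplus>\<^bsub>sec \<D> V\<^esub> res \<D> U V Q" for P Q
      using V by (simp add: diff_op_sheaf_def cut_cut) (intro cut_cong, simp add: cut_apply)
  qed
next
  show "res \<D> U U P = P" if "P \<in> carrier (sec \<D> U)" for U P
    using that by (simp add: D_res carrier_D)
  show "res \<D> V W (res \<D> U V P) = res \<D> U W P" if "W \<subseteq> V" for U V W P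
    using that by (simp add: D_res cut_cut)
qed (rule D_sec_abelian)

text \<open>The glued operator inherits a bound for its order near \<open>x\<close> from any member of the cover that
  contains \<open>x\<close>; this is where local boundedness of the order enters.\<close>

lemma D_sheaf_axiom: "sheaf_axiom T \<D>"
  unfolding sheaf_axiom_def
proof (intro allI impI)
  fix \<V> s
  assume a: "(\<forall>V\<in>\<V>. openin T V \<and> s V \<in> carrier (sec \<D> V)) \<and>
    (\<forall>V\<in>\<V>. \<forall>W\<in>\<V>. res \<D> V (V \<inter> W) (s V) = res \<D> W (V \<inter> W) (s W))"
  let ?U = "\<Union>\<V>"
  have o: "openin T V" and sD: "s V \<in> carrier (sec \<D> V)" if "V \<in> \<V>" for V using a that by auto
  have U: "openin T ?U" using o by auto
  have agree: "s V W f = s V' W f"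
    if V: "V \<in> \<V>" "V' \<in> \<V>" and W: "openin T W" "W \<subseteq> V \<inter> V'" "f \<in> carrier (sec OX W)" for V V' W f
  proof -
    have "cut T OX (V \<inter> V') (s V) = cut T OX (V \<inter> V') (s V')" using a V by (auto simp: D_res)
    then show ?thesis using cut_apply[OF W, of "s V"] cut_apply[OF W, of "s V'"] by simp
  qed
  interpret U: ringed_space K "subtopology T ?U" OX by (rule ringed_sub[OF U])
  obtain k where k: "sheaf_hom K (subtopology T ?U) OX OX k"
    and kV: "\<And>V W f. V \<in> \<V> \<Longrightarrow> openin (subtopology T ?U) W \<Longrightarrow> W \<subseteq> V \<Longrightarrow> f \<in> carrier (sec OX W) \<Longrightarrow> k W f = s V W f"
  proof (rule glue_sheaf_homs[OF U.module_presheaf U.module_sheaf, of \<V> "\<lambda>V. V" s])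
    show "openin (subtopology T ?U) V" if "V \<in> \<V>" for V using that o U by (auto simp: openin_sub)
    show "(\<Union>V\<in>\<V>. V) = topspace (subtopology T ?U)" using topspace_sub[OF U] by simp
    show "sheaf_hom K (subtopology (subtopology T ?U) V) OX OX (s V)" if "V \<in> \<V>" for V
      using sD[OF that] that by (auto simp: subtopology_sub Sup_upper carrier_D dest: diff_op_sheaf_hom)
    show "s V W f = s V' W f" if "V \<in> \<V>" "V' \<in> \<V>" "openin (subtopology T ?U) W" "W \<subseteq> V \<inter> V'"
      "f \<in> carrier (sec OX W)" for V V' W f
      using agree[OF that(1,2) _ that(4,5)] that(3) by (simp add: openin_sub[OF U])
  qed blast
  have kV': "k W f = s V W f" if "V \<in> \<V>" "openin T W" "W \<subseteq> V" "f \<in> carrier (sec OX W)" for V W f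
    using kV[OF that(1) _ that(3,4)] that by (auto simp: openin_sub[OF U])
  have "diff_op K (subtopology T ?U) OX k"
    unfolding diff_op_def
  proof (intro conjI ballI k)
    fix x assume "x \<in> topspace (subtopology T ?U)"
    then obtain V where V: "V \<in> \<V>" "x \<in> V" by auto
    then have "x \<in> topspace (subtopology T V)" using topspace_sub[OF o[OF V(1)]] by simp
    moreover have "diff_op K (subtopology T V) OX (s V)" using sD[OF V(1)] by (simp add: carrier_D)
    ultimately obtain W d where W: "openin (subtopology T V) W" "x \<in> W"
      "diff_order_less d (subtopology (subtopology T V) W) OX (s V)"
      unfolding diff_op_def by blast
    have W': "openin T W" "W \<subseteq> V" using W(1) by (auto simp: openin_sub[OF o[OF V(1)]])
    have "diff_order_less d (subtopology T W) OX (s V)"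
      using W(3) W'(2) by (simp add: subtopology_sub)
    then have "diff_order_less d (subtopology T W) OX k"
      by (rule diff_order_less_cong[OF ringed_sub[OF W'(1)]])
         (use kV'[OF V(1)] W' in \<open>auto simp: openin_sub\<close>)
    moreover have "W \<subseteq> ?U" using W' V by blast
    ultimately show "\<exists>V d. openin (subtopology T ?U) V \<and> x \<in> V \<and>
        diff_order_less d (subtopology (subtopology T ?U) V) OX k"
      using W W' by (intro exI[of _ W] exI[of _ d]) (simp add: openin_sub[OF U] subtopology_sub)
  qed
  then have kD: "cut T OX ?U k \<in> carrier (sec \<D> ?U)" by (rule cut_in_D[OF U])
  have kres: "res \<D> ?U V (cut T OX ?U k) = s V" if V: "V \<in> \<V>" for V
  proof -
    have "cut T OX V k = cut T OX V (s V)" by (rule cut_cong) (rule kV'[OF V])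
    then show ?thesis using sD[OF V] V by (simp add: D_res cut_cut Sup_upper carrier_D)
  qed
  show "\<exists>!t. t \<in> carrier (sec \<D> ?U) \<and> (\<forall>V\<in>\<V>. res \<D> ?U V t = s V)"
  proof (rule ex1I[of _ "cut T OX ?U k"])
    show "cut T OX ?U k \<in> carrier (sec \<D> ?U) \<and> (\<forall>V\<in>\<V>. res \<D> ?U V (cut T OX ?U k) = s V)"
      using kD kres by blast
    fix P assume P: "P \<in> carrier (sec \<D> ?U) \<and> (\<forall>V\<in>\<V>. res \<D> ?U V P = s V)"
    show "P = cut T OX ?U k"
    proof (rule D_eqI[OF _ kD])
      show "P \<in> carrier (sec \<D> ?U)" using P by simp
      fix W f assume W: "openin T W" "W \<subseteq> ?U" and f: "f \<in> carrier (sec OX W)"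
      have WV: "openin T (W \<inter> V)" if "V \<in> \<V>" for V using W o that by auto
      have Ph: "sheaf_hom K (subtopology T ?U) OX OX P" using P by (simp add: carrier_D diff_op_sheaf_hom)
      have WU: "openin (subtopology T ?U) W" using W by (simp add: openin_sub[OF U])
      have "P W f = k W f"
      proof (rule sheaf_separated[OF abelian_presheaf_axioms sheaf_axiom WV])
        show "W = (\<Union>V\<in>\<V>. W \<inter> V)" using W by blast
        show "P W f \<in> carrier (sec OX W)" "k W f \<in> carrier (sec OX W)"
          using sheaf_homD(2)[OF Ph WU f] sheaf_homD(2)[OF k WU f] by auto
        fix V assume V: "V \<in> \<V>"
        have WVU: "openin (subtopology T ?U) (W \<inter> V)" using WV[OF V] W by (auto simp: openin_sub[OF U])
        have r: "res OX W (W \<inter> V) f \<in> carrier (sec OX (W \<inter> V))"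
          using W WV[OF V] f by (simp add: res_closed)
        have "res OX W (W \<inter> V) (P W f) = P (W \<inter> V) (res OX W (W \<inter> V) f)"
          using sheaf_homD(5)[OF Ph WU WVU Int_lower1 f] by simp
        also have "\<dots> = cut T OX V P (W \<inter> V) (res OX W (W \<inter> V) f)"
          using WV[OF V] r by (simp add: cut_apply)
        also have "\<dots> = s V (W \<inter> V) (res OX W (W \<inter> V) f)" using P V by (simp add: D_res)
        also have "\<dots> = k (W \<inter> V) (res OX W (W \<inter> V) f)" using kV'[OF V WV[OF V] Int_lower2 r] by simp
        also have "\<dots> = res OX W (W \<inter> V) (k W f)" by (rule sheaf_homD(5)[OF k WU WVU Int_lower1 f])
        finally show "res OX W (W \<inter> V) (P W f) = res OX W (W \<inter> V) (k W f)" .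
      qed
      then show "P W f = cut T OX ?U k W f" using W f by (simp add: cut_apply)
    qed
  qed
qed

text \<open>Operators that occur as coefficients of gauge equivalences have arbitrary values outside of their
  domain; cutting them off turns them into sections of \<open>\<D>\<close>.\<close>

lemma diff_op_cocycle_splits:
  assumes H1: "carrier (H1 T \<D>) = {\<zero>\<^bsub>H1 T \<D>\<^esub>}"
    and U: "\<And>i. i \<in> I \<Longrightarrow> openin T (U i)" "(\<Union>i\<in>I. U i) = topspace T"
    and P: "\<And>i j. i \<in> I \<Longrightarrow> j \<in> I \<Longrightarrow> diff_op K (subtopology T (U i \<inter> U j)) OX (P i j)"
    and cocycle: "\<And>i j l V f. i \<in> I \<Longrightarrow> j \<in> I \<Longrightarrow> l \<in> I \<Longrightarrow> openin T V \<Longrightarrow> V \<subseteq> U i \<inter> U j \<inter> U l \<Longrightarrow>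
      f \<in> carrier (sec OX V) \<Longrightarrow> P i j V f \<oplus>\<^bsub>sec OX V\<^esub> P j l V f = P i l V f"
  obtains q where "\<And>i. i \<in> I \<Longrightarrow> diff_op K (subtopology T (U i)) OX (q i)"
    and "\<And>i j V f. i \<in> I \<Longrightarrow> j \<in> I \<Longrightarrow> openin T V \<Longrightarrow> V \<subseteq> U i \<inter> U j \<Longrightarrow> f \<in> carrier (sec OX V) \<Longrightarrow>
      q j V f = P i j V f \<oplus>\<^bsub>sec OX V\<^esub> q i V f"
proof -
  interpret D: abelian_presheaf T \<D> by (rule D_abelian_presheaf)
  have o: "openin T (U i \<inter> U j)" if "i \<in> I" "j \<in> I" for i j using U(1) that by auto
  have "\<exists>q. (\<forall>i\<in>I. q i \<in> carrier (sec \<D> (U i))) \<and>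
      (\<forall>i\<in>I. \<forall>j\<in>I. res \<D> (U j) (U i \<inter> U j) (q j) =
        cut T OX (U i \<inter> U j) (P i j) \<oplus>\<^bsub>sec \<D> (U i \<inter> U j)\<^esub> res \<D> (U i) (U i \<inter> U j) (q i))"
  proof (rule D.cech_cocycle_splits[OF D_sheaf_axiom H1 U, of "\<lambda>i j. cut T OX (U i \<inter> U j) (P i j)"])
    show "cut T OX (U i \<inter> U j) (P i j) \<in> carrier (sec \<D> (U i \<inter> U j))" if "i \<in> I" "j \<in> I" for i j
      by (rule cut_in_D[OF o[OF that] P[OF that]])
    fix i j l assume i: "i \<in> I" and j: "j \<in> I" and l: "l \<in> I"
    let ?V = "U i \<inter> U j \<inter> U l"
    have c: "cut T OX ?V (cut T OX (U i \<inter> U j) (P i j)) = cut T OX ?V (P i j)"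
      "cut T OX ?V (cut T OX (U j \<inter> U l) (P j l)) = cut T OX ?V (P j l)"
      "cut T OX ?V (cut T OX (U i \<inter> U l) (P i l)) = cut T OX ?V (P i l)"
      by (rule cut_cut, blast)+
    show "res \<D> (U i \<inter> U j) ?V (cut T OX (U i \<inter> U j) (P i j)) \<oplus>\<^bsub>sec \<D> ?V\<^esub>
        res \<D> (U j \<inter> U l) ?V (cut T OX (U j \<inter> U l) (P j l)) =
        res \<D> (U i \<inter> U l) ?V (cut T OX (U i \<inter> U l) (P i l))"
      unfolding D_res c
      by (simp add: diff_op_sheaf_def) (intro cut_cong, simp add: cut_apply cocycle[OF i j l])
  qed (assumption, blast)
  then obtain q where q: "\<And>i. i \<in> I \<Longrightarrow> q i \<in> carrier (sec \<D> (U i))"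
    and qq: "\<And>i j. i \<in> I \<Longrightarrow> j \<in> I \<Longrightarrow> res \<D> (U j) (U i \<inter> U j) (q j) =
      cut T OX (U i \<inter> U j) (P i j) \<oplus>\<^bsub>sec \<D> (U i \<inter> U j)\<^esub> res \<D> (U i) (U i \<inter> U j) (q i)"
    by blast
  show ?thesis
  proof (rule that[of q])
    show "diff_op K (subtopology T (U i)) OX (q i)" if "i \<in> I" for i
      using q[OF that] by (simp add: carrier_D)
    show "q j V f = P i j V f \<oplus>\<^bsub>sec OX V\<^esub> q i V f"
      if i: "i \<in> I" and j: "j \<in> I" and V: "openin T V" "V \<subseteq> U i \<inter> U j" "f \<in> carrier (sec OX V)" for i j V f
    proof -
      have "q j V f = res \<D> (U j) (U i \<inter> U j) (q j) V f"
        unfolding D_res using cut_apply[OF V] by simp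
      also have "\<dots> = cut T OX (U i \<inter> U j) (P i j) V f \<oplus>\<^bsub>sec OX V\<^esub> res \<D> (U i) (U i \<inter> U j) (q i) V f"
        unfolding qq[OF i j] by (rule D_add_apply[OF V])
      finally show ?thesis
        unfolding D_res using cut_apply[OF V] by simp
    qed
  qed
qed

end

section \<open>Formal power series\<close>

lemma ps_simps:
  "F \<in> carrier (ps_mod M) \<longleftrightarrow> (\<forall>n. F n \<in> carrier M)"
  "F \<oplus>\<^bsub>ps_mod M\<^esub> G = (\<lambda>n. F n \<oplus>\<^bsub>M\<^esub> G n)"
  "\<zero>\<^bsub>ps_mod M\<^esub> = (\<lambda>_. \<zero>\<^bsub>M\<^esub>)"
  "\<one>\<^bsub>ps_mod M\<^esub> = ps_const M \<one>\<^bsub>M\<^esub>"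
  "c \<in> carrier (ps_ring K) \<longleftrightarrow> (\<forall>n. c n \<in> carrier K)"
  "c \<oplus>\<^bsub>ps_ring K\<^esub> d = (\<lambda>n. c n \<oplus>\<^bsub>K\<^esub> d n)"
  "\<one>\<^bsub>ps_ring K\<^esub> = ps_const K \<one>\<^bsub>K\<^esub>"
  by (auto simp: ps_mod_def ps_ring_def ring.extend_def ps_const_def fun_eq_iff)

lemma ps_smult_def: "c \<odot>\<^bsub>ps_mod M\<^esub> F = (\<lambda>n. \<Oplus>\<^bsub>M\<^esub>i\<in>{..n}. c i \<odot>\<^bsub>M\<^esub> F (n - i))"
  by (simp add: ps_mod_def ring.extend_def)

lemma ps_mult_def: "c \<otimes>\<^bsub>ps_ring K\<^esub> d = (\<lambda>n. \<Oplus>\<^bsub>K\<^esub>i\<in>{..n}. c i \<otimes>\<^bsub>K\<^esub> d (n - i))"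
  by (simp add: ps_ring_def)

lemma ps_sheaf_simps: "sec (ps_sheaf F) U = ps_mod (sec F U)" "res (ps_sheaf F) U V s = (\<lambda>n. res F U V (s n))"
  by (simp_all add: ps_sheaf_def)

context module
begin

lemma ps_smult_closed: "(\<And>n. c n \<in> carrier R) \<Longrightarrow> (\<And>n. F n \<in> carrier M) \<Longrightarrow>
    (c \<odot>\<^bsub>ps_mod M\<^esub> F) n \<in> carrier M"
  unfolding ps_smult_def by (rule M.finsum_closed) (simp add: Pi_iff)

lemma ps_smult_0: "c 0 \<in> carrier R \<Longrightarrow> F 0 \<in> carrier M \<Longrightarrow> (c \<odot>\<^bsub>ps_mod M\<^esub> F) 0 = c 0 \<odot>\<^bsub>M\<^esub> F 0"
  unfolding ps_smult_def by simp

lemma ps_smult_Suc: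
  assumes "\<And>n. c n \<in> carrier R" "\<And>n. F n \<in> carrier M"
  shows "(c \<odot>\<^bsub>ps_mod M\<^esub> F) (Suc n) = ((\<lambda>i. c (Suc i)) \<odot>\<^bsub>ps_mod M\<^esub> F) n \<oplus>\<^bsub>M\<^esub> c 0 \<odot>\<^bsub>M\<^esub> F (Suc n)"
  unfolding ps_smult_def using assms by (subst M.finsum_Suc2) (auto simp: Pi_iff)

lemma ps_smult_const:
  assumes "c \<in> carrier R" "\<And>n. F n \<in> carrier M"
  shows "ps_const R c \<odot>\<^bsub>ps_mod M\<^esub> F = (\<lambda>n. c \<odot>\<^bsub>M\<^esub> F n)"
proof
  fix n
  have z: "((\<lambda>i. ps_const R c (Suc i)) \<odot>\<^bsub>ps_mod M\<^esub> F) m = \<zero>\<^bsub>M\<^esub>" for m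
    unfolding ps_smult_def ps_const_def using assms by simp
  show "(ps_const R c \<odot>\<^bsub>ps_mod M\<^esub> F) n = c \<odot>\<^bsub>M\<^esub> F n"
  proof (cases n)
    case 0
    then show ?thesis using assms by (simp add: ps_smult_0 ps_const_def)
  next
    case (Suc m)
    have "\<And>i. ps_const R c i \<in> carrier R" using assms by (simp add: ps_const_def)
    from ps_smult_Suc[OF this assms(2), where n = m] show ?thesis
      using Suc z assms by (simp add: ps_const_def)
  qed
qed

lemma ps_smult_hbar:
  assumes "\<And>n. F n \<in> carrier M"
  shows "hbar R \<odot>\<^bsub>ps_mod M\<^esub> F = case_nat \<zero>\<^bsub>M\<^esub> F"
proof
  fix n
  show "(hbar R \<odot>\<^bsub>ps_mod M\<^esub> F) n = case_nat \<zero>\<^bsub>M\<^esub> F n"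
  proof (cases n)
    case 0
    then show ?thesis using assms by (simp add: ps_smult_0 hbar_def)
  next
    case (Suc m)
    have "\<And>i. hbar R i \<in> carrier R" by (simp add: hbar_def)
    moreover have "(\<lambda>i. hbar R (Suc i)) = ps_const R \<one>" by (auto simp: hbar_def ps_const_def)
    ultimately show ?thesis
      using Suc ps_smult_Suc[of "hbar R" F m] assms by (simp add: ps_smult_const) (simp add: hbar_def)
  qed
qed

lemma ps_abelian: "abelian_group (ps_mod M)"
proof (rule abelian_groupI; unfold ps_simps)
  fix F assume "\<forall>n::nat. F n \<in> carrier M"
  then show "\<exists>G\<in>carrier (ps_mod M). (\<lambda>n. G n \<oplus>\<^bsub>M\<^esub> F n) = (\<lambda>_. \<zero>\<^bsub>M\<^esub>)"
    by (intro bexI[of _ "\<lambda>n. \<ominus>\<^bsub>M\<^esub> F n"]) (auto simp: ps_simps M.l_neg)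
qed (auto simp: fun_eq_iff M.a_ac)

text \<open>Writing \<open>c = c\<^sub>0 + \<hbar> c'\<close> and arguing by induction on the degree avoids exchanging double sums.\<close>

lemma ps_smult_assoc:
  assumes "\<And>n. c n \<in> carrier R" "\<And>n. d n \<in> carrier R" "\<And>n. F n \<in> carrier M"
  shows "((c \<otimes>\<^bsub>ps_ring R\<^esub> d) \<odot>\<^bsub>ps_mod M\<^esub> F) n = (c \<odot>\<^bsub>ps_mod M\<^esub> (d \<odot>\<^bsub>ps_mod M\<^esub> F)) n"
  using assms(1)
proof (induction n arbitrary: c)
  case 0
  then show ?case using assms by (simp add: ps_smult_def ps_mult_def smult_assoc1)
next
  case (Suc n)
  note cc = Suc.prems and dc = assms(2) and Fc = assms(3)
  let ?c' = "\<lambda>i. c (Suc i)" and ?d' = "\<lambda>i. d (Suc i)"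
  have mc: "(c \<otimes>\<^bsub>ps_ring R\<^esub> d) i \<in> carrier R" if "\<And>n. c n \<in> carrier R" for c i
    unfolding ps_mult_def by (rule R.finsum_closed) (simp add: Pi_iff that dc)
  have m0: "(c \<otimes>\<^bsub>ps_ring R\<^esub> d) 0 = c 0 \<otimes> d 0" using cc dc by (simp add: ps_mult_def)
  have mS: "(c \<otimes>\<^bsub>ps_ring R\<^esub> d) (Suc i) = (?c' \<otimes>\<^bsub>ps_ring R\<^esub> d) i \<oplus> c 0 \<otimes> d (Suc i)" for i
    unfolding ps_mult_def using cc dc by (subst R.finsum_Suc2) (auto simp: Pi_iff)
  have "((\<lambda>i. (c \<otimes>\<^bsub>ps_ring R\<^esub> d) (Suc i)) \<odot>\<^bsub>ps_mod M\<^esub> F) n =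
      ((?c' \<otimes>\<^bsub>ps_ring R\<^esub> d) \<odot>\<^bsub>ps_mod M\<^esub> F) n \<oplus>\<^bsub>M\<^esub> ((\<lambda>i. c 0 \<otimes> d (Suc i)) \<odot>\<^bsub>ps_mod M\<^esub> F) n"
    unfolding mS ps_smult_def using mc[of ?c'] cc dc Fc
    by (simp add: smult_l_distr M.finsum_addf Pi_iff)
  also have "((\<lambda>i. c 0 \<otimes> d (Suc i)) \<odot>\<^bsub>ps_mod M\<^esub> F) n = c 0 \<odot>\<^bsub>M\<^esub> (?d' \<odot>\<^bsub>ps_mod M\<^esub> F) n"
    unfolding ps_smult_def using cc dc Fc by (simp add: smult_assoc1 finsum_smult_ldistr Pi_iff)
  finally have 1: "((\<lambda>i. (c \<otimes>\<^bsub>ps_ring R\<^esub> d) (Suc i)) \<odot>\<^bsub>ps_mod M\<^esub> F) n =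
      (?c' \<odot>\<^bsub>ps_mod M\<^esub> (d \<odot>\<^bsub>ps_mod M\<^esub> F)) n \<oplus>\<^bsub>M\<^esub> c 0 \<odot>\<^bsub>M\<^esub> (?d' \<odot>\<^bsub>ps_mod M\<^esub> F) n"
    using Suc.IH[of ?c'] cc by simp
  have dF: "(d \<odot>\<^bsub>ps_mod M\<^esub> F) i \<in> carrier M" for i by (rule ps_smult_closed[OF dc Fc])
  show ?case
    unfolding ps_smult_Suc[OF mc[OF cc] Fc] ps_smult_Suc[OF cc dF] 1 m0 ps_smult_Suc[OF dc Fc, where n = n]
    using cc dc Fc ps_smult_closed[OF _ dF, where c = ?c' and n = n] ps_smult_closed[OF _ Fc, where c = ?d' and n = n]
    by (simp add: smult_r_distr smult_assoc1 M.a_assoc)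
qed

lemma ps_module:
  assumes "cring (ps_ring R)"
  shows "module (ps_ring R) (ps_mod M)"
proof (rule moduleI[OF assms ps_abelian])
  fix c F assume "c \<in> carrier (ps_ring R)" "F \<in> carrier (ps_mod M)"
  then have c: "\<And>n. c n \<in> carrier R" and F: "\<And>n. F n \<in> carrier M" by (auto simp: ps_simps)
  show "c \<odot>\<^bsub>ps_mod M\<^esub> F \<in> carrier (ps_mod M)"
    using ps_smult_closed[OF c F] by (simp add: ps_simps)
  fix d assume "d \<in> carrier (ps_ring R)"
  then have d: "\<And>n. d n \<in> carrier R" by (auto simp: ps_simps)
  show "(c \<oplus>\<^bsub>ps_ring R\<^esub> d) \<odot>\<^bsub>ps_mod M\<^esub> F = c \<odot>\<^bsub>ps_mod M\<^esub> F \<oplus>\<^bsub>ps_mod M\<^esub> d \<odot>\<^bsub>ps_mod M\<^esub> F"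
    unfolding ps_simps ps_smult_def using c d F by (simp add: smult_l_distr M.finsum_addf Pi_iff)
  show "(c \<otimes>\<^bsub>ps_ring R\<^esub> d) \<odot>\<^bsub>ps_mod M\<^esub> F = c \<odot>\<^bsub>ps_mod M\<^esub> (d \<odot>\<^bsub>ps_mod M\<^esub> F)"
    by (rule ext) (rule ps_smult_assoc[OF c d F])
next
  show "\<one>\<^bsub>ps_ring R\<^esub> \<odot>\<^bsub>ps_mod M\<^esub> F = F" if "F \<in> carrier (ps_mod M)" for F
    using that by (simp add: ps_simps ps_smult_const)
next
  fix c F G assume "c \<in> carrier (ps_ring R)" "F \<in> carrier (ps_mod M)" "G \<in> carrier (ps_mod M)"
  then show "c \<odot>\<^bsub>ps_mod M\<^esub> (F \<oplus>\<^bsub>ps_mod M\<^esub> G) = c \<odot>\<^bsub>ps_mod M\<^esub> F \<oplus>\<^bsub>ps_mod M\<^esub> c \<odot>\<^bsub>ps_mod M\<^esub> G"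
    unfolding ps_simps ps_smult_def by (simp add: smult_r_distr M.finsum_addf Pi_iff)
qed

lemma ps_const_closed: "f \<in> carrier M \<Longrightarrow> ps_const M f \<in> carrier (ps_mod M)"
  by (simp add: ps_simps ps_const_def)

lemma ps_split:
  assumes "F \<in> carrier (ps_mod M)"
  shows "F = ps_const M (F 0) \<oplus>\<^bsub>ps_mod M\<^esub> hbar R \<odot>\<^bsub>ps_mod M\<^esub> (\<lambda>n. F (Suc n))"
  using assms by (auto simp: ps_simps ps_smult_hbar ps_const_def fun_eq_iff split: nat.split)

lemma hbar_closed: "hbar R \<in> carrier (ps_ring R)"
  by (simp add: ps_simps hbar_def)

end

text \<open>A \<open>K[[\<hbar>]]\<close>-linear map commutes with multiplication by \<open>\<hbar>\<close> and is therefore continuous for the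
  \<open>\<hbar>\<close>-adic topology. Hence it is determined by its values on constant series.\<close>

lemma ps_hom_coeff:
  assumes M: "module K M" and N: "module K N"
    and h: "h \<in> mod_hom (ps_ring K) (ps_mod M) (ps_mod N)" and F: "F \<in> carrier (ps_mod M)"
  shows "h F n = (\<Oplus>\<^bsub>N\<^esub>a\<in>{..n}. h (ps_const M (F (n - a))) a)"
  using F
proof (induction n arbitrary: F)
  interpret M: module K M by (rule M)
  interpret N: module K N by (rule N)
  have split: "h F n = h (ps_const M (F 0)) n \<oplus>\<^bsub>N\<^esub> case_nat \<zero>\<^bsub>N\<^esub> (h (\<lambda>n. F (Suc n))) n"
    and tc: "(\<lambda>n. F (Suc n)) \<in> carrier (ps_mod M)"
    and hc: "\<And>a f. f \<in> carrier M \<Longrightarrow> h (ps_const M f) a \<in> carrier N"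
    if F: "F \<in> carrier (ps_mod M)" for F n
  proof -
    show t: "(\<lambda>n. F (Suc n)) \<in> carrier (ps_mod M)" using F by (simp add: ps_simps)
    have F0: "ps_const M (F 0) \<in> carrier (ps_mod M)" using F by (intro M.ps_const_closed) (simp add: ps_simps)
    have ht: "hbar K \<odot>\<^bsub>ps_mod M\<^esub> (\<lambda>n. F (Suc n)) \<in> carrier (ps_mod M)"
      using M.ps_smult_closed[of "hbar K" "\<lambda>n. F (Suc n)"] M.hbar_closed t by (simp add: ps_simps)
    have "h F = h (ps_const M (F 0)) \<oplus>\<^bsub>ps_mod N\<^esub> hbar K \<odot>\<^bsub>ps_mod N\<^esub> h (\<lambda>n. F (Suc n))"
      by (subst M.ps_split[OF F]) (simp add: mod_homD(2)[OF h F0 ht] mod_homD(3)[OF h M.hbar_closed t])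
    then show "h F n = h (ps_const M (F 0)) n \<oplus>\<^bsub>N\<^esub> case_nat \<zero>\<^bsub>N\<^esub> (h (\<lambda>n. F (Suc n))) n"
      using mod_homD(1)[OF h t] by (simp add: ps_simps N.ps_smult_hbar)
    show "h (ps_const M f) a \<in> carrier N" if "f \<in> carrier M" for a f
      using mod_homD(1)[OF h M.ps_const_closed[OF that]] by (simp add: ps_simps)
  qed
  {
    case 0
    then show ?case using split[OF 0, of 0] hc[OF 0] by (simp add: ps_simps)
  next
    case (Suc n)
    have "h F (Suc n) = h (ps_const M (F 0)) (Suc n) \<oplus>\<^bsub>N\<^esub> h (\<lambda>n. F (Suc n)) n"
      using split[OF Suc.prems, of "Suc n"] by simp
    also have "h (\<lambda>n. F (Suc n)) n = (\<Oplus>\<^bsub>N\<^esub>a\<in>{..n}. h (ps_const M (F (Suc (n - a)))) a)"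
      by (rule Suc.IH[OF tc[OF Suc.prems]])
    also have "\<dots> = (\<Oplus>\<^bsub>N\<^esub>a\<in>{..n}. h (ps_const M (F (Suc n - a))) a)"
      using hc[OF Suc.prems] Suc.prems by (intro N.finsum_cong') (auto simp: ps_simps Suc_diff_le)
    also have "h (ps_const M (F 0)) (Suc n) \<oplus>\<^bsub>N\<^esub> \<dots> = (\<Oplus>\<^bsub>N\<^esub>a\<in>{..Suc n}. h (ps_const M (F (Suc n - a))) a)"
      using hc[OF Suc.prems] Suc.prems by (subst N.finsum_Suc) (auto simp: ps_simps Pi_iff)
    finally show ?case .
  }
qed

lemma ps_hom_eqI:
  assumes "module K M" "module K N"
    and h: "h \<in> mod_hom (ps_ring K) (ps_mod M) (ps_mod N)" and k: "k \<in> mod_hom (ps_ring K) (ps_mod M) (ps_mod N)"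
    and eq: "\<And>f. f \<in> carrier M \<Longrightarrow> h (ps_const M f) = k (ps_const M f)"
    and F: "F \<in> carrier (ps_mod M)"
  shows "h F = k F"
proof
  fix n
  interpret M: module K M by fact
  interpret N: module K N by fact
  have Fc: "F i \<in> carrier M" for i using F by (simp add: ps_simps)
  have "h (ps_const M f) a \<in> carrier N" if "f \<in> carrier M" for a f
    using mod_homD(1)[OF h M.ps_const_closed[OF that]] by (simp add: ps_simps)
  then show "h F n = k F n"
    using eq Fc unfolding ps_hom_coeff[OF assms(1,2) h F] ps_hom_coeff[OF assms(1,2) k F] by simp
qed

text \<open>The \<open>n\<close>-th coefficient of \<open>h (c F)\<close> involves only \<open>c\<^sub>0, \<dots>, c\<^sub>n\<close>, which are reached by splitting off
  one power of \<open>\<hbar>\<close> at a time.\<close>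

lemma ps_linearI:
  assumes M: "module K M" and N: "module K N"
    and cl: "\<And>F. F \<in> carrier (ps_mod M) \<Longrightarrow> h F \<in> carrier (ps_mod N)"
    and add: "\<And>F G. F \<in> carrier (ps_mod M) \<Longrightarrow> G \<in> carrier (ps_mod M) \<Longrightarrow>
      h (F \<oplus>\<^bsub>ps_mod M\<^esub> G) = h F \<oplus>\<^bsub>ps_mod N\<^esub> h G"
    and const: "\<And>c F. c \<in> carrier K \<Longrightarrow> F \<in> carrier (ps_mod M) \<Longrightarrow>
      h (ps_const K c \<odot>\<^bsub>ps_mod M\<^esub> F) = ps_const K c \<odot>\<^bsub>ps_mod N\<^esub> h F"
    and hbar: "\<And>F. F \<in> carrier (ps_mod M) \<Longrightarrow> h (hbar K \<odot>\<^bsub>ps_mod M\<^esub> F) = hbar K \<odot>\<^bsub>ps_mod N\<^esub> h F"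
  shows "h \<in> mod_hom (ps_ring K) (ps_mod M) (ps_mod N)"
proof (rule mod_homI, erule cl, erule (1) add)
  interpret M: module K M by (rule M)
  interpret N: module K N by (rule N)
  fix c F assume c: "c \<in> carrier (ps_ring K)" and F: "F \<in> carrier (ps_mod M)"
  have hF: "\<And>n. h F n \<in> carrier N" using cl[OF F] by (simp add: ps_simps)
  have Fc: "\<And>n. F n \<in> carrier M" using F by (simp add: ps_simps)
  have eq: "h (c \<odot>\<^bsub>ps_mod M\<^esub> F) n =
      case_nat \<zero>\<^bsub>N\<^esub> (h ((\<lambda>n. c (Suc n)) \<odot>\<^bsub>ps_mod M\<^esub> F)) n \<oplus>\<^bsub>N\<^esub> c 0 \<odot>\<^bsub>N\<^esub> h F n"
    if cc: "\<And>n. c n \<in> carrier K" for c n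
  proof -
    let ?c' = "\<lambda>n. c (Suc n)"
    have c'F: "?c' \<odot>\<^bsub>ps_mod M\<^esub> F \<in> carrier (ps_mod M)"
      using M.ps_smult_closed[of ?c' F] cc Fc by (simp add: ps_simps)
    have c0F: "ps_const K (c 0) \<odot>\<^bsub>ps_mod M\<^esub> F \<in> carrier (ps_mod M)"
      using cc Fc by (simp add: M.ps_smult_const ps_simps)
    have hc'F: "hbar K \<odot>\<^bsub>ps_mod M\<^esub> (?c' \<odot>\<^bsub>ps_mod M\<^esub> F) \<in> carrier (ps_mod M)"
      using M.ps_smult_closed[of "hbar K"] M.hbar_closed c'F by (simp add: ps_simps)
    have "c \<odot>\<^bsub>ps_mod M\<^esub> F = hbar K \<odot>\<^bsub>ps_mod M\<^esub> (?c' \<odot>\<^bsub>ps_mod M\<^esub> F) \<oplus>\<^bsub>ps_mod M\<^esub> ps_const K (c 0) \<odot>\<^bsub>ps_mod M\<^esub> F"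
    proof
      fix n
      show "(c \<odot>\<^bsub>ps_mod M\<^esub> F) n = (hbar K \<odot>\<^bsub>ps_mod M\<^esub> (?c' \<odot>\<^bsub>ps_mod M\<^esub> F) \<oplus>\<^bsub>ps_mod M\<^esub> ps_const K (c 0) \<odot>\<^bsub>ps_mod M\<^esub> F) n"
        using c'F cc Fc M.ps_smult_Suc[OF cc Fc]
        by (cases n) (simp_all add: ps_simps M.ps_smult_hbar M.ps_smult_const M.ps_smult_0)
    qed
    then have "h (c \<odot>\<^bsub>ps_mod M\<^esub> F) = hbar K \<odot>\<^bsub>ps_mod N\<^esub> h (?c' \<odot>\<^bsub>ps_mod M\<^esub> F) \<oplus>\<^bsub>ps_mod N\<^esub> ps_const K (c 0) \<odot>\<^bsub>ps_mod N\<^esub> h F"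
      using add[OF hc'F c0F] const[OF cc F] hbar[OF c'F] by simp
    then show "h (c \<odot>\<^bsub>ps_mod M\<^esub> F) n = case_nat \<zero>\<^bsub>N\<^esub> (h (?c' \<odot>\<^bsub>ps_mod M\<^esub> F)) n \<oplus>\<^bsub>N\<^esub> c 0 \<odot>\<^bsub>N\<^esub> h F n"
      using cl[OF c'F] cc hF by (simp add: ps_simps N.ps_smult_hbar N.ps_smult_const)
  qed
  have "h (c \<odot>\<^bsub>ps_mod M\<^esub> F) n = (c \<odot>\<^bsub>ps_mod N\<^esub> h F) n" for n
    using c
  proof (induction n arbitrary: c)
    case 0
    then have "\<And>n. c n \<in> carrier K" by (simp add: ps_simps)
    then show ?case using eq[of c, where n = 0] hF by (simp add: N.ps_smult_0)
  next
    case (Suc n)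
    then have cc: "\<And>n. c n \<in> carrier K" by (simp add: ps_simps)
    then have "(\<lambda>n. c (Suc n)) \<in> carrier (ps_ring K)" by (simp add: ps_simps)
    then show ?case using eq[OF cc, where n = "Suc n"] Suc.IH[of "\<lambda>n. c (Suc n)"] N.ps_smult_Suc[OF cc hF] by simp
  qed
  then show "h (c \<odot>\<^bsub>ps_mod M\<^esub> F) = c \<odot>\<^bsub>ps_mod N\<^esub> h F" by blast
qed

subsection \<open>Linear maps with prescribed coefficients\<close>

text \<open>The \<open>K[[\<hbar>]]\<close>-linear extension of \<open>f \<mapsto> \<Sum>\<^sub>a R a f \<hbar>\<^sup>a\<close>.\<close>

definition ps_extend :: "('k, 's, 'e) module_scheme \<Rightarrow> (nat \<Rightarrow> 'r \<Rightarrow> 's) \<Rightarrow> (nat \<Rightarrow> 'r) \<Rightarrow> nat \<Rightarrow> 's" where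
  "ps_extend N R F = (\<lambda>n. \<Oplus>\<^bsub>N\<^esub>a\<in>{..n}. R a (F (n - a)))"

lemma ps_extend_mod_hom:
  assumes M: "module K M" and N: "module K N" and R: "\<And>a. R a \<in> mod_hom K M N"
  shows "ps_extend N R \<in> mod_hom (ps_ring K) (ps_mod M) (ps_mod N)"
proof (rule ps_linearI[OF M N])
  interpret M: module K M by (rule M)
  interpret N: module K N by (rule N)
  note RD = mod_homD[OF R]
  have R0: "R a \<zero>\<^bsub>M\<^esub> = \<zero>\<^bsub>N\<^esub>" for a
    using abelian_group_hom.hom_zero[OF mod_hom_abelian[OF R M N]] .
  have cl: "ps_extend N R F n \<in> carrier N" if "\<And>n. F n \<in> carrier M" for F n
    unfolding ps_extend_def by (rule N.finsum_closed) (simp add: that RD)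
  fix F assume "F \<in> carrier (ps_mod M)"
  then have F: "\<And>n. F n \<in> carrier M" by (simp add: ps_simps)
  show "ps_extend N R F \<in> carrier (ps_mod N)" using cl[OF F] by (simp add: ps_simps)
  show "ps_extend N R (ps_const K c \<odot>\<^bsub>ps_mod M\<^esub> F) = ps_const K c \<odot>\<^bsub>ps_mod N\<^esub> ps_extend N R F"
    if c: "c \<in> carrier K" for c
    unfolding M.ps_smult_const[OF c F] N.ps_smult_const[OF c cl[OF F]]
    using c F by (simp add: ps_extend_def RD N.finsum_smult_ldistr Pi_iff)
  show "ps_extend N R (hbar K \<odot>\<^bsub>ps_mod M\<^esub> F) = hbar K \<odot>\<^bsub>ps_mod N\<^esub> ps_extend N R F"
    unfolding M.ps_smult_hbar[OF F] N.ps_smult_hbar[OF cl[OF F]]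
  proof
    fix n
    show "ps_extend N R (case_nat \<zero>\<^bsub>M\<^esub> F) n = case_nat \<zero>\<^bsub>N\<^esub> (ps_extend N R F) n"
    proof (cases n)
      case 0
      then show ?thesis by (simp add: ps_extend_def R0)
    next
      case (Suc m)
      have c: "R a (case_nat \<zero>\<^bsub>M\<^esub> F i) \<in> carrier N" for a i
        using F by (auto simp: RD R0 split: nat.split)
      have "(\<Oplus>\<^bsub>N\<^esub>a\<in>{..m}. R a (case_nat \<zero>\<^bsub>M\<^esub> F (Suc m - a))) = (\<Oplus>\<^bsub>N\<^esub>a\<in>{..m}. R a (F (m - a)))"
        using F by (intro N.finsum_cong') (auto simp: RD Suc_diff_le)
      moreover have "(\<Oplus>\<^bsub>N\<^esub>a\<in>{..m}. R a (F (m - a))) \<in> carrier N"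
        using cl[OF F] by (simp add: ps_extend_def)
      ultimately show ?thesis
        unfolding ps_extend_def Suc using c by (subst N.finsum_Suc) (auto simp: Pi_iff R0)
    qed
  qed
  fix G assume "G \<in> carrier (ps_mod M)"
  then have G: "\<And>n. G n \<in> carrier M" by (simp add: ps_simps)
  show "ps_extend N R (F \<oplus>\<^bsub>ps_mod M\<^esub> G) = ps_extend N R F \<oplus>\<^bsub>ps_mod N\<^esub> ps_extend N R G"
    using F G by (simp add: ps_simps ps_extend_def RD N.finsum_addf Pi_iff)
qed

lemma ps_extend_const:
  assumes M: "module K M" and N: "module K N" and R: "\<And>a. R a \<in> mod_hom K M N" and f: "f \<in> carrier M"
  shows "ps_extend N R (ps_const M f) = (\<lambda>n. R n f)"
proof
  fix n
  interpret M: module K M by (rule M)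
  interpret N: module K N by (rule N)
  note RD = mod_homD[OF R]
  have R0: "R a \<zero>\<^bsub>M\<^esub> = \<zero>\<^bsub>N\<^esub>" for a
    using abelian_group_hom.hom_zero[OF mod_hom_abelian[OF R M N]] .
  show "ps_extend N R (ps_const M f) n = R n f"
  proof (cases n)
    case 0
    then show ?thesis using f by (simp add: ps_extend_def ps_const_def RD)
  next
    case (Suc m)
    have c: "R a (ps_const M f i) \<in> carrier N" for a i using f by (simp add: ps_const_def RD)
    have "(\<Oplus>\<^bsub>N\<^esub>a\<in>{..m}. R a (ps_const M f (Suc m - a))) = (\<Oplus>\<^bsub>N\<^esub>a\<in>{..m}. \<zero>\<^bsub>N\<^esub>)"
      by (intro N.finsum_cong') (auto simp: ps_const_def R0)
    then show ?thesis
      unfolding ps_extend_def Suc using c f by (subst N.finsum_Suc) (auto simp: Pi_iff ps_const_def RD)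
  qed
qed

text \<open>As \<open>h\<close> is the identity modulo \<open>\<hbar>\<close>, the equation \<open>h F = G\<close> has the form \<open>F n = G n -\<close> (terms in
  \<open>F 0, \<dots>, F (n - 1)\<close>) and can be solved degree by degree.\<close>

lemma ps_hom_bij:
  fixes M :: "('k, 'r, 'd) module_scheme"
  assumes M: "module K M" and h: "h \<in> mod_hom (ps_ring K) (ps_mod M) (ps_mod M)"
    and h0: "\<And>f. f \<in> carrier M \<Longrightarrow> h (ps_const M f) 0 = f"
  shows "bij_betw h (carrier (ps_mod M)) (carrier (ps_mod M))"
proof -
  interpret M: module K M by (rule M)
  define L where "L F n = (\<Oplus>\<^bsub>M\<^esub>a\<in>{..n}. h (ps_const M (F (n - a))) (Suc a))" for F n
  have hc: "h (ps_const M f) a \<in> carrier M" if "f \<in> carrier M" for a f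
    using mod_homD(1)[OF h M.ps_const_closed[OF that]] by (simp add: ps_simps)
  have Lc: "L F n \<in> carrier M" if "\<And>i. i \<le> n \<Longrightarrow> F i \<in> carrier M" for F and n :: nat
    unfolding L_def by (rule M.finsum_closed) (simp add: Pi_iff hc that)
  have hF: "h F 0 = F 0" "h F (Suc n) = L F n \<oplus>\<^bsub>M\<^esub> F (Suc n)" if "F \<in> carrier (ps_mod M)" for F n
  proof -
    have F: "\<And>i. F i \<in> carrier M" using that by (simp add: ps_simps)
    show "h F 0 = F 0" using ps_hom_coeff[OF M M h that, of 0] F hc by (simp add: h0)
    show "h F (Suc n) = L F n \<oplus>\<^bsub>M\<^esub> F (Suc n)"
      unfolding ps_hom_coeff[OF M M h that] L_def using F hc
      by (subst M.finsum_Suc2) (auto simp: Pi_iff h0)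
  qed
  have Lcong: "L F n = L G n" if "\<And>i. i \<le> n \<Longrightarrow> F i = G i" "\<And>i. i \<le> n \<Longrightarrow> G i \<in> carrier M" for F G and n :: nat
    unfolding L_def by (rule M.finsum_cong') (auto simp: that hc)
  show ?thesis
    unfolding bij_betw_def
  proof (intro conjI inj_onI subset_antisym subsetI)
    fix F G assume F: "F \<in> carrier (ps_mod M)" and G: "G \<in> carrier (ps_mod M)" and eq: "h F = h G"
    have "F n = G n" for n
    proof (induction n rule: less_induct)
      case (less n)
      show ?case
      proof (cases n)
        case 0
        then show ?thesis using hF(1)[OF F] hF(1)[OF G] eq by simp
      next
        case (Suc m)
        have Gc: "\<And>i. G i \<in> carrier M" and Fc: "\<And>i. F i \<in> carrier M" using F G by (simp_all add: ps_simps)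
        have "L F m = L G m" using less Suc Gc by (intro Lcong) auto
        then have "L G m \<oplus>\<^bsub>M\<^esub> F (Suc m) = L G m \<oplus>\<^bsub>M\<^esub> G (Suc m)"
          using hF(2)[OF F, of m] hF(2)[OF G, of m] eq by simp
        then show ?thesis using Lc[of m G] Gc Fc Suc by simp
      qed
    qed
    then show "F = G" by blast
  next
    fix G assume "G \<in> h ` carrier (ps_mod M)"
    then show "G \<in> carrier (ps_mod M)" using mod_homD(1)[OF h] by blast
  next
    fix G assume "G \<in> carrier (ps_mod M)"
    then have G: "\<And>i. G i \<in> carrier M" by (simp add: ps_simps)
    let ?P = "\<lambda>F n r. r \<in> carrier M \<and> G n = (case n of 0 \<Rightarrow> r | Suc m \<Rightarrow> L F m \<oplus>\<^bsub>M\<^esub> r)"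
    have "\<exists>F. \<forall>n. ?P F n (F n)"
    proof (rule dependent_wellorder_choice)
      fix r and F H :: "nat \<Rightarrow> 'r" and n :: nat
      assume "\<And>m. m < n \<Longrightarrow> F m = H m"
      then have "L F m = L H m" if "n = Suc m" for m
        using that unfolding L_def by (simp add: less_Suc_eq_le)
      then show "?P F n r = ?P H n r" by (cases n) auto
    next
      fix n :: nat and F :: "nat \<Rightarrow> 'r"
      assume a: "\<And>m. m < n \<Longrightarrow> ?P F m (F m)"
      show "\<exists>r. ?P F n r"
      proof (cases n)
        case 0
        then show ?thesis using G by auto
      next
        case (Suc m)
        have "L F m \<in> carrier M" using a Suc by (intro Lc) auto
        then show ?thesis
          using G[of n] Suc by (intro exI[of _ "\<ominus>\<^bsub>M\<^esub> L F m \<oplus>\<^bsub>M\<^esub> G n"])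
            (simp add: M.a_assoc[symmetric] M.r_neg)
      qed
    qed
    then obtain F where F: "\<And>n. ?P F n (F n)" by blast
    have Fc: "F \<in> carrier (ps_mod M)" using F by (simp add: ps_simps)
    have "h F n = G n" for n
      using hF[OF Fc] F[of n] by (cases n) auto
    then have "h F = G" by blast
    then show "G \<in> h ` carrier (ps_mod M)" using Fc by blast
  qed
qed

subsection \<open>Sheaves of power series\<close>

lemma ps_module_sheaf:
  assumes F: "module_sheaf K T F" and K: "cring (ps_ring K)"
  shows "module_sheaf (ps_ring K) T (ps_sheaf F)"
proof -
  have mp: "module_presheaf K T F" and sa: "sheaf_axiom T F" using F by (auto simp: module_sheaf_def)
  interpret F: abelian_presheaf T F by (rule module_presheaf_abelian[OF mp])
  have mod: "module K (sec F U)" if "openin T U" for U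
    using mp that by (simp add: module_presheaf_def)
  have "module_presheaf (ps_ring K) T (ps_sheaf F)"
    unfolding module_presheaf_def ps_sheaf_simps(1)
  proof (intro conjI allI impI ballI)
    show "module (ps_ring K) (ps_mod (sec F U))" if "openin T U" for U
      by (rule module.ps_module[OF mod[OF that] K])
    show "res (ps_sheaf F) U V \<in> mod_hom (ps_ring K) (ps_mod (sec F U)) (ps_mod (sec F V))"
      if UV: "openin T U \<and> openin T V \<and> V \<subseteq> U" for U V
    proof -
      have U: "openin T U" and V: "openin T V" "V \<subseteq> U" using UV by auto
      interpret U: module K "sec F U" by (rule mod[OF U])
      interpret V: module K "sec F V" by (rule mod[OF V(1)])
      have r: "res F U V \<in> mod_hom K (sec F U) (sec F V)"
        using mp U V by (simp add: module_presheaf_def)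
      have sm: "(\<lambda>n. res F U V ((c \<odot>\<^bsub>ps_mod (sec F U)\<^esub> s) n)) = c \<odot>\<^bsub>ps_mod (sec F V)\<^esub> (\<lambda>n. res F U V (s n))"
        if c: "\<And>n. c n \<in> carrier K" and s: "\<And>n. s n \<in> carrier (sec F U)" for c s
      proof
        fix n
        have "res F U V (\<Oplus>\<^bsub>sec F U\<^esub>i\<in>{..n}. c i \<odot>\<^bsub>sec F U\<^esub> s (n - i)) =
            (\<Oplus>\<^bsub>sec F V\<^esub>i\<in>{..n}. res F U V (c i \<odot>\<^bsub>sec F U\<^esub> s (n - i)))"
          by (rule abelian_group_hom.hom_finsum_le[OF F.res_hom[OF U V]]) (simp add: c s)
        then show "res F U V ((c \<odot>\<^bsub>ps_mod (sec F U)\<^esub> s) n) = (c \<odot>\<^bsub>ps_mod (sec F V)\<^esub> (\<lambda>n. res F U V (s n))) n"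
          unfolding ps_smult_def using c s by (simp add: mod_homD(3)[OF r])
      qed
      show ?thesis
        by (rule mod_homI; unfold ps_sheaf_simps)
           (use U V in \<open>auto simp: ps_simps sm F.res_closed F.res_add\<close>)
    qed
    show "res (ps_sheaf F) U U s = s" if "openin T U" "s \<in> carrier (ps_mod (sec F U))" for U s
      using that by (simp add: ps_simps ps_sheaf_simps F.res_id)
    show "res (ps_sheaf F) V W (res (ps_sheaf F) U V s) = res (ps_sheaf F) U W s"
      if "openin T U \<and> openin T V \<and> openin T W \<and> W \<subseteq> V \<and> V \<subseteq> U" "s \<in> carrier (ps_mod (sec F U))" for U V W s
      using that by (simp add: ps_simps ps_sheaf_simps F.res_res)
  qed
  moreover have "sheaf_axiom T (ps_sheaf F)"
    unfolding sheaf_axiom_def ps_sheaf_simps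
  proof (intro allI impI)
    fix \<V> s
    assume a: "(\<forall>V\<in>\<V>. openin T V \<and> s V \<in> carrier (ps_mod (sec F V))) \<and>
      (\<forall>V\<in>\<V>. \<forall>W\<in>\<V>. (\<lambda>n. res F V (V \<inter> W) (s V n)) = (\<lambda>n. res F W (V \<inter> W) (s W n)))"
    have "\<exists>!t. t \<in> carrier (sec F (\<Union>\<V>)) \<and> (\<forall>V\<in>\<V>. res F (\<Union>\<V>) V t = s V n)" for n
    proof (rule sa[unfolded sheaf_axiom_def, rule_format, of \<V> "\<lambda>V. s V n"], intro conjI ballI)
      show "openin T V" "s V n \<in> carrier (sec F V)" if "V \<in> \<V>" for V
        using a that by (auto simp: ps_simps)
      fix V W assume "V \<in> \<V>" "W \<in> \<V>"
      then have "(\<lambda>n. res F V (V \<inter> W) (s V n)) = (\<lambda>n. res F W (V \<inter> W) (s W n))" using a by blast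
      then show "res F V (V \<inter> W) (s V n) = res F W (V \<inter> W) (s W n)" by (rule fun_cong)
    qed
    then obtain t where t: "\<And>n. t n \<in> carrier (sec F (\<Union>\<V>)) \<and> (\<forall>V\<in>\<V>. res F (\<Union>\<V>) V (t n) = s V n)"
      and u: "\<And>n u. u \<in> carrier (sec F (\<Union>\<V>)) \<Longrightarrow> (\<forall>V\<in>\<V>. res F (\<Union>\<V>) V u = s V n) \<Longrightarrow> u = t n"
      by metis
    show "\<exists>!t. t \<in> carrier (ps_mod (sec F (\<Union>\<V>))) \<and> (\<forall>V\<in>\<V>. (\<lambda>n. res F (\<Union>\<V>) V (t n)) = s V)"
    proof (rule ex1I[of _ t])
      show "t \<in> carrier (ps_mod (sec F (\<Union>\<V>))) \<and> (\<forall>V\<in>\<V>. (\<lambda>n. res F (\<Union>\<V>) V (t n)) = s V)"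
        using t by (simp add: ps_simps)
      fix t' assume t': "t' \<in> carrier (ps_mod (sec F (\<Union>\<V>))) \<and> (\<forall>V\<in>\<V>. (\<lambda>n. res F (\<Union>\<V>) V (t' n)) = s V)"
      show "t' = t"
      proof
        fix n
        show "t' n = t n" by (rule u) (use t' in \<open>auto simp: ps_simps fun_eq_iff\<close>)
      qed
    qed
  qed
  ultimately show ?thesis by (simp add: module_sheaf_def)
qed

lemma ps_extend_sheaf_hom:
  assumes F: "module_presheaf K T F" and G: "module_presheaf K T G"
    and R: "\<And>a. sheaf_hom K T F G (R a)"
  shows "sheaf_hom (ps_ring K) T (ps_sheaf F) (ps_sheaf G) (\<lambda>V. ps_extend (sec G V) (\<lambda>a. R a V))"
  unfolding sheaf_hom_def ps_sheaf_simps
proof (intro conjI allI impI ballI)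
  interpret G: abelian_presheaf T G by (rule module_presheaf_abelian[OF G])
  fix U assume U: "openin T U"
  have M: "module K (sec F U)" "module K (sec G U)" using F G U by (simp_all add: module_presheaf_def)
  show "ps_extend (sec G U) (\<lambda>a. R a U) \<in> mod_hom (ps_ring K) (ps_mod (sec F U)) (ps_mod (sec G U))"
    by (rule ps_extend_mod_hom[OF M sheaf_homD(1)[OF R U]])
next
  interpret G: abelian_presheaf T G by (rule module_presheaf_abelian[OF G])
  fix U V s assume a: "openin T U \<and> openin T V \<and> V \<subseteq> U" and "s \<in> carrier (ps_mod (sec F U))"
  then have s: "\<And>n. s n \<in> carrier (sec F U)" by (simp add: ps_simps)
  have U: "openin T U" and V: "openin T V" "V \<subseteq> U" using a by auto
  show "ps_extend (sec G V) (\<lambda>a. R a V) (\<lambda>n. res F U V (s n)) =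
      (\<lambda>n. res G U V (ps_extend (sec G U) (\<lambda>a. R a U) s n))"
  proof
    fix n
    have "res G U V (\<Oplus>\<^bsub>sec G U\<^esub>a\<in>{..n}. R a U (s (n - a))) = (\<Oplus>\<^bsub>sec G V\<^esub>a\<in>{..n}. res G U V (R a U (s (n - a))))"
      by (rule abelian_group_hom.hom_finsum_le[OF G.res_hom[OF U V]]) (simp add: s sheaf_homD(2)[OF R U])
    then show "ps_extend (sec G V) (\<lambda>a. R a V) (\<lambda>n. res F U V (s n)) n =
        res G U V (ps_extend (sec G U) (\<lambda>a. R a U) s n)"
      unfolding ps_extend_def by (simp add: sheaf_homD(5)[OF R U V s])
  qed
qed

section \<open>Gauge equivalences and star products\<close>

lemma sheaf_iso_hom: "sheaf_iso R T F G h \<Longrightarrow> sheaf_hom R T F G h"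
  by (simp add: sheaf_iso_def)

lemma sheaf_iso_bij: "sheaf_iso R T F G h \<Longrightarrow> openin T V \<Longrightarrow> bij_betw (h V) (carrier (sec F V)) (carrier (sec G V))"
  by (simp add: sheaf_iso_def)

lemma sheaf_iso_inverse:
  assumes F: "module_presheaf R T F" and G: "module_presheaf R T G" and h: "sheaf_iso R T F G h"
    and k: "\<And>V t. openin T V \<Longrightarrow> t \<in> carrier (sec G V) \<Longrightarrow> k V t \<in> carrier (sec F V) \<and> h V (k V t) = t"
  shows "sheaf_iso R T G F k"
proof -
  interpret F: abelian_presheaf T F by (rule module_presheaf_abelian[OF F])
  interpret G: abelian_presheaf T G by (rule module_presheaf_abelian[OF G])
  note hD = sheaf_homD[OF sheaf_iso_hom[OF h]] and b = sheaf_iso_bij[OF h]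
  have inj: "s = t" if "openin T V" "s \<in> carrier (sec F V)" "t \<in> carrier (sec F V)" "h V s = h V t" for V s t
    using b[OF that(1)] that(2-4) by (simp add: bij_betw_def inj_on_def)
  have smF: "a \<odot>\<^bsub>sec F V\<^esub> s \<in> carrier (sec F V)"
    if "openin T V" "a \<in> carrier R" "s \<in> carrier (sec F V)" for V a s
    using F that unfolding module_presheaf_def by (meson module.smult_closed)
  have smG: "a \<odot>\<^bsub>sec G V\<^esub> s \<in> carrier (sec G V)"
    if "openin T V" "a \<in> carrier R" "s \<in> carrier (sec G V)" for V a s
    using G that unfolding module_presheaf_def by (meson module.smult_closed)
  show ?thesis
    unfolding sheaf_iso_def sheaf_hom_def
  proof (intro conjI allI impI ballI)
    fix V assume V: "openin T V"
    note kc = conjunct1[OF k[OF V]] and hk = conjunct2[OF k[OF V]]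
    show "k V \<in> mod_hom R (sec G V) (sec F V)"
    proof (rule mod_homI[OF kc])
      show "k V (s \<oplus>\<^bsub>sec G V\<^esub> t) = k V s \<oplus>\<^bsub>sec F V\<^esub> k V t"
        if "s \<in> carrier (sec G V)" "t \<in> carrier (sec G V)" for s t
        using that by (intro inj[OF V]) (simp_all add: kc hk hD(3)[OF V] F.add_closed[OF V] G.add_closed[OF V])
      show "k V (a \<odot>\<^bsub>sec G V\<^esub> t) = a \<odot>\<^bsub>sec F V\<^esub> k V t"
        if "a \<in> carrier R" "t \<in> carrier (sec G V)" for a t
        using that by (intro inj[OF V]) (simp_all add: kc hk hD(4)[OF V] smF[OF V] smG[OF V])
    qed
    have "bij_betw (k V) (carrier (sec G V)) (carrier (sec F V))"
    proof (rule bij_betw_byWitness[where f' = "h V"])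
      show "\<forall>s\<in>carrier (sec F V). k V (h V s) = s"
        using inj[OF V] kc hk hD(2)[OF V] by blast
    qed (use kc hk hD(2)[OF V] in blast)+
    then show "bij_betw (k V) (carrier (sec G V)) (carrier (sec F V))" .
  next
    fix V W t assume "openin T V \<and> openin T W \<and> W \<subseteq> V" and t: "t \<in> carrier (sec G V)"
    then have V: "openin T V" and W: "openin T W" "W \<subseteq> V" by auto
    note kV = k[OF V t] and kW = k[OF W(1) G.res_closed[OF V W t]]
    show "k W (res G V W t) = res F V W (k V t)"
    proof (rule inj[OF W(1)])
      show "h W (k W (res G V W t)) = h W (res F V W (k V t))"
        using kV kW by (simp add: hD(5)[OF V W])
    qed (use kV kW V W in \<open>simp_all add: F.res_closed\<close>)
  qed
qed

context ringed_space
begin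

lemma ps_presheaf_OX:
  "cring (ps_ring K) \<Longrightarrow> module_presheaf (ps_ring K) T (ps_sheaf OX)"
  using ps_module_sheaf[OF module_sheaf] by (simp add: module_sheaf_def)

lemma ps_const_in: "openin T V \<Longrightarrow> f \<in> carrier (sec OX V) \<Longrightarrow> ps_const (sec OX V) f \<in> carrier (ps_mod (sec OX V))"
  using module.ps_const_closed[OF module] .

lemma ps_const_one: "\<one>\<^bsub>sec (ps_sheaf OX) V\<^esub> = ps_const (sec OX V) \<one>\<^bsub>sec OX V\<^esub>"
  by (simp add: ps_sheaf_simps ps_simps)

lemma ps_const_res:
  assumes "openin T U" "openin T V" "V \<subseteq> U"
  shows "res (ps_sheaf OX) U V (ps_const (sec OX U) f) = ps_const (sec OX V) (res OX U V f)"
  using res_zero[OF assms] by (auto simp: ps_sheaf_simps ps_const_def)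

lemma gauge_mod_hom:
  assumes "gauge_equivalence K T OX \<gamma>" "openin T V"
  shows "\<gamma> V \<in> mod_hom (ps_ring K) (ps_mod (sec OX V)) (ps_mod (sec OX V))"
proof -
  have "sheaf_iso (ps_ring K) T (ps_sheaf OX) (ps_sheaf OX) \<gamma>"
    using assms(1) by (simp add: gauge_equivalence_def)
  from sheaf_homD(1)[OF sheaf_iso_hom[OF this] assms(2)] show ?thesis by (simp add: ps_sheaf_simps)
qed

lemma gauge_coeff_0:
  assumes "gauge_equivalence K T OX \<gamma>" "openin T V" "f \<in> carrier (sec OX V)"
  shows "\<gamma> V (ps_const (sec OX V) f) 0 = f"
  using assms unfolding gauge_equivalence_def by auto

lemma gauge_coeff_diff_op:
  assumes "gauge_equivalence K T OX \<gamma>"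
  shows "diff_op K T OX (\<lambda>V f. \<gamma> V (ps_const (sec OX V) f) k)"
proof (cases "k = 0")
  case True
  then show ?thesis using gauge_coeff_0[OF assms] by (intro diff_op_cong[OF diff_op_id]) simp
next
  case False
  obtain \<gamma>' where \<gamma>': "\<And>k. k \<ge> 1 \<Longrightarrow> diff_op K T OX (\<gamma>' k)"
    "\<And>V f. openin T V \<Longrightarrow> f \<in> carrier (sec OX V) \<Longrightarrow>
      \<gamma> V (ps_const (sec OX V) f) = (\<lambda>k. if k = 0 then f else \<gamma>' k V f)"
    using assms unfolding gauge_equivalence_def by blast
  show ?thesis
    by (rule diff_op_cong[OF \<gamma>'(1)[of k]]) (use False \<gamma>'(2) in auto)
qed

lemma gauge_equivalenceI:
  assumes iso: "sheaf_iso (ps_ring K) T (ps_sheaf OX) (ps_sheaf OX) \<gamma>"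
    and one: "\<And>V. openin T V \<Longrightarrow> \<gamma> V \<one>\<^bsub>sec (ps_sheaf OX) V\<^esub> = \<one>\<^bsub>sec (ps_sheaf OX) V\<^esub>"
    and zero: "\<And>V f. openin T V \<Longrightarrow> f \<in> carrier (sec OX V) \<Longrightarrow> \<gamma> V (ps_const (sec OX V) f) 0 = f"
    and diff: "\<And>k. diff_op K T OX (\<lambda>V f. \<gamma> V (ps_const (sec OX V) f) k)"
  shows "gauge_equivalence K T OX \<gamma>"
  unfolding gauge_equivalence_def
proof (intro conjI allI impI iso one exI[of _ "\<lambda>k V f. \<gamma> V (ps_const (sec OX V) f) k"] diff)
  show "\<gamma> V (ps_const (sec OX V) f) = (\<lambda>k. if k = 0 then f else \<gamma> V (ps_const (sec OX V) f) k)"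
    if "openin T V \<and> f \<in> carrier (sec OX V)" for V f
    using zero that by (auto simp: fun_eq_iff)
qed

lemma gauge_id: "gauge_equivalence K T OX (\<lambda>V F. F)"
proof (rule gauge_equivalenceI)
  show "sheaf_iso (ps_ring K) T (ps_sheaf OX) (ps_sheaf OX) (\<lambda>V F. F)"
    by (simp add: sheaf_iso_def sheaf_hom_def mod_hom_def bij_betw_def)
  show "diff_op K T OX (\<lambda>V f. ps_const (sec OX V) f k)" for k
  proof (cases k)
    case 0
    then show ?thesis using diff_op_id by (simp add: ps_const_def)
  next
    case (Suc m)
    then show ?thesis using diff_op_zero by (simp add: ps_const_def)
  qed
qed (simp_all add: ps_const_def)

lemma gauge_cong:
  assumes K: "cring (ps_ring K)" and \<gamma>: "gauge_equivalence K T OX \<gamma>"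
    and eq: "\<And>V F. openin T V \<Longrightarrow> F \<in> carrier (ps_mod (sec OX V)) \<Longrightarrow> \<gamma>' V F = \<gamma> V F"
  shows "gauge_equivalence K T OX \<gamma>'"
proof (rule gauge_equivalenceI)
  have iso: "sheaf_iso (ps_ring K) T (ps_sheaf OX) (ps_sheaf OX) \<gamma>"
    using \<gamma> by (simp add: gauge_equivalence_def)
  have "bij_betw (\<gamma>' V) (carrier (sec (ps_sheaf OX) V)) (carrier (sec (ps_sheaf OX) V))" if V: "openin T V" for V
    using sheaf_iso_bij[OF iso V] eq[OF V] by (subst bij_betw_cong[of _ "\<gamma>' V" "\<gamma> V"]) (auto simp: ps_sheaf_simps)
  then show "sheaf_iso (ps_ring K) T (ps_sheaf OX) (ps_sheaf OX) \<gamma>'"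
    using sheaf_hom_cong[OF sheaf_iso_hom[OF iso] ps_presheaf_OX[OF K], of \<gamma>'] eq
    unfolding sheaf_iso_def by (simp add: ps_sheaf_simps)
  show "\<gamma>' V \<one>\<^bsub>sec (ps_sheaf OX) V\<^esub> = \<one>\<^bsub>sec (ps_sheaf OX) V\<^esub>" if V: "openin T V" for V
    using \<gamma> V eq[OF V ps_const_in[OF V one_closed[OF V]]] unfolding gauge_equivalence_def ps_const_one by simp
  show "\<gamma>' V (ps_const (sec OX V) f) 0 = f" if "openin T V" "f \<in> carrier (sec OX V)" for V f
    using gauge_coeff_0[OF \<gamma> that] eq[OF that(1) ps_const_in[OF that]] by simp
  show "diff_op K T OX (\<lambda>V f. \<gamma>' V (ps_const (sec OX V) f) k)" for k
    by (rule diff_op_cong[OF gauge_coeff_diff_op[OF \<gamma>]]) (simp add: eq ps_const_in)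
qed

lemma gauge_extend:
  assumes R: "\<And>k. diff_op K T OX (R k)"
    and R0: "\<And>V f. openin T V \<Longrightarrow> f \<in> carrier (sec OX V) \<Longrightarrow> R 0 V f = f"
    and R1: "\<And>k V. k \<ge> 1 \<Longrightarrow> openin T V \<Longrightarrow> R k V \<one>\<^bsub>sec OX V\<^esub> = \<zero>\<^bsub>sec OX V\<^esub>"
  shows "gauge_equivalence K T OX (\<lambda>V. ps_extend (sec OX V) (\<lambda>k. R k V))"
proof (rule gauge_equivalenceI)
  note Rh = diff_op_sheaf_hom[OF R]
  have const: "ps_extend (sec OX V) (\<lambda>k. R k V) (ps_const (sec OX V) f) = (\<lambda>k. R k V f)"
    if "openin T V" "f \<in> carrier (sec OX V)" for V f
    by (rule ps_extend_const[OF module[OF that(1)] module[OF that(1)] sheaf_homD(1)[OF Rh that(1)] that(2)])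
  show "sheaf_iso (ps_ring K) T (ps_sheaf OX) (ps_sheaf OX) (\<lambda>V. ps_extend (sec OX V) (\<lambda>k. R k V))"
    unfolding sheaf_iso_def
  proof (intro conjI allI impI ps_extend_sheaf_hom module_presheaf Rh)
    fix V assume V: "openin T V"
    show "bij_betw (ps_extend (sec OX V) (\<lambda>k. R k V)) (carrier (sec (ps_sheaf OX) V)) (carrier (sec (ps_sheaf OX) V))"
      unfolding ps_sheaf_simps
      by (rule ps_hom_bij[OF module[OF V] ps_extend_mod_hom[OF module[OF V] module[OF V] sheaf_homD(1)[OF Rh V]]])
         (simp add: const[OF V] R0[OF V])
  qed
  show "ps_extend (sec OX V) (\<lambda>k. R k V) \<one>\<^bsub>sec (ps_sheaf OX) V\<^esub> = \<one>\<^bsub>sec (ps_sheaf OX) V\<^esub>"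
    if V: "openin T V" for V
    unfolding ps_const_one const[OF V one_closed[OF V]]
    using R0[OF V one_closed[OF V]] R1[OF _ V] by (auto simp: ps_const_def fun_eq_iff)
  show "ps_extend (sec OX V) (\<lambda>k. R k V) (ps_const (sec OX V) f) 0 = f"
    if "openin T V" "f \<in> carrier (sec OX V)" for V f
    using const[OF that] R0[OF that] by simp
  show "diff_op K T OX (\<lambda>V f. ps_extend (sec OX V) (\<lambda>k. R k V) (ps_const (sec OX V) f) k)" for k
    by (rule diff_op_cong[OF R[of k]]) (simp add: const)
qed

text \<open>The top coefficient of \<open>F\<close> enters through \<open>\<gamma>\<^sub>0 = id\<close> and can thus be solved for. The recursions
  for inverses and for transported products rest on this.\<close>

lemma gauge_coeff_Suc:
  assumes \<gamma>: "gauge_equivalence K T OX \<gamma>" and V: "openin T V" and F: "F \<in> carrier (ps_mod (sec OX V))"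
  shows "\<gamma> V F (Suc n) = (\<Oplus>\<^bsub>sec OX V\<^esub>a\<in>{..n}. \<gamma> V (ps_const (sec OX V) (F (n - a))) (Suc a)) \<oplus>\<^bsub>sec OX V\<^esub> F (Suc n)"
proof -
  interpret cring "sec OX V" by (rule cring[OF V])
  have Fc: "F i \<in> carrier (sec OX V)" for i using F by (simp add: ps_simps)
  have c: "\<gamma> V (ps_const (sec OX V) f) a \<in> carrier (sec OX V)" if "f \<in> carrier (sec OX V)" for f a
    using mod_homD(1)[OF gauge_mod_hom[OF \<gamma> V] ps_const_in[OF V that]] by (simp add: ps_simps)
  show ?thesis
    unfolding ps_hom_coeff[OF module[OF V] module[OF V] gauge_mod_hom[OF \<gamma> V] F]
    using Fc c by (subst finsum_Suc2) (auto simp: Pi_iff gauge_coeff_0[OF \<gamma> V])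
qed

lemma gauge_at_0:
  assumes \<gamma>: "gauge_equivalence K T OX \<gamma>" and V: "openin T V" and F: "F \<in> carrier (ps_mod (sec OX V))"
  shows "\<gamma> V F 0 = F 0"
proof -
  interpret cring "sec OX V" by (rule cring[OF V])
  show ?thesis
    unfolding ps_hom_coeff[OF module[OF V] module[OF V] gauge_mod_hom[OF \<gamma> V] F]
    using F by (simp add: ps_simps gauge_coeff_0[OF \<gamma> V])
qed

text \<open>The coefficients of \<open>\<eta> f\<close> satisfy a recursion that involves only the coefficients of \<open>\<gamma>\<close>, because
  \<open>\<gamma> (\<eta> f) = f\<close> has vanishing coefficients in positive degrees.\<close>

lemma gauge_inverse:
  assumes K: "cring (ps_ring K)" and \<gamma>: "gauge_equivalence K T OX \<gamma>"
    and \<eta>: "\<And>V F. openin T V \<Longrightarrow> F \<in> carrier (ps_mod (sec OX V)) \<Longrightarrow>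
      \<eta> V F \<in> carrier (ps_mod (sec OX V)) \<and> \<gamma> V (\<eta> V F) = F"
  shows "gauge_equivalence K T OX \<eta>"
proof (rule gauge_equivalenceI)
  have iso: "sheaf_iso (ps_ring K) T (ps_sheaf OX) (ps_sheaf OX) \<gamma>"
    using \<gamma> by (simp add: gauge_equivalence_def)
  show "sheaf_iso (ps_ring K) T (ps_sheaf OX) (ps_sheaf OX) \<eta>"
    by (rule sheaf_iso_inverse[OF ps_presheaf_OX[OF K] ps_presheaf_OX[OF K] iso]) (use \<eta> in \<open>simp add: ps_sheaf_simps\<close>)
  note \<eta>c = conjunct1[OF \<eta>] and \<gamma>\<eta> = conjunct2[OF \<eta>]
  show "\<eta> V \<one>\<^bsub>sec (ps_sheaf OX) V\<^esub> = \<one>\<^bsub>sec (ps_sheaf OX) V\<^esub>" if V: "openin T V" for V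
  proof -
    have 1: "\<one>\<^bsub>sec (ps_sheaf OX) V\<^esub> \<in> carrier (ps_mod (sec OX V))"
      unfolding ps_const_one by (rule ps_const_in[OF V one_closed[OF V]])
    have "\<gamma> V (\<eta> V \<one>\<^bsub>sec (ps_sheaf OX) V\<^esub>) = \<gamma> V \<one>\<^bsub>sec (ps_sheaf OX) V\<^esub>"
      using \<gamma>\<eta>[OF V 1] \<gamma> V by (simp add: gauge_equivalence_def)
    then show ?thesis
      using sheaf_iso_bij[OF iso V] 1 \<eta>c[OF V 1] by (simp add: ps_sheaf_simps(1) bij_betw_def inj_on_def)
  qed
  show z: "\<eta> V (ps_const (sec OX V) f) 0 = f" if "openin T V" "f \<in> carrier (sec OX V)" for V f
    using gauge_at_0[OF \<gamma> that(1) \<eta>c[OF that(1) ps_const_in[OF that]]] \<gamma>\<eta>[OF that(1) ps_const_in[OF that]]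
    by (simp add: ps_const_def)
  show "diff_op K T OX (\<lambda>V f. \<eta> V (ps_const (sec OX V) f) k)" for k
  proof (induction k rule: less_induct)
    case (less k)
    show ?case
    proof (cases k)
      case 0
      then show ?thesis using z by (intro diff_op_cong[OF diff_op_id]) simp
    next
      case (Suc n)
      have d: "diff_op K T OX (\<lambda>V f. \<ominus>\<^bsub>sec OX V\<^esub> (\<Oplus>\<^bsub>sec OX V\<^esub>a\<in>{..n}.
          \<gamma> V (ps_const (sec OX V) (\<eta> V (ps_const (sec OX V) f) (n - a))) (Suc a)))"
        by (intro diff_op_neg diff_op_sum diff_op_comp[OF gauge_coeff_diff_op[OF \<gamma>] less]) (simp add: Suc)
      show ?thesis
      proof (rule diff_op_cong[OF d])
        fix V f assume V: "openin T V" and f: "f \<in> carrier (sec OX V)"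
        interpret cring "sec OX V" by (rule cring[OF V])
        let ?S = "\<Oplus>\<^bsub>sec OX V\<^esub>a\<in>{..n}. \<gamma> V (ps_const (sec OX V) (\<eta> V (ps_const (sec OX V) f) (n - a))) (Suc a)"
        have e: "\<eta> V (ps_const (sec OX V) f) i \<in> carrier (sec OX V)" for i
          using \<eta>c[OF V ps_const_in[OF V f]] by (simp add: ps_simps)
        have S: "?S \<in> carrier (sec OX V)"
          by (rule finsum_closed) (use diff_op_closed[OF gauge_coeff_diff_op[OF \<gamma>] V e] in auto)
        have "?S \<oplus>\<^bsub>sec OX V\<^esub> \<eta> V (ps_const (sec OX V) f) k = \<zero>\<^bsub>sec OX V\<^esub>"
          using gauge_coeff_Suc[OF \<gamma> V \<eta>c[OF V ps_const_in[OF V f]], of n] \<gamma>\<eta>[OF V ps_const_in[OF V f]] Suc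
          by (simp add: ps_const_def)
        then have "\<eta> V (ps_const (sec OX V) f) k \<oplus>\<^bsub>sec OX V\<^esub> ?S = \<zero>\<^bsub>sec OX V\<^esub>"
          using a_comm[OF S e] by simp
        then show "\<eta> V (ps_const (sec OX V) f) k = \<ominus>\<^bsub>sec OX V\<^esub> ?S"
          using S e[of k] by (intro minus_equality[symmetric])
      qed
    qed
  qed
qed

subsection \<open>Coefficients of star products\<close>

lemma star_mod_hom:
  assumes "star_product K T OX star" "openin T V" "G \<in> carrier (ps_mod (sec OX V))"
  shows "(\<lambda>F. star V F G) \<in> mod_hom (ps_ring K) (ps_mod (sec OX V)) (ps_mod (sec OX V))"
    and "(\<lambda>F. star V G F) \<in> mod_hom (ps_ring K) (ps_mod (sec OX V)) (ps_mod (sec OX V))"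
proof -
  let ?S = "(ps_mod (sec OX V))\<lparr>mult := star V\<rparr>"
  have "assoc_algebra (ps_ring K) ?S"
    using assms(1,2) unfolding star_product_def algebra_sheaf_def by (simp add: ps_sheaf_simps)
  then have r: "ring ?S" and l: "\<And>a F. a \<in> carrier (ps_ring K) \<Longrightarrow> F \<in> carrier ?S \<Longrightarrow>
      (a \<odot>\<^bsub>?S\<^esub> F) \<otimes>\<^bsub>?S\<^esub> G = a \<odot>\<^bsub>?S\<^esub> (F \<otimes>\<^bsub>?S\<^esub> G) \<and> G \<otimes>\<^bsub>?S\<^esub> (a \<odot>\<^bsub>?S\<^esub> F) = a \<odot>\<^bsub>?S\<^esub> (G \<otimes>\<^bsub>?S\<^esub> F)"
    using assms(3) unfolding assoc_algebra_def by simp_all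
  interpret ring ?S by (rule r)
  have G: "G \<in> carrier ?S" using assms(3) by simp
  show "(\<lambda>F. star V F G) \<in> mod_hom (ps_ring K) (ps_mod (sec OX V)) (ps_mod (sec OX V))"
    using m_closed[OF _ G] l_distr[OF _ _ G] l by (intro mod_homI) simp_all
  show "(\<lambda>F. star V G F) \<in> mod_hom (ps_ring K) (ps_mod (sec OX V)) (ps_mod (sec OX V))"
    using m_closed[OF G] r_distr[OF _ _ G] l by (intro mod_homI) simp_all
qed

lemma star_coeff_bidiff:
  assumes "star_product K T OX star"
  shows "bidiff_op K T OX (\<lambda>V f g. star V (ps_const (sec OX V) f) (ps_const (sec OX V) g) k)"
    and "\<And>V f g. openin T V \<Longrightarrow> f \<in> carrier (sec OX V) \<Longrightarrow> g \<in> carrier (sec OX V) \<Longrightarrow>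
      star V (ps_const (sec OX V) f) (ps_const (sec OX V) g) 0 = f \<otimes>\<^bsub>sec OX V\<^esub> g"
proof -
  obtain \<beta> where \<beta>: "\<And>j. j \<ge> 1 \<Longrightarrow> bidiff_op K T OX (\<beta> j)"
    "\<And>V f g. openin T V \<Longrightarrow> f \<in> carrier (sec OX V) \<Longrightarrow> g \<in> carrier (sec OX V) \<Longrightarrow>
      star V (ps_const (sec OX V) f) (ps_const (sec OX V) g) = (\<lambda>j. if j = 0 then f \<otimes>\<^bsub>sec OX V\<^esub> g else \<beta> j V f g)"
    using assms unfolding star_product_def by blast
  show "\<And>V f g. openin T V \<Longrightarrow> f \<in> carrier (sec OX V) \<Longrightarrow> g \<in> carrier (sec OX V) \<Longrightarrow>
      star V (ps_const (sec OX V) f) (ps_const (sec OX V) g) 0 = f \<otimes>\<^bsub>sec OX V\<^esub> g"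
    using \<beta>(2) by simp
  show "bidiff_op K T OX (\<lambda>V f g. star V (ps_const (sec OX V) f) (ps_const (sec OX V) g) k)"
  proof (cases "k = 0")
    case True
    then show ?thesis using \<beta>(2) by (intro bidiff_cong[OF bidiff_mult]) simp
  next
    case False
    then show ?thesis using \<beta>(2) by (intro bidiff_cong[OF \<beta>(1)[of k]]) auto
  qed
qed

text \<open>Bilinearity over \<open>K[[\<hbar>]]\<close> reduces the product of power series to products of constants.\<close>

lemma star_coeff:
  assumes s: "star_product K T OX star" and V: "openin T V"
    and F: "F \<in> carrier (ps_mod (sec OX V))" and G: "G \<in> carrier (ps_mod (sec OX V))"
  shows "star V F G n = (\<Oplus>\<^bsub>sec OX V\<^esub>a\<in>{..n}. \<Oplus>\<^bsub>sec OX V\<^esub>b\<in>{..a}.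
    star V (ps_const (sec OX V) (F (n - a))) (ps_const (sec OX V) (G (a - b))) b)"
proof -
  interpret cring "sec OX V" by (rule cring[OF V])
  note m = module[OF V]
  have Fc: "\<And>i. F i \<in> carrier (sec OX V)" and Gc: "\<And>i. G i \<in> carrier (sec OX V)"
    using F G by (simp_all add: ps_simps)
  have in1: "star V (ps_const (sec OX V) (F (n - a))) G a = (\<Oplus>\<^bsub>sec OX V\<^esub>b\<in>{..a}.
    star V (ps_const (sec OX V) (F (n - a))) (ps_const (sec OX V) (G (a - b))) b)" for a
    by (rule ps_hom_coeff[OF m m star_mod_hom(2)[OF s V ps_const_in[OF V Fc]] G])
  have "star V F G n = (\<Oplus>\<^bsub>sec OX V\<^esub>a\<in>{..n}. star V (ps_const (sec OX V) (F (n - a))) G a)"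
    by (rule ps_hom_coeff[OF m m star_mod_hom(1)[OF s V G] F])
  then show ?thesis unfolding in1 .
qed

text \<open>Comparing coefficients of \<open>\<gamma> (f \<star>' g) = \<gamma> f \<star> \<gamma> g\<close> expresses the \<open>k\<close>-th coefficient of
  \<open>f \<star>' g\<close> by lower ones, by the coefficients of \<open>\<gamma>\<close> and by \<open>E k\<close>, the \<open>k\<close>-th coefficient of
  \<open>\<gamma> f \<star> \<gamma> g\<close>. So it is bidifferential by induction.\<close>

lemma star_transport_coeff:
  assumes s: "star_product K T OX star" and \<gamma>: "gauge_equivalence K T OX \<gamma>"
    and s': "\<And>V F G. openin T V \<Longrightarrow> F \<in> carrier (ps_mod (sec OX V)) \<Longrightarrow> G \<in> carrier (ps_mod (sec OX V)) \<Longrightarrow>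
      star' V F G \<in> carrier (ps_mod (sec OX V)) \<and> \<gamma> V (star' V F G) = star V (\<gamma> V F) (\<gamma> V G)"
  shows "bidiff_op K T OX (\<lambda>V f g. star' V (ps_const (sec OX V) f) (ps_const (sec OX V) g) k)"
    and "\<And>V f g. openin T V \<Longrightarrow> f \<in> carrier (sec OX V) \<Longrightarrow> g \<in> carrier (sec OX V) \<Longrightarrow>
      star' V (ps_const (sec OX V) f) (ps_const (sec OX V) g) 0 = f \<otimes>\<^bsub>sec OX V\<^esub> g"
proof -
  let ?c = "\<lambda>V. ps_const (sec OX V)"
  define E where "E k V f g = (\<Oplus>\<^bsub>sec OX V\<^esub>a\<in>{..k}. \<Oplus>\<^bsub>sec OX V\<^esub>b\<in>{..a}.
      star V (?c V (\<gamma> V (?c V f) (k - a))) (?c V (\<gamma> V (?c V g) (a - b))) b)" for k :: nat and V f g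
  have E: "bidiff_op K T OX (E k)" for k
    unfolding E_def
    by (intro bidiff_sum bidiff_precomp[OF star_coeff_bidiff(1)[OF s]] gauge_coeff_diff_op[OF \<gamma>])
  have c: "\<gamma> V (star' V (?c V f) (?c V g)) k = E k V f g" "star' V (?c V f) (?c V g) \<in> carrier (ps_mod (sec OX V))"
    if V: "openin T V" and f: "f \<in> carrier (sec OX V)" and g: "g \<in> carrier (sec OX V)" for V f g k
  proof -
    note cf = ps_const_in[OF V f] and cg = ps_const_in[OF V g]
    note \<gamma>c = mod_homD(1)[OF gauge_mod_hom[OF \<gamma> V]]
    show "star' V (?c V f) (?c V g) \<in> carrier (ps_mod (sec OX V))" using s'[OF V cf cg] by blast
    show "\<gamma> V (star' V (?c V f) (?c V g)) k = E k V f g"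
      unfolding E_def using s'[OF V cf cg] star_coeff[OF s V \<gamma>c[OF cf] \<gamma>c[OF cg], of k] by simp
  qed
  show z: "star' V (?c V f) (?c V g) 0 = f \<otimes>\<^bsub>sec OX V\<^esub> g"
    if V: "openin T V" and f: "f \<in> carrier (sec OX V)" and g: "g \<in> carrier (sec OX V)" for V f g
  proof -
    interpret cring "sec OX V" by (rule cring[OF V])
    have "E 0 V f g = f \<otimes>\<^bsub>sec OX V\<^esub> g"
      unfolding E_def using f g by (simp add: gauge_coeff_0[OF \<gamma> V] star_coeff_bidiff(2)[OF s V])
    then show ?thesis using gauge_at_0[OF \<gamma> V c(2)[OF that]] c(1)[OF that, of 0] by simp
  qed
  show "bidiff_op K T OX (\<lambda>V f g. star' V (?c V f) (?c V g) k)"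
  proof (induction k rule: less_induct)
    case (less k)
    show ?case
    proof (cases k)
      case 0
      then show ?thesis using z by (intro bidiff_cong[OF bidiff_mult]) simp
    next
      case (Suc n)
      have d: "bidiff_op K T OX (\<lambda>V f g. E k V f g \<ominus>\<^bsub>sec OX V\<^esub> (\<Oplus>\<^bsub>sec OX V\<^esub>a\<in>{..n}.
          \<gamma> V (?c V (star' V (?c V f) (?c V g) (n - a))) (Suc a)))"
        by (intro bidiff_minus E bidiff_sum bidiff_comp[OF gauge_coeff_diff_op[OF \<gamma>] less]) (simp add: Suc)
      show ?thesis
      proof (rule bidiff_cong[OF d])
        fix V f g assume V: "openin T V" and f: "f \<in> carrier (sec OX V)" and g: "g \<in> carrier (sec OX V)"
        interpret cring "sec OX V" by (rule cring[OF V])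
        let ?S = "\<Oplus>\<^bsub>sec OX V\<^esub>a\<in>{..n}. \<gamma> V (?c V (star' V (?c V f) (?c V g) (n - a))) (Suc a)"
        have e: "star' V (?c V f) (?c V g) i \<in> carrier (sec OX V)" for i
          using c(2)[OF V f g] by (simp add: ps_simps)
        have S: "?S \<in> carrier (sec OX V)"
          by (rule finsum_closed) (use diff_op_closed[OF gauge_coeff_diff_op[OF \<gamma>] V e] in auto)
        have "E k V f g = ?S \<oplus>\<^bsub>sec OX V\<^esub> star' V (?c V f) (?c V g) k"
          using gauge_coeff_Suc[OF \<gamma> V c(2)[OF V f g], of n] c(1)[OF V f g, of k] Suc by simp
        then have "E k V f g = star' V (?c V f) (?c V g) k \<oplus>\<^bsub>sec OX V\<^esub> ?S"
          using a_comm[OF S e] by simp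
        then show "star' V (?c V f) (?c V g) k = E k V f g \<ominus>\<^bsub>sec OX V\<^esub> ?S"
          using S e[of k] by (simp add: a_minus_def a_assoc r_neg)
      qed
    qed
  qed
qed

end

section \<open>Splitting cocycles of gauge equivalences\<close>

lemma mod_hom_comp:
  assumes "h \<in> mod_hom R M N" "k \<in> mod_hom R N L"
  shows "(\<lambda>x. k (h x)) \<in> mod_hom R M L"
  by (rule mod_homI) (simp_all add: mod_homD[OF assms(1)] mod_homD[OF assms(2)])

text \<open>Here \<open>z\<close> stands for the zero of the ring that contains the coefficients.\<close>

definition ps_truncate :: "'r \<Rightarrow> nat \<Rightarrow> (nat \<Rightarrow> 'r) \<Rightarrow> nat \<Rightarrow> 'r" where
  "ps_truncate z k F = (\<lambda>b. if b < k then F b else z)"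

context ringed_space
begin

text \<open>The \<open>k\<close>-th coefficient of \<open>F\<close> contributes to the \<open>k\<close>-th coefficient of the image only through
  \<open>\<gamma>\<^sub>0 = id\<close>.\<close>

lemma gauge_truncate:
  assumes \<gamma>: "gauge_equivalence K T OX \<gamma>" and V: "openin T V" and F: "\<And>n. n \<le> k \<Longrightarrow> F n \<in> carrier (sec OX V)"
    and F': "F' \<in> carrier (ps_mod (sec OX V))" "\<And>n. n \<le> k \<Longrightarrow> F' n = F n"
  shows "\<gamma> V F' k = \<gamma> V (ps_truncate \<zero>\<^bsub>sec OX V\<^esub> k F) k \<oplus>\<^bsub>sec OX V\<^esub> F k"
proof -
  interpret cring "sec OX V" by (rule cring[OF V])
  have t: "ps_truncate \<zero>\<^bsub>sec OX V\<^esub> k F \<in> carrier (ps_mod (sec OX V))"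
    using F by (simp add: ps_simps ps_truncate_def)
  show ?thesis
  proof (cases k)
    case 0
    then show ?thesis
      using gauge_at_0[OF \<gamma> V F'(1)] gauge_at_0[OF \<gamma> V t] F'(2)[of 0] F[of 0]
      by (simp add: ps_truncate_def)
  next
    case (Suc n)
    define S where "S = (\<Oplus>\<^bsub>sec OX V\<^esub>a\<in>{..n}. \<gamma> V (ps_const (sec OX V) (F (n - a))) (Suc a))"
    have c: "\<gamma> V (ps_const (sec OX V) f) a \<in> carrier (sec OX V)" if "f \<in> carrier (sec OX V)" for f a
      using diff_op_closed[OF gauge_coeff_diff_op[OF \<gamma>] V that] .
    have S: "S \<in> carrier (sec OX V)"
      unfolding S_def by (rule finsum_closed) (use c F Suc in auto)
    have "(\<Oplus>\<^bsub>sec OX V\<^esub>a\<in>{..n}. \<gamma> V (ps_const (sec OX V) (F' (n - a))) (Suc a)) = S"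
      unfolding S_def using c F F'(2) Suc by (intro finsum_cong') auto
    moreover have "(\<Oplus>\<^bsub>sec OX V\<^esub>a\<in>{..n}. \<gamma> V (ps_const (sec OX V) (ps_truncate \<zero>\<^bsub>sec OX V\<^esub> k F (n - a))) (Suc a)) = S"
      unfolding S_def using c F Suc by (intro finsum_cong') (auto simp: ps_truncate_def)
    ultimately have "\<gamma> V F' k = S \<oplus>\<^bsub>sec OX V\<^esub> F k" "\<gamma> V (ps_truncate \<zero>\<^bsub>sec OX V\<^esub> k F) k = S"
      using gauge_coeff_Suc[OF \<gamma> V F'(1), of n] gauge_coeff_Suc[OF \<gamma> V t, of n] F'(2)[of k] Suc S
      by (simp_all add: ps_truncate_def)
    then show ?thesis by simp
  qed
qed

text \<open>The operators \<open>R k i\<close> are the coefficients of \<open>\<rho> i\<close>. The contribution of those of degree below \<open>k\<close>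
  to the \<open>k\<close>-th coefficient of \<open>g i j \<circ> \<rho> i\<close> is \<open>defect R k i j\<close>, so \<open>g i j \<circ> \<rho> i = \<rho> j\<close> amounts to
  \<open>R k j = defect R k i j + R k i\<close> for all \<open>k\<close>. If this holds below \<open>k\<close>, then the defects in degree \<open>k\<close>
  form an additive cocycle of differential operators, which can be split.\<close>

lemma gauge_cocycle_splits:
  fixes U :: "'i \<Rightarrow> 'a set" and g :: "'i \<Rightarrow> 'i \<Rightarrow> ('a, nat \<Rightarrow> 'r, nat \<Rightarrow> 'r) sheaf_map"
  assumes H1: "carrier (H1 T \<D>) = {\<zero>\<^bsub>H1 T \<D>\<^esub>}"
    and U: "\<And>i. i \<in> I \<Longrightarrow> openin T (U i)" "(\<Union>i\<in>I. U i) = topspace T"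
    and g: "\<And>i j. i \<in> I \<Longrightarrow> j \<in> I \<Longrightarrow> gauge_equivalence K (subtopology T (U i \<inter> U j)) OX (g i j)"
    and cocycle: "\<And>i j l V F. i \<in> I \<Longrightarrow> j \<in> I \<Longrightarrow> l \<in> I \<Longrightarrow> openin T V \<Longrightarrow> V \<subseteq> U i \<inter> U j \<inter> U l \<Longrightarrow>
      F \<in> carrier (ps_mod (sec OX V)) \<Longrightarrow> g j l V (g i j V F) = g i l V F"
  obtains \<rho> where "\<And>i. i \<in> I \<Longrightarrow> gauge_equivalence K (subtopology T (U i)) OX (\<rho> i)"
    and "\<And>i j V F. i \<in> I \<Longrightarrow> j \<in> I \<Longrightarrow> openin T V \<Longrightarrow> V \<subseteq> U i \<inter> U j \<Longrightarrow>
      F \<in> carrier (ps_mod (sec OX V)) \<Longrightarrow> g i j V (\<rho> i V F) = \<rho> j V F"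
proof -
  define defect where "defect R k i j V f = g i j V (ps_truncate \<zero>\<^bsub>sec OX V\<^esub> k (\<lambda>b. R b i V f)) k"
    for R :: "nat \<Rightarrow> 'i \<Rightarrow> ('a, 'r, 'r) sheaf_map" and k i j V f
  define good where "good R k r \<longleftrightarrow>
    (\<forall>i\<in>I. diff_op K (subtopology T (U i)) OX (r i) \<and>
      (\<forall>V. openin T V \<and> V \<subseteq> U i \<longrightarrow> (if k = 0 then \<forall>f\<in>carrier (sec OX V). r i V f = f
         else r i V \<one>\<^bsub>sec OX V\<^esub> = \<zero>\<^bsub>sec OX V\<^esub>))) \<and>
    (\<forall>i\<in>I. \<forall>j\<in>I. \<forall>V f. openin T V \<and> V \<subseteq> U i \<inter> U j \<and> f \<in> carrier (sec OX V) \<longrightarrow>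
      r j V f = defect R k i j V f \<oplus>\<^bsub>sec OX V\<^esub> r i V f)"
    for R :: "nat \<Rightarrow> 'i \<Rightarrow> ('a, 'r, 'r) sheaf_map" and k and r :: "'i \<Rightarrow> ('a, 'r, 'r) sheaf_map"
  have goodD: "diff_op K (subtopology T (U i)) OX (r i)"
    "\<And>V f. openin T V \<Longrightarrow> V \<subseteq> U i \<Longrightarrow> k = 0 \<Longrightarrow> f \<in> carrier (sec OX V) \<Longrightarrow> r i V f = f"
    "\<And>V. openin T V \<Longrightarrow> V \<subseteq> U i \<Longrightarrow> k \<noteq> 0 \<Longrightarrow> r i V \<one>\<^bsub>sec OX V\<^esub> = \<zero>\<^bsub>sec OX V\<^esub>"
    "\<And>V f. openin T V \<Longrightarrow> V \<subseteq> U i \<Longrightarrow> f \<in> carrier (sec OX V) \<Longrightarrow> r i V f \<in> carrier (sec OX V)"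
    if "good R k r" "i \<in> I" for R k r i
  proof -
    show d: "diff_op K (subtopology T (U i)) OX (r i)"
      "\<And>V f. openin T V \<Longrightarrow> V \<subseteq> U i \<Longrightarrow> k = 0 \<Longrightarrow> f \<in> carrier (sec OX V) \<Longrightarrow> r i V f = f"
      "\<And>V. openin T V \<Longrightarrow> V \<subseteq> U i \<Longrightarrow> k \<noteq> 0 \<Longrightarrow> r i V \<one>\<^bsub>sec OX V\<^esub> = \<zero>\<^bsub>sec OX V\<^esub>"
      using bspec[OF conjunct1[OF that(1)[unfolded good_def]] that(2)] by simp_all
    show "r i V f \<in> carrier (sec OX V)" if "openin T V" "V \<subseteq> U i" "f \<in> carrier (sec OX V)" for V f
      using ringed_space.diff_op_closed[OF ringed_sub[OF U(1)[OF \<open>i \<in> I\<close>]] d(1), of V f] that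
      by (simp add: openin_sub[OF U(1)[OF \<open>i \<in> I\<close>]])
  qed
  have goodE: "r j V f = defect R k i j V f \<oplus>\<^bsub>sec OX V\<^esub> r i V f"
    if "good R k r" "i \<in> I" "j \<in> I" "openin T V" "V \<subseteq> U i \<inter> U j" "f \<in> carrier (sec OX V)" for R k r i j V f
    using conjunct2[OF that(1)[unfolded good_def]] that(2-6) by blast
  have o: "openin T (U i \<inter> U j)" if "i \<in> I" "j \<in> I" for i j using U(1) that by auto
  note gR = ringed_sub[OF o]
  have gV: "openin (subtopology T (U i \<inter> U j)) V \<longleftrightarrow> openin T V \<and> V \<subseteq> U i \<inter> U j" if "i \<in> I" "j \<in> I" for i j V
    by (rule openin_sub[OF o[OF that]])
  have gc: "g i j V F \<in> carrier (ps_mod (sec OX V))"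
    if "i \<in> I" "j \<in> I" "openin T V" "V \<subseteq> U i \<inter> U j" "F \<in> carrier (ps_mod (sec OX V))" for i j V F
  proof -
    have VW: "openin (subtopology T (U i \<inter> U j)) V" using gV[OF that(1,2)] that(3,4) by simp
    show ?thesis
      by (rule mod_homD(1)[OF ringed_space.gauge_mod_hom[OF gR[OF that(1,2)] g[OF that(1,2)] VW] that(5)])
  qed
  have "\<exists>R. \<forall>k. good R k (R k)"
  proof (rule dependent_wellorder_choice)
    fix r k and R R' :: "nat \<Rightarrow> 'i \<Rightarrow> ('a, 'r, 'r) sheaf_map"
    assume "\<And>b. b < k \<Longrightarrow> R b = R' b"
    then have tr: "ps_truncate z k (\<lambda>b. R b i V f) = ps_truncate z k (\<lambda>b. R' b i V f)" for z i V f
      by (auto simp: ps_truncate_def fun_eq_iff)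
    have "defect R k = defect R' k" by (intro ext) (simp only: defect_def tr)
    then show "good R k r = good R' k r" by (simp add: good_def)
  next
    fix k and R :: "nat \<Rightarrow> 'i \<Rightarrow> ('a, 'r, 'r) sheaf_map"
    assume IH: "\<And>b. b < k \<Longrightarrow> good R b (R b)"
    let ?u = "\<lambda>i V f. ps_truncate \<zero>\<^bsub>sec OX V\<^esub> k (\<lambda>b. R b i V f)"
    have uc: "?u i V f \<in> carrier (ps_mod (sec OX V))"
      if "i \<in> I" "openin T V" "V \<subseteq> U i" "f \<in> carrier (sec OX V)" for i V f
      using goodD(4)[OF IH that(1)] that zero_closed[OF that(2)] by (simp add: ps_simps ps_truncate_def)
    show "\<exists>r. good R k r"
    proof (cases k)
      case 0
      have "good R k (\<lambda>i V f. f)"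
        unfolding good_def
      proof (intro conjI ballI allI impI)
        show "diff_op K (subtopology T (U i)) OX (\<lambda>V f. f)" if "i \<in> I" for i
          by (rule ringed_space.diff_op_id[OF ringed_sub[OF U(1)[OF that]]])
        fix i j V f assume i: "i \<in> I" and j: "j \<in> I" and "openin T V \<and> V \<subseteq> U i \<inter> U j \<and> f \<in> carrier (sec OX V)"
        then have V: "openin T V" "V \<subseteq> U i \<inter> U j" and f: "f \<in> carrier (sec OX V)" by auto
        interpret cring "sec OX V" by (rule cring[OF V(1)])
        have "defect R k i j V f = \<zero>\<^bsub>sec OX V\<^esub>"
          unfolding defect_def 0
          using ringed_space.gauge_at_0[OF gR[OF i j] g[OF i j], of V "ps_truncate \<zero>\<^bsub>sec OX V\<^esub> 0 (\<lambda>b. R b i V f)"]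
            gV[OF i j] V by (simp add: ps_truncate_def ps_simps)
        then show "f = defect R k i j V f \<oplus>\<^bsub>sec OX V\<^esub> f" using f by simp
      qed (use 0 in simp_all)
      then show ?thesis by blast
    next
      case (Suc n)
      \<comment> \<open>the equation holds below degree \<open>k\<close>\<close>
      have low: "g i j V (?u i V f) b = R b j V f"
        if i: "i \<in> I" and j: "j \<in> I" and V: "openin T V" "V \<subseteq> U i \<inter> U j" and f: "f \<in> carrier (sec OX V)" and b: "b < k"
        for i j V f b
      proof -
        have Vi: "V \<subseteq> U i" using V by auto
        have "g i j V (?u i V f) b = g i j V (ps_truncate \<zero>\<^bsub>sec OX V\<^esub> b (\<lambda>b. R b i V f)) b \<oplus>\<^bsub>sec OX V\<^esub> R b i V f"
        proof (rule ringed_space.gauge_truncate[OF gR[OF i j] g[OF i j]])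
          show "openin (subtopology T (U i \<inter> U j)) V" using V gV[OF i j] by simp
          show "R m i V f \<in> carrier (sec OX V)" if "m \<le> b" for m
            using goodD(4)[OF IH i V(1) Vi f] that b by simp
          show "?u i V f m = R m i V f" if "m \<le> b" for m using that b by (simp add: ps_truncate_def)
        qed (rule uc[OF i V(1) Vi f])
        also have "\<dots> = R b j V f"
          using goodE[OF IH[OF b] i j V f] by (simp add: defect_def)
        finally show ?thesis .
      qed
      have dd: "diff_op K (subtopology T (U i \<inter> U j)) OX (defect R k i j)" if i: "i \<in> I" and j: "j \<in> I" for i j
      proof -
        interpret W: ringed_space K "subtopology T (U i \<inter> U j)" OX by (rule gR[OF i j])
        have Rd: "diff_op K (subtopology T (U i \<inter> U j)) OX (R b i)" if "b < k" for b
          using diff_op_sub[OF goodD(1)[OF IH[OF that] i], of "U i \<inter> U j"] o[OF i j]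
          by (simp add: openin_sub[OF U(1)[OF i]] subtopology_sub)
        have "diff_op K (subtopology T (U i \<inter> U j)) OX
            (\<lambda>V f. \<Oplus>\<^bsub>sec OX V\<^esub>a\<in>{..n}. g i j V (ps_const (sec OX V) (R (n - a) i V f)) (Suc a))"
          by (intro W.diff_op_sum W.diff_op_comp[OF W.gauge_coeff_diff_op[OF g[OF i j]] Rd]) (simp add: Suc)
        then show ?thesis
        proof (rule W.diff_op_cong)
          fix V f assume VW: "openin (subtopology T (U i \<inter> U j)) V" and f: "f \<in> carrier (sec OX V)"
          then have V: "openin T V" "V \<subseteq> U i" using gV[OF i j] by auto
          interpret cring "sec OX V" by (rule cring[OF V(1)])
          have Rc: "R b i V f \<in> carrier (sec OX V)" if "b < k" for b
            by (rule goodD(4)[OF IH[OF that] i V f])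
          have c: "g i j V (ps_const (sec OX V) h) a \<in> carrier (sec OX V)" if "h \<in> carrier (sec OX V)" for h a
            using W.diff_op_closed[OF W.gauge_coeff_diff_op[OF g[OF i j]] VW that] .
          have S: "(\<Oplus>\<^bsub>sec OX V\<^esub>a\<in>{..n}. g i j V (ps_const (sec OX V) (R (n - a) i V f)) (Suc a)) \<in> carrier (sec OX V)"
            by (rule finsum_closed) (use c Rc Suc in auto)
          have "(\<Oplus>\<^bsub>sec OX V\<^esub>a\<in>{..n}. g i j V (ps_const (sec OX V) (?u i V f (n - a))) (Suc a)) =
              (\<Oplus>\<^bsub>sec OX V\<^esub>a\<in>{..n}. g i j V (ps_const (sec OX V) (R (n - a) i V f)) (Suc a))"
            using c Rc Suc by (intro finsum_cong') (auto simp: ps_truncate_def)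
          then show "defect R k i j V f =
              (\<Oplus>\<^bsub>sec OX V\<^esub>a\<in>{..n}. g i j V (ps_const (sec OX V) (R (n - a) i V f)) (Suc a))"
            using W.gauge_coeff_Suc[OF g[OF i j] VW uc[OF i V f], of n] Suc S
            by (simp add: defect_def ps_truncate_def)
        qed
      qed
      have dcl: "defect R k i j V f \<in> carrier (sec OX V)"
        if "i \<in> I" "j \<in> I" "openin T V" "V \<subseteq> U i \<inter> U j" "f \<in> carrier (sec OX V)" for i j V f
        using ringed_space.diff_op_closed[OF gR[OF that(1,2)] dd[OF that(1,2)], of V f] gV[OF that(1,2)] that(3-5)
        by simp
      have add: "defect R k i j V f \<oplus>\<^bsub>sec OX V\<^esub> defect R k j l V f = defect R k i l V f"
        if i: "i \<in> I" and j: "j \<in> I" and l: "l \<in> I" and V: "openin T V" "V \<subseteq> U i \<inter> U j \<inter> U l"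
          and f: "f \<in> carrier (sec OX V)" for i j l V f
      proof -
        interpret cring "sec OX V" by (rule cring[OF V(1)])
        have sub: "V \<subseteq> U i" "V \<subseteq> U j" "V \<subseteq> U i \<inter> U j" "V \<subseteq> U j \<inter> U l" using V by auto
        define w where "w = g i j V (?u i V f)"
        have wc: "w \<in> carrier (ps_mod (sec OX V))"
          unfolding w_def by (rule gc[OF i j V(1) sub(3) uc[OF i V(1) sub(1) f]])
        have "g j l V w k = g j l V (ps_truncate \<zero>\<^bsub>sec OX V\<^esub> k w) k \<oplus>\<^bsub>sec OX V\<^esub> w k"
          by (rule ringed_space.gauge_truncate[OF gR[OF j l] g[OF j l]])
             (use wc gV[OF j l] V sub in \<open>auto simp: ps_simps\<close>)
        also have "ps_truncate \<zero>\<^bsub>sec OX V\<^esub> k w = ?u j V f"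
          using low[OF i j V(1) sub(3) f] by (auto simp: ps_truncate_def w_def fun_eq_iff)
        finally have "g j l V w k = defect R k j l V f \<oplus>\<^bsub>sec OX V\<^esub> defect R k i j V f"
          by (simp add: defect_def w_def)
        moreover have "g j l V w k = defect R k i l V f"
          unfolding w_def defect_def using cocycle[OF i j l V uc[OF i V(1) sub(1) f]] by simp
        ultimately show ?thesis
          using a_comm[OF dcl[OF i j V(1) sub(3) f] dcl[OF j l V(1) sub(4) f]] by simp
      qed
      \<comment> \<open>gauge equivalences fix \<open>1\<close>, hence the defects annihilate it\<close>
      have d1: "defect R k i j V \<one>\<^bsub>sec OX V\<^esub> = \<zero>\<^bsub>sec OX V\<^esub>"
        if i: "i \<in> I" and j: "j \<in> I" and V: "openin T V" "V \<subseteq> U i \<inter> U j" for i j V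
      proof -
        have Vi: "V \<subseteq> U i" using V by auto
        have "?u i V \<one>\<^bsub>sec OX V\<^esub> = \<one>\<^bsub>sec (ps_sheaf OX) V\<^esub>"
          unfolding ps_const_one
          using goodD(2)[OF IH i V(1) Vi _ one_closed[OF V(1)]] goodD(3)[OF IH i V(1) Vi] Suc
          by (auto simp: ps_truncate_def ps_const_def fun_eq_iff)
        then show ?thesis
          using g[OF i j] gV[OF i j] V Suc unfolding defect_def gauge_equivalence_def
          by (simp add: ps_sheaf_simps ps_simps ps_const_def)
      qed
      have "\<exists>q. (\<forall>i\<in>I. diff_op K (subtopology T (U i)) OX (q i)) \<and>
          (\<forall>i\<in>I. \<forall>j\<in>I. \<forall>V f. openin T V \<and> V \<subseteq> U i \<inter> U j \<and> f \<in> carrier (sec OX V) \<longrightarrow>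
            q j V f = defect R k i j V f \<oplus>\<^bsub>sec OX V\<^esub> q i V f)"
      proof (rule diff_op_cocycle_splits[OF H1 U, of "defect R k"])
        show "diff_op K (subtopology T (U i \<inter> U j)) OX (defect R k i j)" if "i \<in> I" "j \<in> I" for i j
          by (rule dd[OF that])
        show "defect R k i j V f \<oplus>\<^bsub>sec OX V\<^esub> defect R k j l V f = defect R k i l V f"
          if "i \<in> I" "j \<in> I" "l \<in> I" "openin T V" "V \<subseteq> U i \<inter> U j \<inter> U l" "f \<in> carrier (sec OX V)" for i j l V f
          by (rule add[OF that])
      qed (assumption, blast)
      then obtain q where q0: "\<forall>i\<in>I. diff_op K (subtopology T (U i)) OX (q i)"
        and qq0: "\<forall>i\<in>I. \<forall>j\<in>I. \<forall>V f. openin T V \<and> V \<subseteq> U i \<inter> U j \<and> f \<in> carrier (sec OX V) \<longrightarrow>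
            q j V f = defect R k i j V f \<oplus>\<^bsub>sec OX V\<^esub> q i V f"
        by (elim exE conjE) (rule that)
      have q: "diff_op K (subtopology T (U i)) OX (q i)" if "i \<in> I" for i
        using q0 that by (rule bspec)
      have qq: "q j V f = defect R k i j V f \<oplus>\<^bsub>sec OX V\<^esub> q i V f"
        if "i \<in> I" "j \<in> I" "openin T V" "V \<subseteq> U i \<inter> U j" "f \<in> carrier (sec OX V)" for i j V f
        by (rule qq0[THEN bspec, OF that(1), THEN bspec, OF that(2), THEN spec, THEN spec, THEN mp])
           (intro conjI that)
      \<comment> \<open>a splitting by operators that annihilate \<open>1\<close>: the functions \<open>q i 1\<close> agree on overlaps, as the defects annihilate \<open>1\<close>\<close>
      define r where "r i V f = q i V f \<ominus>\<^bsub>sec OX V\<^esub> res OX (U i) V (q i (U i) \<one>\<^bsub>sec OX (U i)\<^esub>) \<otimes>\<^bsub>sec OX V\<^esub> f" for i V f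
      have qc: "q i V f \<in> carrier (sec OX V)" if "i \<in> I" "openin T V" "V \<subseteq> U i" "f \<in> carrier (sec OX V)" for i V f
        using ringed_space.diff_op_closed[OF ringed_sub[OF U(1)[OF that(1)]] q[OF that(1)], of V f] that
        by (simp add: openin_sub[OF U(1)[OF that(1)]])
      have q1: "res OX (U i) V (q i (U i) \<one>\<^bsub>sec OX (U i)\<^esub>) = q i V \<one>\<^bsub>sec OX V\<^esub>"
        if i: "i \<in> I" and V: "openin T V" "V \<subseteq> U i" for i V
        using sheaf_homD(5)[OF diff_op_sheaf_hom[OF q[OF i]], of "U i" V "\<one>\<^bsub>sec OX (U i)\<^esub>"] V
        by (simp add: openin_sub[OF U(1)[OF i]] U(1)[OF i] one_closed[OF U(1)[OF i]] res_one[OF U(1)[OF i] V])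
      have "good R k r"
        unfolding good_def
      proof (intro conjI ballI allI impI)
        fix i assume i: "i \<in> I"
        interpret Ui: ringed_space K "subtopology T (U i)" OX by (rule ringed_sub[OF U(1)[OF i]])
        have "r i = (\<lambda>V f. q i V f \<ominus>\<^bsub>sec OX V\<^esub> res OX (U i) V (q i (U i) \<one>\<^bsub>sec OX (U i)\<^esub>) \<otimes>\<^bsub>sec OX V\<^esub> f)"
          by (intro ext) (simp add: r_def)
        then show "diff_op K (subtopology T (U i)) OX (r i)"
          using Ui.diff_op_minus[OF q[OF i] diff_op_mult[OF U(1)[OF i] qc[OF i U(1)[OF i] order_refl one_closed[OF U(1)[OF i]]]]]
          by simp
        fix V assume "openin T V \<and> V \<subseteq> U i"
        then have V: "openin T V" "V \<subseteq> U i" by auto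
        interpret cring "sec OX V" by (rule cring[OF V(1)])
        show "if k = 0 then \<forall>f\<in>carrier (sec OX V). r i V f = f else r i V \<one>\<^bsub>sec OX V\<^esub> = \<zero>\<^bsub>sec OX V\<^esub>"
          using Suc qc[OF i V one_closed] by (simp add: r_def q1[OF i V] a_minus_def r_neg)
      next
        fix i j V f assume i: "i \<in> I" and j: "j \<in> I" and "openin T V \<and> V \<subseteq> U i \<inter> U j \<and> f \<in> carrier (sec OX V)"
        then have V: "openin T V" "V \<subseteq> U i \<inter> U j" and f: "f \<in> carrier (sec OX V)" by auto
        have sub: "V \<subseteq> U i" "V \<subseteq> U j" using V by auto
        interpret cring "sec OX V" by (rule cring[OF V(1)])
        have e: "q j V \<one>\<^bsub>sec OX V\<^esub> = q i V \<one>\<^bsub>sec OX V\<^esub>"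
          using qq[OF i j V one_closed] d1[OF i j V] qc[OF i V(1) sub(1) one_closed] by simp
        show "r j V f = defect R k i j V f \<oplus>\<^bsub>sec OX V\<^esub> r i V f"
          using qq[OF i j V f] dcl[OF i j V f] qc[OF i V(1) sub(1)] f
          by (simp add: r_def q1[OF i V(1) sub(1)] q1[OF j V(1) sub(2)] e a_minus_def a_assoc)
      qed
      then show ?thesis by blast
    qed
  qed
  then obtain R where R: "\<And>k. good R k (R k)" by blast
  define \<rho> where "\<rho> i V = ps_extend (sec OX V) (\<lambda>k. R k i V)" for i V
  have const: "\<rho> i V (ps_const (sec OX V) f) = (\<lambda>k. R k i V f)" and
    lin: "\<rho> i V \<in> mod_hom (ps_ring K) (ps_mod (sec OX V)) (ps_mod (sec OX V))"
    if i: "i \<in> I" and V: "openin T V" "V \<subseteq> U i" and f: "f \<in> carrier (sec OX V)" for i V f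
  proof -
    have Rm: "R k i V \<in> mod_hom K (sec OX V) (sec OX V)" for k
      using sheaf_homD(1)[OF diff_op_sheaf_hom[OF goodD(1)[OF R i]]] V by (simp add: openin_sub[OF U(1)[OF i]])
    show "\<rho> i V (ps_const (sec OX V) f) = (\<lambda>k. R k i V f)"
      unfolding \<rho>_def by (rule ps_extend_const[OF module[OF V(1)] module[OF V(1)] Rm f])
    show "\<rho> i V \<in> mod_hom (ps_ring K) (ps_mod (sec OX V)) (ps_mod (sec OX V))"
      unfolding \<rho>_def by (rule ps_extend_mod_hom[OF module[OF V(1)] module[OF V(1)] Rm])
  qed
  show ?thesis
  proof (rule that[of \<rho>])
    fix i assume i: "i \<in> I"
    show "gauge_equivalence K (subtopology T (U i)) OX (\<rho> i)"
      unfolding \<rho>_def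
    proof (rule ringed_space.gauge_extend[OF ringed_sub[OF U(1)[OF i]]])
      show "diff_op K (subtopology T (U i)) OX (R k i)" for k by (rule goodD(1)[OF R i])
      show "R 0 i V f = f" if "openin (subtopology T (U i)) V" "f \<in> carrier (sec OX V)" for V f
        using goodD(2)[OF R i] that by (simp add: openin_sub[OF U(1)[OF i]])
      show "R k i V \<one>\<^bsub>sec OX V\<^esub> = \<zero>\<^bsub>sec OX V\<^esub>" if "1 \<le> k" "openin (subtopology T (U i)) V" for k V
        using goodD(3)[OF R i, of V k] that by (simp add: openin_sub[OF U(1)[OF i]])
    qed
  next
    fix i j V F assume i: "i \<in> I" and j: "j \<in> I" and V: "openin T V" "V \<subseteq> U i \<inter> U j"
      and F: "F \<in> carrier (ps_mod (sec OX V))"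
    have sub: "V \<subseteq> U i" "V \<subseteq> U j" using V by auto
    note z = zero_closed[OF V(1)]
    have VW: "openin (subtopology T (U i \<inter> U j)) V" using gV[OF i j] V by simp
    show "g i j V (\<rho> i V F) = \<rho> j V F"
    proof (rule ps_hom_eqI[OF module[OF V(1)] module[OF V(1)] _ lin[OF j V(1) sub(2) z] _ F])
      show "(\<lambda>F. g i j V (\<rho> i V F)) \<in> mod_hom (ps_ring K) (ps_mod (sec OX V)) (ps_mod (sec OX V))"
        by (rule mod_hom_comp[OF lin[OF i V(1) sub(1) z] ringed_space.gauge_mod_hom[OF gR[OF i j] g[OF i j] VW]])
      fix f assume f: "f \<in> carrier (sec OX V)"
      have Rc: "R b i V f \<in> carrier (sec OX V)" for b by (rule goodD(4)[OF R i V(1) sub(1) f])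
      have "g i j V (\<lambda>k. R k i V f) b = R b j V f" for b
      proof -
        have "g i j V (\<lambda>k. R k i V f) b =
            g i j V (ps_truncate \<zero>\<^bsub>sec OX V\<^esub> b (\<lambda>k. R k i V f)) b \<oplus>\<^bsub>sec OX V\<^esub> R b i V f"
          by (rule ringed_space.gauge_truncate[OF gR[OF i j] g[OF i j] VW])
             (simp_all add: Rc ps_simps)
        then show ?thesis using goodE[OF R i j V f] by (simp add: defect_def)
      qed
      then show "g i j V (\<rho> i V (ps_const (sec OX V) f)) = \<rho> j V (ps_const (sec OX V) f)"
        unfolding const[OF i V(1) sub(1) f] const[OF j V(1) sub(2) f] by blast
    qed
  qed
qed

end

section \<open>Reduction modulo \<open>\<hbar>\<close>\<close>

context
  fixes K :: "('k, 'c) ring_scheme" and T :: "'a topology" and A :: "('a, nat \<Rightarrow> 'k, 'm) presheaf"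
  assumes A: "module_presheaf (ps_ring K) T A" and K: "ring K"
begin

interpretation A: abelian_presheaf T A by (rule module_presheaf_abelian[OF A])

lemma hbar_in_ps_ring: "hbar K \<in> carrier (ps_ring K)"
proof -
  interpret ring K by (rule K)
  show ?thesis by (simp add: ps_simps hbar_def)
qed

lemma presheaf_sec_module: "openin T U \<Longrightarrow> module (ps_ring K) (sec A U)"
  using A by (simp add: module_presheaf_def)

lemma hbar_multiples_1:
  assumes U: "openin T U"
  shows "hbar_multiples K A 1 U = (\<lambda>a. hbar K \<odot>\<^bsub>sec A U\<^esub> a) ` carrier (sec A U)"
proof -
  interpret module "ps_ring K" "sec A U" by (rule presheaf_sec_module[OF U])
  have "hbar K [^]\<^bsub>ps_ring K\<^esub> (1::nat) = hbar K" using hbar_in_ps_ring by simp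
  then show ?thesis by (simp add: hbar_multiples_def)
qed

lemma hbar_multiples_subgroup:
  assumes U: "openin T U"
  shows "additive_subgroup (hbar_multiples K A 1 U) (sec A U)"
proof (rule additive_subgroupI)
  interpret module "ps_ring K" "sec A U" by (rule presheaf_sec_module[OF U])
  have "abelian_group_hom (sec A U) (sec A U) (\<lambda>a. hbar K \<odot>\<^bsub>sec A U\<^esub> a)"
    by (rule abelian_group_hom_of_additive)
       (use hbar_in_ps_ring in \<open>simp_all add: smult_r_distr M.abelian_group_axioms\<close>)
  then interpret h: abelian_group_hom "sec A U" "sec A U" "\<lambda>a. hbar K \<odot>\<^bsub>sec A U\<^esub> a" .
  show "subgroup (hbar_multiples K A 1 U) (add_monoid (sec A U))"
    using group_hom.img_is_subgroup[OF h.a_group_hom] by (simp add: hbar_multiples_1[OF U] del: One_nat_def)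
qed

lemma hbar_multiples_res:
  assumes "openin T U" "openin T V" "V \<subseteq> U" "n \<in> hbar_multiples K A 1 U"
  shows "res A U V n \<in> hbar_multiples K A 1 V"
proof -
  obtain a where a: "a \<in> carrier (sec A U)" "n = hbar K \<odot>\<^bsub>sec A U\<^esub> a"
    using assms(4) unfolding hbar_multiples_1[OF assms(1)] by blast
  have "res A U V \<in> mod_hom (ps_ring K) (sec A U) (sec A V)" using A assms by (simp add: module_presheaf_def)
  then have "res A U V n = hbar K \<odot>\<^bsub>sec A V\<^esub> res A U V a"
    using a hbar_in_ps_ring by (simp add: mod_homD(3))
  then show ?thesis using a assms by (simp add: hbar_multiples_1 A.res_closed del: One_nat_def)
qed

interpretation Q: abelian_presheaf T "mod_hbar K A 1"
  unfolding mod_hbar_def by (rule A.quot_presheaf_abelian[OF hbar_multiples_subgroup hbar_multiples_res])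

lemma to_mod_hbar_res:
  assumes "openin T V" "openin T W" "W \<subseteq> V" "a \<in> carrier (sec A V)"
  shows "restrict (to_mod_hbar K T A 1 V a) W = to_mod_hbar K T A 1 W (res A V W a)"
proof -
  have "hbar_multiples K A 1 V +>\<^bsub>sec A V\<^esub> a \<in> carrier (sec (mod_hbar K A 1) V)"
    using assms(4) by (simp add: mod_hbar_def quot_presheaf_def carrier_quot_mod)
  then have "restrict (to_mod_hbar K T A 1 V a) W =
      germs T (mod_hbar K A 1) W (res (mod_hbar K A 1) V W (hbar_multiples K A 1 V +>\<^bsub>sec A V\<^esub> a))"
    unfolding to_mod_hbar_def by (rule Q.germs_res[OF assms(1-3)])
  then show ?thesis
    using A.quot_res_coset[OF hbar_multiples_subgroup hbar_multiples_res assms]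
    by (simp add: to_mod_hbar_def mod_hbar_def del: One_nat_def)
qed

lemma to_mod_hbar_closed:
  assumes "openin T V" "a \<in> carrier (sec A V)"
  shows "to_mod_hbar K T A 1 V a \<in> carrier (sec (reduction K T A) V)"
proof -
  have "hbar_multiples K A 1 V +>\<^bsub>sec A V\<^esub> a \<in> carrier (sec (mod_hbar K A 1) V)"
    using assms(2) by (simp add: mod_hbar_def quot_presheaf_def carrier_quot_mod)
  moreover have "restrict (germs T Q V X) V = germs T Q V X" for Q :: "('a, nat \<Rightarrow> 'k, 'm set) presheaf" and X
    by (simp add: germs_def)
  moreover have "germs T Q V X \<in> extensional V" for Q :: "('a, nat \<Rightarrow> 'k, 'm set) presheaf" and X
    by (simp add: germs_def)
  ultimately show ?thesis
    using assms(1) unfolding reduction_def restrict_scalars_def sheafify_def pointwise_def to_mod_hbar_def Let_def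
    by simp blast
qed

context
  fixes OX :: "('a, 'k, 'r) presheaf" and \<psi> :: "('a, 'r, 'm) reduction_map"
  assumes \<psi>: "sheaf_hom K T (reduction K T A) OX \<psi>"
begin

lemma reduction_lift_closed:
  "openin T V \<Longrightarrow> a \<in> carrier (sec A V) \<Longrightarrow> reduction_lift K T A \<psi> V a \<in> carrier (sec OX V)"
  unfolding reduction_lift_def by (rule sheaf_homD(2)[OF \<psi> _ to_mod_hbar_closed])

lemma reduction_lift_res:
  assumes "openin T V" "openin T W" "W \<subseteq> V" "a \<in> carrier (sec A V)"
  shows "res OX V W (reduction_lift K T A \<psi> V a) = reduction_lift K T A \<psi> W (res A V W a)"
proof -
  have "res (reduction K T A) V W (to_mod_hbar K T A 1 V a) = to_mod_hbar K T A 1 W (res A V W a)"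
    using to_mod_hbar_res[OF assms] by (simp add: reduction_def sheafify_def Let_def)
  then show ?thesis
    using sheaf_homD(5)[OF \<psi> assms(1-3) to_mod_hbar_closed[OF assms(1,4)]] by (simp add: reduction_lift_def)
qed

lemma reduction_lift_add_hbar:
  assumes V: "openin T V" and a: "a \<in> carrier (sec A V)" and b: "b \<in> carrier (sec A V)"
  shows "reduction_lift K T A \<psi> V (a \<oplus>\<^bsub>sec A V\<^esub> hbar K \<odot>\<^bsub>sec A V\<^esub> b) = reduction_lift K T A \<psi> V a"
proof -
  interpret module "ps_ring K" "sec A V" by (rule presheaf_sec_module[OF V])
  have hb: "hbar K \<odot>\<^bsub>sec A V\<^esub> b \<in> carrier (sec A V)" using b hbar_in_ps_ring by simp
  have "hbar_multiples K A 1 V +>\<^bsub>sec A V\<^esub> (a \<oplus>\<^bsub>sec A V\<^esub> hbar K \<odot>\<^bsub>sec A V\<^esub> b) = hbar_multiples K A 1 V +>\<^bsub>sec A V\<^esub> a"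
    using coset_eq_iff[OF M.abelian_group_axioms hbar_multiples_subgroup[OF V], of "a \<oplus>\<^bsub>sec A V\<^esub> hbar K \<odot>\<^bsub>sec A V\<^esub> b" a]
      a b hb M.a_comm[OF a hb] by (auto simp: hbar_multiples_1[OF V] simp del: One_nat_def)
  then show ?thesis by (simp add: reduction_lift_def to_mod_hbar_def)
qed

end

end

section \<open>Globally trivializing a deformation quantization\<close>

lemma triv_inv_of_bij:
  assumes "bij_betw (\<tau> V) (carrier (ps_mod (sec OX V))) (carrier (sec A V))"
  shows "a \<in> carrier (sec A V) \<Longrightarrow> triv_inv OX \<tau> V a \<in> carrier (ps_mod (sec OX V))"
    and "a \<in> carrier (sec A V) \<Longrightarrow> \<tau> V (triv_inv OX \<tau> V a) = a"
    and "F \<in> carrier (ps_mod (sec OX V)) \<Longrightarrow> triv_inv OX \<tau> V (\<tau> V F) = F"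
  unfolding triv_inv_def ps_sheaf_simps
  by (rule bij_betw_apply[OF bij_betw_inv_into[OF assms]], assumption)
     (rule bij_betw_inv_into_right[OF assms], assumption, rule bij_betw_inv_into_left[OF assms], assumption)

lemma module_mult_update: "module R (M\<lparr>mult := m\<rparr>) \<longleftrightarrow> module R M"
  by (simp add: module_def module_axioms_def abelian_group_def abelian_monoid_def abelian_group_axioms_def)

lemma module_sheaf_mult_update:
  assumes "module_sheaf R T F"
  shows "module_sheaf R T \<lparr>sec = (\<lambda>V. (sec F V)\<lparr>mult := m V\<rparr>), res = res F\<rparr>"
  using assms unfolding module_sheaf_def module_presheaf_def sheaf_axiom_def mod_hom_def
  by (simp add: module_mult_update) (elim conjE, assumption)

lemma ps_hom_coeff_mod_hom:
  assumes M: "module K M" and N: "module K N" and h: "h \<in> mod_hom (ps_ring K) (ps_mod M) (ps_mod N)"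
  shows "(\<lambda>f. h (ps_const M f) n) \<in> mod_hom K M N"
proof (rule mod_homI)
  interpret M: module K M by (rule M)
  interpret N: module K N by (rule N)
  note hD = mod_homD[OF h]
  have hc: "h (ps_const M f) i \<in> carrier N" if "f \<in> carrier M" for f i
    using hD(1)[OF M.ps_const_closed[OF that]] by (simp add: ps_simps)
  show "h (ps_const M f) n \<in> carrier N" if "f \<in> carrier M" for f by (rule hc[OF that])
  show "h (ps_const M (f \<oplus>\<^bsub>M\<^esub> g)) n = h (ps_const M f) n \<oplus>\<^bsub>N\<^esub> h (ps_const M g) n"
    if "f \<in> carrier M" "g \<in> carrier M" for f g
  proof -
    have "ps_const M (f \<oplus>\<^bsub>M\<^esub> g) = ps_const M f \<oplus>\<^bsub>ps_mod M\<^esub> ps_const M g"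
      by (auto simp: ps_simps ps_const_def)
    then show ?thesis using hD(2)[OF M.ps_const_closed[OF that(1)] M.ps_const_closed[OF that(2)]] by (simp add: ps_simps)
  qed
  show "h (ps_const M (c \<odot>\<^bsub>M\<^esub> f)) n = c \<odot>\<^bsub>N\<^esub> h (ps_const M f) n" if c: "c \<in> carrier K" and f: "f \<in> carrier M" for c f
  proof -
    have fc: "ps_const M f i \<in> carrier M" for i using f by (simp add: ps_const_def)
    have "ps_const M (c \<odot>\<^bsub>M\<^esub> f) = ps_const K c \<odot>\<^bsub>ps_mod M\<^esub> ps_const M f"
      unfolding M.ps_smult_const[OF c fc] using c by (auto simp: ps_const_def)
    moreover have "ps_const K c \<in> carrier (ps_ring K)" using c by (simp add: ps_simps ps_const_def)
    ultimately show ?thesis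
      using hD(3)[OF _ M.ps_const_closed[OF f]] N.ps_smult_const[OF c hc[OF f]] by simp
  qed
qed

context ringed_space
begin

text \<open>The image of the unit of the star product is a left unit of the sections of \<open>A\<close>.\<close>

lemma trivialization_one:
  assumes A: "algebra_sheaf (ps_ring K) T A" and \<tau>: "sheaf_iso (ps_ring K) T (ps_sheaf OX) A \<tau>"
    and star: "star_product K T OX (\<lambda>V F G. triv_inv OX \<tau> V (\<tau> V F \<otimes>\<^bsub>sec A V\<^esub> \<tau> V G))"
    and V: "openin T V"
  shows "\<tau> V \<one>\<^bsub>sec (ps_sheaf OX) V\<^esub> = \<one>\<^bsub>sec A V\<^esub>"
proof -
  have b: "bij_betw (\<tau> V) (carrier (ps_mod (sec OX V))) (carrier (sec A V))"
    using sheaf_iso_bij[OF \<tau> V] by (simp add: ps_sheaf_simps)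
  have \<tau>c: "\<tau> V F \<in> carrier (sec A V)" if "F \<in> carrier (ps_mod (sec OX V))" for F
    using b that by (auto simp: bij_betw_def)
  interpret A: ring "sec A V" using A V by (simp add: algebra_sheaf_def assoc_algebra_def)
  let ?S = "(ps_mod (sec OX V))\<lparr>mult := \<lambda>F G. triv_inv OX \<tau> V (\<tau> V F \<otimes>\<^bsub>sec A V\<^esub> \<tau> V G)\<rparr>"
  interpret S: ring ?S
    using star V unfolding star_product_def algebra_sheaf_def assoc_algebra_def by (simp add: ps_sheaf_simps)
  have 1: "\<one>\<^bsub>ps_mod (sec OX V)\<^esub> \<in> carrier (ps_mod (sec OX V))" using S.one_closed by simp
  obtain F where F: "F \<in> carrier (ps_mod (sec OX V))" "\<tau> V F = \<one>\<^bsub>sec A V\<^esub>"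
    using bij_betw_imp_surj_on[OF b] A.one_closed by (metis imageE)
  have "triv_inv OX \<tau> V (\<tau> V \<one>\<^bsub>ps_mod (sec OX V)\<^esub> \<otimes>\<^bsub>sec A V\<^esub> \<tau> V F) = F"
    using S.l_one[of F] F(1) by simp
  moreover have "\<dots> = triv_inv OX \<tau> V \<one>\<^bsub>sec A V\<^esub>" using triv_inv_of_bij(3)[where \<tau> = \<tau> and V = V, OF b F(1)] F(2) by simp
  ultimately have eq: "triv_inv OX \<tau> V (\<tau> V \<one>\<^bsub>ps_mod (sec OX V)\<^esub>) = triv_inv OX \<tau> V \<one>\<^bsub>sec A V\<^esub>"
    using \<tau>c[OF 1] F(2) by simp
  have "\<tau> V \<one>\<^bsub>ps_mod (sec OX V)\<^esub> = \<tau> V (triv_inv OX \<tau> V (\<tau> V \<one>\<^bsub>ps_mod (sec OX V)\<^esub>))"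
    by (rule triv_inv_of_bij(2)[where \<tau> = \<tau> and V = V, OF b \<tau>c[OF 1], symmetric])
  also have "\<dots> = \<one>\<^bsub>sec A V\<^esub>"
    unfolding eq by (rule triv_inv_of_bij(2)[where \<tau> = \<tau> and V = V, OF b A.one_closed])
  finally show ?thesis unfolding ps_sheaf_simps(1) .
qed

text \<open>Each law for the transported product follows from the same law in \<open>A\<close> by injectivity of \<open>\<tau>\<close>.\<close>

lemma transported_algebra_sheaf:
  assumes K: "cring (ps_ring K)" and A: "algebra_sheaf (ps_ring K) T A"
    and \<tau>: "sheaf_iso (ps_ring K) T (ps_sheaf OX) A \<tau>"
    and one: "\<And>V. openin T V \<Longrightarrow> \<tau> V \<one>\<^bsub>sec (ps_sheaf OX) V\<^esub> = \<one>\<^bsub>sec A V\<^esub>"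
  defines "star \<equiv> \<lambda>V F G. triv_inv OX \<tau> V (\<tau> V F \<otimes>\<^bsub>sec A V\<^esub> \<tau> V G)"
  shows "algebra_sheaf (ps_ring K) T
    \<lparr>sec = (\<lambda>V. (sec (ps_sheaf OX) V)\<lparr>mult := star V\<rparr>), res = res (ps_sheaf OX)\<rparr>"
proof -
  have ms: "module_sheaf (ps_ring K) T (ps_sheaf OX)" by (rule ps_module_sheaf[OF module_sheaf K])
  have mp: "module_presheaf (ps_ring K) T (ps_sheaf OX)" by (rule ps_presheaf_OX[OF K])
  interpret P: abelian_presheaf T "ps_sheaf OX" by (rule module_presheaf_abelian[OF mp])
  note hD = sheaf_homD[OF sheaf_iso_hom[OF \<tau>]]
  have alg: "assoc_algebra (ps_ring K) (sec A V)" if "openin T V" for V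
    using A that by (simp add: algebra_sheaf_def)
  have b: "bij_betw (\<tau> V) (carrier (ps_mod (sec OX V))) (carrier (sec A V))" if "openin T V" for V
    using sheaf_iso_bij[OF \<tau> that] by (simp add: ps_sheaf_simps)
  have \<tau>c: "\<tau> V F \<in> carrier (sec A V)" if "openin T V" "F \<in> carrier (sec (ps_sheaf OX) V)" for V F
    using hD(2)[OF that] .
  have inj: "F = G" if "openin T V" "F \<in> carrier (sec (ps_sheaf OX) V)" "G \<in> carrier (sec (ps_sheaf OX) V)"
    "\<tau> V F = \<tau> V G" for V F G
    using b[OF that(1)] that(2-4) by (simp add: bij_betw_def inj_on_def ps_sheaf_simps)
  have star: "star V F G \<in> carrier (sec (ps_sheaf OX) V)" "\<tau> V (star V F G) = \<tau> V F \<otimes>\<^bsub>sec A V\<^esub> \<tau> V G"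
    if V: "openin T V" and F: "F \<in> carrier (sec (ps_sheaf OX) V)" and G: "G \<in> carrier (sec (ps_sheaf OX) V)" for V F G
  proof -
    interpret A: ring "sec A V" using alg[OF V] by (simp add: assoc_algebra_def)
    have "\<tau> V F \<otimes>\<^bsub>sec A V\<^esub> \<tau> V G \<in> carrier (sec A V)" using \<tau>c[OF V] F G by simp
    then show "star V F G \<in> carrier (sec (ps_sheaf OX) V)" "\<tau> V (star V F G) = \<tau> V F \<otimes>\<^bsub>sec A V\<^esub> \<tau> V G"
      unfolding star_def using triv_inv_of_bij(1,2)[where \<tau> = \<tau> and V = V, OF b[OF V]] by (simp_all add: ps_sheaf_simps)
  qed
  have onec: "\<one>\<^bsub>sec (ps_sheaf OX) V\<^esub> \<in> carrier (sec (ps_sheaf OX) V)" if "openin T V" for V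
    unfolding ps_const_one using ps_const_in[OF that one_closed[OF that]] by (simp add: ps_sheaf_simps)
  show ?thesis
    unfolding algebra_sheaf_def
  proof (intro conjI allI impI)
    show "module_sheaf (ps_ring K) T \<lparr>sec = (\<lambda>V. (sec (ps_sheaf OX) V)\<lparr>mult := star V\<rparr>), res = res (ps_sheaf OX)\<rparr>"
      by (rule module_sheaf_mult_update[OF ms])
    fix V assume V: "openin T V"
    let ?S = "(sec (ps_sheaf OX) V)\<lparr>mult := star V\<rparr>"
    have M: "module (ps_ring K) (sec (ps_sheaf OX) V)" using mp V by (simp add: module_presheaf_def)
    interpret M: module "ps_ring K" "sec (ps_sheaf OX) V" by (rule M)
    interpret A: ring "sec A V" using alg[OF V] by (simp add: assoc_algebra_def)
    have mS: "module (ps_ring K) ?S" using M by (simp add: module_mult_update)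
    have "ring ?S"
    proof (rule ringI)
      show "abelian_group ?S" using mS by (rule module.axioms)
      show "monoid ?S"
        by (rule monoidI; simp; (intro inj[OF V] star(1)[OF V] onec[OF V]; simp?)?)
           (simp_all add: star[OF V] onec[OF V] one[OF V] \<tau>c[OF V] A.m_assoc)
    qed (simp_all, (intro inj[OF V] star(1)[OF V] M.a_closed; simp add: star[OF V] hD(3)[OF V] \<tau>c[OF V] A.l_distr A.r_distr)+)
    moreover have "star V (a \<odot>\<^bsub>sec (ps_sheaf OX) V\<^esub> F) G = a \<odot>\<^bsub>sec (ps_sheaf OX) V\<^esub> star V F G \<and>
        star V F (a \<odot>\<^bsub>sec (ps_sheaf OX) V\<^esub> G) = a \<odot>\<^bsub>sec (ps_sheaf OX) V\<^esub> star V F G"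
      if "a \<in> carrier (ps_ring K)" "F \<in> carrier (sec (ps_sheaf OX) V)" "G \<in> carrier (sec (ps_sheaf OX) V)" for a F G
    proof (intro conjI inj[OF V])
      note sc = M.smult_closed[OF that(1)]
      show "\<tau> V (star V (a \<odot>\<^bsub>sec (ps_sheaf OX) V\<^esub> F) G) = \<tau> V (a \<odot>\<^bsub>sec (ps_sheaf OX) V\<^esub> star V F G)"
        "\<tau> V (star V F (a \<odot>\<^bsub>sec (ps_sheaf OX) V\<^esub> G)) = \<tau> V (a \<odot>\<^bsub>sec (ps_sheaf OX) V\<^esub> star V F G)"
        using alg[OF V] that sc \<tau>c[OF V] unfolding assoc_algebra_def
        by (simp_all add: star[OF V] hD(4)[OF V])
    qed (use that M.smult_closed star(1)[OF V] in simp_all)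
    ultimately show "assoc_algebra (ps_ring K) (sec \<lparr>sec = (\<lambda>V. (sec (ps_sheaf OX) V)\<lparr>mult := star V\<rparr>), res = res (ps_sheaf OX)\<rparr> V)"
      using mS by (simp add: assoc_algebra_def)
  next
    fix V W assume "openin T V \<and> openin T W \<and> W \<subseteq> V"
    then have V: "openin T V" and W: "openin T W" "W \<subseteq> V" by auto
    note rc = P.res_closed[OF V W]
    have rA: "res A V W \<in> ring_hom (sec A V) (sec A W)" using A V W by (simp add: algebra_sheaf_def)
    have "res (ps_sheaf OX) V W (star V F G) = star W (res (ps_sheaf OX) V W F) (res (ps_sheaf OX) V W G)"
      if "F \<in> carrier (sec (ps_sheaf OX) V)" "G \<in> carrier (sec (ps_sheaf OX) V)" for F G
      using that star[OF V that] star[OF W(1) rc rc, OF that] ring_hom_mult[OF rA] \<tau>c[OF V]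
      by (intro inj[OF W(1)]) (simp_all add: rc hD(5)[OF V W])
    moreover have "res (ps_sheaf OX) V W \<one>\<^bsub>sec (ps_sheaf OX) V\<^esub> = \<one>\<^bsub>sec (ps_sheaf OX) W\<^esub>"
      unfolding ps_const_one by (simp add: ps_const_res[OF V W] res_one[OF V W])
    ultimately show "res \<lparr>sec = (\<lambda>V. (sec (ps_sheaf OX) V)\<lparr>mult := star V\<rparr>), res = res (ps_sheaf OX)\<rparr> V W
      \<in> ring_hom (sec \<lparr>sec = (\<lambda>V. (sec (ps_sheaf OX) V)\<lparr>mult := star V\<rparr>), res = res (ps_sheaf OX)\<rparr> V)
         (sec \<lparr>sec = (\<lambda>V. (sec (ps_sheaf OX) V)\<lparr>mult := star V\<rparr>), res = res (ps_sheaf OX)\<rparr> W)"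
      by (intro ring_hom_memI) (simp_all add: rc P.res_add[OF V W])
  qed
qed

lemma bidiff_opI_local:
  assumes lin: "\<And>V f. openin T V \<Longrightarrow> f \<in> carrier (sec OX V) \<Longrightarrow>
      (\<lambda>g. \<beta> V f g) \<in> mod_hom K (sec OX V) (sec OX V) \<and> (\<lambda>g. \<beta> V g f) \<in> mod_hom K (sec OX V) (sec OX V)"
    and res: "\<And>V W f g. openin T V \<Longrightarrow> openin T W \<Longrightarrow> W \<subseteq> V \<Longrightarrow> f \<in> carrier (sec OX V) \<Longrightarrow>
      g \<in> carrier (sec OX V) \<Longrightarrow> \<beta> W (res OX V W f) (res OX V W g) = res OX V W (\<beta> V f g)"
    and U: "\<And>i. i \<in> I \<Longrightarrow> openin T (U i)" "(\<Union>i\<in>I. U i) = topspace T"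
    and loc: "\<And>i. i \<in> I \<Longrightarrow> bidiff_op K (subtopology T (U i)) OX \<beta>"
  shows "bidiff_op K T OX \<beta>"
  unfolding bidiff_op_def
proof (intro conjI allI impI ballI)
  fix x assume "x \<in> topspace T"
  then obtain i where i: "i \<in> I" "x \<in> U i" using U(2) by blast
  have "x \<in> topspace (subtopology T (U i))" using topspace_sub[OF U(1)[OF i(1)]] i(2) by simp
  then obtain V d where V: "openin (subtopology T (U i)) V" "x \<in> V"
    and sl: "slices_less d d (subtopology T (U i)) OX \<beta> V"
    by (rule ringed_space.bidiff_local[OF ringed_sub[OF U(1)[OF i(1)]] loc[OF i(1)]])
  have V': "openin T V" "V \<subseteq> U i" using V(1) by (auto simp: openin_sub[OF U(1)[OF i(1)]])
  have *: "\<forall>W f. openin T W \<and> W \<subseteq> V \<and> f \<in> carrier (sec OX W) \<longrightarrow>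
      diff_order_less d (subtopology T W) OX (\<lambda>W' g. \<beta> W' (res OX W W' f) g) \<and>
      diff_order_less d (subtopology T W) OX (\<lambda>W' g. \<beta> W' g (res OX W W' f))"
  proof (intro allI impI)
    fix W f assume "openin T W \<and> W \<subseteq> V \<and> f \<in> carrier (sec OX W)"
    then have W: "openin T W" "W \<subseteq> V" and f: "f \<in> carrier (sec OX W)" by auto
    have "openin (subtopology T (U i)) W" "W \<subseteq> U i" using W V' by (auto simp: openin_sub[OF U(1)[OF i(1)]])
    from slices_lessD[OF sl this(1) W(2) f] this(2)
    show "diff_order_less d (subtopology T W) OX (\<lambda>W' g. \<beta> W' (res OX W W' f) g) \<and>
        diff_order_less d (subtopology T W) OX (\<lambda>W' g. \<beta> W' g (res OX W W' f))"
      by (simp add: subtopology_sub)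
  qed
  show "\<exists>V d. openin T V \<and> x \<in> V \<and> (\<forall>W f. openin T W \<and> W \<subseteq> V \<and> f \<in> carrier (sec OX W) \<longrightarrow>
      diff_order_less d (subtopology T W) OX (\<lambda>W' g. \<beta> W' (res OX W W' f) g) \<and>
      diff_order_less d (subtopology T W) OX (\<lambda>W' g. \<beta> W' g (res OX W W' f)))"
    by (intro exI[of _ V] exI[of _ d] conjI V'(1) V(2) *)
qed (use lin res in simp_all)

text \<open>Each coefficient of a \<open>K[[\<hbar>]]\<close>-bilinear product is \<open>K\<close>-bilinear on constants.\<close>

lemma bilinear_coeff_mod_hom:
  assumes "assoc_algebra (ps_ring K) ((ps_mod (sec OX V))\<lparr>mult := star\<rparr>)" "openin T V" "f \<in> carrier (sec OX V)"
  shows "(\<lambda>g. star (ps_const (sec OX V) f) (ps_const (sec OX V) g) k) \<in> mod_hom K (sec OX V) (sec OX V)"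
    and "(\<lambda>g. star (ps_const (sec OX V) g) (ps_const (sec OX V) f) k) \<in> mod_hom K (sec OX V) (sec OX V)"
proof -
  let ?S = "(ps_mod (sec OX V))\<lparr>mult := star\<rparr>" and ?F = "ps_const (sec OX V) f"
  have F: "?F \<in> carrier ?S" using ps_const_in[OF assms(2,3)] by simp
  interpret ring ?S using assms(1) by (simp add: assoc_algebra_def)
  note m = module[OF assms(2)]
  have "(\<lambda>G. star ?F G) \<in> mod_hom (ps_ring K) (ps_mod (sec OX V)) (ps_mod (sec OX V))"
    using m_closed[OF F] r_distr[OF _ _ F] assms(1) F by (intro mod_homI) (simp_all add: assoc_algebra_def)
  from ps_hom_coeff_mod_hom[OF m m this]
  show "(\<lambda>g. star ?F (ps_const (sec OX V) g) k) \<in> mod_hom K (sec OX V) (sec OX V)" .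
  have "(\<lambda>G. star G ?F) \<in> mod_hom (ps_ring K) (ps_mod (sec OX V)) (ps_mod (sec OX V))"
    using m_closed[OF _ F] l_distr[OF _ _ F] assms(1) F by (intro mod_homI) (simp_all add: assoc_algebra_def)
  from ps_hom_coeff_mod_hom[OF m m this]
  show "(\<lambda>g. star (ps_const (sec OX V) g) ?F k) \<in> mod_hom K (sec OX V) (sec OX V)" .
qed

text \<open>Everything that makes \<open>\<sigma>\<close> a differential trivialization can be checked on the members of the cover,
  where \<open>\<sigma> = \<tau> i \<circ> \<rho> i\<close>: the product it induces is the one induced by \<open>\<tau> i\<close>, transported along \<open>\<rho> i\<close>,
  and \<open>\<sigma>\<close> agrees with \<open>\<tau> i\<close> on functions modulo \<open>\<hbar>\<close>.\<close>

lemma global_diff_trivialization: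
  assumes K: "cring (ps_ring K)" and A: "algebra_sheaf (ps_ring K) T A"
    and \<psi>: "sheaf_hom K T (reduction K T A) OX \<psi>"
    and U: "\<And>i. i \<in> I \<Longrightarrow> openin T (U i)" "(\<Union>i\<in>I. U i) = topspace T"
    and \<tau>: "\<And>i. i \<in> I \<Longrightarrow> diff_trivialization K T OX A \<psi> (U i) (\<tau> i)"
    and \<rho>: "\<And>i. i \<in> I \<Longrightarrow> gauge_equivalence K (subtopology T (U i)) OX (\<rho> i)"
    and \<sigma>: "sheaf_hom (ps_ring K) T (ps_sheaf OX) A \<sigma>"
    and \<sigma>\<tau>: "\<And>i V F. i \<in> I \<Longrightarrow> openin T V \<Longrightarrow> V \<subseteq> U i \<Longrightarrow> F \<in> carrier (ps_mod (sec OX V)) \<Longrightarrow>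
      \<sigma> V F = \<tau> i V (\<rho> i V F)"
  shows "diff_trivialization K T OX A \<psi> (topspace T) \<sigma>"
proof -
  have mA: "module_sheaf (ps_ring K) T A" using A by (simp add: algebra_sheaf_def)
  then have mpA: "module_presheaf (ps_ring K) T A" and saA: "sheaf_axiom T A" by (auto simp: module_sheaf_def)
  interpret A: abelian_presheaf T A by (rule module_presheaf_abelian[OF mpA])
  have ms: "module_sheaf (ps_ring K) T (ps_sheaf OX)" by (rule ps_module_sheaf[OF module_sheaf K])
  have X: "openin T (topspace T)" by simp
  have K_ring: "ring K" using module[OF X] by (simp add: module_def cring_def)
  have Vi: "openin (subtopology T (U i)) V \<longleftrightarrow> openin T V \<and> V \<subseteq> U i" if "i \<in> I" for i V
    by (rule openin_sub[OF U(1)[OF that]])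
  have cover: "V = (\<Union>i\<in>I. V \<inter> U i)" if "openin T V" for V
    using openin_subset[OF that] unfolding U(2)[symmetric] by blast
  have \<tau>iso: "sheaf_iso (ps_ring K) (subtopology T (U i)) (ps_sheaf OX) A (\<tau> i)"
    and \<tau>star: "star_product K (subtopology T (U i)) OX (\<lambda>V F G. triv_inv OX (\<tau> i) V (\<tau> i V F \<otimes>\<^bsub>sec A V\<^esub> \<tau> i V G))"
    and \<tau>red: "\<And>V f. openin T V \<Longrightarrow> V \<subseteq> U i \<Longrightarrow> f \<in> carrier (sec OX V) \<Longrightarrow>
      reduction_lift K T A \<psi> V (\<tau> i V (ps_const (sec OX V) f)) = f"
    if "i \<in> I" for i
    using \<tau>[OF that] Vi[OF that] unfolding diff_trivialization_def by simp_all
  have \<tau>b: "bij_betw (\<tau> i V) (carrier (ps_mod (sec OX V))) (carrier (sec A V))"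
    if "i \<in> I" "openin T V" "V \<subseteq> U i" for i V
    using sheaf_iso_bij[OF \<tau>iso[OF that(1)]] Vi[OF that(1)] that by (simp add: ps_sheaf_simps)
  have \<rho>iso: "sheaf_iso (ps_ring K) (subtopology T (U i)) (ps_sheaf OX) (ps_sheaf OX) (\<rho> i)" if "i \<in> I" for i
    using \<rho>[OF that] by (simp add: gauge_equivalence_def)
  have \<rho>b: "bij_betw (\<rho> i V) (carrier (ps_mod (sec OX V))) (carrier (ps_mod (sec OX V)))"
    if "i \<in> I" "openin T V" "V \<subseteq> U i" for i V
    using sheaf_iso_bij[OF \<rho>iso[OF that(1)]] Vi[OF that(1)] that by (simp add: ps_sheaf_simps)
  have \<rho>c: "\<rho> i V F \<in> carrier (ps_mod (sec OX V))"
    if "i \<in> I" "openin T V" "V \<subseteq> U i" "F \<in> carrier (ps_mod (sec OX V))" for i V F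
    using bij_betw_apply[OF \<rho>b[OF that(1-3)] that(4)] .
  have \<tau>c: "\<tau> i V F \<in> carrier (sec A V)"
    if "i \<in> I" "openin T V" "V \<subseteq> U i" "F \<in> carrier (ps_mod (sec OX V))" for i V F
    using bij_betw_apply[OF \<tau>b[OF that(1-3)] that(4)] .
  have \<sigma>iso: "sheaf_iso (ps_ring K) T (ps_sheaf OX) A \<sigma>"
  proof (rule sheaf_iso_if_locally_bij[OF ms mpA saA \<sigma> U])
    fix i V assume i: "i \<in> I" and V: "openin T V" "V \<subseteq> U i"
    show "bij_betw (\<sigma> V) (carrier (sec (ps_sheaf OX) V)) (carrier (sec A V))"
      unfolding ps_sheaf_simps(1)
      using bij_betw_trans[OF \<rho>b[OF i V] \<tau>b[OF i V]]
      by (subst bij_betw_cong[of _ "\<sigma> V" "\<tau> i V \<circ> \<rho> i V"]) (simp_all add: \<sigma>\<tau>[OF i V])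
  qed assumption
  have \<sigma>b: "bij_betw (\<sigma> V) (carrier (ps_mod (sec OX V))) (carrier (sec A V))" if "openin T V" for V
    using sheaf_iso_bij[OF \<sigma>iso that] by (simp add: ps_sheaf_simps)
  note \<sigma>D = sheaf_homD[OF \<sigma>]
  have rA: "res A V W \<in> ring_hom (sec A V) (sec A W)" if "openin T V" "openin T W" "W \<subseteq> V" for V W
    using A that by (simp add: algebra_sheaf_def)
  have ringA: "ring (sec A V)" if "openin T V" for V
    using A that by (simp add: algebra_sheaf_def assoc_algebra_def)
  have one: "\<sigma> V \<one>\<^bsub>sec (ps_sheaf OX) V\<^esub> = \<one>\<^bsub>sec A V\<^esub>" if V: "openin T V" for V
  proof (rule sheaf_separated[OF A.abelian_presheaf_axioms saA _ cover[OF V]])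
    have 1: "\<one>\<^bsub>sec (ps_sheaf OX) W\<^esub> \<in> carrier (ps_mod (sec OX W))" if "openin T W" for W
      unfolding ps_const_one by (rule ps_const_in[OF that one_closed[OF that]])
    then show "\<sigma> V \<one>\<^bsub>sec (ps_sheaf OX) V\<^esub> \<in> carrier (sec A V)" using bij_betw_apply[OF \<sigma>b[OF V] 1[OF V]] by simp
    show "\<one>\<^bsub>sec A V\<^esub> \<in> carrier (sec A V)" using ringA[OF V] by (rule ring.ring_simprules)
    fix i assume i: "i \<in> I"
    let ?W = "V \<inter> U i"
    show W: "openin T ?W" using V U(1)[OF i] by auto
    have "res A V ?W (\<sigma> V \<one>\<^bsub>sec (ps_sheaf OX) V\<^esub>) = \<sigma> ?W (res (ps_sheaf OX) V ?W \<one>\<^bsub>sec (ps_sheaf OX) V\<^esub>)"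
      using \<sigma>D(5)[OF V W Int_lower1] 1[OF V] by (simp add: ps_sheaf_simps(1))
    also have "res (ps_sheaf OX) V ?W \<one>\<^bsub>sec (ps_sheaf OX) V\<^esub> = \<one>\<^bsub>sec (ps_sheaf OX) ?W\<^esub>"
      unfolding ps_const_one by (simp add: ps_const_res[OF V W] res_one[OF V W])
    also have "\<sigma> ?W \<one>\<^bsub>sec (ps_sheaf OX) ?W\<^esub> = \<tau> i ?W (\<rho> i ?W \<one>\<^bsub>sec (ps_sheaf OX) ?W\<^esub>)"
      by (rule \<sigma>\<tau>[OF i W Int_lower2 1[OF W]])
    also have "\<rho> i ?W \<one>\<^bsub>sec (ps_sheaf OX) ?W\<^esub> = \<one>\<^bsub>sec (ps_sheaf OX) ?W\<^esub>"
      using \<rho>[OF i] Vi[OF i] W by (simp add: gauge_equivalence_def)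
    also have "\<tau> i ?W \<one>\<^bsub>sec (ps_sheaf OX) ?W\<^esub> = \<one>\<^bsub>sec A ?W\<^esub>"
      by (rule ringed_space.trivialization_one[OF ringed_sub[OF U(1)[OF i]] algebra_sheaf_sub[OF A U(1)[OF i]] \<tau>iso[OF i] \<tau>star[OF i]])
         (simp add: Vi[OF i] W)
    also have "\<one>\<^bsub>sec A ?W\<^esub> = res A V ?W \<one>\<^bsub>sec A V\<^esub>" using ring_hom_one[OF rA[OF V W Int_lower1]] by simp
    finally show "res A V ?W (\<sigma> V \<one>\<^bsub>sec (ps_sheaf OX) V\<^esub>) = res A V ?W \<one>\<^bsub>sec A V\<^esub>" .
  qed
  define star where "star V F G = triv_inv OX \<sigma> V (\<sigma> V F \<otimes>\<^bsub>sec A V\<^esub> \<sigma> V G)" for V F G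
  have star_alg: "algebra_sheaf (ps_ring K) T
      \<lparr>sec = (\<lambda>V. (sec (ps_sheaf OX) V)\<lparr>mult := star V\<rparr>), res = res (ps_sheaf OX)\<rparr>"
    unfolding star_def by (rule transported_algebra_sheaf[OF K A \<sigma>iso one])
  let ?c = "\<lambda>V. ps_const (sec OX V)"
  have star: "star V F G \<in> carrier (ps_mod (sec OX V))" "\<sigma> V (star V F G) = \<sigma> V F \<otimes>\<^bsub>sec A V\<^esub> \<sigma> V G"
    if V: "openin T V" and F: "F \<in> carrier (ps_mod (sec OX V))" and G: "G \<in> carrier (ps_mod (sec OX V))" for V F G
  proof -
    have "\<sigma> V F \<otimes>\<^bsub>sec A V\<^esub> \<sigma> V G \<in> carrier (sec A V)"
      by (rule ring.ring_simprules(5)[OF ringA[OF V] bij_betw_apply[OF \<sigma>b[OF V] F] bij_betw_apply[OF \<sigma>b[OF V] G]])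
    then show "star V F G \<in> carrier (ps_mod (sec OX V))" "\<sigma> V (star V F G) = \<sigma> V F \<otimes>\<^bsub>sec A V\<^esub> \<sigma> V G"
      unfolding star_def by (rule triv_inv_of_bij(1,2)[where \<tau> = \<sigma> and V = V, OF \<sigma>b[OF V]])+
  qed
  \<comment> \<open>on \<open>U i\<close> the new product is the old one, transported along the gauge equivalence \<open>\<rho> i\<close>\<close>
  have star_\<rho>: "\<rho> i V (star V F G) = triv_inv OX (\<tau> i) V (\<tau> i V (\<rho> i V F) \<otimes>\<^bsub>sec A V\<^esub> \<tau> i V (\<rho> i V G))"
    if i: "i \<in> I" and V: "openin T V" "V \<subseteq> U i" and F: "F \<in> carrier (ps_mod (sec OX V))"
      and G: "G \<in> carrier (ps_mod (sec OX V))" for i V F G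
  proof -
    have "\<rho> i V (star V F G) = triv_inv OX (\<tau> i) V (\<tau> i V (\<rho> i V (star V F G)))"
      using triv_inv_of_bij(3)[where \<tau> = "\<tau> i" and V = V, OF \<tau>b[OF i V] \<rho>c[OF i V star(1)[OF V(1) F G]]] by simp
    then show ?thesis
      using star(2)[OF V(1) F G] \<sigma>\<tau>[OF i V star(1)[OF V(1) F G]] \<sigma>\<tau>[OF i V F] \<sigma>\<tau>[OF i V G] by simp
  qed
  have loc: "bidiff_op K (subtopology T (U i)) OX (\<lambda>V f g. star V (?c V f) (?c V g) k)"
    "\<And>V f g. openin (subtopology T (U i)) V \<Longrightarrow> f \<in> carrier (sec OX V) \<Longrightarrow> g \<in> carrier (sec OX V) \<Longrightarrow>
      star V (?c V f) (?c V g) 0 = f \<otimes>\<^bsub>sec OX V\<^esub> g"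
    if i: "i \<in> I" for i k
  proof -
    interpret Ui: ringed_space K "subtopology T (U i)" OX by (rule ringed_sub[OF U(1)[OF i]])
    have tr: "star V F G \<in> carrier (ps_mod (sec OX V)) \<and>
        \<rho> i V (star V F G) = triv_inv OX (\<tau> i) V (\<tau> i V (\<rho> i V F) \<otimes>\<^bsub>sec A V\<^esub> \<tau> i V (\<rho> i V G))"
      if "openin (subtopology T (U i)) V" "F \<in> carrier (ps_mod (sec OX V))" "G \<in> carrier (ps_mod (sec OX V))" for V F G
      using star(1)[OF _ that(2,3)] star_\<rho>[OF i _ _ that(2,3)] that(1) Vi[OF i] by simp
    show "bidiff_op K (subtopology T (U i)) OX (\<lambda>V f g. star V (?c V f) (?c V g) k)"
      by (rule Ui.star_transport_coeff(1)[OF \<tau>star[OF i] \<rho>[OF i] tr])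
    show "star V (?c V f) (?c V g) 0 = f \<otimes>\<^bsub>sec OX V\<^esub> g"
      if "openin (subtopology T (U i)) V" "f \<in> carrier (sec OX V)" "g \<in> carrier (sec OX V)" for V f g
      by (rule Ui.star_transport_coeff(2)[OF \<tau>star[OF i] \<rho>[OF i] tr that])
  qed
  have alg: "assoc_algebra (ps_ring K) ((ps_mod (sec OX V))\<lparr>mult := star V\<rparr>)" if "openin T V" for V
    using star_alg that by (simp add: algebra_sheaf_def ps_sheaf_simps)
  have star_res: "res OX V W (star V (?c V f) (?c V g) k) = star W (?c W (res OX V W f)) (?c W (res OX V W g)) k"
    if V: "openin T V" and W: "openin T W" "W \<subseteq> V" and f: "f \<in> carrier (sec OX V)" and g: "g \<in> carrier (sec OX V)" for V W f g k
  proof -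
    have "res (ps_sheaf OX) V W \<in> ring_hom ((ps_mod (sec OX V))\<lparr>mult := star V\<rparr>) ((ps_mod (sec OX W))\<lparr>mult := star W\<rparr>)"
      using star_alg V W by (simp add: algebra_sheaf_def ps_sheaf_simps(1))
    from ring_hom_mult[OF this, of "?c V f" "?c V g"]
    have "res (ps_sheaf OX) V W (star V (?c V f) (?c V g)) = star W (?c W (res OX V W f)) (?c W (res OX V W g))"
      using ps_const_in[OF V f] ps_const_in[OF V g] by (simp add: ps_const_res[OF V W])
    then show ?thesis by (simp add: ps_sheaf_simps fun_eq_iff)
  qed
  have bidiff: "bidiff_op K T OX (\<lambda>V f g. star V (?c V f) (?c V g) k)" for k
    by (rule bidiff_opI_local[OF _ _ U loc(1)])
       (simp_all add: bilinear_coeff_mod_hom[OF alg] star_res)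
  have star0: "star V (?c V f) (?c V g) 0 = f \<otimes>\<^bsub>sec OX V\<^esub> g"
    if V: "openin T V" and f: "f \<in> carrier (sec OX V)" and g: "g \<in> carrier (sec OX V)" for V f g
  proof (rule sheaf_separated[OF abelian_presheaf_axioms sheaf_axiom _ cover[OF V]])
    show "star V (?c V f) (?c V g) 0 \<in> carrier (sec OX V)"
      using star(1)[OF V ps_const_in[OF V f] ps_const_in[OF V g]] by (simp add: ps_simps)
    show "f \<otimes>\<^bsub>sec OX V\<^esub> g \<in> carrier (sec OX V)" by (rule mult_closed[OF V f g])
    fix i assume i: "i \<in> I"
    show W: "openin T (V \<inter> U i)" using V U(1)[OF i] by auto
    show "res OX V (V \<inter> U i) (star V (?c V f) (?c V g) 0) = res OX V (V \<inter> U i) (f \<otimes>\<^bsub>sec OX V\<^esub> g)"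
      unfolding star_res[OF V W Int_lower1 f g] res_mult[OF V W Int_lower1 f g]
      by (rule loc(2)[OF i]) (simp_all add: Vi[OF i] W res_closed[OF V W Int_lower1] f g)
  qed
  have star_product: "star_product K T OX star"
    unfolding star_product_def
  proof (intro conjI star_alg exI[of _ "\<lambda>k V f g. star V (?c V f) (?c V g) k"] allI impI bidiff)
    show "star V (?c V f) (?c V g) = (\<lambda>j. if j = 0 then f \<otimes>\<^bsub>sec OX V\<^esub> g else star V (?c V f) (?c V g) j)"
      if "openin T V \<and> f \<in> carrier (sec OX V) \<and> g \<in> carrier (sec OX V)" for V f g
      using star0 that by (simp add: fun_eq_iff)
  qed
  have star_eq: "star = (\<lambda>V F G. triv_inv OX \<sigma> V (\<sigma> V F \<otimes>\<^bsub>sec A V\<^esub> \<sigma> V G))"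
    by (intro ext) (simp add: star_def)
  have red: "reduction_lift K T A \<psi> V (\<sigma> V (?c V f)) = f"
    if V: "openin T V" and f: "f \<in> carrier (sec OX V)" for V f
  proof (rule sheaf_separated[OF abelian_presheaf_axioms sheaf_axiom _ cover[OF V] _ f])
    note \<sigma>cf = bij_betw_apply[OF \<sigma>b[OF V] ps_const_in[OF V f]]
    show "reduction_lift K T A \<psi> V (\<sigma> V (?c V f)) \<in> carrier (sec OX V)"
      by (rule reduction_lift_closed[OF mpA K_ring \<psi> V \<sigma>cf])
    fix i assume i: "i \<in> I"
    let ?W = "V \<inter> U i" and ?f = "res OX V (V \<inter> U i) f"
    show W: "openin T ?W" using V U(1)[OF i] by auto
    have f': "?f \<in> carrier (sec OX ?W)" by (rule res_closed[OF V W Int_lower1 f])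
    note cf' = ps_const_in[OF W f']
    note \<rho>cf = \<rho>c[OF i W Int_lower2 cf']
    have WU: "openin (subtopology T (U i)) ?W" by (simp add: Vi[OF i] W)
    have t: "(\<lambda>n. \<rho> i ?W (?c ?W ?f) (Suc n)) \<in> carrier (ps_mod (sec OX ?W))" (is "?H \<in> _")
      using \<rho>cf by (simp add: ps_simps)
    have "\<rho> i ?W (?c ?W ?f) 0 = ?f"
      by (rule ringed_space.gauge_coeff_0[OF ringed_sub[OF U(1)[OF i]] \<rho>[OF i] WU f'])
    then have split: "\<rho> i ?W (?c ?W ?f) = ?c ?W ?f \<oplus>\<^bsub>ps_mod (sec OX ?W)\<^esub> hbar K \<odot>\<^bsub>ps_mod (sec OX ?W)\<^esub> ?H"
      using module.ps_split[OF module[OF W] \<rho>cf] by simp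
    have \<tau>m: "\<tau> i ?W \<in> mod_hom (ps_ring K) (ps_mod (sec OX ?W)) (sec A ?W)"
      using sheaf_homD(1)[OF sheaf_iso_hom[OF \<tau>iso[OF i]] WU] by (simp add: ps_sheaf_simps)
    have hK: "hbar K \<in> carrier (ps_ring K)" by (rule hbar_in_ps_ring[OF mpA K_ring])
    have hH: "hbar K \<odot>\<^bsub>ps_mod (sec OX ?W)\<^esub> ?H \<in> carrier (ps_mod (sec OX ?W))"
      by (rule module.smult_closed[OF module.ps_module[OF module[OF W] K] hK t])
    have "res OX V ?W (reduction_lift K T A \<psi> V (\<sigma> V (?c V f))) =
        reduction_lift K T A \<psi> ?W (res A V ?W (\<sigma> V (?c V f)))"
      by (rule reduction_lift_res[OF mpA K_ring \<psi> V W Int_lower1 \<sigma>cf])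
    also have "res A V ?W (\<sigma> V (?c V f)) = \<sigma> ?W (res (ps_sheaf OX) V ?W (?c V f))"
      using \<sigma>D(5)[OF V W Int_lower1, of "?c V f"] ps_const_in[OF V f] by (simp add: ps_sheaf_simps(1))
    also have "\<dots> = \<tau> i ?W (\<rho> i ?W (?c ?W ?f))"
      unfolding ps_const_res[OF V W Int_lower1] by (rule \<sigma>\<tau>[OF i W Int_lower2 cf'])
    also have "\<dots> = \<tau> i ?W (?c ?W ?f) \<oplus>\<^bsub>sec A ?W\<^esub> hbar K \<odot>\<^bsub>sec A ?W\<^esub> \<tau> i ?W ?H"
      by (rule trans[OF arg_cong[OF split]]) (simp only: mod_homD(2)[OF \<tau>m cf' hH] mod_homD(3)[OF \<tau>m hK t])
    also have "reduction_lift K T A \<psi> ?W \<dots> = reduction_lift K T A \<psi> ?W (\<tau> i ?W (?c ?W ?f))"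
      by (rule reduction_lift_add_hbar[OF mpA K_ring \<psi> W \<tau>c[OF i W Int_lower2 cf'] \<tau>c[OF i W Int_lower2 t]])
    also have "\<dots> = ?f" by (rule \<tau>red[OF i W Int_lower2 f'])
    finally show "res OX V ?W (reduction_lift K T A \<psi> V (\<sigma> V (?c V f))) = ?f" .
  qed
  show ?thesis
    unfolding diff_trivialization_def subtopology_topspace
    using \<sigma>iso star_product red by (simp add: star_eq)
qed

text \<open>The trivialization \<open>\<sigma>\<close> is glued from the maps \<open>\<tau> i \<circ> \<rho> i\<close>, where \<open>\<rho>\<close> splits the cocycle of the
  transition maps. Compared with \<open>\<tau> i\<close> it differs by the inverse of \<open>\<rho> i\<close>, which is a gauge
  equivalence again. So the identity of \<open>A\<close> is a gauge equivalence between the two differential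
  structures.\<close>

theorem differential_structure_globally_trivializes:
  fixes A :: "('a, nat \<Rightarrow> 'k, 'm) presheaf" and \<tau> :: "('i, 'a, 'r, 'm) triv_family"
  assumes H1: "carrier (H1 T \<D>) = {\<zero>\<^bsub>H1 T \<D>\<^esub>}"
    and A: "algebra_sheaf (ps_ring K) T A" and \<psi>: "sheaf_hom K T (reduction K T A) OX \<psi>"
    and \<tau>: "diff_structure K T OX A \<psi> \<tau>"
  obtains \<tau>' :: "(unit, 'a, 'r, 'm) triv_family" where "diff_structure K T OX A \<psi> \<tau>'"
    "globally_trivialized T \<tau>'" "dq_gauge_equivalence K T OX A \<psi> \<tau> A \<psi> \<tau>' (\<lambda>V a. a)"
proof -
  let ?I = "idx \<tau>" and ?U = "cov \<tau>" and ?t = "triv \<tau>"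
  have U: "\<And>i. i \<in> ?I \<Longrightarrow> openin T (?U i)" "(\<Union>i\<in>?I. ?U i) = topspace T"
    and tr: "\<And>i. i \<in> ?I \<Longrightarrow> diff_trivialization K T OX A \<psi> (?U i) (?t i)"
    and g: "\<And>i j. i \<in> ?I \<Longrightarrow> j \<in> ?I \<Longrightarrow> gauge_equivalence K (subtopology T (?U i \<inter> ?U j)) OX
        (\<lambda>V F. triv_inv OX (?t j) V (?t i V F))"
    using \<tau> unfolding diff_structure_def by simp_all
  have mA: "module_sheaf (ps_ring K) T A" using A by (simp add: algebra_sheaf_def)
  then have mpA: "module_presheaf (ps_ring K) T A" by (simp add: module_sheaf_def)
  have X: "openin T (topspace T)" by simp
  have "module (ps_ring K) (sec A (topspace T))" using mpA X by (simp only: module_presheaf_def)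
  then have K: "cring (ps_ring K)" by (rule module.axioms)
  have tiso: "sheaf_iso (ps_ring K) (subtopology T (?U i)) (ps_sheaf OX) A (?t i)" if "i \<in> ?I" for i
    using tr[OF that] unfolding diff_trivialization_def by simp
  have tb: "bij_betw (?t i V) (carrier (ps_mod (sec OX V))) (carrier (sec A V))"
    if "i \<in> ?I" "openin T V" "V \<subseteq> ?U i" for i V
    using sheaf_iso_bij[OF tiso[OF that(1)]] openin_sub[OF U(1)[OF that(1)]] that by (simp add: ps_sheaf_simps)
  note tinv = triv_inv_of_bij[where \<tau> = "?t i" and V = V for i V, OF tb]
  have tc: "?t i V F \<in> carrier (sec A V)"
    if "i \<in> ?I" "openin T V" "V \<subseteq> ?U i" "F \<in> carrier (ps_mod (sec OX V))" for i V F
    using bij_betw_apply[OF tb[OF that(1-3)] that(4)] .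
  have cocycle: "triv_inv OX (?t l) V (?t j V (triv_inv OX (?t j) V (?t i V F))) = triv_inv OX (?t l) V (?t i V F)"
    if "i \<in> ?I" "j \<in> ?I" "l \<in> ?I" "openin T V" "V \<subseteq> ?U i \<inter> ?U j \<inter> ?U l" "F \<in> carrier (ps_mod (sec OX V))" for i j l V F
    using tinv(2)[OF that(2,4) _ tc[OF that(1,4) _ that(6)]] that(5) by simp
  have "\<exists>\<rho>. (\<forall>i\<in>?I. gauge_equivalence K (subtopology T (?U i)) OX (\<rho> i)) \<and>
      (\<forall>i\<in>?I. \<forall>j\<in>?I. \<forall>V F. openin T V \<and> V \<subseteq> ?U i \<inter> ?U j \<and> F \<in> carrier (ps_mod (sec OX V)) \<longrightarrow>
        triv_inv OX (?t j) V (?t i V (\<rho> i V F)) = \<rho> j V F)"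
    by (rule gauge_cocycle_splits[OF H1 U, of "\<lambda>i j V F. triv_inv OX (?t j) V (?t i V F)"])
       (assumption, rule g, assumption, assumption, rule cocycle, assumption+, blast)
  then obtain \<rho> where \<rho>0: "\<forall>i\<in>?I. gauge_equivalence K (subtopology T (?U i)) OX (\<rho> i)"
    and glue0: "\<forall>i\<in>?I. \<forall>j\<in>?I. \<forall>V F. openin T V \<and> V \<subseteq> ?U i \<inter> ?U j \<and> F \<in> carrier (ps_mod (sec OX V)) \<longrightarrow>
        triv_inv OX (?t j) V (?t i V (\<rho> i V F)) = \<rho> j V F"
    by (elim exE conjE) (rule that)
  have \<rho>: "gauge_equivalence K (subtopology T (?U i)) OX (\<rho> i)" if "i \<in> ?I" for i
    using \<rho>0 that by (rule bspec)
  have glue: "triv_inv OX (?t j) V (?t i V (\<rho> i V F)) = \<rho> j V F"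
    if "i \<in> ?I" "j \<in> ?I" "openin T V" "V \<subseteq> ?U i \<inter> ?U j" "F \<in> carrier (ps_mod (sec OX V))" for i j V F
    by (rule glue0[THEN bspec, OF that(1), THEN bspec, OF that(2), THEN spec, THEN spec, THEN mp])
       (intro conjI that)
  have \<rho>h: "sheaf_hom (ps_ring K) (subtopology T (?U i)) (ps_sheaf OX) (ps_sheaf OX) (\<rho> i)" if "i \<in> ?I" for i
    using \<rho>[OF that] by (simp add: gauge_equivalence_def sheaf_iso_def)
  have \<rho>c: "\<rho> i V F \<in> carrier (ps_mod (sec OX V))"
    if "i \<in> ?I" "openin T V" "V \<subseteq> ?U i" "F \<in> carrier (ps_mod (sec OX V))" for i V F
    using sheaf_homD(2)[OF \<rho>h[OF that(1)], of V F] that openin_sub[OF U(1)[OF that(1)]] by (simp add: ps_sheaf_simps)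
  obtain \<sigma> where \<sigma>: "sheaf_hom (ps_ring K) T (ps_sheaf OX) A \<sigma>"
    and \<sigma>t0: "\<And>i V F. i \<in> ?I \<Longrightarrow> openin T V \<Longrightarrow> V \<subseteq> ?U i \<Longrightarrow> F \<in> carrier (sec (ps_sheaf OX) V) \<Longrightarrow>
      \<sigma> V F = ?t i V (\<rho> i V F)"
  proof (rule glue_sheaf_homs[OF ps_presheaf_OX[OF K] mA U, of "\<lambda>i V F. ?t i V (\<rho> i V F)"])
    show "sheaf_hom (ps_ring K) (subtopology T (?U i)) (ps_sheaf OX) A (\<lambda>V F. ?t i V (\<rho> i V F))" if "i \<in> ?I" for i
      by (rule sheaf_hom_comp[OF \<rho>h[OF that] sheaf_iso_hom[OF tiso[OF that]]])
    fix i j V F assume i: "i \<in> ?I" and j: "j \<in> ?I" and V: "openin T V" "V \<subseteq> ?U i \<inter> ?U j"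
      and "F \<in> carrier (sec (ps_sheaf OX) V)"
    then have F: "F \<in> carrier (ps_mod (sec OX V))" by (simp add: ps_sheaf_simps)
    have sub: "V \<subseteq> ?U i" "V \<subseteq> ?U j" using V by auto
    have "?t j V (triv_inv OX (?t j) V (?t i V (\<rho> i V F))) = ?t i V (\<rho> i V F)"
      by (rule tinv(2)[OF j V(1) sub(2) tc[OF i V(1) sub(1) \<rho>c[OF i V(1) sub(1) F]]])
    then show "?t i V (\<rho> i V F) = ?t j V (\<rho> j V F)" using glue[OF i j V F] by simp
  qed (assumption, rule that)
  have \<sigma>t: "\<sigma> V F = ?t i V (\<rho> i V F)"
    if "i \<in> ?I" "openin T V" "V \<subseteq> ?U i" "F \<in> carrier (ps_mod (sec OX V))" for i V F
    using \<sigma>t0[OF that(1-3)] that(4) by (simp add: ps_sheaf_simps)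
  have \<sigma>tr: "diff_trivialization K T OX A \<psi> (topspace T) \<sigma>"
    by (rule global_diff_trivialization[OF K A \<psi> U tr \<rho> \<sigma> \<sigma>t])
  then have \<sigma>b: "bij_betw (\<sigma> V) (carrier (ps_mod (sec OX V))) (carrier (sec A V))" if "openin T V" for V
    using sheaf_iso_bij[of "ps_ring K" T "ps_sheaf OX" A \<sigma> V] that
    by (simp add: diff_trivialization_def ps_sheaf_simps)
  note \<sigma>inv = triv_inv_of_bij[where \<tau> = \<sigma> and V = V for V, OF \<sigma>b]
  define \<tau>' :: "(unit, 'a, 'r, 'm) triv_family" where
    "\<tau>' = \<lparr>idx = {()}, cov = (\<lambda>_. topspace T), triv = (\<lambda>_. \<sigma>)\<rparr>"
  show ?thesis
  proof (rule that[of \<tau>'])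
    have "gauge_equivalence K T OX (\<lambda>V F. triv_inv OX \<sigma> V (\<sigma> V F))"
      by (rule gauge_cong[OF K gauge_id \<sigma>inv(3)])
    then show "diff_structure K T OX A \<psi> \<tau>'"
      using \<sigma>tr by (simp add: diff_structure_def \<tau>'_def)
    show "globally_trivialized T \<tau>'" by (simp add: globally_trivialized_def \<tau>'_def)
    have "gauge_equivalence K (subtopology T (?U i)) OX (\<lambda>V F. triv_inv OX \<sigma> V (?t i V F))" if i: "i \<in> ?I" for i
    proof (rule ringed_space.gauge_inverse[OF ringed_sub[OF U(1)[OF i]] K \<rho>[OF i]])
      fix V F assume "openin (subtopology T (?U i)) V" and F: "F \<in> carrier (ps_mod (sec OX V))"
      then have V: "openin T V" "V \<subseteq> ?U i" by (auto simp: openin_sub[OF U(1)[OF i]])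
      let ?G = "triv_inv OX \<sigma> V (?t i V F)"
      have G: "?G \<in> carrier (ps_mod (sec OX V))" by (rule \<sigma>inv(1)[OF V(1) tc[OF i V F]])
      have "?t i V (\<rho> i V ?G) = ?t i V F"
        using \<sigma>t[OF i V G] \<sigma>inv(2)[OF V(1) tc[OF i V F]] by simp
      then have "\<rho> i V ?G = F"
        using tb[OF i V] \<rho>c[OF i V G] F by (simp add: bij_betw_def inj_on_def)
      then show "?G \<in> carrier (ps_mod (sec OX V)) \<and> \<rho> i V ?G = F" using G by blast
    qed
    moreover have "?U i \<inter> topspace T = ?U i" if "i \<in> ?I" for i
      using openin_subset[OF U(1)[OF that]] by blast
    moreover have "algebra_sheaf_iso (ps_ring K) T A A (\<lambda>V a. a)"
      by (simp add: algebra_sheaf_iso_def sheaf_iso_def sheaf_hom_def mod_hom_def ring_hom_def bij_betw_def)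
    ultimately show "dq_gauge_equivalence K T OX A \<psi> \<tau> A \<psi> \<tau>' (\<lambda>V a. a)"
      by (simp add: dq_gauge_equivalence_def \<tau>'_def)
  qed
qed

end

theorem theorem1p13:
  fixes K :: "'k ring" and T :: "'a topology" and OX :: "('a, 'k, 'r) presheaf" and n :: nat
    and A :: "('a, nat \<Rightarrow> 'k, 'm) presheaf" and \<psi> :: "('a, 'r, 'm) reduction_map"
    and \<tau> :: "('i, 'a, 'r, 'm) triv_family"
  assumes "field K"
    and "\<And>j::nat. j > 0 \<Longrightarrow> add_pow K j \<one>\<^bsub>K\<^esub> \<noteq> \<zero>\<^bsub>K\<^esub>"
    and "scheme_over K T OX" and "finite_type K T OX"
    and "separated_over K T OX" and "irreducible_space T"
    and "smooth_over K T OX n"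
    and "carrier (H1 T (diff_op_sheaf K T OX)) = {\<zero>\<^bsub>H1 T (diff_op_sheaf K T OX)\<^esub>}"
    and "deformation_quantization K T OX A \<psi> \<tau>"
  shows "\<exists>(A' :: ('a, nat \<Rightarrow> 'k, 'm) presheaf) \<psi>' (\<tau>' :: (unit, 'a, 'r, 'm) triv_family) \<gamma>.
    deformation_quantization K T OX A' \<psi>' \<tau>' \<and> globally_trivialized T \<tau>' \<and>
    dq_gauge_equivalence K T OX A \<psi> \<tau> A' \<psi>' \<tau>' \<gamma>"
proof -
  interpret ringed_space K T OX
    by (rule ringed_space.intro) (use assms(3) in \<open>simp_all add: scheme_over_def\<close>)
  have A: "algebra_sheaf (ps_ring K) T A" and \<psi>: "sheaf_hom K T (reduction K T A) OX \<psi>"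
    and \<tau>: "diff_structure K T OX A \<psi> \<tau>"
    using assms(9) by (simp_all add: deformation_quantization_def algebra_sheaf_iso_def sheaf_iso_def)
  obtain \<tau>' :: "(unit, 'a, 'r, 'm) triv_family" where \<tau>': "diff_structure K T OX A \<psi> \<tau>'"
    "globally_trivialized T \<tau>'" "dq_gauge_equivalence K T OX A \<psi> \<tau> A \<psi> \<tau>' (\<lambda>V a. a)"
    by (rule differential_structure_globally_trivializes[OF assms(8) A \<psi> \<tau>])
  moreover have "deformation_quantization K T OX A \<psi> \<tau>'"
    using assms(9) \<tau>'(1) by (simp add: deformation_quantization_def)
  ultimately show ?thesis by blast
qed

end
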